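(* Let $q$ be a prime power, let $n$ be a positive integer, and let $\Delta$ be a pure, shellable $q$-complex of dimension $k$ on $\mathbb{F}_q^n$. Let $\mathring{\Delta}=\Delta\setminus\{\{0\}\}$, viewed as a poset under inclusion. Then each of the spaces $\mathcal{T}(\mathring{\Delta})$, $N(\mathring{\Delta})$ and $B(\mathring{\Delta})$ has the (weak) homotopy type of a wedge sum of finitely many spheres of dimension $k-1$.
   Context: A $q$-complex on $\mathbb{F}_q^n$ is a set $\Delta$ of $\mathbb{F}_q$-subspaces of $\mathbb{F}_q^n$ such that whenever $A\in\Delta$, every subspace of $A$ lies in $\Delta$. Its elements are faces; the maximal faces (under inclusion) are facets; $\Delta$ is pure if all facets have the same dimension; $\dim\Delta=\max\{\dim A: A\in\Delta\}$. A pure $q$-complex $\Delta$ of dimension $r$ is shellable if there is a total order $F_1,\dots,F_t$ of its facets such that for all $1\le i<j\le t$ there exists $k<j$ with $F_i\cap F_j\subseteq F_k\cap F_j$ and $\dim(F_k\cap F_j)=r-1$. For a finite poset $P$: $\mathcal{T}(P)$ is the associated finite $T_0$ Alexandroff topological space (McCord's correspondence between finite posets and finite $T_0$ spaces); $N(P)$ is the nerve of $P$, the simplicial set whose $i$-simplices are chains $V_0\subseteq V_1\subseteq\cdots\subseteq V_i$ in $P$; $B(P)=|N(P)|$ is its geometric realization. Homotopy types are understood up to weak homotopy equivalence (equivalently, in the homotopy categories of these model categories). *)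

theory Defs
  imports "HOL-Analysis.Analysis" "HOL-Homology.Homology"
begin

section \<open>q-complexes\<close>

text \<open>The field with q elements is a type of class \<open>{field, finite}\<close> (q is its cardinality), and its
  n-th power is the vector type \<open>'q ^ 'n\<close> with n = \<open>CARD('n)\<close>. Subspaces and dimensions are those
  over this field (\<open>vec.subspace\<close>, \<open>vec.dim\<close>).\<close>

definition q_complex :: "('q::{field,finite} ^ 'n) set set \<Rightarrow> bool" where
  "q_complex \<Delta> \<longleftrightarrow>
     (\<forall>A\<in>\<Delta>. vec.subspace A) \<and> (\<forall>A\<in>\<Delta>. \<forall>B. vec.subspace B \<and> B \<subseteq> A \<longrightarrow> B \<in> \<Delta>)"

definition facets :: "'a set set \<Rightarrow> 'a set set" where
  "facets \<Delta> = {F \<in> \<Delta>. \<forall>A\<in>\<Delta>. F \<subseteq> A \<longrightarrow> A = F}"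

definition q_dim :: "('q::{field,finite} ^ 'n) set set \<Rightarrow> nat" where
  "q_dim \<Delta> = Max (vec.dim ` \<Delta>)"

definition pure :: "('q::{field,finite} ^ 'n) set set \<Rightarrow> bool" where
  "pure \<Delta> \<longleftrightarrow> (\<forall>F\<in>facets \<Delta>. \<forall>G\<in>facets \<Delta>. vec.dim F = vec.dim G)"

text \<open>The dimension condition is written additively because subtraction on \<open>nat\<close> truncates.\<close>

definition shellable :: "('q::{field,finite} ^ 'n) set set \<Rightarrow> bool" where
  "shellable \<Delta> \<longleftrightarrow>
     (\<exists>Fs. distinct Fs \<and> set Fs = facets \<Delta> \<and>
        (\<forall>j<length Fs. \<forall>i<j. \<exists>k<j.
           Fs ! i \<inter> Fs ! j \<subseteq> Fs ! k \<inter> Fs ! j \<and> vec.dim (Fs ! k \<inter> Fs ! j) + 1 = q_dim \<Delta>))"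


section \<open>Quotients, spheres and wedges of spaces\<close>

definition quotient_space :: "'a topology \<Rightarrow> ('a \<times> 'a) set \<Rightarrow> 'a set topology" where
  "quotient_space X R = topology (\<lambda>U. U \<subseteq> topspace X // R \<and> openin X (\<Union>U))"

lemma openin_quotient_space:
  assumes "equiv UNIV R"
  shows "openin (quotient_space X R) U \<longleftrightarrow> U \<subseteq> topspace X // R \<and> openin X (\<Union>U)"
proof -
  have dj: "A = B" if "x \<in> A" "x \<in> B" "A \<in> topspace X // R" "B \<in> topspace X // R" for A B x
  proof -
    have "topspace X // R \<subseteq> UNIV // R" by (auto simp: quotient_def)
    then show ?thesis using quotient_disj[OF assms, of A B] that by blast
  qed
  have "istopology (\<lambda>U. U \<subseteq> topspace X // R \<and> openin X (\<Union>U))"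
    unfolding istopology_def
  proof (intro conjI allI impI)
    fix S T assume S: "S \<subseteq> topspace X // R \<and> openin X (\<Union>S)" and T: "T \<subseteq> topspace X // R \<and> openin X (\<Union>T)"
    have "\<Union>(S \<inter> T) = \<Union>S \<inter> \<Union>T"
      using dj S T by blast
    then show "openin X (\<Union>(S \<inter> T))" using S T by auto
    show "S \<inter> T \<subseteq> topspace X // R" using S by auto
  next
    fix K assume K: "\<forall>U\<in>K. U \<subseteq> topspace X // R \<and> openin X (\<Union>U)"
    have "\<Union>(\<Union>K) = \<Union>((\<lambda>U. \<Union>U) ` K)" by auto
    then show "openin X (\<Union>(\<Union>K))" using K by auto
    show "\<Union>K \<subseteq> topspace X // R" using K by auto
  qed
  then show ?thesis unfolding quotient_space_def by (simp add: topology_inverse')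
qed

text \<open>\<open>unit_sphere k\<close> is the sphere of dimension k - 1, the unit sphere of k-dimensional Euclidean
  space. Indexing by k rather than k - 1 gives the usual convention that the (-1)-dimensional
  sphere is empty.\<close>

definition unit_sphere :: "nat \<Rightarrow> (nat \<Rightarrow> real) topology" where
  "unit_sphere k = subtopology (Euclidean_space k) {x. (\<Sum>i<k. x i ^ 2) = 1}"

lemma unit_sphere_Suc: "unit_sphere (Suc d) = nsphere d"
  by (simp add: unit_sphere_def nsphere_def lessThan_Suc_atMost)

lemma topspace_unit_sphere_0: "topspace (unit_sphere 0) = {}"
  by (simp add: unit_sphere_def)

definition sphere_base :: "nat \<Rightarrow> real" where
  "sphere_base = (\<lambda>i. if i = 0 then 1 else 0)"

lemma sphere_base_in: "sphere_base \<in> topspace (unit_sphere (Suc d))"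
  by (simp add: unit_sphere_def sphere_base_def topspace_Euclidean_space if_distrib[of "\<lambda>x. x ^ 2"]
           del: sum.lessThan_Suc cong: if_cong)

definition wedge_rel :: "nat \<Rightarrow> 'a \<Rightarrow> ((nat \<times> 'a) \<times> (nat \<times> 'a)) set" where
  "wedge_rel m b = {(p, p') . p = p' \<or> (p \<in> {..<m} \<times> {b} \<and> p' \<in> {..<m} \<times> {b})}"

lemma equiv_wedge_rel: "equiv UNIV (wedge_rel m b)"
  by (rule equivI) (auto simp: wedge_rel_def refl_on_def sym_def trans_def)

text \<open>The wedge of m copies of X at b; the empty wedge is a point. Copies of an empty X have no base
  points to identify, so their wedge (for m > 0) is empty; in particular a wedge of (-1)-spheres
  is a (-1)-sphere.\<close>

definition wedge_space :: "nat \<Rightarrow> 'a topology \<Rightarrow> 'a \<Rightarrow> (nat \<times> 'a) set topology" where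
  "wedge_space m X b =
     (if m = 0 then discrete_topology {{(0, b)}}
      else quotient_space (sum_topology (\<lambda>_. X) {..<m}) (wedge_rel m b))"


section \<open>Weak homotopy equivalence of spaces\<close>

definition sphere_maps :: "nat \<Rightarrow> 'a topology \<Rightarrow> 'a \<Rightarrow> ((nat \<Rightarrow> real) \<Rightarrow> 'a) set" where
  "sphere_maps n X x = {g. continuous_map (nsphere n) X g \<and> g sphere_base = x}"

definition sphere_homotopy ::
  "nat \<Rightarrow> 'a topology \<Rightarrow> 'a \<Rightarrow> (((nat \<Rightarrow> real) \<Rightarrow> 'a) \<times> ((nat \<Rightarrow> real) \<Rightarrow> 'a)) set" where
  "sphere_homotopy n X x =
     {(g, h). homotopic_with (\<lambda>u. u sphere_base = x) (nsphere n) X g h}"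

definition homotopy_group :: "nat \<Rightarrow> 'a topology \<Rightarrow> 'a \<Rightarrow> ((nat \<Rightarrow> real) \<Rightarrow> 'a) set set" where
  "homotopy_group n X x = sphere_maps n X x // sphere_homotopy n X x"

definition induced_homotopy ::
  "nat \<Rightarrow> 'b topology \<Rightarrow> ('a \<Rightarrow> 'b) \<Rightarrow> 'a \<Rightarrow> ((nat \<Rightarrow> real) \<Rightarrow> 'a) set \<Rightarrow> ((nat \<Rightarrow> real) \<Rightarrow> 'b) set" where
  "induced_homotopy n Y f x c = (\<Union>g\<in>c. sphere_homotopy n Y (f x) `` {f \<circ> g})"

definition induced_components :: "'b topology \<Rightarrow> ('a \<Rightarrow> 'b) \<Rightarrow> 'a set \<Rightarrow> 'b set" where
  "induced_components Y f C = (\<Union>x\<in>C. path_component_of_set Y (f x))"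

text \<open>The maps induced on homotopy groups are homomorphisms, so they are isomorphisms precisely when
  they are bijective; the group structure is therefore not needed here.\<close>

definition weak_homotopy_equivalence :: "'a topology \<Rightarrow> 'b topology \<Rightarrow> ('a \<Rightarrow> 'b) \<Rightarrow> bool" where
  "weak_homotopy_equivalence X Y f \<longleftrightarrow>
     continuous_map X Y f \<and>
     bij_betw (induced_components Y f) (path_components_of X) (path_components_of Y) \<and>
     (\<forall>n\<ge>1. \<forall>x\<in>topspace X.
        bij_betw (induced_homotopy n Y f x) (homotopy_group n X x) (homotopy_group n Y (f x)))"

text \<open>Two spaces are isomorphic in the homotopy category (i.e. joined by a zigzag of weak homotopy
  equivalences) iff there is a span of weak homotopy equivalences between them, and one can take
  the realization of the singular complex of X as its apex. The type \<open>('a \<times> real) set\<close> has at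
  least as many elements as that realization has points, so prescribing it as the type of the
  apex is no restriction.\<close>

definition same_weak_homotopy_type :: "'a topology \<Rightarrow> 'b topology \<Rightarrow> bool" where
  "same_weak_homotopy_type X Y \<longleftrightarrow>
     (\<exists>(Z :: ('a \<times> real) set topology) f g.
        weak_homotopy_equivalence Z X f \<and> weak_homotopy_equivalence Z Y g)"


section \<open>Simplicial sets\<close>

text \<open>\<open>face X n i\<close> maps (n+1)-simplices to n-simplices (for i \<open>\<le>\<close> n+1), and \<open>degen X n i\<close> maps
  n-simplices to (n+1)-simplices (for i \<open>\<le>\<close> n).\<close>

record 'a sset =
  splx :: "nat \<Rightarrow> 'a set"
  face :: "nat \<Rightarrow> nat \<Rightarrow> 'a \<Rightarrow> 'a"
  degen :: "nat \<Rightarrow> nat \<Rightarrow> 'a \<Rightarrow> 'a"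

definition simplicial_set :: "'a sset \<Rightarrow> bool" where
  "simplicial_set X \<longleftrightarrow>
     (\<forall>n. \<forall>i\<le>Suc n. \<forall>x\<in>splx X (Suc n). face X n i x \<in> splx X n) \<and>
     (\<forall>n. \<forall>i\<le>n. \<forall>x\<in>splx X n. degen X n i x \<in> splx X (Suc n)) \<and>
     (\<forall>n. \<forall>j\<le>Suc (Suc n). \<forall>i<j. \<forall>x\<in>splx X (Suc (Suc n)).
        face X n i (face X (Suc n) j x) = face X n (j - 1) (face X (Suc n) i x)) \<and>
     (\<forall>n. \<forall>j\<le>n. \<forall>i\<le>j. \<forall>x\<in>splx X n.
        degen X (Suc n) i (degen X n j x) = degen X (Suc n) (Suc j) (degen X n i x)) \<and>
     (\<forall>n. \<forall>j\<le>Suc n. \<forall>i<j. \<forall>x\<in>splx X (Suc n).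
        face X (Suc n) i (degen X (Suc n) j x) = degen X n (j - 1) (face X n i x)) \<and>
     (\<forall>n. \<forall>j\<le>n. \<forall>x\<in>splx X n.
        face X n j (degen X n j x) = x \<and> face X n (Suc j) (degen X n j x) = x) \<and>
     (\<forall>n. \<forall>j\<le>Suc n. \<forall>i\<le>Suc (Suc n). \<forall>x\<in>splx X (Suc n). Suc j < i \<longrightarrow>
        face X (Suc n) i (degen X (Suc n) j x) = degen X n j (face X n (i - 1) x))"

definition simplicial_map :: "'a sset \<Rightarrow> 'b sset \<Rightarrow> (nat \<Rightarrow> 'a \<Rightarrow> 'b) \<Rightarrow> bool" where
  "simplicial_map X Y f \<longleftrightarrow>
     simplicial_set X \<and> simplicial_set Y \<and>
     (\<forall>n. \<forall>x\<in>splx X n. f n x \<in> splx Y n) \<and>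
     (\<forall>n. \<forall>i\<le>Suc n. \<forall>x\<in>splx X (Suc n). f n (face X n i x) = face Y n i (f (Suc n) x)) \<and>
     (\<forall>n. \<forall>i\<le>n. \<forall>x\<in>splx X n. f (Suc n) (degen X n i x) = degen Y n i (f n x))"

text \<open>The codegeneracy maps of the standard topological simplices; the coface maps are the library's
  \<open>simplical_face\<close> (sic).\<close>

definition simplex_degen :: "nat \<Rightarrow> (nat \<Rightarrow> real) \<Rightarrow> nat \<Rightarrow> real" where
  "simplex_degen i t = (\<lambda>j. if j < i then t j else if j = i then t i + t (Suc i) else t (Suc j))"

type_synonym 'a cell_point = "(nat \<times> 'a) \<times> (nat \<Rightarrow> real)"

definition glue_step :: "'a sset \<Rightarrow> ('a cell_point \<times> 'a cell_point) set" where
  "glue_step X =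
     {(((n, face X n i x), t), ((Suc n, x), simplical_face i t)) | n i x t.
        x \<in> splx X (Suc n) \<and> i \<le> Suc n \<and> t \<in> standard_simplex n} \<union>
     {(((Suc n, degen X n i x), t), ((n, x), simplex_degen i t)) | n i x t.
        x \<in> splx X n \<and> i \<le> n \<and> t \<in> standard_simplex (Suc n)}"

definition glue_rel :: "'a sset \<Rightarrow> ('a cell_point \<times> 'a cell_point) set" where
  "glue_rel X = (glue_step X \<union> (glue_step X)\<inverse>)\<^sup>*"

lemma equiv_glue_rel: "equiv UNIV (glue_rel X)"
  by (rule equivI)
     (auto simp: glue_rel_def refl_on_def trans_rtrancl intro!: sym_rtrancl sym_Un_converse)

definition realization :: "'a sset \<Rightarrow> 'a cell_point set topology" where
  "realization X =
     quotient_space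
       (sum_topology (\<lambda>(n, x). subtopology (powertop_real UNIV) (standard_simplex n))
          (SIGMA n:UNIV. splx X n))
       (glue_rel X)"

definition realization_map ::
  "'b sset \<Rightarrow> (nat \<Rightarrow> 'a \<Rightarrow> 'b) \<Rightarrow> 'a cell_point set \<Rightarrow> 'b cell_point set" where
  "realization_map Y f c = (\<Union>((n, x), t)\<in>c. glue_rel Y `` {((n, f n x), t)})"

definition weak_equivalence_sset :: "'a sset \<Rightarrow> 'b sset \<Rightarrow> (nat \<Rightarrow> 'a \<Rightarrow> 'b) \<Rightarrow> bool" where
  "weak_equivalence_sset X Y f \<longleftrightarrow>
     simplicial_map X Y f \<and>
     weak_homotopy_equivalence (realization X) (realization Y) (realization_map Y f)"

text \<open>Two simplicial sets are isomorphic in the homotopy category of the Kan-Quillen model structure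
  iff there is a cospan of weak equivalences between them, and one may take a fibrant replacement
  of Y as its apex. Kan's functor \<open>Ex\<^sup>\<infinity>\<close> provides one whose simplices in each degree can be
  injected into \<open>nat \<times> 'b\<close>, so prescribing this type for the apex is no restriction.\<close>

definition same_weak_homotopy_type_sset :: "'a sset \<Rightarrow> 'b sset \<Rightarrow> bool" where
  "same_weak_homotopy_type_sset X Y \<longleftrightarrow>
     (\<exists>(Z :: (nat \<times> 'b) sset) f g.
        weak_equivalence_sset X Z f \<and> weak_equivalence_sset Y Z g)"


section \<open>Simplicial spheres and their wedges\<close>

text \<open>Nerve of a subset P of an ordered type, with the induced order; the simplex
  \<open>V\<^sub>0 \<le> \<dots> \<le> V\<^sub>n\<close> is the list of its vertices.\<close>

definition nerve :: "'a::order set \<Rightarrow> 'a list sset" where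
  "nerve P =
     \<lparr>splx = (\<lambda>n. {xs. length xs = Suc n \<and> set xs \<subseteq> P \<and> sorted_wrt (\<le>) xs}),
      face = (\<lambda>n i xs. take i xs @ drop (Suc i) xs),
      degen = (\<lambda>n i xs. take (Suc i) xs @ drop i xs)\<rparr>"

text \<open>The boundary of the standard k-simplex, which is a simplicial (k-1)-sphere (empty for k = 0).
  The standard simplex is the nerve of \<open>{0..k}\<close>.\<close>

definition boundary_simplex :: "nat \<Rightarrow> nat list sset" where
  "boundary_simplex k =
     (nerve {0..k}) \<lparr>splx := (\<lambda>n. {xs \<in> splx (nerve {0..k}) n. set xs \<noteq> {0..k}})\<rparr>"

primrec base_simplex :: "'a sset \<Rightarrow> 'a \<Rightarrow> nat \<Rightarrow> 'a" where
  "base_simplex X v 0 = v"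
| "base_simplex X v (Suc n) = degen X n 0 (base_simplex X v n)"

text \<open>The wedge of m copies of X at the vertex v, with the same conventions as for spaces: in each
  degree the copies of the degenerate base simplex are identified, using the copy in the summand 0
  as the common representative.\<close>

definition wedge_rep :: "'a sset \<Rightarrow> 'a \<Rightarrow> nat \<Rightarrow> nat \<times> 'a \<Rightarrow> nat \<times> 'a" where
  "wedge_rep X v n p = (if snd p = base_simplex X v n then (0, snd p) else p)"

definition wedge_sset :: "nat \<Rightarrow> 'a sset \<Rightarrow> 'a \<Rightarrow> (nat \<times> 'a) sset" where
  "wedge_sset m X v =
     \<lparr>splx = (\<lambda>n. if m = 0 then {(0, base_simplex X v n)}
                   else wedge_rep X v n ` ({..<m} \<times> splx X n)),
      face = (\<lambda>n i p. wedge_rep X v n (fst p, face X n i (snd p))),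
      degen = (\<lambda>n i p. wedge_rep X v (Suc n) (fst p, degen X n i (snd p)))\<rparr>"


section \<open>Spaces associated with a poset\<close>

text \<open>McCord's convention: the open sets are the down-sets, so that \<open>x \<le> y\<close> iff every open set
  containing y contains x.\<close>

definition alexandroff_space :: "'a::order set \<Rightarrow> 'a topology" where
  "alexandroff_space P = topology (\<lambda>U. U \<subseteq> P \<and> (\<forall>x\<in>U. \<forall>y\<in>P. y \<le> x \<longrightarrow> y \<in> U))"

lemma openin_alexandroff_space:
  "openin (alexandroff_space P) U \<longleftrightarrow> U \<subseteq> P \<and> (\<forall>x\<in>U. \<forall>y\<in>P. y \<le> x \<longrightarrow> y \<in> U)"
proof -
  have "istopology (\<lambda>U. U \<subseteq> P \<and> (\<forall>x\<in>U. \<forall>y\<in>P. y \<le> x \<longrightarrow> y \<in> U))"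
    unfolding istopology_def by blast
  then show ?thesis unfolding alexandroff_space_def by (simp add: topology_inverse')
qed

definition classifying_space :: "'a::order set \<Rightarrow> 'a list cell_point set topology" where
  "classifying_space P = realization (nerve P)"

end

(* Let k be the dimension of \<Delta>. The order complex of \<Delta> without 0 is shellable of dimension k - 1: its facets
   are the complete flags in the facets of \<Delta>, ordered by the shelling of \<Delta> and, inductively, within each
   facet by ordering the hyperplanes so that those met by earlier facets come first. In a shellable complex
   each facet is either attached along its whole boundary or its addition is an elementary expansion. Coning off
   the facets of the second kind does not change the homotopy type, since it is a sequence of expansions; it
   leaves a cone with m simplices of dimension k - 1 attached along their boundaries, and contracting the
   cone gives a wedge of m spheres. McCord's map from the order complex to the Alexandroff space is a weak
   equivalence because maps into the space lift to the order complex by partitions of unity. The nerve realizes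
   to the order complex, and on the simplicial side the coned complex, as an ordered simplicial set, receives
   equivalences from both the nerve and the wedge of boundaries of simplices. *)

theory Submission
  imports Defs
begin

section \<open>Weak equivalences tested on maps from spheres\<close>

subsection \<open>Weak and strong homotopy equivalences\<close>

text \<open>The obstacle is the base point. Homotopy groups are compared at every point, while the
  natural homotopies (a deformation, a lift to the order complex, a jump between comparable maps)
  move it. The relation \<open>tracked\<close> records this motion by a lift to a contractible
  space, and contractibility turns the result back into a based homotopy. McCord's map is tested
  directly on maps of spheres and cylinders; these lift only up to order, to maps whose supports lie
  above the given values. The remaining equivalences are genuine homotopy equivalences, mostly built
  from straight-line homotopies in barycentric coordinates. No fibrant replacement has to be
  constructed, because nerve and wedge map to one ordered complex. For this the apex of the cone is
  the least vertex 0: the boundary of a simplex is the cone from vertex 0 over the boundary of the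
  opposite face, together with that face. So the wedge of boundaries is itself a coned complex, and
  a map of vertices that is increasing on each simplex compares it with the one obtained from the
  shelling.\<close>

abbreviation I01 :: "real topology" where "I01 \<equiv> top_of_set {0..1}"

lemma sphere_homotopy_sym: "(g, h) \<in> sphere_homotopy n X x \<Longrightarrow> (h, g) \<in> sphere_homotopy n X x"
  by (simp add: sphere_homotopy_def homotopic_with_sym)

lemma sphere_homotopy_trans:
  "(g, h) \<in> sphere_homotopy n X x \<Longrightarrow> (h, k) \<in> sphere_homotopy n X x \<Longrightarrow> (g, k) \<in> sphere_homotopy n X x"
  unfolding sphere_homotopy_def using homotopic_with_trans by blast

lemma sphere_homotopy_refl: "g \<in> sphere_maps n X x \<Longrightarrow> (g, g) \<in> sphere_homotopy n X x"
  by (simp add: sphere_homotopy_def sphere_maps_def)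

lemma sphere_homotopy_compose:
  assumes "(g, h) \<in> sphere_homotopy n X x" and "continuous_map X Y f"
  shows "(f \<circ> g, f \<circ> h) \<in> sphere_homotopy n Y (f x)"
  using homotopic_with_compose_continuous_map_left[of "\<lambda>u. u sphere_base = x" "nsphere n" X g h Y f] assms
  by (auto simp: sphere_homotopy_def)

lemma sphere_homotopy_class_eq:
  assumes "(g, h) \<in> sphere_homotopy n X x"
  shows "sphere_homotopy n X x `` {g} = sphere_homotopy n X x `` {h}"
  using sphere_homotopy_trans[OF assms] sphere_homotopy_trans[OF sphere_homotopy_sym[OF assms]] by blast

lemma path_component_of_set_cong:
  assumes "path_component_of X x y"
  shows "path_component_of_set X x = path_component_of_set X y"
  using path_component_of_trans[OF assms] path_component_of_trans[OF path_component_of_sym[OF assms]] by blast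

lemma induced_homotopy_class:
  assumes f: "continuous_map X Y f" and g: "g \<in> sphere_maps n X x"
  shows "induced_homotopy n Y f x (sphere_homotopy n X x `` {g}) = sphere_homotopy n Y (f x) `` {f \<circ> g}"
proof -
  have "sphere_homotopy n Y (f x) `` {f \<circ> g'} = sphere_homotopy n Y (f x) `` {f \<circ> g}"
    if "g' \<in> sphere_homotopy n X x `` {g}" for g'
    using sphere_homotopy_class_eq[OF sphere_homotopy_compose[OF _ f, of g g' n x]] that by simp
  moreover have "g \<in> sphere_homotopy n X x `` {g}"
    using g by (simp add: sphere_homotopy_refl)
  ultimately show ?thesis unfolding induced_homotopy_def by blast
qed

lemma induced_components_component:
  assumes f: "continuous_map X Y f" and x: "x \<in> topspace X"
  shows "induced_components Y f (path_component_of_set X x) = path_component_of_set Y (f x)"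
proof -
  have im: "path_component_of Y (f x) (f x')" if "path_component_of X x x'" for x'
  proof -
    obtain p where "pathin X p" "p 0 = x" "p 1 = x'"
      using \<open>path_component_of X x x'\<close> unfolding path_component_of_def by blast
    then show ?thesis unfolding path_component_of_def
      using f by (intro exI[of _ "f \<circ> p"]) (auto simp: pathin_compose)
  qed
  have "path_component_of_set Y (f x') = path_component_of_set Y (f x)" if "path_component_of X x x'" for x'
    using path_component_of_set_cong[OF im[OF that]] by simp
  moreover have "x \<in> path_component_of_set X x"
    using x by (simp add: path_component_of_refl)
  ultimately show ?thesis unfolding induced_components_def by blast
qed

text \<open>Bijectivity on classes becomes a statement about representatives: surjectivity lifts a
  map up to based homotopy, injectivity lifts a based homotopy between composites. Homotopy
  equivalences and McCord's map are both handled in this form.\<close>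

lemma weak_homotopy_equivalenceI:
  assumes f: "continuous_map X Y f"
    and pc_surj: "\<And>y. y \<in> topspace Y \<Longrightarrow> \<exists>x\<in>topspace X. path_component_of Y (f x) y"
    and pc_inj: "\<And>x x'. x \<in> topspace X \<Longrightarrow> x' \<in> topspace X \<Longrightarrow> path_component_of Y (f x) (f x')
      \<Longrightarrow> path_component_of X x x'"
    and surj: "\<And>n x u. x \<in> topspace X \<Longrightarrow> u \<in> sphere_maps n Y (f x) \<Longrightarrow>
      \<exists>g\<in>sphere_maps n X x. (f \<circ> g, u) \<in> sphere_homotopy n Y (f x)"
    and inj: "\<And>n x g g'. x \<in> topspace X \<Longrightarrow> g \<in> sphere_maps n X x \<Longrightarrow> g' \<in> sphere_maps n X x \<Longrightarrow>
      (f \<circ> g, f \<circ> g') \<in> sphere_homotopy n Y (f x) \<Longrightarrow> (g, g') \<in> sphere_homotopy n X x"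
  shows "weak_homotopy_equivalence X Y f"
  unfolding weak_homotopy_equivalence_def
proof (intro conjI allI impI ballI)
  have img: "f x \<in> topspace Y" if "x \<in> topspace X" for x
    using f that by (auto simp: continuous_map_def)
  show "bij_betw (induced_components Y f) (path_components_of X) (path_components_of Y)"
    unfolding bij_betw_def
  proof
    show "inj_on (induced_components Y f) (path_components_of X)"
    proof (rule inj_onI)
      fix C C' assume C: "C \<in> path_components_of X" "C' \<in> path_components_of X"
        and eq: "induced_components Y f C = induced_components Y f C'"
      obtain x x' where x: "x \<in> topspace X" "C = path_component_of_set X x"
        and x': "x' \<in> topspace X" "C' = path_component_of_set X x'"
        using C unfolding path_components_of_def by auto
      have "path_component_of Y (f x) (f x')"
        using eq x x' img f by (auto simp: induced_components_component path_component_of_refl)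
      then show "C = C'"
        using path_component_of_set_cong[OF pc_inj[OF x(1) x'(1)]] x(2) x'(2) by simp
    qed
    show "induced_components Y f ` path_components_of X = path_components_of Y"
    proof
      show "induced_components Y f ` path_components_of X \<subseteq> path_components_of Y"
        using f img by (auto simp: path_components_of_def induced_components_component)
      show "path_components_of Y \<subseteq> induced_components Y f ` path_components_of X"
      proof
        fix D assume "D \<in> path_components_of Y"
        then obtain y where y: "y \<in> topspace Y" "D = path_component_of_set Y y"
          unfolding path_components_of_def by auto
        obtain x where x: "x \<in> topspace X" "path_component_of Y (f x) y" using pc_surj y by blast
        have "D = induced_components Y f (path_component_of_set X x)"
          unfolding induced_components_component[OF f x(1)] y(2)
          using path_component_of_set_cong[OF x(2)] by simp
        then show "D \<in> induced_components Y f ` path_components_of X"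
          using x(1) unfolding path_components_of_def by blast
      qed
    qed
  qed
next
  fix n x assume x: "x \<in> topspace X"
  show "bij_betw (induced_homotopy n Y f x) (homotopy_group n X x) (homotopy_group n Y (f x))"
    unfolding bij_betw_def
  proof
    show "inj_on (induced_homotopy n Y f x) (homotopy_group n X x)"
    proof (rule inj_onI)
      fix C C' assume C: "C \<in> homotopy_group n X x" "C' \<in> homotopy_group n X x"
        and eq: "induced_homotopy n Y f x C = induced_homotopy n Y f x C'"
      obtain g g' where g: "g \<in> sphere_maps n X x" "C = sphere_homotopy n X x `` {g}"
        and g': "g' \<in> sphere_maps n X x" "C' = sphere_homotopy n X x `` {g'}"
        using C unfolding homotopy_group_def quotient_def by auto
      have "f \<circ> g' \<in> sphere_maps n Y (f x)"
        using g'(1) f by (auto simp: sphere_maps_def intro: continuous_map_compose)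
      then have "f \<circ> g' \<in> sphere_homotopy n Y (f x) `` {f \<circ> g'}"
        by (simp add: sphere_homotopy_refl)
      also have "\<dots> = sphere_homotopy n Y (f x) `` {f \<circ> g}"
        using eq unfolding g(2) g'(2) induced_homotopy_class[OF f g(1)] induced_homotopy_class[OF f g'(1)] by simp
      finally have "f \<circ> g' \<in> sphere_homotopy n Y (f x) `` {f \<circ> g}" .
      then have "(g, g') \<in> sphere_homotopy n X x"
        using inj[OF x g(1) g'(1)] by auto
      then show "C = C'" unfolding g(2) g'(2) by (rule sphere_homotopy_class_eq)
    qed
    show "induced_homotopy n Y f x ` homotopy_group n X x = homotopy_group n Y (f x)"
    proof
      have "f \<circ> g \<in> sphere_maps n Y (f x)" if "g \<in> sphere_maps n X x" for g
        using that f by (auto simp: sphere_maps_def intro: continuous_map_compose)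
      then show "induced_homotopy n Y f x ` homotopy_group n X x \<subseteq> homotopy_group n Y (f x)"
        by (fastforce simp: homotopy_group_def quotient_def induced_homotopy_class[OF f])
      show "homotopy_group n Y (f x) \<subseteq> induced_homotopy n Y f x ` homotopy_group n X x"
      proof
        fix D assume "D \<in> homotopy_group n Y (f x)"
        then obtain u where u: "u \<in> sphere_maps n Y (f x)" "D = sphere_homotopy n Y (f x) `` {u}"
          by (auto simp: homotopy_group_def quotient_def)
        obtain g where g: "g \<in> sphere_maps n X x" "(f \<circ> g, u) \<in> sphere_homotopy n Y (f x)"
          using surj[OF x u(1)] by blast
        have "D = induced_homotopy n Y f x (sphere_homotopy n X x `` {g})"
          unfolding induced_homotopy_class[OF f g(1)] u(2)
          using sphere_homotopy_class_eq[OF g(2)] by simp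
        then show "D \<in> induced_homotopy n Y f x ` homotopy_group n X x"
          using g(1) by (auto simp: homotopy_group_def quotient_def)
      qed
    qed
  qed
qed (fact f)

subsection \<open>Changing the base point of a map from a sphere\<close>

lemma continuous_map_snd':
  "continuous_map X Z f \<Longrightarrow> continuous_map (prod_topology W X) Z (\<lambda>p. f (snd p))"
  using continuous_map_compose[OF continuous_map_snd, of X Z f W] by (simp add: o_def)

lemma continuous_map_fst':
  "continuous_map W Z f \<Longrightarrow> continuous_map (prod_topology W X) Z (\<lambda>p. f (fst p))"
  using continuous_map_compose[OF continuous_map_fst, of W Z f X] by (simp add: o_def)

lemma continuous_map_compose': "continuous_map X Y f \<Longrightarrow> continuous_map Y Z g \<Longrightarrow> continuous_map X Z (\<lambda>x. g (f x))"
  using continuous_map_compose[of X Y f Z g] by (simp add: o_def)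

lemma continuous_map_I01_iff:
  "continuous_map X I01 f \<longleftrightarrow> continuous_map X euclideanreal f \<and> (\<forall>x\<in>topspace X. 0 \<le> f x \<and> f x \<le> 1)"
  by (auto simp: continuous_map_in_subtopology)

lemma continuous_map_I01_id: "continuous_map I01 euclideanreal (\<lambda>s. s)"
  using continuous_map_id_subt[of euclideanreal] by (simp add: id_def)

lemma sphere_base_in': "sphere_base \<in> topspace (nsphere n)"
  using sphere_base_in[of n] by (simp add: unit_sphere_Suc)

lemma in_nsphere:
  "t \<in> topspace (nsphere n) \<longleftrightarrow> (\<forall>i>n. t i = 0) \<and> (\<Sum>i\<le>n. (t i)\<^sup>2) = 1"
  by (auto simp: nsphere)

lemma in_nsphere_0:
  "t \<in> topspace (nsphere n) \<longleftrightarrow> (\<forall>i>n. t i = 0) \<and> (\<Sum>i=1..n. (t i)\<^sup>2) = 1 - (t 0)\<^sup>2"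
proof -
  have "(\<Sum>i\<le>n. (t i)\<^sup>2) = (t 0)\<^sup>2 + (\<Sum>i=1..n. (t i)\<^sup>2)"
    by (simp add: atMost_atLeast0 sum.atLeast_Suc_atMost)
  then show ?thesis by (auto simp: in_nsphere)
qed

lemma nsphere_coord_le: "t \<in> topspace (nsphere n) \<Longrightarrow> \<bar>t i\<bar> \<le> 1"
proof (cases "i \<le> n")
  case True
  assume "t \<in> topspace (nsphere n)"
  then have "(t i)\<^sup>2 \<le> 1" using member_le_sum[of i "{..n}" "\<lambda>i. (t i)\<^sup>2"] True by (simp add: in_nsphere)
  then show ?thesis by (simp add: abs_square_le_1)
qed (simp add: in_nsphere)

lemma continuous_map_nsphere_iff:
  "continuous_map X (nsphere n) f \<longleftrightarrow>
   (\<forall>i. continuous_map X euclideanreal (\<lambda>x. f x i)) \<and> (\<forall>x\<in>topspace X. f x \<in> topspace (nsphere n))"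
  unfolding nsphere continuous_map_in_subtopology continuous_map_componentwise_UNIV by auto

text \<open>The upper hemisphere is collapsed to the base point; the coordinates of the lower one are
  those of \<open>(1 + 2 t\<^sub>0, c t\<^sub>1, \<dots>, c t\<^sub>n)\<close> with c chosen to stay on the sphere.\<close>

definition pinch :: "(nat \<Rightarrow> real) \<Rightarrow> nat \<Rightarrow> real" where
  "pinch t = (\<lambda>i. let m = max 0 (- t 0) in if i = 0 then 1 - 2 * m else 2 * sqrt (m / (1 + m)) * t i)"

lemma pinch_nonneg: "t 0 \<ge> 0 \<Longrightarrow> pinch t = sphere_base"
  by (auto simp: pinch_def sphere_base_def)

lemma pinch_in:
  assumes "t \<in> topspace (nsphere n)"
  shows "pinch t \<in> topspace (nsphere n)"
proof (cases "t 0 \<ge> 0")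
  case True then show ?thesis by (simp add: pinch_nonneg sphere_base_in')
next
  case False
  define m where "m = - t 0"
  have m: "m > 0" "max 0 (- t 0) = m" using False by (auto simp: m_def)
  have s: "(\<Sum>i=1..n. (t i)\<^sup>2) = 1 - m\<^sup>2" using assms by (simp add: in_nsphere_0 m_def)
  have "(\<Sum>i=1..n. (pinch t i)\<^sup>2) = (\<Sum>i=1..n. 4 * (m / (1 + m)) * (t i)\<^sup>2)"
    using m by (intro sum.cong) (auto simp: pinch_def power_mult_distrib)
  also have "\<dots> = 4 * (m / (1 + m)) * (1 - m\<^sup>2)" by (simp only: s flip: sum_distrib_left)
  also have "\<dots> = 1 - (1 - 2 * m)\<^sup>2" using m by (simp add: divide_simps) (simp add: power2_eq_square algebra_simps)
  finally show ?thesis using assms m by (simp add: in_nsphere_0 pinch_def)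
qed

lemma continuous_map_pinch: "continuous_map (nsphere n) (nsphere n) pinch"
  unfolding continuous_map_nsphere_iff
proof (intro conjI allI ballI)
  fix i
  have [continuous_intros]: "continuous_map (nsphere n) euclideanreal (\<lambda>x. x k)" for k
    by (rule continuous_map_nsphere_projection)
  show "continuous_map (nsphere n) euclideanreal (\<lambda>x. pinch x i)"
    unfolding pinch_def Let_def
    by (cases "i = 0") (auto intro!: continuous_intros continuous_map_sqrt[THEN continuous_map_compose'[rotated]])
qed (rule pinch_in)

lemma continuous_map_nsphere_coord [continuous_intros]:
  "continuous_map (prod_topology W (nsphere n)) euclideanreal (\<lambda>p. snd p k)"
  using continuous_map_snd'[OF continuous_map_nsphere_projection] .

lemma continuous_map_I01_snd [continuous_intros]:
  "continuous_map (prod_topology X I01) euclideanreal snd"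
  by (rule continuous_map_snd'[OF continuous_map_I01_id])

lemma continuous_map_I01_fst [continuous_intros]:
  "continuous_map (prod_topology I01 X) euclideanreal fst"
  by (rule continuous_map_fst'[OF continuous_map_I01_id])

lemma sphere_homotopyI:
  assumes "continuous_map (prod_topology I01 (nsphere n)) Y h"
    and "\<And>t. t \<in> topspace (nsphere n) \<Longrightarrow> h (0, t) = g t"
    and "\<And>t. t \<in> topspace (nsphere n) \<Longrightarrow> h (1, t) = g' t"
    and "\<And>s. 0 \<le> s \<Longrightarrow> s \<le> 1 \<Longrightarrow> h (s, sphere_base) = y"
  shows "(g, g') \<in> sphere_homotopy n Y y"
proof -
  have "homotopic_with (\<lambda>u. u sphere_base = y) (nsphere n) Y g g'"
    by (subst homotopic_with) (use assms sphere_base_in' in auto)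
  then show ?thesis by (simp add: sphere_homotopy_def)
qed

text \<open>The segment from \<open>pinch t\<close> to \<open>t\<close> is projected radially to the
  sphere, so it must avoid the origin. For \<open>t 0 \<ge> 0\<close> its zeroth coordinate is
  positive unless \<open>s = 1\<close>. For \<open>t 0 < 0\<close> the other coordinates of the two
  ends differ by a positive factor, so they all vanish only at the pole \<open>t 0 = -1\<close>,
  which \<open>pinch\<close> fixes.\<close>

lemma pinch_homotopic_id: "(pinch, id) \<in> sphere_homotopy n (nsphere n) sphere_base"
proof -
  define w where "w = (\<lambda>(s::real, t) j. (1 - s) * pinch t j + s * t j)"
  define N where "N = (\<lambda>p. \<Sum>j\<le>n. (w p j)\<^sup>2)"
  have N0: "N (s, t) \<noteq> 0" if s: "0 \<le> s" "s \<le> 1" and t: "t \<in> topspace (nsphere n)" for s t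
  proof
    assume "N (s, t) = 0"
    then have w0: "w (s, t) j = 0" if "j \<le> n" for j
      unfolding N_def by (subst (asm) sum_nonneg_eq_0_iff) (use that in auto)
    show False
    proof (cases "t 0 \<ge> 0")
      case True
      then have "(1 - s) + s * t 0 = 0" using w0[of 0] by (simp add: w_def pinch_nonneg sphere_base_def)
      moreover have "s * t 0 \<ge> 0" using True s by simp
      ultimately have "s = 1" using s by linarith
      then have "t j = 0" if "j \<le> n" for j using w0[OF that] by (simp add: w_def)
      then show False using t by (simp add: in_nsphere)
    next
      case False
      define c where "c = 2 * sqrt (- t 0 / (1 - t 0))"
      have c: "c > 0" using False by (simp add: c_def divide_neg_pos)
      have "t i = 0" if "i \<in> {1..n}" for i
      proof -
        have "((1 - s) * c + s) * t i = 0"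
          using w0[of i] that False by (simp add: w_def pinch_def c_def algebra_simps)
        moreover have "(1 - s) * c + s > 0"
        proof (cases "s = 0")
          case False
          then have "s > 0" using s by simp
          moreover have "(1 - s) * c \<ge> 0" using c s by simp
          ultimately show ?thesis by linarith
        qed (simp add: c)
        ultimately show ?thesis by simp
      qed
      then have "(t 0)\<^sup>2 = 1" using t by (simp add: in_nsphere_0)
      then have "t 0 = -1" using False by (simp add: power2_eq_1_iff)
      then show False using w0[of 0] by (simp add: w_def pinch_def)
    qed
  qed
  have Npos: "N (s, t) > 0" if s: "0 \<le> s" "s \<le> 1" and t: "t \<in> topspace (nsphere n)" for s t
    using N0[OF that] sum_nonneg[of "{..n}" "\<lambda>j. (w (s, t) j)\<^sup>2"] by (simp add: N_def)
  have cp: "continuous_map (prod_topology I01 (nsphere n)) euclideanreal (\<lambda>p. pinch (snd p) j)" for j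
    using continuous_map_pinch[of n] by (intro continuous_map_snd'[of _ _ "\<lambda>t. pinch t j"]) (simp add: continuous_map_nsphere_iff)
  have cw: "continuous_map (prod_topology I01 (nsphere n)) euclideanreal (\<lambda>p. w p j)" for j
    unfolding w_def case_prod_unfold by (intro continuous_intros cp)
  show ?thesis
  proof (rule sphere_homotopyI)
    show "continuous_map (prod_topology I01 (nsphere n)) (nsphere n) (\<lambda>p i. w p i / sqrt (N p))"
      unfolding continuous_map_nsphere_iff
    proof (intro conjI allI ballI)
      fix i
      show "continuous_map (prod_topology I01 (nsphere n)) euclideanreal (\<lambda>p. w p i / sqrt (N p))"
      proof (intro continuous_intros cw)
        show "continuous_map (prod_topology I01 (nsphere n)) euclideanreal N"
          unfolding N_def by (intro continuous_intros cw) auto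
      qed (use N0 in auto)
    next
      fix p assume "p \<in> topspace (prod_topology I01 (nsphere n))"
      then obtain s t where p: "p = (s, t)" "0 \<le> s" "s \<le> 1" "t \<in> topspace (nsphere n)" by auto
      have "(\<Sum>i\<le>n. (w p i / sqrt (N p))\<^sup>2) = N p / N p"
        using Npos[OF p(2-4)] by (simp add: power_divide p(1) N_def flip: sum_divide_distrib)
      moreover have "w p i = 0" if "i > n" for i
        using pinch_in[OF p(4)] p(4) that by (simp add: w_def p(1) in_nsphere)
      ultimately show "(\<lambda>i. w p i / sqrt (N p)) \<in> topspace (nsphere n)"
        using Npos[OF p(2-4)] p(1) by (simp add: in_nsphere)
    qed
  next
    fix t assume t: "t \<in> topspace (nsphere n)"
    show "(\<lambda>i. w (0, t) i / sqrt (N (0, t))) = pinch t"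
      using pinch_in[OF t] by (simp add: N_def w_def in_nsphere)
    show "(\<lambda>i. w (1, t) i / sqrt (N (1, t))) = id t"
      using t by (simp add: N_def w_def in_nsphere)
  next
    fix s :: real
    have "w (s, sphere_base) = sphere_base"
      using pinch_nonneg[of sphere_base] by (auto simp: w_def sphere_base_def algebra_simps)
    then show "(\<lambda>i. w (s, sphere_base) i / sqrt (N (s, sphere_base))) = sphere_base"
      using sphere_base_in'[of n] by (simp add: N_def in_nsphere)
  qed
qed

lemma sphere_homotopy_pinch:
  assumes "g \<in> sphere_maps n Y y"
  shows "(g \<circ> pinch, g) \<in> sphere_homotopy n Y y"
  using sphere_homotopy_compose[OF pinch_homotopic_id, of n Y g] assms by (simp add: sphere_maps_def)

text \<open>\<open>V\<close> lives on the lower hemisphere through \<open>pinch\<close>, which sends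
  the equator to the base point; the upper hemisphere carries \<open>T\<close> as a function of the
  height \<open>t 0\<close> alone. Since \<open>sphere_base\<close> has height 1, it now moves along
  \<open>T (s, 1)\<close> instead of \<open>V (s, sphere_base)\<close>.\<close>

lemma continuous_map_attach:
  assumes V: "continuous_map (prod_topology I01 (nsphere n)) Y V"
    and T: "continuous_map (prod_topology I01 I01) Y T"
    and VT: "\<And>s. 0 \<le> s \<Longrightarrow> s \<le> 1 \<Longrightarrow> T (s, 0) = V (s, sphere_base)"
  shows "continuous_map (prod_topology I01 (nsphere n)) Y
           (\<lambda>p. if snd p 0 \<le> 0 then V (fst p, pinch (snd p)) else T (fst p, snd p 0))"
proof (rule continuous_map_cases_le)
  let ?X = "prod_topology I01 (nsphere n)"
  show "continuous_map ?X euclideanreal (\<lambda>p. snd p 0)" "continuous_map ?X euclideanreal (\<lambda>p. 0)"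
    by (intro continuous_intros)+ simp
  have "continuous_map ?X ?X (\<lambda>p. (fst p, pinch (snd p)))"
    by (intro continuous_intros continuous_map_snd' continuous_map_pinch)
  then show "continuous_map (subtopology ?X {x \<in> topspace ?X. snd x 0 \<le> 0}) Y (\<lambda>p. V (fst p, pinch (snd p)))"
    by (intro continuous_map_from_subtopology continuous_map_compose'[OF _ V])
  have "continuous_map (subtopology ?X {x \<in> topspace ?X. 0 \<le> snd x 0}) (prod_topology I01 I01) (\<lambda>p. (fst p, snd p 0))"
    unfolding continuous_map_pairedI continuous_map_paired continuous_map_I01_iff
    using nsphere_coord_le[of _ n 0]
    by (auto intro!: continuous_map_from_subtopology continuous_intros simp: abs_le_iff)
  then show "continuous_map (subtopology ?X {x \<in> topspace ?X. 0 \<le> snd x 0}) Y (\<lambda>p. T (fst p, snd p 0))"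
    by (intro continuous_map_compose'[OF _ T])
  show "V (fst p, pinch (snd p)) = T (fst p, snd p 0)" if "p \<in> topspace ?X" "snd p 0 = 0" for p
    using that VT[of "fst p"] by (auto simp: pinch_nonneg)
qed

text \<open>A contraction \<open>H\<close> may move \<open>c\<close>, so it does not fix the ends of
  the loop. The loop is therefore squeezed into the middle third of the interval by
  \<open>k\<close>; then \<open>H\<close> is applied with intensity \<open>m\<close>, which is 0 at
  the ends and 1 on that third. This turns the loop into the path from \<open>c\<close> to the
  centre \<open>z\<close> and back, and scaling \<open>m\<close> down to 0 retracts that
  path.\<close>

lemma contractible_space_null_loop:
  assumes C: "contractible_space C" and w: "continuous_map I01 C \<omega>" and w01: "\<omega> 0 = c" "\<omega> 1 = c"
  obtains T where "continuous_map (prod_topology I01 I01) C T"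
    "\<And>s. 0 \<le> s \<Longrightarrow> s \<le> 1 \<Longrightarrow> T (s, 0) = \<omega> s" "\<And>s. 0 \<le> s \<Longrightarrow> s \<le> 1 \<Longrightarrow> T (s, 1) = c"
    "\<And>r. 0 \<le> r \<Longrightarrow> r \<le> 1 \<Longrightarrow> T (0, r) = c" "\<And>r. 0 \<le> r \<Longrightarrow> r \<le> 1 \<Longrightarrow> T (1, r) = c"
proof -
  obtain z H where H: "continuous_map (prod_topology I01 C) C H"
    and H0: "\<And>x. H (0, x) = x" and H1: "\<And>x. H (1, x) = z"
    using C by (auto simp: contractible_space_def homotopic_with_def)
  have c: "c \<in> topspace C" using w w01 by (force simp: continuous_map_def)
  let ?P = "\<lambda>u. u 0 = c \<and> u 1 = c"
  define k where "k = (\<lambda>s::real. max 0 (min 1 (3 * s - 1)))"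
  define m where "m = (\<lambda>s::real. min 1 (min (3 * s) (3 - 3 * s)))"
  have ck: "continuous_map (prod_topology I01 I01) euclideanreal (\<lambda>p. k (snd p))"
    unfolding k_def by (intro continuous_intros) auto
  have cm: "continuous_map (prod_topology I01 I01) euclideanreal (\<lambda>p. m (snd p))"
    unfolding m_def by (intro continuous_intros) auto
  have k01: "0 \<le> k s" "k s \<le> 1" "k 0 = 0" "k 1 = 1" for s by (auto simp: k_def)
  have m01: "0 \<le> m s" "m s \<le> 1" if "0 \<le> s" "s \<le> 1" for s using that by (auto simp: m_def)
  \<comment> \<open>The alternative makes \<open>H (m s, \<omega> (k s))\<close> equal to
    \<open>H (m s, c)\<close>: either the contraction is complete or the loop rests at
    \<open>c\<close>.\<close>
  have mk: "m 0 = 0" "m 1 = 0" "m s = 1 \<or> \<omega> (k s) = c" for s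
    using w01 by (auto simp: m_def k_def min_def max_def)
  have h1: "homotopic_with ?P I01 C \<omega> (\<omega> \<circ> k)"
  proof (subst homotopic_with, (simp; fail), intro exI conjI ballI)
    have "continuous_map (prod_topology I01 I01) I01 (\<lambda>p. (1 - fst p) * snd p + fst p * k (snd p))"
      unfolding continuous_map_I01_iff
    proof (intro conjI ballI)
      fix p assume "p \<in> topspace (prod_topology I01 I01)"
      then show "0 \<le> (1 - fst p) * snd p + fst p * k (snd p)" "(1 - fst p) * snd p + fst p * k (snd p) \<le> 1"
        using k01 by (auto intro: convex_bound_le)
    qed (intro continuous_intros ck)
    then show "continuous_map (prod_topology I01 I01) C (\<lambda>p. \<omega> ((1 - fst p) * snd p + fst p * k (snd p)))"
      by (rule continuous_map_compose'[OF _ w])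
  qed (use w01 k01 in auto)
  have h2: "homotopic_with ?P I01 C (\<omega> \<circ> k) (\<lambda>s. H (m s, c))"
  proof (subst homotopic_with, (simp; fail), intro exI conjI ballI)
    have 1: "continuous_map (prod_topology I01 I01) I01 (\<lambda>p. fst p * m (snd p))"
      unfolding continuous_map_I01_iff
    proof (intro conjI ballI)
      fix p assume "p \<in> topspace (prod_topology I01 I01)"
      then show "0 \<le> fst p * m (snd p)" "fst p * m (snd p) \<le> 1"
        using m01 by (auto intro: mult_le_one)
    qed (intro continuous_intros cm)
    have 2: "continuous_map (prod_topology I01 I01) C (\<lambda>p. \<omega> (k (snd p)))"
      by (rule continuous_map_compose'[OF _ w]) (unfold continuous_map_I01_iff, intro conjI ck, simp add: k01)
    show "continuous_map (prod_topology I01 I01) C (\<lambda>p. H (fst p * m (snd p), \<omega> (k (snd p))))"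
      by (rule continuous_map_compose'[OF _ H]) (intro continuous_map_pairedI 1 2)
  next
    fix s :: real show "H (fst (1, s) * m (snd (1, s)), \<omega> (k (snd (1, s)))) = H (m s, c)"
      using mk(3)[of s] by (auto simp: H1)
  qed (use w01 k01 mk in \<open>auto simp: H0\<close>)
  have h3: "homotopic_with ?P I01 C (\<lambda>s. H (m s, c)) (\<lambda>s. c)"
  proof (subst homotopic_with, (simp; fail), intro exI conjI ballI)
    have 1: "continuous_map (prod_topology I01 I01) I01 (\<lambda>p. (1 - fst p) * m (snd p))"
      unfolding continuous_map_I01_iff
    proof (intro conjI ballI)
      fix p assume "p \<in> topspace (prod_topology I01 I01)"
      then show "0 \<le> (1 - fst p) * m (snd p)" "(1 - fst p) * m (snd p) \<le> 1"
        using m01 by (auto intro: mult_le_one)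
    qed (intro continuous_intros cm)
    show "continuous_map (prod_topology I01 I01) C (\<lambda>p. H ((1 - fst p) * m (snd p), c))"
      by (rule continuous_map_compose'[OF _ H]) (intro continuous_map_pairedI 1, simp add: c)
  qed (use mk in \<open>auto simp: H0\<close>)
  have "homotopic_with ?P I01 C \<omega> (\<lambda>s. c)"
    using homotopic_with_trans[OF h1 homotopic_with_trans[OF h2 h3]] .
  then obtain h where h: "continuous_map (prod_topology I01 I01) C h"
    "\<And>x. h (0, x) = \<omega> x" "\<And>x. h (1, x) = c" "\<And>t. t \<in> {0..1} \<Longrightarrow> h (t, 0) = c \<and> h (t, 1) = c"
    by (auto simp: homotopic_with_def)
  show thesis
  proof
    show "continuous_map (prod_topology I01 I01) C (\<lambda>p. h (snd p, fst p))"
      by (rule continuous_map_compose'[OF _ h(1)]) (intro continuous_map_pairedI continuous_map_fst continuous_map_snd)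
  qed (use h in auto)
qed

text \<open>A homotopy of maps \<open>v\<close> from a sphere, together with a lift through \<open>\<kappa>\<close> of the path
  traced by the base point. Keeping the lift as data makes this relation transitive.\<close>

definition tracked :: "nat \<Rightarrow> 'b topology \<Rightarrow> 'c topology \<Rightarrow> ('c \<Rightarrow> 'b) \<Rightarrow>
    ((nat \<Rightarrow> real) \<Rightarrow> 'b) \<Rightarrow> 'c \<Rightarrow> ((nat \<Rightarrow> real) \<Rightarrow> 'b) \<Rightarrow> 'c \<Rightarrow> bool" where
  "tracked n Y C \<kappa> v c v' c' \<longleftrightarrow>
     homotopic_with (\<lambda>u. fst (u sphere_base) = \<kappa> (snd (u sphere_base))) (nsphere n) (prod_topology Y C)
       (\<lambda>t. (v t, c)) (\<lambda>t. (v' t, c'))"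

lemma tracked_sym: "tracked n Y C \<kappa> v c v' c' \<Longrightarrow> tracked n Y C \<kappa> v' c' v c"
  by (simp add: tracked_def homotopic_with_sym)

lemma tracked_trans:
  "tracked n Y C \<kappa> v c v' c' \<Longrightarrow> tracked n Y C \<kappa> v' c' v'' c'' \<Longrightarrow> tracked n Y C \<kappa> v c v'' c''"
  unfolding tracked_def using homotopic_with_trans by blast

lemma trackedI:
  assumes "continuous_map (prod_topology I01 (nsphere n)) Y h"
    and "continuous_map I01 C k"
    and "\<And>t. t \<in> topspace (nsphere n) \<Longrightarrow> h (0, t) = v t"
    and "\<And>t. t \<in> topspace (nsphere n) \<Longrightarrow> h (1, t) = v' t"
    and "k 0 = c" "k 1 = c'"
    and "\<And>s. 0 \<le> s \<Longrightarrow> s \<le> 1 \<Longrightarrow> h (s, sphere_base) = \<kappa> (k s)"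
  shows "tracked n Y C \<kappa> v c v' c'"
  unfolding tracked_def
proof (subst homotopic_with)
  show "\<exists>h. continuous_map (prod_topology I01 (nsphere n)) (prod_topology Y C) h \<and>
      (\<forall>x\<in>topspace (nsphere n). h (0, x) = (v x, c)) \<and> (\<forall>x\<in>topspace (nsphere n). h (1, x) = (v' x, c')) \<and>
      (\<forall>t\<in>{0..1}. fst (h (t, sphere_base)) = \<kappa> (snd (h (t, sphere_base))))"
    using assms
    by (intro exI[of _ "\<lambda>p. (h p, k (fst p))"]) (auto intro!: continuous_map_pairedI continuous_map_fst')
qed (use sphere_base_in' in auto)

lemma tracked_of_homotopy:
  assumes h: "(v, v') \<in> sphere_homotopy n Y (\<kappa> c)" and c: "c \<in> topspace C"
  shows "tracked n Y C \<kappa> v c v' c"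
proof -
  obtain h where h: "continuous_map (prod_topology I01 (nsphere n)) Y h"
    "\<And>x. h (0, x) = v x" "\<And>x. h (1, x) = v' x" "\<And>t. t \<in> {0..1} \<Longrightarrow> h (t, sphere_base) = \<kappa> c"
    using h by (auto simp: sphere_homotopy_def homotopic_with_def)
  show ?thesis
    by (rule trackedI[OF h(1), where k = "\<lambda>_. c"]) (use h c in auto)
qed

text \<open>The lifted track of the base point is a loop in \<open>C\<close>, hence null-homotopic
  there. Attaching the image of the null homotopy to the upper hemisphere keeps the base point
  fixed, at the price of replacing \<open>v\<close> and \<open>v'\<close> by their composites with
  \<open>pinch\<close>, which are homotopic to them.\<close>

lemma tracked_imp_sphere_homotopy:
  assumes C: "contractible_space C" and k: "continuous_map C Y \<kappa>"
    and tr: "tracked n Y C \<kappa> v c v' c"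
  shows "(v, v') \<in> sphere_homotopy n Y (\<kappa> c)"
proof -
  obtain h where h: "continuous_map (prod_topology I01 (nsphere n)) (prod_topology Y C) h"
    and h01: "\<And>x. h (0, x) = (v x, c)" "\<And>x. h (1, x) = (v' x, c)"
    and hb: "\<And>t. t \<in> {0..1} \<Longrightarrow> fst (h (t, sphere_base)) = \<kappa> (snd (h (t, sphere_base)))"
    using tr by (auto simp: tracked_def homotopic_with_def)
  have v: "v sphere_base = \<kappa> c" "v' sphere_base = \<kappa> c"
    using hb[of 0] hb[of 1] h01 by auto
  have "continuous_map I01 C (\<lambda>s. snd (h (s, sphere_base)))"
    by (rule continuous_map_compose'[OF continuous_map_compose'[OF _ h] continuous_map_snd])
       (simp add: continuous_map_paired sphere_base_in' continuous_map_id[unfolded id_def])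
  moreover have "snd (h (0, sphere_base)) = c" "snd (h (1, sphere_base)) = c"
    using h01 by auto
  ultimately obtain T where T: "continuous_map (prod_topology I01 I01) C T"
    "\<And>s. 0 \<le> s \<Longrightarrow> s \<le> 1 \<Longrightarrow> T (s, 0) = snd (h (s, sphere_base))"
    "\<And>s. 0 \<le> s \<Longrightarrow> s \<le> 1 \<Longrightarrow> T (s, 1) = c"
    "\<And>r. 0 \<le> r \<Longrightarrow> r \<le> 1 \<Longrightarrow> T (0, r) = c" "\<And>r. 0 \<le> r \<Longrightarrow> r \<le> 1 \<Longrightarrow> T (1, r) = c"
    by (rule contractible_space_null_loop[OF C]) (rule that)
  let ?H = "\<lambda>p. if snd p 0 \<le> 0 then fst (h (fst p, pinch (snd p))) else \<kappa> (T (fst p, snd p 0))"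
  have cont: "continuous_map (prod_topology I01 (nsphere n)) Y ?H"
    by (rule continuous_map_attach[of n Y "\<lambda>p. fst (h p)" "\<lambda>p. \<kappa> (T p)",
          OF continuous_map_compose'[OF h continuous_map_fst] continuous_map_compose'[OF T(1) k]])
       (use T hb in auto)
  have "(v \<circ> pinch, v' \<circ> pinch) \<in> sphere_homotopy n Y (\<kappa> c)"
  proof (rule sphere_homotopyI[OF cont])
    fix t assume "t \<in> topspace (nsphere n)"
    then have "\<bar>t 0\<bar> \<le> 1" by (rule nsphere_coord_le)
    then show "?H (0, t) = (v \<circ> pinch) t" "?H (1, t) = (v' \<circ> pinch) t"
      using T h01 v by (auto simp: pinch_nonneg)
  qed (use T in \<open>auto simp: sphere_base_def\<close>)
  moreover have "v \<in> sphere_maps n Y (\<kappa> c)" "v' \<in> sphere_maps n Y (\<kappa> c)"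
    using homotopic_with_imp_continuous_maps[OF tr[unfolded tracked_def]] v
    by (auto simp: sphere_maps_def continuous_map_paired)
  ultimately show ?thesis
    by (meson sphere_homotopy_pinch sphere_homotopy_sym sphere_homotopy_trans)
qed

lemma contractible_space_I01: "contractible_space I01"
  by (simp add: convex_imp_contractible)

text \<open>Here the contractible space is the interval itself and \<open>\<kappa>\<close> is the
  path of the base point. Going along the homotopy and later back gives a closed lift, although the
  path in \<open>Y\<close> need not be null-homotopic in itself.\<close>

lemma tracked_homotopic:
  assumes h: "continuous_map (prod_topology I01 X) Y h"
    and x: "x \<in> topspace X" and g: "g \<in> sphere_maps n X x"
  shows "tracked n Y I01 (\<lambda>s. h (s, x)) (\<lambda>t. h (0, g t)) 0 (\<lambda>t. h (1, g t)) 1"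
proof (rule trackedI[where k = "\<lambda>s. s"])
  show "continuous_map (prod_topology I01 (nsphere n)) Y (\<lambda>p. h (fst p, g (snd p)))"
    using g by (intro continuous_map_compose'[OF _ h] continuous_map_pairedI continuous_map_fst continuous_map_snd')
               (auto simp: sphere_maps_def)
  show "continuous_map I01 I01 (\<lambda>s. s)" using continuous_map_id[of I01] by (simp add: id_def)
qed (use g in \<open>auto simp: sphere_maps_def\<close>)

text \<open>Transport of a sphere map along a path: at time \<open>s\<close> the upper hemisphere is
  mapped by \<open>\<tau> (s * t 0)\<close>, so that the equator stays at \<open>\<tau> 0\<close>
  and the base point is at \<open>\<tau> s\<close>.\<close>

lemma tracked_attach:
  assumes tau: "continuous_map I01 Y \<tau>" and u: "u \<in> sphere_maps n Y (\<tau> 0)"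
  obtains v where "v \<in> sphere_maps n Y (\<tau> 1)" "tracked n Y I01 \<tau> u 0 v 1"
proof
  let ?H = "\<lambda>p. if snd p 0 \<le> 0 then u (pinch (snd p)) else \<tau> (fst p * snd p 0)"
  have u0: "u sphere_base = \<tau> 0" and cu: "continuous_map (nsphere n) Y u"
    using u by (auto simp: sphere_maps_def)
  have "continuous_map (prod_topology I01 I01) I01 (\<lambda>p. fst p * snd p)"
    unfolding continuous_map_I01_iff by (intro conjI continuous_intros) (auto intro: mult_le_one)
  then have T: "continuous_map (prod_topology I01 I01) Y (\<lambda>p. \<tau> (fst p * snd p))"
    by (rule continuous_map_compose'[OF _ tau])
  have V: "continuous_map (prod_topology I01 (nsphere n)) Y (\<lambda>p. u (snd p))"
    by (rule continuous_map_snd'[OF cu])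
  have H: "continuous_map (prod_topology I01 (nsphere n)) Y ?H"
    using continuous_map_attach[OF V T] u0 by (simp cong: if_cong)
  have tr: "tracked n Y I01 \<tau> (u \<circ> pinch) 0 (\<lambda>t. ?H (1, t)) 1"
    by (rule trackedI[OF H, where k = "\<lambda>s. s"])
       (use continuous_map_id[of I01] u0 in \<open>auto simp: id_def pinch_nonneg sphere_base_def\<close>)
  moreover have "tracked n Y I01 \<tau> (u \<circ> pinch) 0 u 0"
    by (rule tracked_of_homotopy) (use sphere_homotopy_pinch[OF u] in auto)
  ultimately show "tracked n Y I01 \<tau> u 0 (\<lambda>t. ?H (1, t)) 1"
    by (blast intro: tracked_trans tracked_sym)
  show "(\<lambda>t. ?H (1, t)) \<in> sphere_maps n Y (\<tau> 1)"
    using homotopic_with_imp_continuous_maps[OF tr[unfolded tracked_def]]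
    by (auto simp: sphere_maps_def continuous_map_paired sphere_base_def)
qed

text \<open>\<open>u\<close> is carried along the path of \<open>x\<close> to the base point
  \<open>\<psi> x\<close>, represented there by some \<open>\<psi> \<circ> g\<close>, and carried
  back. The lifts to the interval start and end at 0, so the result is a based homotopy.\<close>

lemma homotopic_sphere_maps_surj:
  assumes hom: "homotopic_with (\<lambda>_. True) X Y \<phi> \<psi>" and x: "x \<in> topspace X"
    and surj: "\<And>u. u \<in> sphere_maps n Y (\<psi> x) \<Longrightarrow> \<exists>g\<in>sphere_maps n X x. (\<psi> \<circ> g, u) \<in> sphere_homotopy n Y (\<psi> x)"
    and u: "u \<in> sphere_maps n Y (\<phi> x)"
  shows "\<exists>g\<in>sphere_maps n X x. (\<phi> \<circ> g, u) \<in> sphere_homotopy n Y (\<phi> x)"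
proof -
  obtain h where h: "continuous_map (prod_topology I01 X) Y h"
    and h01: "\<And>x. h (0, x) = \<phi> x" "\<And>x. h (1, x) = \<psi> x"
    using hom by (auto simp: homotopic_with_def)
  define \<tau> where "\<tau> = (\<lambda>s. h (s, x))"
  have tau: "continuous_map I01 Y \<tau>" "\<tau> 0 = \<phi> x" "\<tau> 1 = \<psi> x"
    unfolding \<tau>_def using x h01
    by (auto intro!: continuous_map_compose'[OF _ h] continuous_map_pairedI continuous_map_id[unfolded id_def])
  obtain v where v: "v \<in> sphere_maps n Y (\<tau> 1)" "tracked n Y I01 \<tau> u 0 v 1"
    using tracked_attach[OF tau(1), of u n] u tau by metis
  obtain g where g: "g \<in> sphere_maps n X x" "(\<psi> \<circ> g, v) \<in> sphere_homotopy n Y (\<tau> 1)"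
    using surj v(1) tau(3) by metis
  have "tracked n Y I01 \<tau> (\<phi> \<circ> g) 0 (\<psi> \<circ> g) 1"
    using tracked_homotopic[OF h x g(1)] by (simp add: h01 \<tau>_def o_def)
  moreover have "tracked n Y I01 \<tau> (\<psi> \<circ> g) 1 v 1"
    by (rule tracked_of_homotopy) (use g(2) in auto)
  ultimately have "tracked n Y I01 \<tau> (\<phi> \<circ> g) 0 u 0"
    using v(2) by (blast intro: tracked_trans tracked_sym)
  from tracked_imp_sphere_homotopy[OF contractible_space_I01 tau(1) this] g(1)
  show ?thesis by (auto simp: tau)
qed

lemma homotopic_sphere_maps_inj:
  assumes hom: "homotopic_with (\<lambda>_. True) X Y \<phi> \<psi>" and x: "x \<in> topspace X"
    and g: "g \<in> sphere_maps n X x" "g' \<in> sphere_maps n X x"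
    and eq: "(\<phi> \<circ> g, \<phi> \<circ> g') \<in> sphere_homotopy n Y (\<phi> x)"
  shows "(\<psi> \<circ> g, \<psi> \<circ> g') \<in> sphere_homotopy n Y (\<psi> x)"
proof -
  obtain h where h: "continuous_map (prod_topology I01 X) Y h"
    and h01: "\<And>x. h (0, x) = \<phi> x" "\<And>x. h (1, x) = \<psi> x"
    using hom by (auto simp: homotopic_with_def)
  define \<tau> where "\<tau> = (\<lambda>s. h (s, x))"
  have tau: "continuous_map I01 Y \<tau>" "\<tau> 0 = \<phi> x" "\<tau> 1 = \<psi> x"
    unfolding \<tau>_def using x h01
    by (auto intro!: continuous_map_compose'[OF _ h] continuous_map_pairedI continuous_map_id[unfolded id_def])
  have *: "tracked n Y I01 \<tau> (\<phi> \<circ> k) 0 (\<psi> \<circ> k) 1" if "k \<in> sphere_maps n X x" for k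
    using tracked_homotopic[OF h x that] by (simp add: h01 \<tau>_def o_def)
  have "tracked n Y I01 \<tau> (\<phi> \<circ> g) 0 (\<phi> \<circ> g') 0"
    by (rule tracked_of_homotopy) (use eq tau in auto)
  then have "tracked n Y I01 \<tau> (\<psi> \<circ> g) 1 (\<psi> \<circ> g') 1"
    using *[OF g(1)] *[OF g(2)] by (blast intro: tracked_trans tracked_sym)
  from tracked_imp_sphere_homotopy[OF contractible_space_I01 tau(1) this]
  show ?thesis by (auto simp: tau)
qed

section \<open>Homotopy equivalences\<close>

definition homotopy_equivalence :: "'a topology \<Rightarrow> 'b topology \<Rightarrow> ('a \<Rightarrow> 'b) \<Rightarrow> bool" where
  "homotopy_equivalence X Y f \<longleftrightarrow> continuous_map X Y f \<and>
     (\<exists>r. continuous_map Y X r \<and> homotopic_with (\<lambda>_. True) X X (r \<circ> f) id \<and> homotopic_with (\<lambda>_. True) Y Y (f \<circ> r) id)"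

lemma homotopic_path_component:
  assumes "homotopic_with (\<lambda>_. True) X Y \<phi> \<psi>" and x: "x \<in> topspace X"
  shows "path_component_of Y (\<phi> x) (\<psi> x)"
proof -
  obtain h where h: "continuous_map (prod_topology I01 X) Y h"
    and h01: "\<And>x. h (0, x) = \<phi> x" "\<And>x. h (1, x) = \<psi> x"
    using assms by (auto simp: homotopic_with_def)
  have "pathin Y (\<lambda>s. h (s, x))"
    unfolding pathin_def using x
    by (auto intro!: continuous_map_compose'[OF _ h] continuous_map_pairedI continuous_map_id[unfolded id_def])
  then show ?thesis unfolding path_component_of_def using h01 by blast
qed

lemma path_component_of_continuous_image:
  assumes "path_component_of X x y" and "continuous_map X Y f"
  shows "path_component_of Y (f x) (f y)"
proof -
  obtain p where "pathin X p" "p 0 = x" "p 1 = y"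
    using assms(1) unfolding path_component_of_def by blast
  then show ?thesis unfolding path_component_of_def
    using assms(2) by (intro exI[of _ "f \<circ> p"]) (auto simp: pathin_compose)
qed

lemma id_sphere_maps_surj:
  assumes "homotopic_with (\<lambda>_. True) X X \<phi> id" "x \<in> topspace X" "u \<in> sphere_maps n X (\<phi> x)"
  shows "\<exists>g\<in>sphere_maps n X x. (\<phi> \<circ> g, u) \<in> sphere_homotopy n X (\<phi> x)"
  using homotopic_sphere_maps_surj[OF assms(1,2) _ assms(3)] by (auto intro: sphere_homotopy_refl)

lemma id_sphere_maps_inj:
  assumes "homotopic_with (\<lambda>_. True) X X \<phi> id" "x \<in> topspace X" "g \<in> sphere_maps n X x" "g' \<in> sphere_maps n X x"
    "(\<phi> \<circ> g, \<phi> \<circ> g') \<in> sphere_homotopy n X (\<phi> x)"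
  shows "(g, g') \<in> sphere_homotopy n X x"
  using homotopic_sphere_maps_inj[OF assms] by simp

text \<open>On homotopy groups \<open>f\<^sub>*\<close> is injective since \<open>(r f)\<^sub>*\<close> is; for surjectivity at \<open>x\<close> one uses that
  \<open>r\<^sub>*\<close> is injective at \<open>f x\<close>, because \<open>(f r)\<^sub>*\<close> is.\<close>

lemma homotopy_equivalence_imp_weak:
  assumes "homotopy_equivalence X Y f"
  shows "weak_homotopy_equivalence X Y f"
proof -
  obtain r where f: "continuous_map X Y f" and r: "continuous_map Y X r"
    and rf: "homotopic_with (\<lambda>_. True) X X (r \<circ> f) id" and fr: "homotopic_with (\<lambda>_. True) Y Y (f \<circ> r) id"
    using assms by (auto simp: homotopy_equivalence_def)
  have fX: "f x \<in> topspace Y" if "x \<in> topspace X" for x using f that by (auto simp: continuous_map_def)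
  have rY: "r y \<in> topspace X" if "y \<in> topspace Y" for y using r that by (auto simp: continuous_map_def)
  have comp: "f \<circ> g \<in> sphere_maps n Y (f x)" if "g \<in> sphere_maps n X x" for g n x
    using that f by (auto simp: sphere_maps_def intro: continuous_map_compose)
  have compr: "r \<circ> g \<in> sphere_maps n X (r y)" if "g \<in> sphere_maps n Y y" for g n y
    using that r by (auto simp: sphere_maps_def intro: continuous_map_compose)
  show ?thesis
  proof (rule weak_homotopy_equivalenceI[OF f])
    fix y assume "y \<in> topspace Y"
    then show "\<exists>x\<in>topspace X. path_component_of Y (f x) y"
      using homotopic_path_component[OF fr] rY by auto
  next
    fix x x' assume x: "x \<in> topspace X" "x' \<in> topspace X" and p: "path_component_of Y (f x) (f x')"
    show "path_component_of X x x'"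
      using path_component_of_continuous_image[OF p r] homotopic_path_component[OF rf x(1)]
        homotopic_path_component[OF rf x(2)]
      by (metis comp_apply id_apply path_component_of_sym path_component_of_trans)
  next
    fix n x g g' assume x: "x \<in> topspace X" and g: "g \<in> sphere_maps n X x" "g' \<in> sphere_maps n X x"
      and eq: "(f \<circ> g, f \<circ> g') \<in> sphere_homotopy n Y (f x)"
    show "(g, g') \<in> sphere_homotopy n X x"
      using id_sphere_maps_inj[OF rf x g] sphere_homotopy_compose[OF eq r] by (simp add: o_assoc)
  next
    fix n x u assume x: "x \<in> topspace X" and u: "u \<in> sphere_maps n Y (f x)"
    obtain g where g: "g \<in> sphere_maps n X x" "(r \<circ> f \<circ> g, r \<circ> u) \<in> sphere_homotopy n X (r (f x))"
      using id_sphere_maps_surj[OF rf x, of "r \<circ> u" n] compr[OF u] by auto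
    have "(f \<circ> r \<circ> (f \<circ> g), f \<circ> r \<circ> u) \<in> sphere_homotopy n Y ((f \<circ> r) (f x))"
      using sphere_homotopy_compose[OF g(2) f] by (simp add: o_assoc)
    then have "(f \<circ> g, u) \<in> sphere_homotopy n Y (f x)"
      using id_sphere_maps_inj[OF fr fX[OF x] comp[OF g(1)] u] by simp
    then show "\<exists>g\<in>sphere_maps n X x. (f \<circ> g, u) \<in> sphere_homotopy n Y (f x)"
      using g(1) by blast
  qed
qed

lemma homotopy_equivalence_compose:
  assumes "homotopy_equivalence X Y f" "homotopy_equivalence Y Z g"
  shows "homotopy_equivalence X Z (g \<circ> f)"
proof -
  obtain r where f: "continuous_map X Y f" and r: "continuous_map Y X r"
    and rf: "homotopic_with (\<lambda>_. True) X X (r \<circ> f) id" and fr: "homotopic_with (\<lambda>_. True) Y Y (f \<circ> r) id"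
    using assms by (auto simp: homotopy_equivalence_def)
  obtain s where g: "continuous_map Y Z g" and s: "continuous_map Z Y s"
    and sg: "homotopic_with (\<lambda>_. True) Y Y (s \<circ> g) id" and gs: "homotopic_with (\<lambda>_. True) Z Z (g \<circ> s) id"
    using assms by (auto simp: homotopy_equivalence_def)
  have "homotopic_with (\<lambda>_. True) X X (r \<circ> (s \<circ> g) \<circ> f) (r \<circ> id \<circ> f)"
    by (intro homotopic_with_compose_continuous_map_right[OF _ f]
          homotopic_with_compose_continuous_map_left[OF sg r]) auto
  then have 1: "homotopic_with (\<lambda>_. True) X X ((r \<circ> s) \<circ> (g \<circ> f)) id"
    using rf homotopic_with_trans by (fastforce simp: o_assoc)
  have "homotopic_with (\<lambda>_. True) Z Z (g \<circ> (f \<circ> r) \<circ> s) (g \<circ> id \<circ> s)"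
    by (intro homotopic_with_compose_continuous_map_right[OF _ s]
          homotopic_with_compose_continuous_map_left[OF fr g]) auto
  then have 2: "homotopic_with (\<lambda>_. True) Z Z ((g \<circ> f) \<circ> (r \<circ> s)) id"
    using gs homotopic_with_trans by (fastforce simp: o_assoc)
  show ?thesis unfolding homotopy_equivalence_def
    using continuous_map_compose[OF f g] continuous_map_compose[OF s r] 1 2 by blast
qed

lemma homotopy_equivalence_homotopic:
  assumes f: "homotopy_equivalence X Y f" and fg: "homotopic_with (\<lambda>_. True) X Y f g"
  shows "homotopy_equivalence X Y g"
proof -
  obtain r where r: "continuous_map Y X r"
    and rf: "homotopic_with (\<lambda>_. True) X X (r \<circ> f) id" and fr: "homotopic_with (\<lambda>_. True) Y Y (f \<circ> r) id"
    using f by (auto simp: homotopy_equivalence_def)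
  have gf: "homotopic_with (\<lambda>_. True) X Y g f" using fg by (simp add: homotopic_with_sym)
  have "homotopic_with (\<lambda>_. True) X X (r \<circ> g) (r \<circ> f)" "homotopic_with (\<lambda>_. True) Y Y (g \<circ> r) (f \<circ> r)"
    using homotopic_with_compose_continuous_map_left[OF gf r]
      homotopic_with_compose_continuous_map_right[OF gf r] by auto
  then have "homotopic_with (\<lambda>_. True) X X (r \<circ> g) id" "homotopic_with (\<lambda>_. True) Y Y (g \<circ> r) id"
    using rf fr homotopic_with_trans by blast+
  then show ?thesis unfolding homotopy_equivalence_def
    using homotopic_with_imp_continuous_maps[OF fg] r by blast
qed

text \<open>With a homotopy inverse \<open>s\<close> of \<open>g\<close>, the map \<open>f\<close>
  is homotopic to \<open>s \<circ> h\<close>.\<close>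

lemma homotopy_equivalence_cancel:
  assumes h: "homotopy_equivalence X Z h" and g: "homotopy_equivalence Y Z g"
    and f: "continuous_map X Y f" and gf: "\<And>x. x \<in> topspace X \<Longrightarrow> g (f x) = h x"
  shows "homotopy_equivalence X Y f"
proof -
  obtain s where cg: "continuous_map Y Z g" and s: "continuous_map Z Y s"
    and sg: "homotopic_with (\<lambda>_. True) Y Y (s \<circ> g) id" and gs: "homotopic_with (\<lambda>_. True) Z Z (g \<circ> s) id"
    using g by (auto simp: homotopy_equivalence_def)
  have "homotopy_equivalence Z Y s"
    unfolding homotopy_equivalence_def using cg s sg gs by blast
  then have he: "homotopy_equivalence X Y (s \<circ> h)" by (rule homotopy_equivalence_compose[OF h])
  have 1: "homotopic_with (\<lambda>_. True) X Y ((s \<circ> g) \<circ> f) (id \<circ> f)"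
    by (rule homotopic_with_compose_continuous_map_right[OF sg f]) auto
  have "homotopic_with (\<lambda>_. True) X Y (s \<circ> h) f"
    by (rule homotopic_with_eq[OF 1]) (use gf in auto)
  then show ?thesis by (rule homotopy_equivalence_homotopic[OF he])
qed

lemma homeomorphic_imp_homotopy_equivalence:
  assumes "homeomorphic_map X Y f"
  shows "homotopy_equivalence X Y f"
proof -
  obtain r where r: "homeomorphic_maps X Y f r"
    using assms homeomorphic_map_maps by blast
  then have "homotopic_with (\<lambda>_. True) X X (r \<circ> f) id" "homotopic_with (\<lambda>_. True) Y Y (f \<circ> r) id"
    by (auto intro!: homotopic_with_equal continuous_map_compose simp: homeomorphic_maps_def)
  then show ?thesis using r by (auto simp: homotopy_equivalence_def homeomorphic_maps_def)
qed

section \<open>From finite complexes to finite spaces\<close>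

subsection \<open>Geometric realization of finite simplicial complexes\<close>

definition vsupp :: "('v \<Rightarrow> real) \<Rightarrow> 'v set" where
  "vsupp x = {v. x v \<noteq> 0}"

text \<open>The empty face belongs to every nonempty complex but carries no point, since the
  coordinates of a point sum to 1. The complex without any face is allowed; its realization is
  empty.\<close>

definition simplicial_complex :: "'v set set \<Rightarrow> bool" where
  "simplicial_complex L \<longleftrightarrow> finite (\<Union>L) \<and> (\<forall>A\<in>L. \<forall>B. B \<subseteq> A \<longrightarrow> B \<in> L)"

definition gpoints :: "'v set set \<Rightarrow> ('v \<Rightarrow> real) set" where
  "gpoints L = {x. (\<forall>v. 0 \<le> x v) \<and> vsupp x \<in> L \<and> sum x (vsupp x) = 1}"

text \<open>With finitely many vertices, pointwise convergence of the barycentric coordinates gives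
  the usual topology of a polyhedron.\<close>

definition geo :: "'v set set \<Rightarrow> ('v \<Rightarrow> real) topology" where
  "geo L = subtopology (powertop_real UNIV) (gpoints L)"

lemma topspace_geo [simp]: "topspace (geo L) = gpoints L"
  by (simp add: geo_def)

lemma in_vsupp [simp]: "v \<in> vsupp x \<longleftrightarrow> x v \<noteq> 0"
  by (simp add: vsupp_def)

lemma simplicial_complexD:
  assumes "simplicial_complex L" "A \<in> L"
  shows "finite A" "B \<subseteq> A \<Longrightarrow> B \<in> L"
  using assms unfolding simplicial_complex_def by (meson Union_upper finite_subset)+

lemma finite_simplicial_complex: "simplicial_complex L \<Longrightarrow> finite L"
  unfolding simplicial_complex_def using finite_UnionD by blast

lemma sum_vsupp: "finite A \<Longrightarrow> vsupp x \<subseteq> A \<Longrightarrow> sum x (vsupp x) = sum x A"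
  by (rule sum.mono_neutral_left) (auto simp: vsupp_def)

lemma gpointsI:
  assumes L: "simplicial_complex L" "A \<in> L" and x: "\<And>v. v \<in> A \<Longrightarrow> 0 \<le> x v" "\<And>v. v \<notin> A \<Longrightarrow> x v = 0" "sum x A = 1"
  shows "x \<in> gpoints L"
proof -
  have sub: "vsupp x \<subseteq> A" using x(2) by (auto simp: vsupp_def)
  then have "vsupp x \<in> L" "sum x (vsupp x) = 1"
    using simplicial_complexD[OF L] sum_vsupp[of A x] x(3) by auto
  moreover have "0 \<le> x v" for v using x(1,2)[of v] by (cases "v \<in> A") auto
  ultimately show ?thesis by (simp add: gpoints_def)
qed

lemma gpointsD:
  assumes "x \<in> gpoints L"
  shows "0 \<le> x v" "vsupp x \<in> L" "sum x (vsupp x) = 1"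
  using assms by (auto simp: gpoints_def)

lemma gpoints_sum:
  assumes "x \<in> gpoints L" "finite A" "vsupp x \<subseteq> A"
  shows "sum x A = 1"
  using sum_vsupp[OF assms(2,3)] gpointsD[OF assms(1)] by simp

lemma gpoints_nonempty_supp: "x \<in> gpoints L \<Longrightarrow> vsupp x \<noteq> {}"
  using gpointsD(3)[of x L] by fastforce

lemma gpoints_le_1:
  assumes "simplicial_complex L" "x \<in> gpoints L"
  shows "x v \<le> 1"
proof (cases "v \<in> vsupp x")
  case True
  then have "x v \<le> sum x (vsupp x)"
    using gpointsD[OF assms(2)] simplicial_complexD(1)[OF assms(1)] by (intro member_le_sum) auto
  then show ?thesis using gpointsD[OF assms(2)] by simp
qed simp

lemma gpoints_mono: "L \<subseteq> L' \<Longrightarrow> gpoints L \<subseteq> gpoints L'"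
  by (auto simp: gpoints_def)

lemma vertex_in_gpoints:
  assumes "{v} \<in> L"
  shows "(\<lambda>u. if u = v then 1 else 0) \<in> gpoints L"
proof -
  have "vsupp (\<lambda>u. if u = v then 1 else (0::real)) = {v}" by (auto simp: vsupp_def)
  then show ?thesis using assms by (simp add: gpoints_def)
qed

lemma continuous_map_geo_coord [continuous_intros]: "continuous_map (geo L) euclideanreal (\<lambda>x. x v)"
  unfolding geo_def by (intro continuous_map_from_subtopology continuous_map_product_projection) simp

lemma continuous_map_geo_coord':
  "continuous_map X (geo L) f \<Longrightarrow> continuous_map X euclideanreal (\<lambda>t. f t v)"
  by (rule continuous_map_compose'[OF _ continuous_map_geo_coord])

lemma continuous_map_into_geo:
  "continuous_map X (geo L) f \<longleftrightarrow>
     (\<forall>v. continuous_map X euclideanreal (\<lambda>t. f t v)) \<and> (\<forall>t\<in>topspace X. f t \<in> gpoints L)"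
  unfolding geo_def continuous_map_in_subtopology continuous_map_componentwise_UNIV by auto

lemma continuous_map_geo_mono: "L \<subseteq> L' \<Longrightarrow> continuous_map (geo L) (geo L') (\<lambda>x. x)"
  using gpoints_mono by (auto simp: continuous_map_into_geo intro: continuous_map_geo_coord)

lemma gpoints_line:
  assumes L: "simplicial_complex L" and x: "x \<in> gpoints L" "y \<in> gpoints L" "vsupp x \<union> vsupp y \<in> L"
    and s: "0 \<le> s" "s \<le> 1"
  shows "(\<lambda>v. (1 - s) * x v + s * y v) \<in> gpoints L"
proof (rule gpointsI[OF L x(3)])
  note fin = simplicial_complexD(1)[OF L x(3)]
  have "sum x (vsupp x \<union> vsupp y) = 1" "sum y (vsupp x \<union> vsupp y) = 1"
    using gpoints_sum[OF x(1) fin] gpoints_sum[OF x(2) fin] by auto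
  then show "(\<Sum>v\<in>vsupp x \<union> vsupp y. (1 - s) * x v + s * y v) = 1"
    by (simp add: sum.distrib flip: sum_distrib_left)
qed (use s gpointsD(1)[OF x(1)] gpointsD(1)[OF x(2)] in auto)

text \<open>At each point the whole segment lies in the simplex spanned by the two supports. The
  predicate \<open>P\<close> lets later homotopies respect a support condition or the fibres of a
  map.\<close>

lemma homotopic_with_geo_line:
  assumes L: "simplicial_complex L" and f: "continuous_map X (geo L) f" and g: "continuous_map X (geo L) g"
    and fg: "\<And>t. t \<in> topspace X \<Longrightarrow> vsupp (f t) \<union> vsupp (g t) \<in> L"
    and P: "\<And>s. 0 \<le> s \<Longrightarrow> s \<le> 1 \<Longrightarrow> P (\<lambda>t v. (1 - s) * f t v + s * g t v)"
  shows "homotopic_with P X (geo L) f g"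
  unfolding homotopic_with_def
proof (intro exI conjI allI ballI)
  have fX: "f t \<in> gpoints L" "g t \<in> gpoints L" if "t \<in> topspace X" for t
    using f g that by (auto simp: continuous_map_into_geo)
  show "continuous_map (prod_topology I01 X) (geo L) (\<lambda>p v. (1 - fst p) * f (snd p) v + fst p * g (snd p) v)"
    unfolding continuous_map_into_geo
  proof (intro conjI allI ballI)
    fix v show "continuous_map (prod_topology I01 X) euclideanreal (\<lambda>p. (1 - fst p) * f (snd p) v + fst p * g (snd p) v)"
      by (intro continuous_intros continuous_map_snd'[OF continuous_map_geo_coord'[OF f]]
          continuous_map_snd'[OF continuous_map_geo_coord'[OF g]])
  qed (use fX fg in \<open>auto intro!: gpoints_line[OF L]\<close>)
qed (use P in auto)

lemma contractible_geo_cone: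
  assumes L: "simplicial_complex L" and a: "{a} \<in> L" "\<And>A. A \<in> L \<Longrightarrow> insert a A \<in> L"
  shows "contractible_space (geo L)"
  unfolding contractible_space_def
proof (intro exI homotopic_with_geo_line[OF L])
  have e: "vsupp (\<lambda>u. if u = a then 1 else (0::real)) = {a}" by (auto simp: vsupp_def)
  show "vsupp (id x) \<union> vsupp (\<lambda>u. if u = a then 1 else (0::real)) \<in> L" if "x \<in> topspace (geo L)" for x
    unfolding e using a(2)[OF gpointsD(2)[of x L]] that by simp
qed (use vertex_in_gpoints[OF a(1)] in auto)

lemma compact_space_geo:
  assumes L: "simplicial_complex L"
  shows "compact_space (geo L)"
proof -
  let ?X = "powertop_real UNIV :: ('a \<Rightarrow> real) topology"
  \<comment> \<open>\<open>K A\<close> is the closed simplex on \<open>A\<close>. Finitely many of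
    these cover the complex, and all lie in a cube that is compact by Tychonoff's theorem.\<close>
  define K where "K = (\<lambda>A. {x::'a \<Rightarrow> real. (\<forall>v. 0 \<le> x v) \<and> (\<forall>v. v \<notin> A \<longrightarrow> x v = 0) \<and> sum x A = 1})"
  have eq: "gpoints L = (\<Union>A\<in>L. K A)"
  proof
    show "gpoints L \<subseteq> (\<Union>A\<in>L. K A)"
    proof
      fix x assume x: "x \<in> gpoints L"
      then have "x \<in> K (vsupp x)" using gpointsD[OF x] by (simp add: K_def)
      then show "x \<in> (\<Union>A\<in>L. K A)" using gpointsD(2)[OF x] by blast
    qed
    show "(\<Union>A\<in>L. K A) \<subseteq> gpoints L"
      by (auto simp: K_def intro!: gpointsI[OF L])
  qed
  have clo: "closedin ?X (K A)" if "A \<in> L" for A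
  proof -
    have c: "continuous_map ?X euclideanreal (\<lambda>x. sum x A)" "continuous_map ?X euclideanreal (\<lambda>x. x v)" for v
      using simplicial_complexD(1)[OF L that]
      by (auto intro!: continuous_map_sum continuous_map_product_projection)
    have "closedin ?X ((\<Inter>v. {x \<in> topspace ?X. x v \<in> {0..}})
        \<inter> (\<Inter>v. {x \<in> topspace ?X. x v \<in> (if v \<in> A then UNIV else {0})})
        \<inter> {x \<in> topspace ?X. sum x A \<in> {1}})"
      by (intro closedin_Int closedin_INT closedin_continuous_map_preimage[OF c(1)]
          closedin_continuous_map_preimage[OF c(2)]) (auto split: if_splits)
    moreover have "K A = (\<Inter>v. {x \<in> topspace ?X. x v \<in> {0..}})
        \<inter> (\<Inter>v. {x \<in> topspace ?X. x v \<in> (if v \<in> A then UNIV else {0})})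
        \<inter> {x \<in> topspace ?X. sum x A \<in> {1}}"
      by (auto simp: K_def split: if_splits)
    ultimately show ?thesis by simp
  qed
  have "compactin ?X (gpoints L)"
  proof (rule closed_compactin)
    show "compactin ?X (UNIV \<rightarrow>\<^sub>E {0..1})" by (simp add: compactin_PiE)
    show "gpoints L \<subseteq> UNIV \<rightarrow>\<^sub>E {0..1}"
      using gpointsD gpoints_le_1[OF L] by auto
    show "closedin ?X (gpoints L)"
      unfolding eq using finite_simplicial_complex[OF L] clo by (intro closedin_Union) auto
  qed
  then show ?thesis by (simp add: geo_def compact_space_subtopology)
qed

subsection \<open>Simplicial maps\<close>

text \<open>The pushforward of \<open>x\<close>, regarded as a measure on the vertices: this is the
  affine extension of the vertex map \<open>w\<close>.\<close>

definition push :: "('v \<Rightarrow> 'w) \<Rightarrow> ('v \<Rightarrow> real) \<Rightarrow> 'w \<Rightarrow> real" where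
  "push w x = (\<lambda>u. \<Sum>v\<in>vsupp x. if w v = u then x v else 0)"

lemma push_eq_sum:
  assumes "finite A" "vsupp x \<subseteq> A"
  shows "push w x u = (\<Sum>v\<in>A. if w v = u then x v else 0)"
  unfolding push_def using assms by (intro sum.mono_neutral_left) auto

lemma vsupp_push:
  assumes "finite (vsupp x)" "\<And>v. 0 \<le> x v"
  shows "vsupp (push w x) = w ` vsupp x"
proof -
  have "push w x u = 0 \<longleftrightarrow> (\<forall>v\<in>vsupp x. w v \<noteq> u)" for u
    unfolding push_def using assms by (subst sum_nonneg_eq_0_iff) auto
  then show ?thesis by (force simp del: in_vsupp simp: vsupp_def[of "push w x"])
qed

lemma sum_push:
  assumes "finite (vsupp x)"
  shows "sum (push w x) (w ` vsupp x) = sum x (vsupp x)"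
proof -
  have "sum (push w x) (w ` vsupp x) = (\<Sum>v\<in>vsupp x. \<Sum>u\<in>w ` vsupp x. if w v = u then x v else 0)"
    unfolding push_def by (rule sum.swap)
  also have "\<dots> = sum x (vsupp x)"
    using assms by (intro sum.cong) (auto simp: sum.delta')
  finally show ?thesis .
qed

lemma push_in_gpoints:
  assumes L: "simplicial_complex L" and w: "\<And>A. A \<in> L \<Longrightarrow> w ` A \<in> L'" and x: "x \<in> gpoints L"
  shows "push w x \<in> gpoints L'"
proof -
  note fin = simplicial_complexD(1)[OF L gpointsD(2)[OF x]]
  note vp = vsupp_push[OF fin gpointsD(1)[OF x]]
  have "0 \<le> push w x u" for u
    unfolding push_def using gpointsD(1)[OF x] by (intro sum_nonneg) auto
  then show ?thesis unfolding gpoints_def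
    using sum_push[OF fin, of w] gpointsD(3)[OF x] w[OF gpointsD(2)[OF x]] by (auto simp: vp)
qed

lemma continuous_map_push:
  assumes L: "simplicial_complex L" and w: "\<And>A. A \<in> L \<Longrightarrow> w ` A \<in> L'"
  shows "continuous_map (geo L) (geo L') (push w)"
  unfolding continuous_map_into_geo
proof (intro conjI allI ballI)
  fix u
  have fin: "finite (\<Union>L)" using L by (simp add: simplicial_complex_def)
  have "continuous_map (geo L) euclideanreal (\<lambda>x. \<Sum>v\<in>\<Union>L. if w v = u then x v else 0)"
  proof (intro continuous_map_sum)
    fix v show "continuous_map (geo L) euclideanreal (\<lambda>x. if w v = u then x v else 0)"
      by (cases "w v = u") (auto intro: continuous_map_geo_coord)
  qed (use fin in auto)
  then show "continuous_map (geo L) euclideanreal (\<lambda>x. push w x u)"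
  proof (rule continuous_map_eq)
    fix x assume "x \<in> topspace (geo L)"
    then have "vsupp x \<subseteq> \<Union>L" using gpointsD(2)[of x L] by auto
    then show "(\<Sum>v\<in>\<Union>L. if w v = u then x v else 0) = push w x u" by (rule push_eq_sum[OF fin, symmetric])
  qed
qed (use push_in_gpoints[OF L w] in auto)

lemma push_compose:
  assumes "finite (vsupp x)" "\<And>v. 0 \<le> x v"
  shows "push w' (push w x) = push (w' \<circ> w) x"
proof
  fix u
  have "push w' (push w x) u = (\<Sum>y\<in>w ` vsupp x. if w' y = u then push w x y else 0)"
    using assms by (intro push_eq_sum) (auto simp: vsupp_push)
  also have "\<dots> = (\<Sum>y\<in>w ` vsupp x. \<Sum>v\<in>vsupp x. if w' y = u then (if w v = y then x v else 0) else 0)"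
    unfolding push_def by (auto intro!: sum.cong)
  also have "\<dots> = (\<Sum>v\<in>vsupp x. \<Sum>y\<in>w ` vsupp x. if w v = y then (if w' y = u then x v else 0) else 0)"
    by (subst sum.swap) (auto intro!: sum.cong)
  also have "\<dots> = (\<Sum>v\<in>vsupp x. if w' (w v) = u then x v else 0)"
    using assms by (intro sum.cong) (auto simp: sum.delta')
  finally show "push w' (push w x) u = push (w' \<circ> w) x u" by (simp add: push_def)
qed

lemma push_cong: "(\<And>v. v \<in> vsupp x \<Longrightarrow> w v = w' v) \<Longrightarrow> push w x = push w' x"
  unfolding push_def by (auto intro!: sum.cong)

lemma push_id:
  assumes "finite (vsupp x)"
  shows "push (\<lambda>v. v) x = x"
  using assms by (auto simp: push_def fun_eq_iff)

lemma homotopy_equivalence_push: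
  assumes L: "simplicial_complex L" and inj: "inj_on w (\<Union>L)"
  shows "homotopy_equivalence (geo L) (geo ((`) w ` L)) (push w)"
proof (rule homeomorphic_imp_homotopy_equivalence)
  let ?L = "(`) w ` L" and ?r = "inv_into (\<Union>L) w"
  have rw: "?r ` w ` A = A" if "A \<in> L" for A
  proof -
    have "?r (w v) = v" if "v \<in> A" for v using inj that \<open>A \<in> L\<close> by (auto intro!: inv_into_f_f)
    then show ?thesis by (simp add: image_image)
  qed
  have sub: "\<exists>A'\<in>L. B = w ` A'" if "A \<in> L" "B \<subseteq> w ` A" for A B
    using that simplicial_complexD(2)[OF L that(1)] by (meson subset_imageE)
  have L': "simplicial_complex ?L"
    unfolding simplicial_complex_def
  proof (intro conjI ballI allI impI)
    show "finite (\<Union> ?L)" using L by (simp add: simplicial_complex_def flip: image_Union)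
    fix B C assume "B \<in> ?L" "C \<subseteq> B"
    then show "C \<in> ?L" using sub[of _ C] by blast
  qed
  have fin: "finite (vsupp x)" if "x \<in> gpoints L" for x
    using simplicial_complexD(1)[OF L] gpointsD(2)[OF that] by auto
  have fin': "finite (vsupp x)" if "x \<in> gpoints ?L" for x
    using simplicial_complexD(1)[OF L'] gpointsD(2)[OF that] by auto
  have "homeomorphic_maps (geo L) (geo ?L) (push w) (push ?r)"
    unfolding homeomorphic_maps_def
  proof (intro conjI ballI)
    show "continuous_map (geo L) (geo ?L) (push w)" by (rule continuous_map_push[OF L]) auto
    show "continuous_map (geo ?L) (geo L) (push ?r)"
      by (rule continuous_map_push[OF L']) (use rw in auto)
    fix x assume "x \<in> topspace (geo L)"
    then have x: "x \<in> gpoints L" by simp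
    have "push ?r (push w x) = push (?r \<circ> w) x"
      using fin[OF x] gpointsD(1)[OF x] by (rule push_compose)
    also have "\<dots> = push (\<lambda>v. v) x"
      by (rule push_cong) (use gpointsD(2)[OF x] inj in \<open>auto intro!: inv_into_f_f\<close>)
    finally show "push ?r (push w x) = x" by (simp add: push_id fin[OF x])
  next
    fix x assume "x \<in> topspace (geo ?L)"
    then have x: "x \<in> gpoints ?L" by simp
    have "push w (push ?r x) = push (w \<circ> ?r) x"
      using fin'[OF x] gpointsD(1)[OF x] by (rule push_compose)
    also have "\<dots> = push (\<lambda>v. v) x"
    proof (rule push_cong)
      fix v assume "v \<in> vsupp x"
      moreover have "vsupp x \<subseteq> w ` \<Union>L" using gpointsD(2)[OF x] by blast
      ultimately show "(w \<circ> ?r) v = v" unfolding o_def by (blast intro: f_inv_into_f)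
    qed
    finally show "push w (push ?r x) = x" by (simp add: push_id fin'[OF x])
  qed
  then show "homeomorphic_map (geo L) (geo ?L) (push w)"
    using homeomorphic_map_maps by blast
qed

subsection \<open>The order complex of a finite poset\<close>

definition order_chains :: "'a::order set \<Rightarrow> 'a set set" where
  "order_chains P = {A. A \<subseteq> P \<and> (\<forall>x\<in>A. \<forall>y\<in>A. x \<le> y \<or> y \<le> x)}"

lemma simplicial_complex_chains: "finite P \<Longrightarrow> simplicial_complex (order_chains P)"
  unfolding simplicial_complex_def order_chains_def by (auto intro: finite_subset[of _ P])

lemma chains_mono: "P \<subseteq> Q \<Longrightarrow> order_chains P \<subseteq> order_chains Q"
  by (auto simp: order_chains_def)

definition lowest :: "'a::order set \<Rightarrow> 'a" where
  "lowest A = (SOME a. a \<in> A \<and> (\<forall>b\<in>A. a \<le> b))"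

lemma lowest_chain:
  assumes "A \<in> order_chains P" "finite A" "A \<noteq> {}"
  shows "lowest A \<in> A" "b \<in> A \<Longrightarrow> lowest A \<le> b"
proof -
  obtain a where a: "a \<in> A" "\<And>b. b \<in> A \<Longrightarrow> b \<le> a \<Longrightarrow> a = b"
    using finite_has_minimal[OF assms(2,3)] by metis
  then have "a \<in> A \<and> (\<forall>b\<in>A. a \<le> b)"
    using assms(1) unfolding order_chains_def by blast
  then have "lowest A \<in> A \<and> (\<forall>b\<in>A. lowest A \<le> b)"
    unfolding lowest_def by (rule someI)
  then show "lowest A \<in> A" "b \<in> A \<Longrightarrow> lowest A \<le> b" by auto
qed

definition mccord :: "('a::order \<Rightarrow> real) \<Rightarrow> 'a" where
  "mccord x = lowest (vsupp x)"

lemma mccord_props: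
  assumes "finite P" "x \<in> gpoints (order_chains P)"
  shows "mccord x \<in> vsupp x" "v \<in> vsupp x \<Longrightarrow> mccord x \<le> v" "vsupp x \<subseteq> P" "finite (vsupp x)"
proof -
  note x = gpointsD(2)[OF assms(2)] gpoints_nonempty_supp[OF assms(2)]
  show P: "vsupp x \<subseteq> P" using x(1) by (simp add: order_chains_def)
  then show f: "finite (vsupp x)" using assms(1) finite_subset by blast
  show "mccord x \<in> vsupp x" "v \<in> vsupp x \<Longrightarrow> mccord x \<le> v"
    unfolding mccord_def using lowest_chain[OF x(1) f x(2)] by auto
qed

lemma mccord_le_iff:
  assumes "finite P" "x \<in> gpoints (order_chains P)"
  shows "a \<le> mccord x \<longleftrightarrow> (\<forall>v\<in>vsupp x. a \<le> v)"
  using mccord_props[OF assms] order_trans by blast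

lemma topspace_alexandroff [simp]: "topspace (alexandroff_space P) = P"
proof -
  have "openin (alexandroff_space P) P" by (simp add: openin_alexandroff_space)
  then show ?thesis
    using openin_subset openin_alexandroff_space[of P "topspace (alexandroff_space P)"] by blast
qed

text \<open>The preimage of an open set is the union of the open stars of its elements: if
  \<open>x a > 0\<close> then \<open>mccord x \<le> a\<close>, and open sets are closed
  downwards.\<close>

lemma continuous_map_mccord:
  assumes P: "finite P"
  shows "continuous_map (geo (order_chains P)) (alexandroff_space P) mccord"
  unfolding continuous_map_def
proof (intro conjI allI impI)
  show "mccord \<in> topspace (geo (order_chains P)) \<rightarrow> topspace (alexandroff_space P)"
    using mccord_props[OF P] by fastforce
  fix U assume U: "openin (alexandroff_space P) U"
  have "{x \<in> topspace (geo (order_chains P)). mccord x \<in> U} = (\<Union>a\<in>U. {x \<in> topspace (geo (order_chains P)). x a \<in> {0<..}})"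
    (is "?l = ?r")
  proof
    show "?l \<subseteq> ?r"
    proof
      fix x assume x: "x \<in> ?l"
      then have "x (mccord x) \<noteq> 0" "x (mccord x) \<ge> 0"
        using mccord_props(1)[OF P, of x] gpointsD(1)[of x] by auto
      then show "x \<in> ?r" using x by (intro UN_I[of "mccord x"]) auto
    qed
    show "?r \<subseteq> ?l"
    proof
      fix x assume "x \<in> ?r"
      then obtain a where a: "a \<in> U" "x \<in> gpoints (order_chains P)" "x a > 0" by auto
      then have "mccord x \<le> a" "mccord x \<in> P" using mccord_props[OF P a(2)] by auto
      then show "x \<in> ?l" using a U by (auto simp: openin_alexandroff_space)
    qed
  qed
  also have "openin (geo (order_chains P)) \<dots>"
  proof -
    have "openin (geo (order_chains P)) {x \<in> topspace (geo (order_chains P)). x a \<in> {0<..}}" for a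
      by (rule openin_continuous_map_preimage[OF continuous_map_geo_coord]) simp
    then show ?thesis by blast
  qed
  finally show "openin (geo (order_chains P)) {x \<in> topspace (geo (order_chains P)). mccord x \<in> U}" .
qed

text \<open>The jump at time 0 is a homotopy between comparable maps.\<close>

lemma continuous_map_alexandroff_jump:
  assumes f: "continuous_map X (alexandroff_space P) f" and g: "continuous_map X (alexandroff_space P) g"
    and fg: "\<And>t. t \<in> topspace X \<Longrightarrow> f t \<le> g t"
  shows "continuous_map (prod_topology I01 X) (alexandroff_space P) (\<lambda>p. if fst p = 0 then g (snd p) else f (snd p))"
  unfolding continuous_map_def
proof (intro conjI allI impI)
  let ?X = "prod_topology I01 X"
  let ?h = "\<lambda>p. if fst p = (0::real) then g (snd p) else f (snd p)"
  have fX: "f t \<in> P" "g t \<in> P" if "t \<in> topspace X" for t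
    using f g that by (auto simp: continuous_map_def)
  then show "?h \<in> topspace ?X \<rightarrow> topspace (alexandroff_space P)" by auto
  fix U assume U: "openin (alexandroff_space P) U"
  have *: "f t \<in> U" if "t \<in> topspace X" "g t \<in> U" for t
    using U fg[OF that(1)] fX[OF that(1)] that(2) unfolding openin_alexandroff_space by blast
  \<comment> \<open>Where \<open>g\<close> is in \<open>U\<close>, so is the smaller
    \<open>f\<close>, at all times; the other points of the preimage have positive time, and this is
    an open condition.\<close>
  have "{p \<in> topspace ?X. ?h p \<in> U} =
      {p \<in> topspace ?X. g (snd p) \<in> U} \<union> ({p \<in> topspace ?X. fst p \<in> {0<..}} \<inter> {p \<in> topspace ?X. f (snd p) \<in> U})"
    using * by (auto split: if_splits)
  also have "openin ?X \<dots>"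
    by (intro openin_Un openin_Int openin_continuous_map_preimage[OF continuous_map_snd'[OF f] U]
        openin_continuous_map_preimage[OF continuous_map_snd'[OF g] U]
        openin_continuous_map_preimage[OF continuous_map_I01_fst]) auto
  finally show "openin ?X {p \<in> topspace ?X. ?h p \<in> U}" .
qed

text \<open>The constant map at \<open>a\<close> lies below the identity, so the jump between them
  is a contraction.\<close>

lemma contractible_alexandroff_least:
  assumes "a \<in> P" "\<And>b. b \<in> P \<Longrightarrow> a \<le> b"
  shows "contractible_space (alexandroff_space P)"
  unfolding contractible_space_def homotopic_with_def
  using continuous_map_alexandroff_jump[of "alexandroff_space P" P "\<lambda>x. a" id] assms
  by (intro exI[of _ a] exI[of _ "\<lambda>p. if fst p = 0 then id (snd p) else a"]) auto

subsection \<open>Lifting maps into a finite poset to its order complex\<close>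

lemma uniform_positive:
  assumes "finite F" and "\<And>x. x \<in> F \<Longrightarrow> \<exists>\<epsilon>>0::real. Q x \<epsilon>"
    and mono: "\<And>x \<epsilon> \<epsilon>'. x \<in> F \<Longrightarrow> Q x \<epsilon> \<Longrightarrow> 0 < \<epsilon>' \<Longrightarrow> \<epsilon>' \<le> \<epsilon> \<Longrightarrow> Q x \<epsilon>'"
  shows "\<exists>\<epsilon>>0. \<forall>x\<in>F. Q x \<epsilon>"
proof -
  obtain e where e: "\<And>x. x \<in> F \<Longrightarrow> e x > 0 \<and> Q x (e x)" using assms(2) by metis
  let ?m = "Min (insert 1 (e ` F))"
  have "?m > 0" using assms(1) e by (subst Min_gr_iff) auto
  moreover have "?m \<le> e x" if "x \<in> F" for x using assms(1) that by (intro Min_le) auto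
  ultimately show ?thesis using e mono by (intro exI[of _ ?m]) blast
qed

lemma compact_positive_bound:
  fixes \<phi> :: "'c::metric_space \<Rightarrow> real"
  assumes "compact K" "continuous_on K \<phi>" "\<And>t. t \<in> K \<Longrightarrow> \<phi> t > 0"
  shows "\<exists>\<epsilon>>0. \<forall>t\<in>K. \<epsilon> \<le> \<phi> t"
proof (cases "K = {}")
  case False
  then obtain t where "t \<in> K" "\<And>s. s \<in> K \<Longrightarrow> \<phi> t \<le> \<phi> s"
    using continuous_attains_inf[OF assms(1) _ assms(2)] by auto
  then show ?thesis using assms(3) by auto
qed (auto intro: exI[of _ 1])

text \<open>A maximal element is removed and receives the last number. The numbers start at 1 so
  that 0 remains free for the apex of a cone.\<close>

lemma linear_extension:
  fixes P :: "'a::order set"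
  assumes "finite P"
  shows "\<exists>e::'a \<Rightarrow> nat. inj_on e P \<and> (\<forall>a\<in>P. \<forall>b\<in>P. a < b \<longrightarrow> e a < e b) \<and> (\<forall>a\<in>P. 1 \<le> e a \<and> e a \<le> card P)"
  using assms
proof (induction "card P" arbitrary: P)
  case 0 then show ?case by auto
next
  case (Suc k)
  obtain m where m: "m \<in> P" "\<And>b. b \<in> P \<Longrightarrow> m \<le> b \<Longrightarrow> m = b"
    using finite_has_maximal[of P] Suc by (metis card.empty nat.simps(3))
  obtain e where e: "inj_on e (P - {m})" "\<forall>a\<in>P-{m}. \<forall>b\<in>P-{m}. a < b \<longrightarrow> e a < e b"
      "\<forall>a\<in>P-{m}. 1 \<le> e a \<and> e a \<le> card (P - {m})"
  proof -
    have "k = card (P - {m})" "finite (P - {m})" using Suc.hyps(2) Suc.prems m(1) by auto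
    from Suc.hyps(1)[OF this] show ?thesis using that by blast
  qed
  have c: "card P = Suc (card (P - {m}))" using card_Suc_Diff1[OF Suc.prems m(1)] by simp
  have nlt: "\<not> m < b" if "b \<in> P" for b using m(2)[OF that] order_less_imp_le[of m b] by blast
  show ?case
  proof (intro exI[of _ "e(m := card P)"] conjI)
    show "inj_on (e(m := card P)) P"
    proof (rule inj_onI)
      fix x y assume xy: "x \<in> P" "y \<in> P" "(e(m := card P)) x = (e(m := card P)) y"
      have lt: "e z < card P" if "z \<in> P" "z \<noteq> m" for z using e(3) c that by (metis DiffI insertE le_imp_less_Suc singletonD)
      then show "x = y" using xy inj_onD[OF e(1), of x y] lt[of x] lt[of y] m(1) by (cases "x = m"; cases "y = m") simp_all
    qed
    show "\<forall>a\<in>P. \<forall>b\<in>P. a < b \<longrightarrow> (e(m := card P)) a < (e(m := card P)) b"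
    proof (intro ballI impI)
      fix a b assume ab: "a \<in> P" "b \<in> P" "a < b"
      then have "a \<noteq> m" using nlt by blast
      then show "(e(m := card P)) a < (e(m := card P)) b"
      proof (cases "b = m")
        case True
        have "e a \<le> card (P - {m})" using e(3) ab(1) \<open>a \<noteq> m\<close> by blast
        then show ?thesis using True \<open>a \<noteq> m\<close> c by simp
      next
        case False
        then have "e a < e b" using e(2) ab \<open>a \<noteq> m\<close> by blast
        then show ?thesis using False \<open>a \<noteq> m\<close> by simp
      qed
    qed
    show "\<forall>a\<in>P. 1 \<le> (e(m := card P)) a \<and> (e(m := card P)) a \<le> card P"
    proof
      fix a assume "a \<in> P"
      then have "a = m \<or> 1 \<le> e a \<and> e a \<le> card (P - {m})" using e(3) by blast
      then show "1 \<le> (e(m := card P)) a \<and> (e(m := card P)) a \<le> card P" using c by auto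
    qed
  qed
qed

text \<open>The lift has coordinates \<open>w\<^sub>a = \<lambda>\<^sub>a \<Prod> (1 - \<lambda>\<^sub>c)\<close>, the product being over all \<open>c\<close> after \<open>a\<close> in a linear
  extension, where \<open>\<lambda>\<^sub>a\<close> is a bump function around the closed set \<open>h \<ge> a\<close>. The widths of the bumps
  shrink so fast along the linear extension (from top to bottom) that if \<open>\<lambda>\<^sub>a\<close> and \<open>\<lambda>\<^sub>b\<close> are positive for
  incomparable \<open>a\<close> and \<open>b\<close>, then \<open>\<lambda>\<^sub>c = 1\<close> for some \<open>c\<close> above both. So the support is a chain.\<close>

lemma order_complex_lift:
  fixes S :: "'c::metric_space set" and P :: "'a::order set"
  assumes P: "finite P" and S: "compact S" and C: "closed C" "C \<subseteq> S"
    and h: "continuous_map (top_of_set S) (alexandroff_space P) h"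
    and g: "continuous_map (top_of_set C) (geo (order_chains P)) g"
    and gh: "\<And>t b. t \<in> C \<Longrightarrow> b \<in> vsupp (g t) \<Longrightarrow> h t \<le> b"
  obtains G g' where "continuous_map (top_of_set S) (geo (order_chains P)) G"
    "\<And>t b. t \<in> S \<Longrightarrow> b \<in> vsupp (G t) \<Longrightarrow> h t \<le> b"
    "continuous_map (top_of_set C) (geo (order_chains P)) g'"
    "\<And>t. t \<in> C \<Longrightarrow> vsupp (g' t) \<subseteq> vsupp (g t)"
    "\<And>t. t \<in> C \<Longrightarrow> vsupp (G t) \<union> vsupp (g' t) \<in> order_chains P"
proof -
  note complexP = simplicial_complex_chains[OF P]
  have hP: "h t \<in> P" if "t \<in> S" for t using h that by (auto simp: continuous_map_def)
  have cC: "compact C" using compact_Int_closed[OF S C(1)] C(2) by (simp add: inf.absorb2)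
  define A where "A = (\<lambda>a. {t \<in> S. a \<le> h t})"
  have clA: "closed (A a)" for a
  proof -
    have "openin (alexandroff_space P) {b \<in> P. \<not> a \<le> b}"
      unfolding openin_alexandroff_space using order_trans by blast
    then have "openin (top_of_set S) {t \<in> S. h t \<in> {b \<in> P. \<not> a \<le> b}}"
      using openin_continuous_map_preimage[OF h] by fastforce
    moreover have "{t \<in> S. h t \<in> {b \<in> P. \<not> a \<le> b}} = S - A a" using hP by (auto simp: A_def)
    ultimately have "closedin (top_of_set S) (A a)" by (simp add: closedin_def) (auto simp: A_def)
    then show ?thesis by (rule closedin_closed_trans[OF _ compact_imp_closed[OF S]])
  qed
  \<comment> \<open>The default 1 is needed because \<open>infdist\<close> to the empty set is 0;
    with it, \<open>d a t = 0\<close> means exactly \<open>a \<le> h t\<close> on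
    \<open>S\<close>.\<close>
  define d where "d = (\<lambda>a t. if A a = {} then 1 else infdist t (A a))"
  have cd: "continuous_on K (d a)" for K a
    unfolding d_def by (cases "A a = {}") (auto intro!: continuous_intros)
  have d0: "0 \<le> d a t" for a t by (simp add: d_def infdist_nonneg)
  have dz: "d a t = 0 \<longleftrightarrow> a \<le> h t" if "t \<in> S" for a t
    using in_closed_iff_infdist_zero[OF clA, of a t] that by (auto simp: d_def A_def)
  \<comment> \<open>On the compact set where every common upper bound \<open>c\<close> has
    \<open>d c t \<ge> \<delta>\<close>, the distances of \<open>a\<close> and \<open>b\<close>
    cannot both vanish, since then \<open>h t\<close> would be such a \<open>c\<close> with distance
    0. So their maximum has a positive lower bound there.\<close>
  have sep: "\<exists>\<epsilon>>0. \<forall>(a, b)\<in>P \<times> P. \<forall>t\<in>S. d a t < \<epsilon> \<and> d b t < \<epsilon> \<longrightarrow> (\<exists>c\<in>P. a \<le> c \<and> b \<le> c \<and> d c t < \<delta>)"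
    if "\<delta> > 0" for \<delta>
  proof (rule uniform_positive)
    fix x assume "x \<in> P \<times> P"
    obtain a b where x: "x = (a, b)" by force
    define K where "K = S \<inter> (\<Inter>c\<in>{c\<in>P. a \<le> c \<and> b \<le> c}. {t. \<delta> \<le> d c t})"
    have "closed {t. \<delta> \<le> d c t}" for c by (intro closed_Collect_le cd continuous_intros)
    then have "compact K" unfolding K_def by (intro compact_Int_closed S closed_INT) auto
    moreover have "max (d a t) (d b t) > 0" if "t \<in> K" for t
    proof (rule ccontr)
      assume "\<not> max (d a t) (d b t) > 0"
      then have "d a t = 0" "d b t = 0" using d0[of a t] d0[of b t] by (auto simp: max_def split: if_splits)
      then have "a \<le> h t" "b \<le> h t" using that dz by (auto simp: K_def)
      then have "\<delta> \<le> d (h t) t" using that hP by (auto simp: K_def)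
      then show False using dz[of t "h t"] that \<open>\<delta> > 0\<close> by (auto simp: K_def)
    qed
    ultimately obtain \<epsilon> where e: "\<epsilon> > 0" "\<And>t. t \<in> K \<Longrightarrow> \<epsilon> \<le> max (d a t) (d b t)"
      using compact_positive_bound[of K "\<lambda>t. max (d a t) (d b t)"] continuous_on_max[OF cd cd] by blast
    have "\<exists>c\<in>P. a \<le> c \<and> b \<le> c \<and> d c t < \<delta>" if "t \<in> S" "d a t < \<epsilon>" "d b t < \<epsilon>" for t
      using e(2)[of t] that by (force simp: K_def)
    then show "\<exists>\<epsilon>>0. case x of (a, b) \<Rightarrow> \<forall>t\<in>S. d a t < \<epsilon> \<and> d b t < \<epsilon> \<longrightarrow> (\<exists>c\<in>P. a \<le> c \<and> b \<le> c \<and> d c t < \<delta>)"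
      using e(1) x by auto
  qed (use P in \<open>auto simp: case_prod_unfold\<close>)
  define N where "N = card P"
  \<comment> \<open>A threshold small enough that \<open>card P * \<eta> < 1\<close>: every point of
    the order complex has a coordinate larger than \<open>\<eta>\<close>.\<close>
  define \<eta> where "\<eta> = 1 / (2 * real (Suc N))"
  have eta: "\<eta> > 0" by (simp add: \<eta>_def)
  have cg: "continuous_on C (\<lambda>t. g t b)" for b
    using continuous_map_geo_coord'[OF g, of b] by simp
  have gP: "g t \<in> gpoints (order_chains P)" if "t \<in> C" for t using g that by (auto simp: continuous_map_into_geo)
  \<comment> \<open>Where \<open>g t b \<ge> \<eta>\<close>, the value \<open>h t\<close> is below
    \<open>b\<close> and hence not above \<open>a\<close>; by compactness such points keep a
    distance from the set \<open>h \<ge> a\<close>.\<close>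
  have "\<exists>\<delta>>0. \<forall>(a, b)\<in>P \<times> P. \<not> a \<le> b \<longrightarrow> (\<forall>t\<in>C. d a t < \<delta> \<longrightarrow> g t b < \<eta>)"
  proof (rule uniform_positive)
    fix x assume "x \<in> P \<times> P"
    obtain a b where x: "x = (a, b)" by force
    show "\<exists>\<delta>>0. case x of (a, b) \<Rightarrow> \<not> a \<le> b \<longrightarrow> (\<forall>t\<in>C. d a t < \<delta> \<longrightarrow> g t b < \<eta>)"
    proof (cases "a \<le> b")
      case False
      define K where "K = {t \<in> C. \<eta> \<le> g t b}"
      have "closed K" unfolding K_def
        using continuous_closed_preimage[OF cg C(1), of "{\<eta>..}" b] by (simp add: vimage_def Int_def)
      moreover have "C \<inter> K = K" by (auto simp: K_def)
      ultimately have cK: "compact K" using compact_Int_closed[OF cC] by metis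
      have dpos: "d a t > 0" if "t \<in> K" for t
      proof (rule ccontr)
        assume "\<not> d a t > 0"
        then have "a \<le> h t" using d0[of a t] dz[of t a] that C(2) by (auto simp: K_def)
        moreover have "h t \<le> b" using gh[of t b] that eta by (auto simp: K_def)
        ultimately show False using False by simp
      qed
      obtain \<epsilon> where e: "\<epsilon> > 0" "\<And>t. t \<in> K \<Longrightarrow> \<epsilon> \<le> d a t"
        using compact_positive_bound[OF cK cd dpos] by metis
      then have "\<forall>t\<in>C. d a t < \<epsilon> \<longrightarrow> g t b < \<eta>" by (force simp: K_def)
      then show ?thesis using e(1) x by auto
    qed (use x in \<open>auto intro: exI[of _ 1]\<close>)
  qed (use P in \<open>auto simp: case_prod_unfold\<close>)
  then obtain \<delta>0 where del0: "\<delta>0 > 0" "\<And>a b t. a \<in> P \<Longrightarrow> b \<in> P \<Longrightarrow> \<not> a \<le> b \<Longrightarrow> t \<in> C \<Longrightarrow> d a t < \<delta>0 \<Longrightarrow> g t b < \<eta>"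
    by blast
  \<comment> \<open>The condition on consecutive widths: two elements whose sets are within the
    smaller width \<open>y\<close> of \<open>t\<close> have a common upper bound within half the
    larger width \<open>x\<close>.\<close>
  let ?R = "\<lambda>x y. y \<le> x / 2 \<and> (\<forall>a\<in>P. \<forall>b\<in>P. \<forall>t\<in>S. d a t < y \<and> d b t < y \<longrightarrow> (\<exists>c\<in>P. a \<le> c \<and> b \<le> c \<and> d c t < x / 2))"
  have "\<exists>F::nat \<Rightarrow> real. \<forall>n. F n > 0 \<and> F n \<le> \<delta>0 \<and> ?R (F n) (F (Suc n))"
  proof (rule dependent_nat_choice[of "\<lambda>n x. x > 0 \<and> x \<le> \<delta>0" "\<lambda>n. ?R", simplified conj_assoc])
    show "\<exists>x. 0 < x \<and> x \<le> \<delta>0" using del0(1) by blast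
    fix x :: real assume x: "0 < x \<and> x \<le> \<delta>0"
    obtain e where e: "e > 0" "\<forall>(a, b)\<in>P \<times> P. \<forall>t\<in>S. d a t < e \<and> d b t < e \<longrightarrow> (\<exists>c\<in>P. a \<le> c \<and> b \<le> c \<and> d c t < x / 2)"
      using sep[of "x / 2"] x by auto
    show "\<exists>y. 0 < y \<and> y \<le> \<delta>0 \<and> ?R x y"
    proof (intro exI[of _ "min e (x / 2)"] conjI)
      show "\<forall>a\<in>P. \<forall>b\<in>P. \<forall>t\<in>S. d a t < min e (x / 2) \<and> d b t < min e (x / 2) \<longrightarrow>
              (\<exists>c\<in>P. a \<le> c \<and> b \<le> c \<and> d c t < x / 2)" using e(2) by fastforce
    qed (use e(1) x in auto)
  qed
  then obtain F where F: "\<forall>n. F n > 0 \<and> F n \<le> \<delta>0 \<and> ?R (F n) (F (Suc n))" by (rule exE)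
  have F0: "F n > 0" "F n \<le> \<delta>0" and Fh: "F (Suc n) \<le> F n / 2" for n
    using F by auto
  have Fs: "\<exists>c\<in>P. a \<le> c \<and> b \<le> c \<and> d c t < F n / 2"
    if "a \<in> P" "b \<in> P" "t \<in> S" "d a t < F (Suc n)" "d b t < F (Suc n)" for n a b t
    using F that by blast
  have "F (Suc n) \<le> F n" for n using Fh[of n] F0(1)[of n] by linarith
  then have Fmono: "F m \<le> F n" if "n \<le> m" for m n
    using lift_Suc_antimono_le[of F n m] that by blast
  obtain e :: "'a \<Rightarrow> nat" where e: "inj_on e P" "\<And>a b. a \<in> P \<Longrightarrow> b \<in> P \<Longrightarrow> a < b \<Longrightarrow> e a < e b"
    "\<And>a. a \<in> P \<Longrightarrow> 1 \<le> e a \<and> e a \<le> N"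
    using linear_extension[OF P] unfolding N_def by blast
  \<comment> \<open>Elements late in the linear extension get the wide bumps. The bump
    \<open>l a\<close> equals 1 up to distance \<open>\<epsilon> a / 2\<close> and vanishes from
    distance \<open>\<epsilon> a\<close> on.\<close>
  define \<epsilon> where "\<epsilon> = (\<lambda>a. F (Suc N - e a))"
  have e0: "\<epsilon> a > 0" for a by (simp add: \<epsilon>_def F0)
  define l where "l = (\<lambda>a t. max 0 (min 1 (2 - 2 * d a t / \<epsilon> a)))"
  have l01: "0 \<le> l a t" "l a t \<le> 1" for a t by (auto simp: l_def)
  have l_pos: "d a t < \<epsilon> a" if "l a t > 0" for a t
    using that e0[of a] by (auto simp: l_def max_def min_def field_simps split: if_splits)
  have l_one: "l a t = 1" if "d a t \<le> \<epsilon> a / 2" for a t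
  proof -
    have "2 * d a t / \<epsilon> a \<le> 1" using that e0[of a] by (simp add: field_simps)
    then show ?thesis by (simp add: l_def)
  qed
  have cl: "continuous_on K (l a)" for K a
    unfolding l_def using e0 by (intro continuous_intros cd) (auto simp: less_imp_neq[symmetric])
  have lh: "l (h t) t = 1" if "t \<in> S" for t
    using dz[OF that, of "h t"] e0[of "h t"] by (intro l_one) auto
  have key: "\<exists>c\<in>P. a < c \<and> b < c \<and> l c t = 1"
    if ab: "a \<in> P" "b \<in> P" "\<not> a \<le> b" "\<not> b \<le> a" "l a t > 0" "l b t > 0" "t \<in> S" for a b t
  proof -
    \<comment> \<open>By symmetry the later element is \<open>b\<close>, whose width is
      \<open>F (Suc i)\<close>; the width of \<open>a\<close> is at most that. The resulting upper
      bound \<open>c\<close> comes strictly after \<open>b\<close>, so its width is at least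
      \<open>F i\<close> and its bump is 1 at \<open>t\<close>.\<close>
    have *: "\<exists>c\<in>P. a \<le> c \<and> b \<le> c \<and> c \<noteq> a \<and> c \<noteq> b \<and> l c t = 1"
      if ab: "a \<in> P" "b \<in> P" "\<not> a \<le> b" "\<not> b \<le> a" "l a t > 0" "l b t > 0" "e a < e b" for a b
    proof -
      define i where "i = N - e b"
      have i: "Suc N - e b = Suc i" "Suc i \<le> Suc N - e a" using e(3)[OF ab(2)] ab(7) by (auto simp: i_def)
      have "d a t < F (Suc i)" "d b t < F (Suc i)"
        using l_pos[OF ab(5)] l_pos[OF ab(6)] Fmono[OF i(2)] i(1) by (auto simp: \<epsilon>_def)
      then obtain c where c: "c \<in> P" "a \<le> c" "b \<le> c" "d c t < F i / 2"
        using Fs[OF ab(1,2) \<open>t \<in> S\<close>] by blast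
      have "b < c" using c ab by auto
      then have "e b < e c" using e(2) ab(2) c(1) by blast
      then have "Suc N - e c \<le> i" by (auto simp: i_def)
      then have "d c t \<le> \<epsilon> c / 2" using c(4) Fmono[of "Suc N - e c" i] by (auto simp: \<epsilon>_def)
      then show ?thesis using c ab l_one by blast
    qed
    have "e a \<noteq> e b" using e(1) ab(1-3) by (auto simp: inj_on_def)
    then show ?thesis using *[of a b] *[of b a] ab by (metis linorder_neqE_nat order_le_less)
  qed
  \<comment> \<open>The product kills \<open>a\<close> as soon as a later element has bump 1. For
    incomparable \<open>a\<close> and \<open>b\<close> with positive bumps, \<open>key\<close>
    supplies an element that kills both.\<close>
  define w where "w = (\<lambda>a t. l a t * (\<Prod>c\<in>{c\<in>P. e a < e c}. 1 - l c t))"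
  have w0: "0 \<le> w a t" for a t
    unfolding w_def using l01 by (intro mult_nonneg_nonneg prod_nonneg) auto
  have wD: "l a t > 0" "\<And>c. c \<in> P \<Longrightarrow> e a < e c \<Longrightarrow> l c t \<noteq> 1" if "w a t \<noteq> 0" for a t
    using that P l01(1)[of a t] unfolding w_def by (auto simp: prod_zero_iff order_le_less)
  have w_chain: "a \<le> b \<or> b \<le> a" if "a \<in> P" "b \<in> P" "t \<in> S" "w a t \<noteq> 0" "w b t \<noteq> 0" for a b t
    using key[OF that(1,2) _ _ _ _ that(3)] wD[OF that(4)] wD[OF that(5)] e(2)[OF that(1)] by blast
  \<comment> \<open>The bump of \<open>h t\<close> is 1 at \<open>t\<close>. An \<open>a\<close>
    below \<open>h t\<close> is killed by \<open>h t\<close> itself, and an incomparable one by the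
    common upper bound from \<open>key\<close>.\<close>
  have w_above: "h t \<le> a" if aP: "a \<in> P" and tS: "t \<in> S" and wz: "w a t \<noteq> 0" for a t
  proof (rule ccontr)
    assume na: "\<not> h t \<le> a"
    show False
    proof (cases "a \<le> h t")
      case True
      then have "a < h t" using na by auto
      then show False using e(2)[OF aP hP[OF tS]] wD(2)[OF wz hP[OF tS]] lh[OF tS] by blast
    next
      case False
      have "l (h t) t > 0" using lh[OF tS] by simp
      then obtain c where "c \<in> P" "a < c" "l c t = 1"
        using key[OF aP hP[OF tS] False na wD(1)[OF wz] _ tS] by blast
      then show False using e(2)[OF aP] wD(2)[OF wz] by blast
    qed
  qed
  define W where "W = (\<lambda>t. \<Sum>a\<in>P. w a t)"
  have W: "W t > 0" if t: "t \<in> S" for t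
  proof -
    \<comment> \<open>The last element with bump 1 has positive weight: no factor of its product
      vanishes.\<close>
    have "finite {a\<in>P. l a t = 1}" "{a\<in>P. l a t = 1} \<noteq> {}" using P lh[OF t] hP[OF t] by auto
    then have "Max (e ` {a\<in>P. l a t = 1}) \<in> e ` {a\<in>P. l a t = 1}" by (intro Max_in) auto
    then obtain a where a: "a \<in> P" "l a t = 1" "Max (e ` {a\<in>P. l a t = 1}) = e a" by auto
    have amax: "e c \<le> e a" if "c \<in> P" "l c t = 1" for c
      unfolding a(3)[symmetric] using that P by (intro Max_ge) auto
    have "1 - l c t > 0" if "c \<in> P" "e a < e c" for c
      using amax[OF that(1)] that(2) l01(2)[of c t] by (cases "l c t = 1") auto
    then have "(\<Prod>c\<in>{c\<in>P. e a < e c}. 1 - l c t) > 0" by (intro prod_pos) auto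
    then have "w a t > 0" unfolding w_def a(2) by simp
    then show ?thesis unfolding W_def using w0 P a(1) by (intro sum_pos2) auto
  qed
  define G where "G = (\<lambda>t a. if a \<in> P then w a t / W t else 0)"
  have G_supp: "a \<in> vsupp (G t) \<longleftrightarrow> a \<in> P \<and> w a t \<noteq> 0" if "t \<in> S" for a t
    using W[OF that] by (auto simp: G_def)
  have G_chain: "vsupp (G t) \<in> order_chains P" if "t \<in> S" for t
    using w_chain[OF _ _ that] unfolding order_chains_def by (auto simp del: in_vsupp simp: G_supp[OF that])
  have cG: "continuous_map (top_of_set S) (geo (order_chains P)) G"
    unfolding continuous_map_into_geo
  proof (intro conjI allI ballI)
    fix a
    have cw: "continuous_on S (w a)" for a
      unfolding w_def by (intro continuous_intros cl)
    then have "continuous_on S W" unfolding W_def by (intro continuous_intros)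
    then have "continuous_on S (\<lambda>t. w a t / W t)" using cw W by (intro continuous_intros) force+
    then show "continuous_map (top_of_set S) euclideanreal (\<lambda>t. G t a)"
      by (cases "a \<in> P") (auto simp: G_def)
  next
    fix t assume "t \<in> topspace (top_of_set S)"
    then have t: "t \<in> S" by simp
    have "sum (G t) (vsupp (G t)) = sum (G t) P"
      using P G_supp[OF t] by (intro sum_vsupp) blast+
    also have "\<dots> = 1" using W[OF t] by (simp add: G_def W_def flip: sum_divide_distrib)
    finally show "G t \<in> gpoints (order_chains P)"
      using G_chain[OF t] w0 W[OF t] by (auto simp: gpoints_def G_def less_imp_le)
  qed
  define W' where "W' = (\<lambda>t. \<Sum>c\<in>P. max 0 (g t c - \<eta>))"
  have W': "W' t > 0" if t: "t \<in> C" for t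
  proof -
    have "\<exists>c\<in>P. g t c > \<eta>"
    proof (rule ccontr)
      assume "\<not> (\<exists>c\<in>P. g t c > \<eta>)"
      then have "sum (g t) P \<le> real (card P) * \<eta>" by (intro sum_bounded_above) auto
      also have "\<dots> < 1" by (simp add: \<eta>_def N_def field_simps)
      finally show False
        using gpoints_sum[OF gP[OF t] P] gpointsD(2)[OF gP[OF t]] by (simp add: order_chains_def)
    qed
    then obtain c where "c \<in> P" "g t c > \<eta>" by blast
    then show ?thesis unfolding W'_def using P by (intro sum_pos2[of _ c]) auto
  qed
  \<comment> \<open>\<open>g\<close> is trimmed: coordinates up to \<open>\<eta>\<close> are dropped
    and the rest renormalized. A vertex of \<open>G t\<close> is below every surviving vertex,
    because its distance is below \<open>\<delta>0\<close>. So the two supports form one chain,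
    which may fail for \<open>g\<close> itself.\<close>
  define g' where "g' = (\<lambda>t b. if b \<in> P then max 0 (g t b - \<eta>) / W' t else 0)"
  have g'_supp: "b \<in> vsupp (g' t) \<longleftrightarrow> b \<in> P \<and> g t b > \<eta>" if "t \<in> C" for b t
    using W'[OF that] by (auto simp: g'_def max_def)
  have g'_sub: "vsupp (g' t) \<subseteq> vsupp (g t)" if "t \<in> C" for t
    using eta g'_supp[OF that] by fastforce
  have cg': "continuous_map (top_of_set C) (geo (order_chains P)) g'"
    unfolding continuous_map_into_geo
  proof (intro conjI allI ballI)
    fix b
    have "continuous_on C W'" unfolding W'_def by (intro continuous_intros cg)
    then have "continuous_on C (\<lambda>t. max 0 (g t b - \<eta>) / W' t)" using W' by (intro continuous_intros cg) force+
    then show "continuous_map (top_of_set C) euclideanreal (\<lambda>t. g' t b)"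
      by (cases "b \<in> P") (auto simp: g'_def)
  next
    fix t assume "t \<in> topspace (top_of_set C)"
    then have t: "t \<in> C" by simp
    have "sum (g' t) (vsupp (g' t)) = sum (g' t) P"
      using P g'_supp[OF t] by (intro sum_vsupp) blast+
    also have "\<dots> = 1" using W'[OF t] by (simp add: g'_def W'_def flip: sum_divide_distrib)
    finally show "g' t \<in> gpoints (order_chains P)"
      using simplicial_complexD(2)[OF complexP gpointsD(2)[OF gP[OF t]] g'_sub[OF t]] W'[OF t]
      by (auto simp: gpoints_def g'_def less_imp_le)
  qed
  have "vsupp (G t) \<union> vsupp (g' t) \<in> order_chains P" if t: "t \<in> C" for t
  proof -
    have tS: "t \<in> S" using t C by auto
    have g_chain: "vsupp (g' t) \<in> order_chains P"
      by (rule simplicial_complexD(2)[OF complexP gpointsD(2)[OF gP[OF t]] g'_sub[OF t]])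
    have "a \<le> b" if "a \<in> vsupp (G t)" "b \<in> vsupp (g' t)" for a b
    proof (rule ccontr)
      assume n: "\<not> a \<le> b"
      have a: "a \<in> P" "w a t \<noteq> 0" and b: "b \<in> P" "g t b > \<eta>"
        using that G_supp[OF tS] g'_supp[OF t] by blast+
      have "d a t < \<delta>0" using l_pos[OF wD(1)[OF a(2)]] F0(2)[of "Suc N - e a"] by (simp add: \<epsilon>_def)
      then show False using del0(2)[OF a(1) b(1) n t] b(2) by simp
    qed
    then show ?thesis using g_chain G_chain[OF tS] unfolding order_chains_def by blast
  qed
  then show thesis
    using that[OF cG _ cg' g'_sub] w_above G_supp by blast
qed

text \<open>Two straight lines, from \<open>G\<close> to the trimmed \<open>g'\<close> and from
  \<open>g'\<close> to \<open>g\<close>. Supports along a line lie in the union of the supports of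
  its ends, so every intermediate map stays above \<open>h\<close>.\<close>

lemma order_complex_lift_homotopy:
  fixes S :: "'c::metric_space set" and P :: "'a::order set"
  assumes P: "finite P" and S: "compact S" and C: "closed C" "C \<subseteq> S"
    and h: "continuous_map (top_of_set S) (alexandroff_space P) h"
    and g: "continuous_map (top_of_set C) (geo (order_chains P)) g"
    and gh: "\<And>t b. t \<in> C \<Longrightarrow> b \<in> vsupp (g t) \<Longrightarrow> h t \<le> b"
  obtains G where "continuous_map (top_of_set S) (geo (order_chains P)) G"
    "\<And>t b. t \<in> S \<Longrightarrow> b \<in> vsupp (G t) \<Longrightarrow> h t \<le> b"
    "homotopic_with (\<lambda>u. \<forall>t\<in>C. \<forall>b\<in>vsupp (u t). h t \<le> b) (top_of_set C) (geo (order_chains P)) G g"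
proof -
  note complexP = simplicial_complex_chains[OF P]
  obtain G g' where G: "continuous_map (top_of_set S) (geo (order_chains P)) G"
    "\<And>t b. t \<in> S \<Longrightarrow> b \<in> vsupp (G t) \<Longrightarrow> h t \<le> b"
    and g': "continuous_map (top_of_set C) (geo (order_chains P)) g'"
    "\<And>t. t \<in> C \<Longrightarrow> vsupp (g' t) \<subseteq> vsupp (g t)"
    "\<And>t. t \<in> C \<Longrightarrow> vsupp (G t) \<union> vsupp (g' t) \<in> order_chains P"
    using order_complex_lift[OF assms] by metis
  let ?P = "\<lambda>u. \<forall>t\<in>C. \<forall>b\<in>vsupp (u t). h t \<le> b"
  have line: "?P (\<lambda>t v. (1 - s) * f t v + s * f' t v)" if "?P f" "?P f'" for s f f'
    using that by (auto simp: vsupp_def) (metis add.right_neutral mult_zero_right)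
  have PG: "?P G" "?P g" "?P g'" using G(2) gh g'(2) C(2) by blast+
  have "homotopic_with ?P (top_of_set C) (geo (order_chains P)) G g'"
  proof (rule homotopic_with_geo_line[OF complexP])
    show "continuous_map (top_of_set C) (geo (order_chains P)) G"
      using G(1) C(2) by (rule continuous_map_from_subtopology_mono)
  qed (use g' line[OF PG(1,3)] in auto)
  moreover have "homotopic_with ?P (top_of_set C) (geo (order_chains P)) g' g"
  proof (rule homotopic_with_geo_line[OF complexP g'(1) g])
    fix t assume "t \<in> topspace (top_of_set C)"
    then have "vsupp (g' t) \<union> vsupp (g t) = vsupp (g t)" "g t \<in> gpoints (order_chains P)"
      using g'(2) g by (auto simp: continuous_map_into_geo)
    then show "vsupp (g' t) \<union> vsupp (g t) \<in> order_chains P" using gpointsD(2) by metis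
  qed (use line[OF PG(3,2)] in auto)
  ultimately have "homotopic_with ?P (top_of_set C) (geo (order_chains P)) G g"
    by (rule homotopic_with_trans)
  then show thesis using that[OF G] by blast
qed

subsection \<open>McCord's weak equivalence\<close>

text \<open>Presents the sphere as a compact subset of the metric space of real sequences, the form
  in which the lifting lemma can be applied.\<close>

lemma compact_nsphere:
  "nsphere n = top_of_set (topspace (nsphere n))" "compact (topspace (nsphere n))"
proof -
  let ?X = "powertop_real UNIV :: (nat \<Rightarrow> real) topology"
  let ?S = "topspace (nsphere n)"
  show eq: "nsphere n = top_of_set ?S"
    unfolding nsphere by (simp add: euclidean_product_topology)
  have c: "continuous_map ?X euclideanreal (\<lambda>x. \<Sum>i\<le>n. (x i)\<^sup>2)" "continuous_map ?X euclideanreal (\<lambda>x. x i)" for i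
    by (auto intro!: continuous_intros continuous_map_product_projection)
  have "compactin ?X ?S"
  proof (rule closed_compactin)
    show "compactin ?X (UNIV \<rightarrow>\<^sub>E {-1..1})" by (simp add: compactin_PiE)
    show "?S \<subseteq> UNIV \<rightarrow>\<^sub>E {-1..1}" using nsphere_coord_le by (fastforce simp: abs_le_iff)
    have "closedin ?X ({x \<in> topspace ?X. (\<Sum>i\<le>n. (x i)\<^sup>2) \<in> {1}} \<inter>
        (\<Inter>i. {x \<in> topspace ?X. x i \<in> (if i \<le> n then UNIV else {0})}))"
      by (intro closedin_Int closedin_INT closedin_continuous_map_preimage[OF c(1)]
          closedin_continuous_map_preimage[OF c(2)]) auto
    moreover have "?S = {x \<in> topspace ?X. (\<Sum>i\<le>n. (x i)\<^sup>2) \<in> {1}} \<inter>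
        (\<Inter>i. {x \<in> topspace ?X. x i \<in> (if i \<le> n then UNIV else {0})})"
      by (auto simp: nsphere not_le split: if_splits)
    ultimately show "closedin ?X ?S" by simp
  qed
  then show "compact ?S" by (simp add: euclidean_product_topology)
qed

lemma tracked_map:
  assumes tr: "tracked n Y C \<kappa> v c v' c'" and f: "continuous_map Y Y' f" and k: "continuous_map C C' k"
    and fk: "\<And>z. z \<in> topspace C \<Longrightarrow> f (\<kappa> z) = \<kappa>' (k z)"
  shows "tracked n Y' C' \<kappa>' (f \<circ> v) (k c) (f \<circ> v') (k c')"
proof -
  obtain h where h: "continuous_map (prod_topology I01 (nsphere n)) (prod_topology Y C) h"
    and h01: "\<And>x. h (0, x) = (v x, c)" "\<And>x. h (1, x) = (v' x, c')"
    and hb: "\<And>t. t \<in> {0..1} \<Longrightarrow> fst (h (t, sphere_base)) = \<kappa> (snd (h (t, sphere_base)))"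
    using tr by (auto simp: tracked_def homotopic_with_def)
  have hC: "snd (h (s, sphere_base)) \<in> topspace C" if "0 \<le> s" "s \<le> 1" for s
    using h sphere_base_in'[of n] that unfolding continuous_map_def
    by (fastforce simp: Pi_iff mem_Times_iff)
  show ?thesis
  proof (rule trackedI)
    show "continuous_map (prod_topology I01 (nsphere n)) Y' (\<lambda>p. f (fst (h p)))"
      by (intro continuous_map_compose'[OF _ f] continuous_map_compose'[OF h continuous_map_fst])
    have "continuous_map I01 (prod_topology I01 (nsphere n)) (\<lambda>s. (s, sphere_base))"
      by (simp add: continuous_map_paired sphere_base_in' continuous_map_id[unfolded id_def])
    from continuous_map_compose'[OF continuous_map_compose'[OF continuous_map_compose'[OF this h] continuous_map_snd] k]
    show "continuous_map I01 C' (\<lambda>s. k (snd (h (s, sphere_base))))" .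
  qed (use h01 hb hC fk in auto)
qed

text \<open>The induced order gives the subspace topology: an open subset of \<open>Q\<close> is the
  trace of its down-closure in \<open>P\<close>.\<close>

lemma continuous_map_alexandroff_restrict:
  assumes f: "continuous_map X (alexandroff_space P) f" and Q: "Q \<subseteq> P" "\<And>x. x \<in> topspace X \<Longrightarrow> f x \<in> Q"
  shows "continuous_map X (alexandroff_space Q) f"
  unfolding continuous_map_def
proof (intro conjI allI impI)
  fix U assume U: "openin (alexandroff_space Q) U"
  have "openin (alexandroff_space P) {y \<in> P. \<exists>u\<in>U. y \<le> u}"
    unfolding openin_alexandroff_space using order_trans by blast
  then have "openin X {x \<in> topspace X. f x \<in> {y \<in> P. \<exists>u\<in>U. y \<le> u}}"
    by (rule openin_continuous_map_preimage[OF f])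
  moreover have "{x \<in> topspace X. f x \<in> {y \<in> P. \<exists>u\<in>U. y \<le> u}} = {x \<in> topspace X. f x \<in> U}"
  proof -
    have "f x \<in> {y \<in> P. \<exists>u\<in>U. y \<le> u} \<longleftrightarrow> f x \<in> U" if "x \<in> topspace X" for x
    proof
      assume "f x \<in> {y \<in> P. \<exists>u\<in>U. y \<le> u}"
      then obtain u where "u \<in> U" "f x \<le> u" by blast
      then show "f x \<in> U" using U Q(2)[OF that] unfolding openin_alexandroff_space by blast
    qed (use U Q(1) in \<open>auto simp: openin_alexandroff_space\<close>)
    then show ?thesis by blast
  qed
  ultimately show "openin X {x \<in> topspace X. f x \<in> U}" by simp
qed (use Q in auto)

lemma contractible_order_complex_above:
  fixes a :: "'a::order"
  assumes "finite P" "a \<in> P"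
  shows "contractible_space (geo (order_chains {b \<in> P. a \<le> b}))"
proof (rule contractible_geo_cone)
  show "simplicial_complex (order_chains {b \<in> P. a \<le> b})" using assms(1) by (simp add: simplicial_complex_chains)
qed (use assms(2) in \<open>auto simp: order_chains_def\<close>)

lemma in_order_complex_above:
  assumes "x \<in> gpoints (order_chains P)" "\<And>b. b \<in> vsupp x \<Longrightarrow> a \<le> b"
  shows "x \<in> gpoints (order_chains {b \<in> P. a \<le> b})"
proof -
  have "vsupp x \<in> order_chains {b \<in> P. a \<le> b}"
    using gpointsD(2)[OF assms(1)] assms(2) unfolding order_chains_def by blast
  then show ?thesis using assms(1) by (simp add: gpoints_def)
qed

lemma continuous_map_into_geo_sub:
  assumes "continuous_map X (geo L) f" "\<And>t. t \<in> topspace X \<Longrightarrow> f t \<in> gpoints L'"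
  shows "continuous_map X (geo L') f"
  using assms by (auto simp: continuous_map_into_geo)

text \<open>With \<open>a = mccord x\<close>, the elements above \<open>a\<close> span a
  contractible subspace on both sides: a poset with least element \<open>a\<close>, and a cone with
  apex \<open>a\<close>. A lift only has its support above the given value, so its base point is
  merely known to lie in that cone; these subspaces are used as tracking spaces.\<close>

theorem mccord_weak_homotopy_equivalence:
  fixes P :: "'a::order set"
  assumes P: "finite P"
  shows "weak_homotopy_equivalence (geo (order_chains P)) (alexandroff_space P) mccord"
proof -
  let ?K = "geo (order_chains P)"
  let ?Q = "\<lambda>a. {b \<in> P. a \<le> b}"
  note cm = continuous_map_mccord[OF P]
  have mP: "mccord x \<in> P" if "x \<in> gpoints (order_chains P)" for x
    using mccord_props[OF P that] by blast
  have above: "x \<in> gpoints (order_chains (?Q (mccord x)))" if "x \<in> gpoints (order_chains P)" for x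
    using in_order_complex_above[OF that mccord_props(2)[OF P that]] .
  have incl: "continuous_map (geo (order_chains (?Q a))) ?K (\<lambda>x. x)" for a
    by (rule continuous_map_geo_mono) (auto intro!: chains_mono)
  have path: "\<exists>\<tau>. continuous_map I01 (geo (order_chains (?Q a))) \<tau> \<and> \<tau> 0 = x \<and> \<tau> 1 = y"
    if "a \<in> P" "x \<in> gpoints (order_chains (?Q a))" "y \<in> gpoints (order_chains (?Q a))" for a x y
  proof -
    have "path_connected_space (geo (order_chains (?Q a)))"
      by (rule contractible_imp_path_connected_space[OF contractible_order_complex_above[OF P that(1)]])
    then show ?thesis using that unfolding path_connected_space_def pathin_def by auto
  qed
  have pc: "path_component_of ?K x y"
    if axy: "a \<in> P" "x \<in> gpoints (order_chains (?Q a))" "y \<in> gpoints (order_chains (?Q a))" for a x y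
  proof -
    obtain \<tau> where t: "continuous_map I01 (geo (order_chains (?Q a))) \<tau>" "\<tau> 0 = x" "\<tau> 1 = y"
      using path[OF axy] by blast
    show ?thesis unfolding path_component_of_def pathin_def
      using t continuous_map_compose'[OF t(1) incl] by blast
  qed
  show ?thesis
  proof (rule weak_homotopy_equivalenceI[OF cm])
    fix y assume "y \<in> topspace (alexandroff_space P)"
    then have y: "y \<in> P" by simp
    let ?x = "\<lambda>u. if u = y then 1 else (0::real)"
    have x: "?x \<in> gpoints (order_chains P)" using y by (intro vertex_in_gpoints) (auto simp: order_chains_def)
    then have "mccord ?x = y" using mccord_props(1)[OF P x] by (auto split: if_splits)
    then show "\<exists>x\<in>topspace ?K. path_component_of (alexandroff_space P) (mccord x) y"
      using x y by (intro bexI[of _ ?x]) (auto simp: path_component_of_refl)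
  next
    fix x x' assume "x \<in> topspace ?K" "x' \<in> topspace ?K"
      and pc': "path_component_of (alexandroff_space P) (mccord x) (mccord x')"
    then have x: "x \<in> gpoints (order_chains P)" "x' \<in> gpoints (order_chains P)" by auto
    obtain q where q: "continuous_map I01 (alexandroff_space P) q" "q 0 = mccord x" "q 1 = mccord x'"
      using pc' unfolding path_component_of_def pathin_def by blast
    \<comment> \<open>The lift is taken with empty \<open>C\<close>, without any boundary condition;
      its ends lie in the cones above \<open>mccord x\<close> and \<open>mccord x'\<close>.\<close>
    obtain G where G: "continuous_map I01 ?K G" "\<And>t b. t \<in> {0..1} \<Longrightarrow> b \<in> vsupp (G t) \<Longrightarrow> q t \<le> b"
      by (rule order_complex_lift_homotopy[OF P compact_Icc closed_empty empty_subsetI q(1), of "\<lambda>_. x"])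
         (auto simp: continuous_map_def)
    have GP: "G t \<in> gpoints (order_chains P)" if "t \<in> {0..1}" for t
      using G(1) that by (auto simp: continuous_map_into_geo)
    have "G 0 \<in> gpoints (order_chains (?Q (mccord x)))" "G 1 \<in> gpoints (order_chains (?Q (mccord x')))"
      using in_order_complex_above[OF GP[of 0] G(2)[of 0]] in_order_complex_above[OF GP[of 1] G(2)[of 1]] q(2,3)
      by auto
    then have "path_component_of ?K x (G 0)" "path_component_of ?K (G 1) x'"
      using pc[OF mP[OF x(1)] above[OF x(1)]] pc[OF mP[OF x(2)] _ above[OF x(2)]] by blast+
    moreover have "path_component_of ?K (G 0) (G 1)"
      unfolding path_component_of_def pathin_def using G(1) by blast
    ultimately show "path_component_of ?K x x'" by (meson path_component_of_trans)
  next
    fix n x u assume "x \<in> topspace ?K" and u: "u \<in> sphere_maps n (alexandroff_space P) (mccord x)"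
    then have x: "x \<in> gpoints (order_chains P)" by simp
    define a where "a = mccord x"
    have a: "a \<in> P" using mP[OF x] by (simp add: a_def)
    have cu: "continuous_map (nsphere n) (alexandroff_space P) u" and ub: "u sphere_base = a"
      using u by (auto simp: sphere_maps_def a_def)
    obtain G where "continuous_map (top_of_set (topspace (nsphere n))) ?K G"
      and Gu: "\<And>t b. t \<in> topspace (nsphere n) \<Longrightarrow> b \<in> vsupp (G t) \<Longrightarrow> u t \<le> b"
      by (rule order_complex_lift_homotopy[OF P compact_nsphere(2)[of n] closed_empty empty_subsetI, of u "\<lambda>_. x"])
         (use cu compact_nsphere(1)[of n] in \<open>auto simp: continuous_map_def\<close>)
    then have G: "continuous_map (nsphere n) ?K G" using compact_nsphere(1)[of n] by simp
    have GP: "G t \<in> gpoints (order_chains P)" if "t \<in> topspace (nsphere n)" for t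
      using G that by (auto simp: continuous_map_into_geo)
    have uG: "u t \<le> mccord (G t)" if "t \<in> topspace (nsphere n)" for t
      using Gu[OF that] mccord_le_iff[OF P GP[OF that]] by blast
    have Gb: "G sphere_base \<in> gpoints (order_chains (?Q a))"
      using in_order_complex_above[OF GP Gu] sphere_base_in' ub by blast
    \<comment> \<open>The base point of the lift is moved back to \<open>x\<close> inside the cone
      above \<open>a\<close>, so the image of this path under McCord's map stays in the elements
      above \<open>a\<close>.\<close>
    obtain \<tau> where t: "continuous_map I01 (geo (order_chains (?Q a))) \<tau>" "\<tau> 0 = G sphere_base" "\<tau> 1 = x"
      using path[OF a Gb] above[OF x] unfolding a_def by blast
    have "continuous_map I01 ?K \<tau>" "G \<in> sphere_maps n ?K (\<tau> 0)"
      using continuous_map_compose'[OF t(1) incl] G t(2) by (auto simp: sphere_maps_def)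
    then obtain v where v: "v \<in> sphere_maps n ?K (\<tau> 1)" "tracked n ?K I01 \<tau> G 0 v 1"
      by (rule tracked_attach)
    let ?m = "\<lambda>s. mccord (\<tau> s)"
    have "continuous_map I01 (alexandroff_space (?Q a)) ?m"
      using continuous_map_compose'[OF t(1) continuous_map_mccord] P by simp
    then have "tracked n (alexandroff_space P) (alexandroff_space (?Q a)) (\<lambda>y. y) (mccord \<circ> G) (?m 0) (mccord \<circ> v) (?m 1)"
      by (rule tracked_map[OF v(2) cm]) simp
    then have tr1: "tracked n (alexandroff_space P) (alexandroff_space (?Q a)) (\<lambda>y. y)
        (mccord \<circ> G) (mccord (G sphere_base)) (mccord \<circ> v) a"
      by (simp add: t a_def)
    \<comment> \<open>\<open>u\<close> lies below \<open>mccord \<circ> G\<close> pointwise, so the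
      two are joined by a jump. Its base point remains in the contractible set above
      \<open>a\<close>.\<close>
    let ?j = "\<lambda>p. if fst p = (0::real) then (mccord \<circ> G) (snd p) else u (snd p)"
    have j: "continuous_map (prod_topology I01 (nsphere n)) (alexandroff_space P) ?j"
      by (rule continuous_map_alexandroff_jump[OF cu continuous_map_compose[OF G cm]]) (use uG in auto)
    have "continuous_map I01 (prod_topology I01 (nsphere n)) (\<lambda>s. (s, sphere_base))"
      by (simp add: continuous_map_paired sphere_base_in' continuous_map_id[unfolded id_def])
    from continuous_map_compose'[OF this j]
    have "continuous_map I01 (alexandroff_space (?Q a)) (\<lambda>s. ?j (s, sphere_base))"
      by (rule continuous_map_alexandroff_restrict)
         (use uG[OF sphere_base_in'] ub a mP[OF GP[OF sphere_base_in']] in auto)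
    then have tr2: "tracked n (alexandroff_space P) (alexandroff_space (?Q a)) (\<lambda>y. y)
        (mccord \<circ> G) (mccord (G sphere_base)) u a"
      by (rule trackedI[OF j]) (auto simp: ub)
    have "tracked n (alexandroff_space P) (alexandroff_space (?Q a)) (\<lambda>y. y) (mccord \<circ> v) a u a"
      using tr1 tr2 by (blast intro: tracked_trans tracked_sym)
    moreover have "contractible_space (alexandroff_space (?Q a))"
      by (rule contractible_alexandroff_least[of a]) (use a in auto)
    moreover have "continuous_map (alexandroff_space (?Q a)) (alexandroff_space P) (\<lambda>y. y)"
      unfolding continuous_map_def openin_alexandroff_space by auto
    ultimately have "(mccord \<circ> v, u) \<in> sphere_homotopy n (alexandroff_space P) a"
      using tracked_imp_sphere_homotopy by fast
    then show "\<exists>g\<in>sphere_maps n ?K x. (mccord \<circ> g, u) \<in> sphere_homotopy n (alexandroff_space P) (mccord x)"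
      using v(1) by (auto simp: t(3) a_def)
  next
    fix n x g0 g1 assume "x \<in> topspace ?K" and g: "g0 \<in> sphere_maps n ?K x" "g1 \<in> sphere_maps n ?K x"
      and eq: "(mccord \<circ> g0, mccord \<circ> g1) \<in> sphere_homotopy n (alexandroff_space P) (mccord x)"
    then have x: "x \<in> gpoints (order_chains P)" by simp
    define a where "a = mccord x"
    have a: "a \<in> P" using mP[OF x] by (simp add: a_def)
    have cg: "continuous_map (nsphere n) ?K g0" "continuous_map (nsphere n) ?K g1"
      and gb: "g0 sphere_base = x" "g1 sphere_base = x"
      using g by (auto simp: sphere_maps_def)
    let ?S = "topspace (nsphere n)"
    have prod: "prod_topology I01 (nsphere n) = top_of_set ({0..1} \<times> ?S)"
      by (subst compact_nsphere(1)) (rule prod_topology_subtopology_eu)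
    obtain H where H: "continuous_map (prod_topology I01 (nsphere n)) (alexandroff_space P) H"
      and H01: "\<And>t. H (0, t) = mccord (g0 t)" "\<And>t. H (1, t) = mccord (g1 t)"
      and Hb: "\<And>s. s \<in> {0..1} \<Longrightarrow> H (s, sphere_base) = a"
      using eq by (auto simp: sphere_homotopy_def homotopic_with_def a_def)
    \<comment> \<open>The homotopy is lifted on the cylinder relative to its two ends, where
      \<open>g0\<close> and \<open>g1\<close> are given; 1/2 merely separates these ends.\<close>
    let ?C = "{0, 1::real} \<times> ?S"
    let ?g = "\<lambda>p. if fst p \<le> (1/2::real) then g0 (snd p) else g1 (snd p)"
    have C: "closed ?C" "?C \<subseteq> {0..1} \<times> ?S"
      by (intro closed_Times finite_imp_closed compact_imp_closed compact_nsphere) auto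
    have prodC: "top_of_set ?C = subtopology (prod_topology I01 (nsphere n)) ?C"
      unfolding prod by (simp add: subtopology_subtopology) (metis C(2) inf.absorb_iff2)
    have g: "continuous_map (top_of_set ?C) ?K ?g"
    proof (rule continuous_map_cases_le)
      show "continuous_map (top_of_set ?C) euclideanreal fst"
        by (simp add: continuous_on_fst)
      show "continuous_map (subtopology (top_of_set ?C) {x \<in> topspace (top_of_set ?C). fst x \<le> 1/2}) ?K (\<lambda>p. g0 (snd p))"
        "continuous_map (subtopology (top_of_set ?C) {x \<in> topspace (top_of_set ?C). 1/2 \<le> fst x}) ?K (\<lambda>p. g1 (snd p))"
        unfolding prodC
        by (intro continuous_map_from_subtopology continuous_map_snd'[OF cg(1)] continuous_map_snd'[OF cg(2)])+
    qed auto
    have gP: "g0 t \<in> gpoints (order_chains P)" "g1 t \<in> gpoints (order_chains P)" if "t \<in> ?S" for t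
      using cg that by (auto simp: continuous_map_into_geo)
    have S: "compact ({0..1::real} \<times> ?S)" by (intro compact_Times compact_nsphere) auto
    have gH: "H p \<le> b" if "p \<in> ?C" "b \<in> vsupp (?g p)" for p b
      using that mccord_props(2)[OF P gP(1)] mccord_props(2)[OF P gP(2)]
      by (auto simp: H01 simp del: in_vsupp)
    obtain G where G: "continuous_map (top_of_set ({0..1} \<times> ?S)) ?K G"
      and GH: "\<And>p b. p \<in> {0..1} \<times> ?S \<Longrightarrow> b \<in> vsupp (G p) \<Longrightarrow> H p \<le> b"
      and hom: "homotopic_with (\<lambda>u. \<forall>p\<in>?C. \<forall>b\<in>vsupp (u p). H p \<le> b) (top_of_set ?C) ?K G ?g"
      by (rule order_complex_lift_homotopy[OF P S C H[unfolded prod] g]) (erule (1) gH, rule that)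
    have G': "continuous_map (prod_topology I01 (nsphere n)) ?K G" using G prod by simp
    have pt: "continuous_map I01 (prod_topology I01 (nsphere n)) (\<lambda>s. (s, sphere_base))"
      by (simp add: continuous_map_paired sphere_base_in' continuous_map_id[unfolded id_def])
    let ?B = "geo (order_chains (?Q a))"
    let ?tr = "tracked n ?K ?B (\<lambda>y. y)"
    have tr1: "?tr (\<lambda>t. G (0, t)) (G (0, sphere_base)) (\<lambda>t. G (1, t)) (G (1, sphere_base))"
    proof (rule trackedI[OF G'])
      show "continuous_map I01 ?B (\<lambda>s. G (s, sphere_base))"
      proof (rule continuous_map_into_geo_sub[OF continuous_map_compose'[OF pt G']])
        fix s assume s: "s \<in> topspace I01"
        then have "G (s, sphere_base) \<in> gpoints (order_chains P)"
          using G' sphere_base_in'[of n] by (auto simp: continuous_map_into_geo)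
        then show "G (s, sphere_base) \<in> gpoints (order_chains (?Q a))"
          using GH[of "(s, sphere_base)"] Hb[of s] s sphere_base_in'[of n]
          by (intro in_order_complex_above) auto
      qed
    qed auto
    have tr2: "?tr (\<lambda>t. G (i, t)) (G (i, sphere_base)) (\<lambda>t. ?g (i, t)) (?g (i, sphere_base))" if i: "i \<in> {0, 1}" for i
    proof -
      obtain J where J: "continuous_map (prod_topology I01 (top_of_set ?C)) ?K J"
        "\<And>p. J (0, p) = G p" "\<And>p. J (1, p) = ?g p"
        "\<And>r p b. r \<in> {0..1} \<Longrightarrow> p \<in> ?C \<Longrightarrow> b \<in> vsupp (J (r, p)) \<Longrightarrow> H p \<le> b"
        using hom unfolding homotopic_with_def by blast
      have ci: "continuous_map (nsphere n) (top_of_set ?C) (\<lambda>t. (i, t))"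
        unfolding prodC continuous_map_in_subtopology
        using i by (auto simp: continuous_map_paired continuous_map_id[unfolded id_def])
      have cJ: "continuous_map (prod_topology I01 (nsphere n)) ?K (\<lambda>p. J (fst p, (i, snd p)))"
        by (intro continuous_map_compose'[OF _ J(1)] continuous_map_pairedI continuous_map_fst continuous_map_snd'[OF ci])
      show ?thesis
      proof (rule trackedI[OF cJ])
        have "continuous_map I01 ?K (\<lambda>s. J (s, (i, sphere_base)))"
          using continuous_map_compose'[OF pt cJ] by simp
        then show "continuous_map I01 ?B (\<lambda>s. J (s, (i, sphere_base)))"
        proof (rule continuous_map_into_geo_sub)
          fix s assume s: "s \<in> topspace I01"
          then have "J (s, (i, sphere_base)) \<in> gpoints (order_chains P)"
            using \<open>continuous_map I01 ?K (\<lambda>s. J (s, (i, sphere_base)))\<close> by (auto simp: continuous_map_into_geo)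
          then show "J (s, (i, sphere_base)) \<in> gpoints (order_chains (?Q a))"
            using J(4)[of s "(i, sphere_base)"] Hb[of i] i s sphere_base_in'[of n]
            by (intro in_order_complex_above) auto
        qed
      qed (use J i in auto)
    qed
    have "?tr (\<lambda>t. G (0, t)) (G (0, sphere_base)) g0 x" "?tr (\<lambda>t. G (1, t)) (G (1, sphere_base)) g1 x"
      using tr2[of 0] tr2[of 1] gb by (simp_all)
    \<comment> \<open>The route is from \<open>g0\<close> to \<open>G\<close> at time 0, along the
      cylinder, and from \<open>G\<close> at time 1 to \<open>g1\<close>; throughout, the base point
      stays in the cone above \<open>a\<close>.\<close>
    then have "?tr g0 x g1 x" using tr1 by (blast intro: tracked_trans tracked_sym)
    then show "(g0, g1) \<in> sphere_homotopy n ?K x"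
      using tracked_imp_sphere_homotopy[OF contractible_order_complex_above[OF P a] incl] by fast
  qed
qed

section \<open>Realizations of ordered simplicial sets\<close>

subsection \<open>Simplicial sets presented by lists of vertices\<close>

definition del_nth :: "nat \<Rightarrow> 'a list \<Rightarrow> 'a list" where
  "del_nth i xs = take i xs @ drop (Suc i) xs"

definition dup_nth :: "nat \<Rightarrow> 'a list \<Rightarrow> 'a list" where
  "dup_nth i xs = take (Suc i) xs @ drop i xs"

lemma length_del_nth: "i < length xs \<Longrightarrow> length (del_nth i xs) = length xs - 1"
  by (simp add: del_nth_def)

lemma length_dup_nth: "i < length xs \<Longrightarrow> length (dup_nth i xs) = Suc (length xs)"
  by (simp add: dup_nth_def)

lemma nth_del_nth: "i < length xs \<Longrightarrow> j < length xs - 1 \<Longrightarrow> del_nth i xs ! j = xs ! (if j < i then j else Suc j)"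
  by (auto simp: del_nth_def nth_append)

lemma nth_dup_nth: "i < length xs \<Longrightarrow> j \<le> length xs \<Longrightarrow> dup_nth i xs ! j = xs ! (if j \<le> i then j else j - 1)"
  by (auto simp: dup_nth_def nth_append min_def intro!: arg_cong[of _ _ "nth xs"])

lemma del_nth_del_nth:
  assumes "i < j" "j < length xs"
  shows "del_nth i (del_nth j xs) = del_nth (j - 1) (del_nth i xs)"
  by (rule nth_equalityI) (use assms in \<open>auto simp: length_del_nth nth_del_nth\<close>)

lemma dup_nth_dup_nth:
  assumes "i \<le> j" "j < length xs"
  shows "dup_nth i (dup_nth j xs) = dup_nth (Suc j) (dup_nth i xs)"
  by (rule nth_equalityI) (use assms in \<open>auto simp: length_dup_nth nth_dup_nth\<close>)

lemma del_nth_dup_nth_less: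
  assumes "i < j" "j < length xs"
  shows "del_nth i (dup_nth j xs) = dup_nth (j - 1) (del_nth i xs)"
  by (rule nth_equalityI) (use assms in \<open>auto simp: length_dup_nth nth_dup_nth length_del_nth nth_del_nth\<close>)

lemma del_nth_dup_nth_eq:
  assumes "j < length xs"
  shows "del_nth j (dup_nth j xs) = xs" "del_nth (Suc j) (dup_nth j xs) = xs"
  by (rule nth_equalityI; use assms in \<open>auto simp: length_dup_nth nth_dup_nth length_del_nth nth_del_nth\<close>)+

lemma del_nth_dup_nth_greater:
  assumes "Suc j < i" "i \<le> length xs"
  shows "del_nth i (dup_nth j xs) = dup_nth j (del_nth (i - 1) xs)"
  by (rule nth_equalityI) (use assms in \<open>auto simp: length_dup_nth nth_dup_nth length_del_nth nth_del_nth\<close>)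

lemma dup_nth_del_nth:
  assumes "Suc j < length xs" "xs ! j = xs ! Suc j"
  shows "dup_nth j (del_nth j xs) = xs"
  by (rule nth_equalityI) (use assms in \<open>auto simp: length_dup_nth nth_dup_nth length_del_nth nth_del_nth le_less_Suc_eq
       intro!: arg_cong[of _ _ "nth xs"]\<close>)

section \<open>Quotients and disjoint unions of topological spaces\<close>

lemma topspace_quotient_space:
  assumes R: "equiv UNIV R" and sat: "R `` topspace X \<subseteq> topspace X"
  shows "topspace (quotient_space X R) = topspace X // R"
proof -
  have "\<Union>(topspace X // R) = topspace X"
  proof
    show "\<Union>(topspace X // R) \<subseteq> topspace X" using sat by (auto simp: quotient_def)
    show "topspace X \<subseteq> \<Union>(topspace X // R)"
      using R by (auto simp: quotient_def equiv_def refl_on_def)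
  qed
  then have "openin (quotient_space X R) (topspace X // R)"
    by (simp add: openin_quotient_space[OF R])
  then show ?thesis
    using openin_subset openin_quotient_space[OF R, of X "topspace (quotient_space X R)"] by blast
qed

lemma quotient_map_quotient_space:
  assumes R: "equiv UNIV R" and sat: "R `` topspace X \<subseteq> topspace X"
  shows "quotient_map X (quotient_space X R) (\<lambda>x. R `` {x})"
  unfolding quotient_map_def
proof (intro conjI allI impI)
  note top = topspace_quotient_space[OF assms]
  show "(\<lambda>x. R `` {x}) ` topspace X = topspace (quotient_space X R)"
    unfolding top by (auto simp: quotient_def)
  fix U assume "U \<subseteq> topspace (quotient_space X R)"
  then have U: "U \<subseteq> topspace X // R" by (simp only: top)
  have "{x \<in> topspace X. R `` {x} \<in> U} = \<Union>U"
  proof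
    have "x \<in> R `` {x}" for x using R by (auto simp: equiv_def refl_on_def)
    then show "{x \<in> topspace X. R `` {x} \<in> U} \<subseteq> \<Union>U" by blast
    show "\<Union>U \<subseteq> {x \<in> topspace X. R `` {x} \<in> U}"
    proof
      fix y assume "y \<in> \<Union>U"
      then obtain x where x: "x \<in> topspace X" "R `` {x} \<in> U" "(x, y) \<in> R" using U by (auto simp: quotient_def)
      then have "R `` {x} = R `` {y}" using equiv_class_eq[OF R] by blast
      then show "y \<in> {x \<in> topspace X. R `` {x} \<in> U}" using sat x by auto
    qed
  qed
  then show "openin X {x \<in> topspace X. R `` {x} \<in> U} = openin (quotient_space X R) U"
    using U by (simp add: openin_quotient_space[OF R])
qed

lemma continuous_map_from_sum_topology:
  assumes "\<And>i. i \<in> I \<Longrightarrow> continuous_map (X i) Y (\<lambda>x. f (i, x))"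
  shows "continuous_map (sum_topology X I) Y f"
  unfolding continuous_map_def openin_sum_topology
proof (intro conjI allI impI ballI)
  show "f \<in> topspace (sum_topology X I) \<rightarrow> topspace Y"
    using assms by (fastforce simp: continuous_map_def)
  fix U i assume U: "openin Y U" and i: "i \<in> I"
  have "{x. (i, x) \<in> {x \<in> topspace (sum_topology X I). f x \<in> U}} = {x \<in> topspace (X i). f (i, x) \<in> U}"
    using i by auto
  then show "openin (X i) {x. (i, x) \<in> {x \<in> topspace (sum_topology X I). f x \<in> U}}"
    using openin_continuous_map_preimage[OF assms[OF i] U] by simp
qed auto

lemma continuous_map_into_sum_topology:
  assumes "i \<in> I"
  shows "continuous_map (X i) (sum_topology X I) (\<lambda>x. (i, x))"
proof -
  have "{x \<in> topspace (X i). (i, x) \<in> U} = {x. (i, x) \<in> U}" if "U \<subseteq> Sigma I (topspace \<circ> X)" for U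
    using that by auto
  then show ?thesis using assms by (auto simp: continuous_map_def openin_sum_topology)
qed

section \<open>Standard simplices and index maps\<close>

lemma in_standard_simplex:
  "t \<in> standard_simplex n \<longleftrightarrow> (\<forall>i. 0 \<le> t i) \<and> (\<forall>i>n. t i = 0) \<and> (\<Sum>i\<le>n. t i) = 1"
proof
  assume t: "(\<forall>i. 0 \<le> t i) \<and> (\<forall>i>n. t i = 0) \<and> (\<Sum>i\<le>n. t i) = 1"
  have "t i \<le> 1" for i
    using member_le_sum[of i "{..n}" t] t by (cases "i \<le> n") auto
  then show "t \<in> standard_simplex n" using t by (simp add: standard_simplex_def)
qed (simp add: standard_simplex_def)

text \<open>\<open>s\<close> is the pushforward of \<open>t\<close> along \<open>\<sigma>\<close>.
  With \<open>Q\<close> constantly true this preserves total mass; with \<open>Q\<close> testing for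
  a vertex it shows that gluing preserves barycentric coordinates.\<close>

lemma sum_push_index:
  fixes s t :: "nat \<Rightarrow> real"
  assumes "\<And>k. k \<le> n \<Longrightarrow> s k = (\<Sum>j\<le>m. if \<sigma> j = k then t j else 0)" "\<And>j. j \<le> m \<Longrightarrow> \<sigma> j \<le> n"
  shows "(\<Sum>k\<le>n. if Q k then s k else 0) = (\<Sum>j\<le>m. if Q (\<sigma> j) then t j else 0)"
proof -
  have "(\<Sum>k\<le>n. if Q k then s k else 0) = (\<Sum>k\<le>n. \<Sum>j\<le>m. if \<sigma> j = k then (if Q (\<sigma> j) then t j else 0) else 0)"
  proof (intro sum.cong refl)
    fix k assume "k \<in> {..n}"
    then show "(if Q k then s k else 0) = (\<Sum>j\<le>m. if \<sigma> j = k then (if Q (\<sigma> j) then t j else 0) else 0)"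
      using assms(1)[of k] by (cases "Q k") (auto intro!: sum.cong sum.neutral)
  qed
  also have "\<dots> = (\<Sum>j\<le>m. \<Sum>k\<le>n. if \<sigma> j = k then (if Q (\<sigma> j) then t j else 0) else 0)"
    by (rule sum.swap)
  also have "\<dots> = (\<Sum>j\<le>m. if Q (\<sigma> j) then t j else 0)"
  proof (intro sum.cong refl)
    fix j assume "j \<in> {..m}"
    then show "(\<Sum>k\<le>n. if \<sigma> j = k then (if Q (\<sigma> j) then t j else 0) else 0) = (if Q (\<sigma> j) then t j else 0)"
      using assms(2)[of j] by (subst sum.delta') auto
  qed
  finally show ?thesis .
qed

text \<open>A coface is the pushforward along the increasing injection that skips
  \<open>i\<close>.\<close>

lemma simplical_face_push:
  assumes "k \<le> Suc n" "i \<le> Suc n"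
  shows "simplical_face i t k = (\<Sum>j\<le>n. if (if j < i then j else Suc j) = k then t j else (0::real))"
proof -
  consider "k < i" | "k = i" | "k > i" by linarith
  then show ?thesis
  proof cases
    case 1
    then have "(\<Sum>j\<le>n. if (if j < i then j else Suc j) = k then t j else 0) = (\<Sum>j\<le>n. if j = k then t j else 0)"
      by (intro sum.cong) auto
    then show ?thesis using 1 assms by (simp add: simplical_face_def)
  next
    case 2
    then have "(\<Sum>j\<le>n. if (if j < i then j else Suc j) = k then t j else 0) = (\<Sum>j\<le>n. 0)"
      by (intro sum.cong) auto
    then show ?thesis using 2 by (simp add: simplical_face_def)
  next
    case 3
    then have "(\<Sum>j\<le>n. if (if j < i then j else Suc j) = k then t j else 0) = (\<Sum>j\<le>n. if j = k - 1 then t j else 0)"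
      by (intro sum.cong) auto
    then show ?thesis using 3 assms by (auto simp: simplical_face_def)
  qed
qed

text \<open>A codegeneracy is the pushforward along the monotone surjection that takes the value
  \<open>i\<close> twice.\<close>

lemma simplex_degen_push:
  assumes "k \<le> n" "i \<le> n"
  shows "simplex_degen i t k = (\<Sum>j\<le>Suc n. if (if j \<le> i then j else j - 1) = k then t j else 0)"
proof -
  consider "k < i" | "k = i" | "k > i" by linarith
  then show ?thesis
  proof cases
    case 1
    then have "(\<Sum>j\<le>Suc n. if (if j \<le> i then j else j - 1) = k then t j else 0) = (\<Sum>j\<le>Suc n. if j = k then t j else 0)"
      by (intro sum.cong) auto
    then show ?thesis using 1 assms by (simp add: simplex_degen_def)
  next
    case 2
    then have "(\<Sum>j\<le>Suc n. if (if j \<le> i then j else j - 1) = k then t j else 0)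
        = (\<Sum>j\<le>Suc n. (if j = i then t j else 0) + (if j = Suc i then t j else 0))"
      by (intro sum.cong) auto
    also have "\<dots> = t i + t (Suc i)" using assms by (simp add: sum.distrib del: sum.atMost_Suc)
    finally show ?thesis using 2 by (simp add: simplex_degen_def)
  next
    case 3
    then have "(\<Sum>j\<le>Suc n. if (if j \<le> i then j else j - 1) = k then t j else 0) = (\<Sum>j\<le>Suc n. if j = Suc k then t j else 0)"
      by (intro sum.cong) auto
    then show ?thesis using 3 assms by (simp add: simplex_degen_def del: sum.atMost_Suc)
  qed
qed

lemma simplical_face_in:
  assumes "t \<in> standard_simplex n" "i \<le> Suc n"
  shows "simplical_face i t \<in> standard_simplex (Suc n)"
  using simplical_face_in_standard_simplex[of "Suc n" i t] assms by simp

lemma simplex_degen_in: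
  assumes "t \<in> standard_simplex (Suc n)" "i \<le> n"
  shows "simplex_degen i t \<in> standard_simplex n"
proof -
  have "(\<Sum>k\<le>n. if True then simplex_degen i t k else 0) = (\<Sum>j\<le>Suc n. if True then t j else 0)"
    by (rule sum_push_index[where \<sigma> = "\<lambda>j. if j \<le> i then j else j - 1"])
       (use simplex_degen_push[OF _ assms(2)] assms(2) in \<open>auto simp del: sum.atMost_Suc\<close>)
  then show ?thesis using assms by (auto simp: in_standard_simplex simplex_degen_def)
qed

text \<open>The simplicial set of an ordered complex: its simplices are coded by the weakly
  increasing lists of vertices of a face. Nerves, wedges of boundaries and coned complexes all have
  this form, so the simplicial identities and the realization are treated only once.\<close>

locale vertex_presentation =
  fixes X :: "'a sset" and vl :: "'a \<Rightarrow> nat list" and L :: "nat set set"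
  assumes L: "simplicial_complex L"
    and vl_bij: "\<And>n. bij_betw vl (splx X n) {xs. length xs = Suc n \<and> sorted xs \<and> set xs \<in> L}"
    and face_in: "\<And>n i x. x \<in> splx X (Suc n) \<Longrightarrow> i \<le> Suc n \<Longrightarrow> face X n i x \<in> splx X n"
    and face_vl: "\<And>n i x. x \<in> splx X (Suc n) \<Longrightarrow> i \<le> Suc n \<Longrightarrow> vl (face X n i x) = del_nth i (vl x)"
    and degen_in: "\<And>n i x. x \<in> splx X n \<Longrightarrow> i \<le> n \<Longrightarrow> degen X n i x \<in> splx X (Suc n)"
    and degen_vl: "\<And>n i x. x \<in> splx X n \<Longrightarrow> i \<le> n \<Longrightarrow> vl (degen X n i x) = dup_nth i (vl x)"
begin

lemma vl_props:
  assumes "x \<in> splx X n"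
  shows "length (vl x) = Suc n" "sorted (vl x)" "set (vl x) \<in> L"
  using bij_betwE[OF vl_bij] assms by blast+

lemma vl_eqI: "x \<in> splx X n \<Longrightarrow> y \<in> splx X n \<Longrightarrow> vl x = vl y \<Longrightarrow> x = y"
  using bij_betw_imp_inj_on[OF vl_bij[of n]] by (auto dest: inj_onD)

lemma simplicial_set: "simplicial_set X"
  unfolding simplicial_set_def
proof (intro conjI allI ballI impI)
  fix n j i x assume *: "j \<le> Suc (Suc n)" "i < j" "x \<in> splx X (Suc (Suc n))"
  show "face X n i (face X (Suc n) j x) = face X n (j - 1) (face X (Suc n) i x)"
    by (rule vl_eqI[of _ n]) (use * vl_props[OF *(3)] in \<open>auto simp: face_in face_vl intro!: del_nth_del_nth[simplified]\<close>)
next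
  fix n j i x assume *: "j \<le> n" "i \<le> j" "x \<in> splx X n"
  show "degen X (Suc n) i (degen X n j x) = degen X (Suc n) (Suc j) (degen X n i x)"
    by (rule vl_eqI[of _ "Suc (Suc n)"]) (use * vl_props[OF *(3)] in \<open>auto simp: degen_in degen_vl intro!: dup_nth_dup_nth[simplified]\<close>)
next
  fix n j i x assume *: "j \<le> Suc n" "i < j" "x \<in> splx X (Suc n)"
  show "face X (Suc n) i (degen X (Suc n) j x) = degen X n (j - 1) (face X n i x)"
    by (rule vl_eqI[of _ "Suc n"]) (use * vl_props[OF *(3)] in \<open>auto simp: degen_in degen_vl face_in face_vl intro!: del_nth_dup_nth_less[simplified]\<close>)
next
  fix n j x assume *: "j \<le> n" "x \<in> splx X n"
  show "face X n j (degen X n j x) = x" "face X n (Suc j) (degen X n j x) = x"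
    by (rule vl_eqI[of _ n]; use * vl_props[OF *(2)] in \<open>auto simp: degen_in degen_vl face_in face_vl intro!: del_nth_dup_nth_eq[simplified]\<close>)+
next
  fix n j i x assume *: "j \<le> Suc n" "i \<le> Suc (Suc n)" "x \<in> splx X (Suc n)" "Suc j < i"
  show "face X (Suc n) i (degen X (Suc n) j x) = degen X n j (face X n (i - 1) x)"
    by (rule vl_eqI[of _ "Suc n"]) (use * vl_props[OF *(3)] in \<open>auto simp: degen_in degen_vl face_in face_vl intro!: del_nth_dup_nth_greater[simplified]\<close>)
qed (auto simp: face_in degen_in)

definition cells :: "'a cell_point set" where
  "cells = {((n, x), t) | n x t. x \<in> splx X n \<and> t \<in> standard_simplex n}"

definition cell_space :: "'a cell_point topology" where
  "cell_space = sum_topology (\<lambda>(n, x). subtopology (powertop_real UNIV) (standard_simplex n)) (SIGMA n:UNIV. splx X n)"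

text \<open>The point of \<open>geo L\<close> represented by a cell point: the mass at index
  \<open>j\<close> goes to the j-th vertex, and repeated vertices collect theirs.\<close>

definition coords :: "'a cell_point \<Rightarrow> nat \<Rightarrow> real" where
  "coords p = (case p of ((n, x), t) \<Rightarrow> \<lambda>v. \<Sum>j\<le>n. if vl x ! j = v then t j else 0)"

lemma topspace_cell_space: "topspace cell_space = cells"
  by (auto simp: cell_space_def cells_def)

lemma coords_outside:
  assumes "x \<in> splx X n" "v \<notin> set (vl x)"
  shows "coords ((n, x), t) v = 0"
  using assms(2) vl_props(1)[OF assms(1)] by (auto simp: coords_def intro!: sum.neutral)

lemma coords_in:
  assumes "p \<in> cells"
  shows "coords p \<in> gpoints L"
proof -
  obtain n x t where p: "p = ((n, x), t)" "x \<in> splx X n" "t \<in> standard_simplex n"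
    using assms by (auto simp: cells_def)
  note vl = vl_props[OF p(2)]
  show ?thesis
  proof (rule gpointsI[OF L vl(3)])
    show "0 \<le> coords p v" for v using p by (auto simp: coords_def in_standard_simplex intro!: sum_nonneg)
    show "coords p v = 0" if "v \<notin> set (vl x)" for v
      using that vl(1) by (auto simp: coords_def p(1) intro!: sum.neutral)
    have "sum (coords p) (set (vl x)) = (\<Sum>j\<le>n. \<Sum>v\<in>set (vl x). if vl x ! j = v then t j else 0)"
      unfolding coords_def p(1) prod.case by (rule sum.swap)
    also have "\<dots> = (\<Sum>j\<le>n. t j)" using vl(1) by (intro sum.cong) (auto simp: sum.delta')
    finally show "sum (coords p) (set (vl x)) = 1" using p(3) by (simp add: in_standard_simplex)
  qed
qed

lemma glue_step_props:
  assumes "(p, q) \<in> glue_step X"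
  shows "p \<in> cells" "q \<in> cells" "coords p = coords q"
proof -
  consider n i x t where "p = ((n, face X n i x), t)" "q = ((Suc n, x), simplical_face i t)"
      "x \<in> splx X (Suc n)" "i \<le> Suc n" "t \<in> standard_simplex n"
    | n i x t where "p = ((Suc n, degen X n i x), t)" "q = ((n, x), simplex_degen i t)"
      "x \<in> splx X n" "i \<le> n" "t \<in> standard_simplex (Suc n)"
    using assms unfolding glue_step_def by blast
  then have "p \<in> cells \<and> q \<in> cells \<and> coords p = coords q"
  proof cases
    case 1
    note vl = vl_props[OF 1(3)]
    have "coords q v = coords p v" for v
    proof -
      have "coords q v = (\<Sum>j\<le>n. if vl x ! (if j < i then j else Suc j) = v then t j else 0)"
        unfolding coords_def 1(2) prod.case
        by (rule sum_push_index) (use simplical_face_push[OF _ 1(4)] 1(4) in auto)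
      also have "\<dots> = coords p v"
        unfolding coords_def 1(1) prod.case using 1 vl
        by (intro sum.cong) (auto simp: face_vl nth_del_nth)
      finally show ?thesis .
    qed
    then show ?thesis using 1 by (auto simp: cells_def face_in simplical_face_in)
  next
    case 2
    note vl = vl_props[OF 2(3)]
    have "coords q v = coords p v" for v
    proof -
      have "coords q v = (\<Sum>j\<le>Suc n. if vl x ! (if j \<le> i then j else j - 1) = v then t j else 0)"
        unfolding coords_def 2(2) prod.case
        by (rule sum_push_index) (use simplex_degen_push[OF _ 2(4)] 2(4) in auto)
      also have "\<dots> = coords p v"
        unfolding coords_def 2(1) prod.case using 2 vl
        by (intro sum.cong) (auto simp: degen_vl nth_dup_nth)
      finally show ?thesis .
    qed
    then show ?thesis using 2 by (auto simp: cells_def degen_in simplex_degen_in)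
  qed
  then show "p \<in> cells" "q \<in> cells" "coords p = coords q" by auto
qed

lemma glue_rel_props:
  assumes "(p, q) \<in> glue_rel X" "p \<in> cells"
  shows "q \<in> cells \<and> coords p = coords q"
  using assms unfolding glue_rel_def
  by (induction rule: rtrancl_induct) (use glue_step_props in \<open>auto\<close>)

lemma glue_relI: "(p, q) \<in> glue_step X \<Longrightarrow> (p, q) \<in> glue_rel X" "(p, q) \<in> glue_step X \<Longrightarrow> (q, p) \<in> glue_rel X"
  unfolding glue_rel_def by (auto intro: r_into_rtrancl)

lemma glue_rel_trans: "(p, q) \<in> glue_rel X \<Longrightarrow> (q, r) \<in> glue_rel X \<Longrightarrow> (p, r) \<in> glue_rel X"
  using equiv_glue_rel[of X] by (meson equivE transD)

lemma glue_rel_sym: "(p, q) \<in> glue_rel X \<Longrightarrow> (q, p) \<in> glue_rel X"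
  using equiv_glue_rel[of X] by (meson equivE symD)

definition simplex_of :: "nat set \<Rightarrow> 'a" where
  "simplex_of A = inv_into (splx X (card A - 1)) vl (sorted_list_of_set A)"

text \<open>Places a point whose support is in \<open>A\<close> in the nondegenerate simplex on
  \<open>A\<close>. Allowing \<open>A\<close> to exceed the support makes this continuous on each
  closed simplex; indices beyond the dimension get 0, as \<open>standard_simplex\<close>
  requires.\<close>

definition cell_on :: "nat set \<Rightarrow> (nat \<Rightarrow> real) \<Rightarrow> 'a cell_point" where
  "cell_on A y = ((card A - 1, simplex_of A), \<lambda>j. if j \<le> card A - 1 then y (sorted_list_of_set A ! j) else 0)"

lemma simplex_of:
  assumes "A \<in> L" "A \<noteq> {}"
  shows "simplex_of A \<in> splx X (card A - 1)" "vl (simplex_of A) = sorted_list_of_set A"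
proof -
  have f: "finite A" using simplicial_complexD(1)[OF L assms(1)] .
  then have "Suc (card A - 1) = card A" using assms(2) by (simp add: card_gt_0_iff)
  then have "sorted_list_of_set A \<in> vl ` splx X (card A - 1)"
    using bij_betw_imp_surj_on[OF vl_bij[of "card A - 1"]] assms f by auto
  then show "simplex_of A \<in> splx X (card A - 1)" "vl (simplex_of A) = sorted_list_of_set A"
    unfolding simplex_of_def by (auto intro: inv_into_into f_inv_into_f)
qed

lemma cell_on:
  assumes A: "A \<in> L" "A \<noteq> {}" and y: "y \<in> gpoints L" "vsupp y \<subseteq> A"
  shows "cell_on A y \<in> cells" "coords (cell_on A y) = y"
proof -
  have f: "finite A" using simplicial_complexD(1)[OF L A(1)] .
  then have c: "Suc (card A - 1) = card A" using A(2) by (simp add: card_gt_0_iff)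
  let ?l = "sorted_list_of_set A" and ?n = "card A - 1"
  have bij: "bij_betw (nth ?l) {..?n} A"
    using bij_betw_nth[of ?l "{..?n}" A] f unfolding lessThan_Suc_atMost[symmetric] c by simp
  have sum: "(\<Sum>j\<le>?n. F (?l ! j)) = sum F A" for F :: "nat \<Rightarrow> real"
    by (rule sum.reindex_bij_betw[OF bij])
  have "(\<lambda>j. if j \<le> ?n then y (?l ! j) else 0) \<in> standard_simplex ?n"
    using sum[of y] gpoints_sum[OF y(1) f y(2)] gpointsD(1)[OF y(1)] by (simp add: in_standard_simplex)
  then show "cell_on A y \<in> cells"
    using simplex_of(1)[OF A] by (auto simp: cells_def cell_on_def)
  show "coords (cell_on A y) = y"
  proof
    fix v
    have "coords (cell_on A y) v = (\<Sum>j\<le>?n. if ?l ! j = v then y (?l ! j) else 0)"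
      unfolding coords_def cell_on_def prod.case simplex_of(2)[OF A] by (intro sum.cong) auto
    also have "\<dots> = (\<Sum>u\<in>A. if u = v then y u else 0)" by (rule sum)
    also have "\<dots> = y v" using f y(2) by auto
    finally show "coords (cell_on A y) v = y v" .
  qed
qed

text \<open>Each point of a cell is equivalent to one in the interior of a nondegenerate simplex: remove
  vanishing coordinates by faces and repeated vertices by degeneracies.\<close>

lemma nondegenerate_cell_on:
  assumes x: "x \<in> splx X n" and t: "t \<in> standard_simplex n" and nz: "\<And>j. j \<le> n \<Longrightarrow> t j \<noteq> 0" and d: "distinct (vl x)"
  shows "cell_on (vsupp (coords ((n, x), t))) (coords ((n, x), t)) = ((n, x), t)"
proof -
  note vl = vl_props[OF x]
  let ?y = "coords ((n, x), t)"
  have yj: "?y (vl x ! j) = t j" if "j \<le> n" for j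
  proof -
    have "?y (vl x ! j) = (\<Sum>i\<le>n. if i = j then t i else 0)"
      unfolding coords_def prod.case using d vl(1) that by (intro sum.cong) (auto simp: nth_eq_iff_index_eq)
    then show ?thesis using that by simp
  qed
  have y0: "?y v = 0" if "v \<notin> set (vl x)" for v
    using that vl(1) by (auto simp: coords_def intro!: sum.neutral)
  have supp: "vsupp ?y = set (vl x)"
  proof
    show "vsupp ?y \<subseteq> set (vl x)" using y0 by (auto simp: vsupp_def)
    show "set (vl x) \<subseteq> vsupp ?y" using yj nz vl(1) by (auto simp: in_set_conv_nth)
  qed
  have l: "sorted_list_of_set (set (vl x)) = vl x"
    using vl(2) d by (simp add: sorted_list_of_set.idem_if_sorted_distinct)
  have c: "card (set (vl x)) - 1 = n" using d vl(1) by (simp add: distinct_card)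
  have "simplex_of (set (vl x)) = x"
    unfolding simplex_of_def l c using bij_betw_imp_inj_on[OF vl_bij] x by (rule inv_into_f_f)
  moreover have "(\<lambda>j. if j \<le> n then ?y (vl x ! j) else 0) = t"
    using yj t by (auto simp: in_standard_simplex)
  ultimately show ?thesis unfolding supp cell_on_def l c by simp
qed

lemma glue_canonical:
  assumes "x \<in> splx X n" "t \<in> standard_simplex n"
  shows "(((n, x), t), cell_on (vsupp (coords ((n, x), t))) (coords ((n, x), t))) \<in> glue_rel X"
  using assms
proof (induction n arbitrary: x t)
  case (0 x t)
  then have "t 0 = 1" by (simp add: in_standard_simplex)
  moreover have "distinct (vl x)" using vl_props(1)[OF 0(1)] by (auto simp: length_Suc_conv)
  ultimately have "cell_on (vsupp (coords ((0, x), t))) (coords ((0, x), t)) = ((0, x), t)"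
    using 0 by (intro nondegenerate_cell_on) auto
  then show ?case by (simp add: glue_rel_def)
next
  case (Suc n x t)
  note vl = vl_props[OF Suc.prems(1)]
  have step: ?case if q: "(q, ((Suc n, x), t)) \<in> glue_step X \<or> (((Suc n, x), t), q) \<in> glue_step X"
    "q = ((n, x'), t')" "x' \<in> splx X n" "t' \<in> standard_simplex n" for q x' t'
  proof -
    have "coords q = coords ((Suc n, x), t)" "(((Suc n, x), t), q) \<in> glue_rel X"
      using q(1) glue_step_props(3) glue_relI by metis+
    then show ?thesis using Suc.IH[OF q(3,4)] glue_rel_trans unfolding q(2) by metis
  qed
  consider j where "j \<le> Suc n" "t j = 0" | j where "Suc j \<le> Suc n" "vl x ! j = vl x ! Suc j"
    | "\<And>j. j \<le> Suc n \<Longrightarrow> t j \<noteq> 0" "distinct (vl x)"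
  proof -
    \<comment> \<open>A repeated vertex in a sorted list occurs at two neighbouring positions, so
      the simplex is a degeneracy of a face.\<close>
    have "\<exists>j. Suc j < length (vl x) \<and> vl x ! j = vl x ! Suc j" if "\<not> distinct (vl x)"
    proof (rule ccontr)
      assume "\<not> ?thesis"
      then have "sorted_wrt (<) (vl x)"
        using vl(2) unfolding sorted_wrt_iff_nth_Suc_transp[OF transp_on_less] sorted_iff_nth_Suc
        by (auto simp: order_less_le)
      then show False using that strict_sorted_iff by blast
    qed
    note nd = this
    show ?thesis
    proof (cases "\<exists>j\<le>Suc n. t j = 0")
      case True then show ?thesis using that(1) by blast
    next
      case nz: False
      show ?thesis
      proof (cases "distinct (vl x)")
        case True then show ?thesis using that(3) nz by blast
      next
        case False
        then obtain j where "Suc j < length (vl x)" "vl x ! j = vl x ! Suc j" using nd by blast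
        then show ?thesis using that(2)[of j] vl(1) by simp
      qed
    qed
  qed
  then show ?case
  proof cases
    case 1
    define t' where "t' = (\<lambda>k. if k < j then t k else t (Suc k))"
    have t: "simplical_face j t' = t" using 1 by (auto simp: simplical_face_def t'_def fun_eq_iff)
    have "(\<Sum>k\<le>Suc n. if True then simplical_face j t' k else 0) = (\<Sum>k\<le>n. if True then t' k else 0)"
      by (rule sum_push_index[where \<sigma> = "\<lambda>k. if k < j then k else Suc k"])
         (use simplical_face_push[OF _ 1(1)] in \<open>auto simp del: sum.atMost_Suc\<close>)
    then have t': "t' \<in> standard_simplex n"
      using Suc.prems(2) 1(1) unfolding t by (auto simp: in_standard_simplex t'_def)
    show ?thesis
    proof (rule step[OF disjI1 refl face_in[OF Suc.prems(1) 1(1)] t'])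
      show "(((n, face X n j x), t'), ((Suc n, x), t)) \<in> glue_step X"
        unfolding glue_step_def using Suc.prems(1) 1(1) t' t by (intro UnI1 CollectI) metis
    qed
  next
    case 2
    define x' where "x' = face X n j x"
    have x': "x' \<in> splx X n" unfolding x'_def using Suc.prems(1) 2(1) by (simp add: face_in)
    have "degen X n j x' = x"
    proof (rule vl_eqI[OF degen_in[OF x'] Suc.prems(1)])
      show "vl (degen X n j x') = vl x"
        using 2 vl(1) x' Suc.prems(1) by (simp add: degen_vl x'_def face_vl dup_nth_del_nth)
    qed (use 2 in simp)
    then have "(((Suc n, x), t), ((n, x'), simplex_degen j t)) \<in> glue_step X"
      unfolding glue_step_def using x' 2(1) Suc.prems(2) by (intro UnI2 CollectI) (metis Suc_le_mono)
    then show ?thesis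
      using step[OF disjI2 refl x' simplex_degen_in[OF Suc.prems(2)]] 2(1) by simp
  next
    case 3
    then have "cell_on (vsupp (coords ((Suc n, x), t))) (coords ((Suc n, x), t)) = ((Suc n, x), t)"
      using Suc.prems by (intro nondegenerate_cell_on) auto
    then show ?thesis by (simp add: glue_rel_def)
  qed
qed

text \<open>Both points are equivalent to a canonical cell point that depends only on the
  coordinates.\<close>

lemma glue_rel_iff:
  assumes "p \<in> cells" "q \<in> cells"
  shows "(p, q) \<in> glue_rel X \<longleftrightarrow> coords p = coords q"
proof
  show "(p, q) \<in> glue_rel X \<Longrightarrow> coords p = coords q" using glue_rel_props assms by blast
  assume eq: "coords p = coords q"
  have "(p, cell_on (vsupp (coords p)) (coords p)) \<in> glue_rel X" if "p \<in> cells" for p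
    using that glue_canonical by (auto simp: cells_def)
  from this[OF assms(1)] this[OF assms(2)] show "(p, q) \<in> glue_rel X"
    using eq glue_rel_trans glue_rel_sym by metis
qed

lemma realization_quotient: "realization X = quotient_space cell_space (glue_rel X)"
  by (simp add: realization_def cell_space_def)

lemma glue_saturated: "glue_rel X `` topspace cell_space \<subseteq> topspace cell_space"
  using glue_rel_props by (auto simp: topspace_cell_space)

lemma topspace_realization: "topspace (realization X) = (\<lambda>p. glue_rel X `` {p}) ` cells"
  unfolding realization_quotient topspace_quotient_space[OF equiv_glue_rel glue_saturated] topspace_cell_space
  by (auto simp: quotient_def)

definition realization_coords :: "'a cell_point set \<Rightarrow> nat \<Rightarrow> real" where
  "realization_coords c = coords (SOME p. p \<in> c)"

lemma realization_coords:
  assumes "p \<in> cells"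
  shows "realization_coords (glue_rel X `` {p}) = coords p"
proof -
  have "p \<in> glue_rel X `` {p}" by (simp add: glue_rel_def)
  then have "(SOME q. q \<in> glue_rel X `` {p}) \<in> glue_rel X `` {p}" by (rule someI)
  then show ?thesis using glue_rel_props[OF _ assms] by (auto simp: realization_coords_def)
qed

lemma continuous_map_coords: "continuous_map cell_space (geo L) coords"
  unfolding cell_space_def
proof (rule continuous_map_from_sum_topology)
  fix i assume "i \<in> (SIGMA n:UNIV. splx X n)"
  then obtain n x where i: "i = (n, x)" "x \<in> splx X n" by auto
  let ?S = "subtopology (powertop_real UNIV) (standard_simplex n)"
  have "continuous_map ?S (geo L) (\<lambda>t. coords (i, t))"
    unfolding continuous_map_into_geo
  proof (intro conjI allI ballI)
    fix v
    have "continuous_map ?S euclideanreal (\<lambda>t. if b then t j else 0)" for b and j :: nat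
      by (cases b) (auto intro!: continuous_map_from_subtopology continuous_map_product_projection)
    then show "continuous_map ?S euclideanreal (\<lambda>t. coords (i, t) v)"
      unfolding coords_def i(1) prod.case by (intro continuous_map_sum) auto
  qed (use i in \<open>auto intro!: coords_in simp: cells_def\<close>)
  then show "continuous_map (case i of (n, x) \<Rightarrow> subtopology (powertop_real UNIV) (standard_simplex n)) (geo L) (\<lambda>t. coords (i, t))"
    by (simp add: i)
qed

text \<open>The coordinates are continuous on the sum of the cells and constant on classes. The
  inverse chooses the simplex on the support, a choice that jumps; continuity comes from a finite
  closed cover.\<close>

lemma homeomorphic_realization:
  "homeomorphic_map (realization X) (geo L) realization_coords"
proof -
  let ?pi = "\<lambda>p. glue_rel X `` {p}"
  have qm: "quotient_map cell_space (realization X) ?pi"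
    unfolding realization_quotient by (rule quotient_map_quotient_space[OF equiv_glue_rel glue_saturated])
  have "continuous_map cell_space (geo L) (realization_coords \<circ> ?pi)"
    by (rule continuous_map_eq[OF continuous_map_coords]) (simp add: topspace_cell_space realization_coords)
  then have c1: "continuous_map (realization X) (geo L) realization_coords"
    using qm by (rule continuous_compose_quotient_map[rotated])
  define sect where "sect = (\<lambda>y. ?pi (cell_on (vsupp y) y))"
  have cell: "cell_on (vsupp y) y \<in> cells" "coords (cell_on (vsupp y) y) = y" if "y \<in> gpoints L" for y
    using cell_on[OF gpointsD(2)[OF that] gpoints_nonempty_supp[OF that] that] by auto
  have c2: "continuous_map (geo L) (realization X) sect"
  \<comment> \<open>On the closed simplex \<open>A\<close> the fixed section
    \<open>cell_on A\<close> is used. Different choices of \<open>A\<close> give glued points, since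
    the coordinates agree.\<close>
  proof (rule pasting_lemma_closed[where I = "L - {{}}" and T = "\<lambda>A. {y \<in> gpoints L. vsupp y \<subseteq> A}"
        and f = "\<lambda>A y. ?pi (cell_on A y)"])
    show "finite (L - {{}})" using finite_simplicial_complex[OF L] by simp
  next
    fix A assume A: "A \<in> L - {{}}"
    have "{y \<in> gpoints L. vsupp y \<subseteq> A} = topspace (geo L) \<inter> (\<Inter>v\<in>-A. {y \<in> topspace (geo L). y v \<in> {0}})"
      by (auto simp: vsupp_def)
    also have "closedin (geo L) \<dots>"
    proof (cases "- A = {}")
      case False
      then show ?thesis
        by (intro closedin_Int closedin_INT closedin_continuous_map_preimage[OF continuous_map_geo_coord] closedin_topspace) auto
    next
      case True
      then show ?thesis using closedin_topspace[of "geo L"] by (simp only: True INT_empty Int_UNIV_right)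
    qed
    finally show "closedin (geo L) {y \<in> gpoints L. vsupp y \<subseteq> A}" .
    let ?Y = "subtopology (geo L) {y \<in> gpoints L. vsupp y \<subseteq> A}" and ?n = "card A - 1"
    have "continuous_map ?Y (subtopology (powertop_real UNIV) (standard_simplex ?n)) (\<lambda>y. snd (cell_on A y))"
      unfolding continuous_map_in_subtopology continuous_map_componentwise_UNIV
    proof (intro conjI allI)
      fix j
      show "continuous_map ?Y euclideanreal (\<lambda>y. snd (cell_on A y) j)"
        unfolding cell_on_def snd_conv
        by (cases "j \<le> ?n") (auto intro: continuous_map_from_subtopology continuous_map_geo_coord)
      show "(\<lambda>y. snd (cell_on A y)) \<in> topspace ?Y \<rightarrow> standard_simplex ?n"
        using cell_on(1)[of A] A by (fastforce simp: cells_def cell_on_def)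
    qed
    moreover have "continuous_map (subtopology (powertop_real UNIV) (standard_simplex ?n)) cell_space
        (\<lambda>t. ((?n, simplex_of A), t))"
      unfolding cell_space_def
      using continuous_map_into_sum_topology[of "(?n, simplex_of A)" "SIGMA n:UNIV. splx X n"
        "\<lambda>(n, x). subtopology (powertop_real UNIV) (standard_simplex n)"] simplex_of(1)[of A] A
      by simp
    ultimately have "continuous_map ?Y cell_space (\<lambda>y. ((?n, simplex_of A), snd (cell_on A y)))"
      by (rule continuous_map_compose')
    then have "continuous_map ?Y cell_space (cell_on A)" by (simp add: cell_on_def[abs_def])
    then show "continuous_map ?Y (realization X) (\<lambda>y. ?pi (cell_on A y))"
      by (rule continuous_map_compose'[OF _ quotient_imp_continuous_map[OF qm]])
  next
    fix A B y assume "A \<in> L - {{}}" "B \<in> L - {{}}"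
      "y \<in> topspace (geo L) \<inter> {y \<in> gpoints L. vsupp y \<subseteq> A} \<inter> {y \<in> gpoints L. vsupp y \<subseteq> B}"
    then have "(cell_on A y, cell_on B y) \<in> glue_rel X"
      by (subst glue_rel_iff) (auto simp: cell_on)
    then show "?pi (cell_on A y) = ?pi (cell_on B y)" by (rule equiv_class_eq[OF equiv_glue_rel])
  next
    fix y assume "y \<in> topspace (geo L)"
    then show "\<exists>A. A \<in> L - {{}} \<and> y \<in> {y \<in> gpoints L. vsupp y \<subseteq> A} \<and> sect y = ?pi (cell_on A y)"
      using gpointsD(2)[of y] gpoints_nonempty_supp[of y] unfolding sect_def
      by (intro exI[of _ "vsupp y"]) auto
  qed
  have "homeomorphic_maps (realization X) (geo L) realization_coords sect"
    unfolding homeomorphic_maps_def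
  proof (intro conjI c1 c2 ballI)
    fix c assume "c \<in> topspace (realization X)"
    then obtain p where p: "p \<in> cells" "c = ?pi p" unfolding topspace_realization by blast
    have "(cell_on (vsupp (coords p)) (coords p), p) \<in> glue_rel X"
      using cell[OF coords_in[OF p(1)]] p(1) by (subst glue_rel_iff) auto
    then show "sect (realization_coords c) = c"
      unfolding sect_def p(2) realization_coords[OF p(1)] by (rule equiv_class_eq[OF equiv_glue_rel])
  next
    fix y assume "y \<in> topspace (geo L)"
    then show "realization_coords (sect y) = y" by (simp add: sect_def realization_coords cell)
  qed
  then show ?thesis using homeomorphic_map_maps by blast
qed

end

text \<open>A simplicial map determined by a map \<open>w\<close> of vertices; its realization
  becomes \<open>push w\<close> in barycentric coordinates.\<close>

locale presentation_map =
  X: vertex_presentation X vl L + Y: vertex_presentation Y vl' L'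
  for X :: "'a sset" and vl L and Y :: "'b sset" and vl' L' +
  fixes f :: "nat \<Rightarrow> 'a \<Rightarrow> 'b" and w :: "nat \<Rightarrow> nat"
  assumes f_in: "\<And>n x. x \<in> splx X n \<Longrightarrow> f n x \<in> splx Y n"
    and f_vl: "\<And>n x. x \<in> splx X n \<Longrightarrow> vl' (f n x) = map w (vl x)"
begin

lemma map_del_nth: "map g (del_nth i xs) = del_nth i (map g xs)"
  by (simp add: del_nth_def take_map drop_map)

lemma map_dup_nth: "map g (dup_nth i xs) = dup_nth i (map g xs)"
  by (simp add: dup_nth_def take_map drop_map)

lemma simplicial_map: "simplicial_map X Y f"
  unfolding simplicial_map_def
proof (intro conjI X.simplicial_set Y.simplicial_set allI ballI impI)
  fix n i x assume *: "i \<le> Suc n" "x \<in> splx X (Suc n)"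
  show "f n (face X n i x) = face Y n i (f (Suc n) x)"
    by (rule Y.vl_eqI[of _ n]) (use * in \<open>auto simp: X.face_in Y.face_in f_in X.face_vl Y.face_vl f_vl map_del_nth\<close>)
next
  fix n i x assume *: "i \<le> n" "x \<in> splx X n"
  show "f (Suc n) (degen X n i x) = degen Y n i (f n x)"
    by (rule Y.vl_eqI[of _ "Suc n"]) (use * in \<open>auto simp: X.degen_in Y.degen_in f_in X.degen_vl Y.degen_vl f_vl map_dup_nth\<close>)
qed (rule f_in)

definition cell_map :: "'a cell_point \<Rightarrow> 'b cell_point" where
  "cell_map p = (case p of ((n, x), t) \<Rightarrow> ((n, f n x), t))"

lemma cell_map:
  assumes "p \<in> X.cells"
  shows "cell_map p \<in> Y.cells" "Y.coords (cell_map p) = push w (X.coords p)"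
proof -
  obtain n x t where p: "p = ((n, x), t)" "x \<in> splx X n" "t \<in> standard_simplex n"
    using assms by (auto simp: X.cells_def)
  note vl = X.vl_props[OF p(2)]
  show "cell_map p \<in> Y.cells" using p f_in by (auto simp: Y.cells_def cell_map_def)
  have sub: "vsupp (X.coords p) \<subseteq> set (vl x)"
  proof
    fix v assume "v \<in> vsupp (X.coords p)"
    then show "v \<in> set (vl x)" using X.coords_outside[OF p(2)] by (auto simp: p(1))
  qed
  show "Y.coords (cell_map p) = push w (X.coords p)"
  proof
    fix u
    have "push w (X.coords p) u = (\<Sum>v\<in>set (vl x). if w v = u then X.coords p v else 0)"
      by (rule push_eq_sum[OF _ sub]) simp
    also have "\<dots> = (\<Sum>v\<in>set (vl x). \<Sum>j\<le>n. if vl x ! j = v then (if w v = u then t j else 0) else 0)"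
    proof (intro sum.cong refl)
      fix v show "(if w v = u then X.coords p v else 0) = (\<Sum>j\<le>n. if vl x ! j = v then (if w v = u then t j else 0) else 0)"
        by (cases "w v = u") (simp_all add: X.coords_def p(1) cong: if_cong)
    qed
    also have "\<dots> = (\<Sum>j\<le>n. \<Sum>v\<in>set (vl x). if vl x ! j = v then (if w v = u then t j else 0) else 0)"
      by (rule sum.swap)
    also have "\<dots> = (\<Sum>j\<le>n. if w (vl x ! j) = u then t j else 0)"
      using vl(1) by (intro sum.cong) (auto simp: sum.delta')
    also have "\<dots> = Y.coords (cell_map p) u"
      using vl(1) p by (auto simp: Y.coords_def cell_map_def f_vl intro!: sum.cong)
    finally show "Y.coords (cell_map p) u = push w (X.coords p) u" by simp
  qed
qed

lemma realization_map_class: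
  assumes p: "p \<in> X.cells"
  shows "realization_map Y f (glue_rel X `` {p}) = glue_rel Y `` {cell_map p}"
proof -
  have "glue_rel Y `` {cell_map q} = glue_rel Y `` {cell_map p}" if "q \<in> glue_rel X `` {p}" for q
  proof (rule equiv_class_eq[OF equiv_glue_rel])
    have q: "q \<in> X.cells" "X.coords q = X.coords p" using X.glue_rel_props[OF _ p, of q] that by auto
    then show "(cell_map q, cell_map p) \<in> glue_rel Y"
      using Y.glue_rel_iff[OF cell_map(1) cell_map(1)] p by (simp add: cell_map)
  qed
  moreover have "realization_map Y f c = (\<Union>q\<in>c. glue_rel Y `` {cell_map q})" for c
    unfolding realization_map_def cell_map_def by (auto split: prod.splits)
  moreover have "p \<in> glue_rel X `` {p}" by (simp add: glue_rel_def)
  ultimately show ?thesis by blast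
qed

text \<open>Both realizations are identified with complexes by their coordinates, and the square
  with \<open>push w\<close> commutes; the homeomorphism on the target side is then
  cancelled.\<close>

lemma weak_equivalence:
  assumes "homotopy_equivalence (geo L) (geo L') (push w)"
  shows "weak_equivalence_sset X Y f"
proof -
  note hX = X.homeomorphic_realization and hY = Y.homeomorphic_realization
  have he: "homotopy_equivalence (realization X) (geo L') (push w \<circ> X.realization_coords)"
    by (rule homotopy_equivalence_compose[OF homeomorphic_imp_homotopy_equivalence[OF hX] assms])
  obtain r where r: "homeomorphic_maps (realization Y) (geo L') Y.realization_coords r"
    using hY homeomorphic_map_maps by blast
  have eq: "Y.realization_coords (realization_map Y f c) = push w (X.realization_coords c)"
    "realization_map Y f c \<in> topspace (realization Y)"
    if c: "c \<in> topspace (realization X)" for c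
  proof -
    obtain p where p: "p \<in> X.cells" "c = glue_rel X `` {p}" using c unfolding X.topspace_realization by blast
    show "Y.realization_coords (realization_map Y f c) = push w (X.realization_coords c)"
      unfolding p(2) realization_map_class[OF p(1)]
      by (simp add: X.realization_coords Y.realization_coords p(1) cell_map)
    show "realization_map Y f c \<in> topspace (realization Y)"
      unfolding p(2) realization_map_class[OF p(1)] Y.topspace_realization using cell_map(1)[OF p(1)] by blast
  qed
  have "continuous_map (realization X) (realization Y) (r \<circ> (push w \<circ> X.realization_coords))"
  proof (rule continuous_map_compose)
    show "continuous_map (realization X) (geo L') (push w \<circ> X.realization_coords)"
      using he by (simp add: homotopy_equivalence_def)
    show "continuous_map (geo L') (realization Y) r" using r by (simp add: homeomorphic_maps_def)
  qed
  then have "continuous_map (realization X) (realization Y) (realization_map Y f)"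
  proof (rule continuous_map_eq)
    fix c assume c: "c \<in> topspace (realization X)"
    have "r (Y.realization_coords (realization_map Y f c)) = realization_map Y f c"
      using r eq(2)[OF c] by (auto simp: homeomorphic_maps_def)
    then show "(r \<circ> (push w \<circ> X.realization_coords)) c = realization_map Y f c" by (simp add: eq(1)[OF c])
  qed
  then have "homotopy_equivalence (realization X) (realization Y) (realization_map Y f)"
    by (rule homotopy_equivalence_cancel[OF he homeomorphic_imp_homotopy_equivalence[OF hY]]) (simp add: eq)
  then show ?thesis
    unfolding weak_equivalence_sset_def using simplicial_map homotopy_equivalence_imp_weak by blast
qed

end

section \<open>From a coned complex to a wedge of spheres\<close>

subsection \<open>Elementary expansions\<close>

lemma Min_attained:
  assumes "finite R" "R \<noteq> {}"
  shows "\<exists>u\<in>R. Min (f ` R) = f u"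
proof -
  have "Min (f ` R) \<in> f ` R" using assms by (intro Min_in) auto
  then show ?thesis by auto
qed

lemma continuous_map_Min:
  assumes "finite R" "R \<noteq> {}" and "\<And>v. v \<in> R \<Longrightarrow> continuous_map X euclideanreal (\<lambda>t. f t v)"
  shows "continuous_map X euclideanreal (\<lambda>t. Min (f t ` R))"
  using assms
proof (induction R rule: finite_ne_induct)
  case (insert v R)
  have "Min (f t ` insert v R) = min (f t v) (Min (f t ` R))" for t
    using insert.hyps by simp
  then show ?case using insert by (simp add: continuous_map_real_min)
qed simp

text \<open>The new faces are those containing \<open>R\<close>; mass is moved from \<open>R\<close> to the vertex \<open>v\<close>.\<close>

lemma homotopy_equivalence_expansion:
  assumes L: "simplicial_complex L" and R: "R \<noteq> {}" "R \<subseteq> \<tau>" and v: "v \<in> \<tau>" "v \<notin> R"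
    and tau: "\<tau> \<in> L" and max: "\<And>A. A \<in> L \<Longrightarrow> R \<subseteq> A \<Longrightarrow> A \<subseteq> \<tau>"
  shows "homotopy_equivalence (geo {A \<in> L. \<not> R \<subseteq> A}) (geo L) (\<lambda>x. x)"
proof -
  let ?L0 = "{A \<in> L. \<not> R \<subseteq> A}"
  have ft: "finite \<tau>" and fR: "finite R" using simplicial_complexD(1)[OF L tau] R(2) finite_subset by auto
  define \<mu> where "\<mu> = (\<lambda>x::'a \<Rightarrow> real. Min (x ` R))"
  \<comment> \<open>The common mass \<open>\<mu>\<close> is taken from each vertex of
    \<open>R\<close> and given to \<open>v\<close>, which keeps the sum. Some vertex of
    \<open>R\<close> drops to 0, so the result lies in the smaller complex, and points already there
    have \<open>\<mu> = 0\<close> and are fixed.\<close>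
  define r where "r = (\<lambda>x u. x u - (if u \<in> R then \<mu> x else 0) + (if u = v then real (card R) * \<mu> x else 0))"
  have mu_le: "\<mu> x \<le> x u" if "u \<in> R" for x u using that fR by (simp add: \<mu>_def)
  have mu_in: "\<exists>u\<in>R. \<mu> x = x u" for x
    using Min_attained[OF fR R(1), of x] by (simp add: \<mu>_def)
  have mu0: "0 \<le> \<mu> x" if "x \<in> gpoints L" for x using mu_in[of x] gpointsD(1)[OF that] by auto
  have muR: "\<mu> x = 0" if x: "x \<in> gpoints L" "\<not> R \<subseteq> vsupp x" for x
  proof -
    obtain u where "u \<in> R" "x u = 0" using x(2) by (auto simp: vsupp_def)
    then show ?thesis using mu_le[of u x] mu0[OF x(1)] by simp
  qed
  have r0: "r x = x" if "\<mu> x = 0" for x using that by (auto simp: r_def fun_eq_iff)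
  have supp: "vsupp (r x) \<subseteq> \<tau> \<and> vsupp x \<subseteq> \<tau> \<and> r x \<in> gpoints ?L0" if x: "x \<in> gpoints L" "\<mu> x \<noteq> 0" for x
  proof -
    \<comment> \<open>Only points whose support contains \<open>R\<close> are moved. By
      \<open>max\<close> such a support is in \<open>\<tau>\<close>, which therefore contains the
      segment to \<open>r x\<close>.\<close>
    have "R \<subseteq> vsupp x" using muR[OF x(1)] x(2) by blast
    then have xt: "vsupp x \<subseteq> \<tau>" using max[OF gpointsD(2)[OF x(1)]] by blast
    have rt: "vsupp (r x) \<subseteq> \<tau>" using xt R(2) v by (auto simp: r_def vsupp_def split: if_splits)
    have "r x \<in> gpoints L"
    proof (rule gpointsI[OF L tau])
      show "0 \<le> r x u" for u
        using mu_le[of u x] mu0[OF x(1)] gpointsD(1)[OF x(1), of u] by (auto simp: r_def)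
      have "sum (r x) \<tau> = sum x \<tau> - (\<Sum>u\<in>\<tau>. if u \<in> R then \<mu> x else 0) + (\<Sum>u\<in>\<tau>. if u = v then real (card R) * \<mu> x else 0)"
        by (simp add: r_def sum.distrib sum_subtractf)
      also have "(\<Sum>u\<in>\<tau>. if u \<in> R then \<mu> x else 0) = real (card R) * \<mu> x"
        using ft R(2) by (simp add: Int_absorb1 flip: sum.inter_restrict)
      also have "(\<Sum>u\<in>\<tau>. if u = v then real (card R) * \<mu> x else 0) = real (card R) * \<mu> x"
        using ft v by simp
      finally show "sum (r x) \<tau> = 1" using gpoints_sum[OF x(1) ft xt] by simp
    qed (use rt in \<open>auto simp: vsupp_def\<close>)
    moreover obtain u where "u \<in> R" "\<mu> x = x u" using mu_in by blast
    then have "r x u = 0" using v by (auto simp: r_def)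
    ultimately show ?thesis using xt rt \<open>u \<in> R\<close> by (auto simp: gpoints_def vsupp_def)
  qed
  have rL0: "r x \<in> gpoints ?L0" if "x \<in> gpoints L" for x
  proof (cases "\<mu> x = 0")
    case True
    then have "\<not> R \<subseteq> vsupp x" using mu_in[of x] by (auto simp: vsupp_def)
    then show ?thesis using that r0[OF True] by (auto simp: gpoints_def)
  qed (use supp[OF that] in blast)
  have rc: "continuous_map (geo L) (geo ?L0) r"
    unfolding continuous_map_into_geo
  proof (intro conjI allI ballI)
    fix u
    have "continuous_map (geo L) euclideanreal \<mu>"
      unfolding \<mu>_def using fR R(1) by (intro continuous_map_Min continuous_map_geo_coord)
    then have "continuous_map (geo L) euclideanreal (\<lambda>x. if b then c * \<mu> x else 0)" for b c
      by (cases b) (auto intro: continuous_map_real_mult_left)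
    from continuous_map_add[OF continuous_map_diff[OF continuous_map_geo_coord this[of "u \<in> R" 1]] this[of "u = v" "real (card R)"]]
    show "continuous_map (geo L) euclideanreal (\<lambda>x. r x u)" by (simp add: r_def cong: if_cong)
  qed (use rL0 in auto)
  have inc: "continuous_map (geo ?L0) (geo L) (\<lambda>x. x)" by (rule continuous_map_geo_mono) auto
  have "homotopic_with (\<lambda>_. True) (geo L) (geo L) ((\<lambda>x. x) \<circ> r) id"
  proof (rule homotopic_with_geo_line[OF L])
    show "continuous_map (geo L) (geo L) ((\<lambda>x. x) \<circ> r)" using continuous_map_compose[OF rc inc] .
    fix x assume "x \<in> topspace (geo L)"
    then have x: "x \<in> gpoints L" by simp
    show "vsupp (((\<lambda>x. x) \<circ> r) x) \<union> vsupp (id x) \<in> L"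
    proof (cases "\<mu> x = 0")
      case True then show ?thesis using gpointsD(2)[OF x] by (simp add: r0)
    next
      case False
      then have "vsupp (r x) \<union> vsupp x \<subseteq> \<tau>" using supp[OF x] by blast
      then show ?thesis using simplicial_complexD(2)[OF L tau] by simp
    qed
  qed auto
  moreover have "homotopic_with (\<lambda>_. True) (geo ?L0) (geo ?L0) (r \<circ> (\<lambda>x. x)) id"
  proof (rule homotopic_with_equal)
    show "continuous_map (geo ?L0) (geo ?L0) (r \<circ> (\<lambda>x. x))" by (rule continuous_map_compose[OF inc rc])
    fix x assume "x \<in> topspace (geo ?L0)"
    then have "x \<in> gpoints L" "\<not> R \<subseteq> vsupp x" by (auto simp: gpoints_def)
    then show "(r \<circ> (\<lambda>x. x)) x = id x" using muR r0 by simp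
  qed auto
  ultimately show ?thesis unfolding homotopy_equivalence_def using inc rc by blast
qed

subsection \<open>Collapsing a contractible subspace\<close>

text \<open>The map \<open>c\<close> is constant on the fibres of \<open>q\<close> and so descends
  to a map back to \<open>X\<close>; the stages of the homotopy respect the fibres and so descend to
  \<open>Y\<close>. Continuity of what descends holds because \<open>q\<close> and its product with
  the interval are quotient maps, being closed maps from compact to Hausdorff spaces.\<close>

lemma homotopy_equivalence_collapse:
  assumes X: "compact_space X" and Y: "Hausdorff_space Y" and q: "continuous_map X Y q" and surj: "q ` topspace X = topspace Y"
    and hom: "homotopic_with (\<lambda>u. \<forall>x\<in>topspace X. \<forall>x'\<in>topspace X. q x = q x' \<longrightarrow> q (u x) = q (u x')) X X id c"
    and c: "\<And>x x'. x \<in> topspace X \<Longrightarrow> x' \<in> topspace X \<Longrightarrow> q x = q x' \<Longrightarrow> c x = c x'"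
  shows "homotopy_equivalence X Y q"
proof -
  let ?P = "\<lambda>u. \<forall>x\<in>topspace X. \<forall>x'\<in>topspace X. q x = q x' \<longrightarrow> q (u x) = q (u x')"
  obtain h where H: "continuous_map (prod_topology I01 X) X h \<and> (\<forall>x. h (0, x) = id x) \<and> (\<forall>x. h (1, x) = c x)
      \<and> (\<forall>s\<in>{0..1}. ?P (\<lambda>x. h (s, x)))"
    using hom unfolding homotopic_with_def by (rule exE)
  have h: "continuous_map (prod_topology I01 X) X h" "h (0, x) = x" "h (1, x) = c x" for x
    using H by simp_all
  have hq: "q (h (s, x)) = q (h (s, x'))" if "s \<in> {0..1}" "x \<in> topspace X" "x' \<in> topspace X" "q x = q x'" for s x x'
    using H that by blast
  define sec where "sec = (\<lambda>y. SOME x. x \<in> topspace X \<and> q x = y)"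
  have sec: "sec y \<in> topspace X" "q (sec y) = y" if "y \<in> topspace Y" for y
  proof -
    have "y \<in> q ` topspace X" using surj that by simp
    then have "\<exists>x. x \<in> topspace X \<and> q x = y" by blast
    then have "sec y \<in> topspace X \<and> q (sec y) = y" unfolding sec_def by (rule someI_ex)
    then show "sec y \<in> topspace X" "q (sec y) = y" by auto
  qed
  have qY: "q x \<in> topspace Y" if "x \<in> topspace X" for x using surj that by auto
  have qm: "quotient_map X Y q"
    using continuous_imp_closed_map[OF q X Y] q surj by (intro continuous_closed_imp_quotient_map) auto
  have idq: "continuous_map (prod_topology I01 X) (prod_topology I01 Y) (\<lambda>p. (fst p, q (snd p)))"
    by (intro continuous_map_pairedI continuous_map_fst continuous_map_snd'[OF q])
  have qm': "quotient_map (prod_topology I01 X) (prod_topology I01 Y) (\<lambda>p. (fst p, q (snd p)))"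
  proof (rule continuous_closed_imp_quotient_map[OF idq])
    have "compact_space (prod_topology I01 X)" using X by (simp add: compact_space_prod_topology compact_space_subtopology)
    moreover have "Hausdorff_space (prod_topology I01 Y)" using Y by (simp add: Hausdorff_space_prod_topology Hausdorff_space_subtopology)
    ultimately show "closed_map (prod_topology I01 X) (prod_topology I01 Y) (\<lambda>p. (fst p, q (snd p)))"
      using continuous_imp_closed_map[OF idq] by blast
    show "(\<lambda>p. (fst p, q (snd p))) ` topspace (prod_topology I01 X) = topspace (prod_topology I01 Y)"
      using surj by (force simp: image_iff)
  qed
  have cX: "continuous_map X X c" using homotopic_with_imp_continuous_maps[OF hom] by blast
  define r where "r = (\<lambda>y. c (sec y))"
  have rq: "r (q x) = c x" if "x \<in> topspace X" for x
    unfolding r_def using c[of "sec (q x)" x] sec[OF qY[OF that]] that by auto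
  have "continuous_map X X (r \<circ> q)" by (rule continuous_map_eq[OF cX]) (simp add: rq)
  then have r: "continuous_map Y X r" using continuous_compose_quotient_map[OF qm] by blast
  have hom': "homotopic_with (\<lambda>_. True) X X id c"
    by (rule homotopic_with_mono[OF hom]) auto
  have 1: "homotopic_with (\<lambda>_. True) X X (r \<circ> q) id"
    by (rule homotopic_with_eq[OF homotopic_with_symD[OF hom']]) (auto simp: rq)
  define g where "g = (\<lambda>p. q (h (fst p, sec (snd p))))"
  have "continuous_map (prod_topology I01 X) Y (g \<circ> (\<lambda>p. (fst p, q (snd p))))"
  proof (rule continuous_map_eq[OF continuous_map_compose'[OF h(1) q]])
    fix p assume "p \<in> topspace (prod_topology I01 X)"
    then show "q (h p) = (g \<circ> (\<lambda>p. (fst p, q (snd p)))) p"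
      using hq[of "fst p" "snd p" "sec (q (snd p))"] sec[OF qY] by (auto simp: g_def)
  qed
  then have "continuous_map (prod_topology I01 Y) Y g"
    using continuous_compose_quotient_map[OF qm'] by blast
  then have "homotopic_with (\<lambda>_. True) Y Y id (q \<circ> r)"
    by (subst homotopic_with) (auto simp: g_def h r_def sec intro!: exI[of _ g])
  then have 2: "homotopic_with (\<lambda>_. True) Y Y (q \<circ> r) id" by (rule homotopic_with_symD)
  show ?thesis unfolding homotopy_equivalence_def using q r 1 2 by blast
qed

subsection \<open>Collapsing the boundary of a simplex to get a sphere\<close>

text \<open>With \<open>\<mu>\<close> the minimum of the barycentric coordinates \<open>y\<^sub>j\<close>, this is inverse stereographic projection
  of the point \<open>((y\<^sub>j - y\<^sub>0) / \<mu>)\<^sub>j\<close>. The square of \<open>1 - \<Sum> y\<^sub>j\<close> only serves to make the denominator nonzero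
  off the simplex, where \<open>\<mu> = 0\<close>.\<close>

definition simplex_to_sphere :: "nat \<Rightarrow> (nat \<Rightarrow> real) \<Rightarrow> nat \<Rightarrow> real" where
  "simplex_to_sphere d y = (\<lambda>j.
     let \<mu> = Min (y ` {..d}); a = (\<Sum>j=1..d. (y j - y 0)\<^sup>2) + (1 - sum y {..d})\<^sup>2
     in if j = 0 then (a - \<mu>\<^sup>2) / (a + \<mu>\<^sup>2) else if j \<le> d then 2 * \<mu> * (y j - y 0) / (a + \<mu>\<^sup>2) else 0)"

context
  fixes d :: nat and y :: "nat \<Rightarrow> real" and \<mu> a b :: real
  assumes y0: "\<And>j. j \<le> d \<Longrightarrow> 0 \<le> y j"
  defines "\<mu> \<equiv> Min (y ` {..d})"
    and "b \<equiv> (\<Sum>j=1..d. (y j - y 0)\<^sup>2)"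
    and "a \<equiv> (\<Sum>j=1..d. (y j - y 0)\<^sup>2) + (1 - sum y {..d})\<^sup>2"
begin

lemma simplex_min: "0 \<le> \<mu>" "j \<le> d \<Longrightarrow> \<mu> \<le> y j" "\<exists>j\<le>d. \<mu> = y j"
proof -
  show ex: "\<exists>j\<le>d. \<mu> = y j" using Min_attained[of "{..d}" y] by (auto simp: \<mu>_def)
  then show "0 \<le> \<mu>" using y0 by auto
  show "j \<le> d \<Longrightarrow> \<mu> \<le> y j" by (simp add: \<mu>_def)
qed

text \<open>If the denominator vanished, all coordinates would equal \<open>y 0\<close> with minimum
  0, so they would all be 0, while the square added to \<open>a\<close> forces their sum to be
  1.\<close>

lemma simplex_denominator_pos: "a + \<mu>\<^sup>2 > 0"
proof -
  have nn: "(\<Sum>j=1..d. (y j - y 0)\<^sup>2) \<ge> 0" by (rule sum_nonneg) simp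
  have "a + \<mu>\<^sup>2 \<noteq> 0"
  proof
    assume "a + \<mu>\<^sup>2 = 0"
    then have *: "(\<Sum>j=1..d. (y j - y 0)\<^sup>2) = 0" "(1 - sum y {..d})\<^sup>2 = 0" "\<mu>\<^sup>2 = 0"
      using nn unfolding a_def by (smt (verit) zero_le_power2)+
    have "y j = y 0" if "j \<le> d" for j
      using *(1) that by (cases "j = 0") (auto simp: sum_nonneg_eq_0_iff)
    moreover have "\<mu> = 0" using *(3) by simp
    ultimately have "y j = 0" if "j \<le> d" for j using that simplex_min(3) by metis
    then have "sum y {..d} = 0" by simp
    then show False using *(2) by simp
  qed
  moreover have "a + \<mu>\<^sup>2 \<ge> 0" using nn by (simp add: a_def)
  ultimately show ?thesis by linarith
qed

lemma simplex_to_sphere_simps: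
  "simplex_to_sphere d y 0 = (a - \<mu>\<^sup>2) / (a + \<mu>\<^sup>2)"
  "1 \<le> j \<Longrightarrow> j \<le> d \<Longrightarrow> simplex_to_sphere d y j = 2 * \<mu> * (y j - y 0) / (a + \<mu>\<^sup>2)"
  "j > d \<Longrightarrow> simplex_to_sphere d y j = 0"
  by (auto simp: simplex_to_sphere_def Let_def a_def \<mu>_def)

lemma simplex_to_sphere_base:
  assumes "\<mu> = 0"
  shows "simplex_to_sphere d y = sphere_base"
proof
  fix j
  have "a \<noteq> 0" using simplex_denominator_pos assms by simp
  then show "simplex_to_sphere d y j = sphere_base j"
    using simplex_to_sphere_simps(1) simplex_to_sphere_simps(2,3)[of j] assms
    by (cases "j = 0"; cases "j \<le> d") (auto simp: sphere_base_def)
qed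

lemma simplex_to_sphere_in:
  assumes "\<mu> \<noteq> 0 \<Longrightarrow> sum y {..d} = 1"
  shows "simplex_to_sphere d y \<in> topspace (nsphere d)"
proof (cases "\<mu> = 0")
  case True then show ?thesis by (simp add: simplex_to_sphere_base sphere_base_in')
next
  case False
  let ?D = "a + \<mu>\<^sup>2"
  have a: "a = (\<Sum>j=1..d. (y j - y 0)\<^sup>2)" using assms[OF False] by (simp add: a_def)
  have "(\<Sum>j=1..d. (simplex_to_sphere d y j)\<^sup>2) = (\<Sum>j=1..d. 4 * \<mu>\<^sup>2 / ?D\<^sup>2 * (y j - y 0)\<^sup>2)"
    by (intro sum.cong) (auto simp: simplex_to_sphere_simps power_mult_distrib power_divide)
  also have "\<dots> = 4 * \<mu>\<^sup>2 / ?D\<^sup>2 * a" by (simp only: a flip: sum_distrib_left)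
  also have "\<dots> = 1 - ((a - \<mu>\<^sup>2) / ?D)\<^sup>2"
    using simplex_denominator_pos by (simp add: power_divide divide_simps) (simp add: power2_eq_square algebra_simps)
  finally show ?thesis by (simp add: in_nsphere_0 simplex_to_sphere_simps)
qed

text \<open>Stereographic projection from the base point recovers the plane coordinates; their
  formula is the key to injectivity.\<close>

lemma simplex_to_sphere_less:
  assumes "\<mu> \<noteq> 0"
  shows "1 - simplex_to_sphere d y 0 = 2 * \<mu>\<^sup>2 / (a + \<mu>\<^sup>2)" "simplex_to_sphere d y 0 < 1"
    "1 \<le> j \<Longrightarrow> j \<le> d \<Longrightarrow> simplex_to_sphere d y j / (1 - simplex_to_sphere d y 0) = (y j - y 0) / \<mu>"
proof -
  show *: "1 - simplex_to_sphere d y 0 = 2 * \<mu>\<^sup>2 / (a + \<mu>\<^sup>2)"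
    using simplex_denominator_pos by (simp add: simplex_to_sphere_simps divide_simps)
  have "2 * \<mu>\<^sup>2 / (a + \<mu>\<^sup>2) > 0" using simplex_denominator_pos assms by simp
  then show "simplex_to_sphere d y 0 < 1" using * by linarith
  show "simplex_to_sphere d y j / (1 - simplex_to_sphere d y 0) = (y j - y 0) / \<mu>" if "1 \<le> j" "j \<le> d"
    unfolding * simplex_to_sphere_simps(2)[OF that] using simplex_denominator_pos assms
    by (simp add: divide_simps power2_eq_square)
qed

end

text \<open>The plane coordinates determine the differences of the numbers
  \<open>y j / \<mu>\<close>. The least of these numbers is 1, which determines all of them, and the
  sum condition then determines \<open>\<mu>\<close>.\<close>

lemma simplex_to_sphere_inj:
  assumes y: "\<And>j. j \<le> d \<Longrightarrow> 0 < y j" "sum y {..d} = 1" and y': "\<And>j. j \<le> d \<Longrightarrow> 0 < y' j" "sum y' {..d} = 1"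
    and eq: "simplex_to_sphere d y = simplex_to_sphere d y'" and j: "j \<le> d"
  shows "y j = y' j"
proof -
  define m where "m = Min (y ` {..d})"
  define m' where "m' = Min (y' ` {..d})"
  have m: "m > 0" "m' > 0" unfolding m_def m'_def using y y' by (auto simp: Min_gr_iff)
  have mn: "Min (y ` {..d}) \<noteq> 0" "Min (y' ` {..d}) \<noteq> 0" using m unfolding m_def m'_def by linarith+
  have *: "(y i - y 0) / m = (y' i - y' 0) / m'" if "i \<le> d" for i
  proof (cases "i = 0")
    case False
    have "simplex_to_sphere d y i / (1 - simplex_to_sphere d y 0) = (y i - y 0) / m"
      unfolding m_def using simplex_to_sphere_less(3)[of d y i] less_imp_le[OF y(1)] mn(1) False that by simp
    moreover have "simplex_to_sphere d y' i / (1 - simplex_to_sphere d y' 0) = (y' i - y' 0) / m'"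
      unfolding m'_def using simplex_to_sphere_less(3)[of d y' i] less_imp_le[OF y'(1)] mn(2) False that by simp
    ultimately show ?thesis using eq by simp
  qed simp
  have le: "y 0 / m \<le> y' 0 / m'" if m: "m > 0" "m' > 0" and *: "\<And>i. i \<le> d \<Longrightarrow> (y i - y 0) / m = (y' i - y' 0) / m'"
    and "m = Min (y ` {..d})" "m' = Min (y' ` {..d})"
    for y y' :: "nat \<Rightarrow> real" and m m' :: real
  proof -
    obtain i where i: "i \<le> d" "m = y i" using Min_attained[of "{..d}" y] \<open>m = Min _\<close> by auto
    have "m' \<le> y' i" using i(1) \<open>m' = Min _\<close> by simp
    then have "1 \<le> y' i / m'" using m by simp
    moreover have "1 - y 0 / m = y' i / m' - y' 0 / m'" using *[OF i(1)] i(2) m by (simp add: diff_divide_distrib)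
    ultimately show ?thesis by linarith
  qed
  have "y 0 / m = y' 0 / m'"
    using le[OF m * m_def m'_def] le[OF m(2,1) *[symmetric] m'_def m_def] by linarith
  then have r: "y i / m = y' i / m'" if "i \<le> d" for i using *[OF that] by (simp add: diff_divide_distrib)
  have "sum y {..d} / m = sum y' {..d} / m'" unfolding sum_divide_distrib using r by (intro sum.cong) auto
  then have "m = m'" using y(2) y'(2) m by (simp add: field_simps)
  then show ?thesis using r[OF j] m by simp
qed

text \<open>\<open>w\<close> consists of the stereographic coordinates of \<open>z\<close>, with 0
  in place 0. Adding \<open>1 - M\<close> makes the minimum 1, and dividing by the sum
  \<open>S\<close> gives a point of the open simplex with minimal coordinate
  \<open>1 / S\<close>.\<close>

lemma simplex_to_sphere_surj:
  assumes z: "z \<in> topspace (nsphere d)" "z \<noteq> sphere_base"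
  obtains y where "\<And>j. j \<le> d \<Longrightarrow> 0 < y j" "sum y {..d} = 1" "simplex_to_sphere d y = z"
proof -
  have s: "(\<Sum>i=1..d. (z i)\<^sup>2) = 1 - (z 0)\<^sup>2" and z_out: "\<And>i. i > d \<Longrightarrow> z i = 0" using z(1) by (auto simp: in_nsphere_0)
  have "z 0 \<noteq> 1"
  proof
    assume 1: "z 0 = 1"
    then have "z i = 0" if "i \<in> {1..d}" for i using s that by (simp add: sum_nonneg_eq_0_iff)
    then have "z = sphere_base" using z_out 1 by (auto simp: sphere_base_def fun_eq_iff) (metis One_nat_def Suc_leI atLeastAtMost_iff not_le not_gr_zero)
    then show False using z(2) by simp
  qed
  then have z0: "1 - z 0 > 0" using nsphere_coord_le[OF z(1), of 0] by auto
  define w where "w = (\<lambda>j. if j = 0 then 0 else z j / (1 - z 0))"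
  define M where "M = Min (w ` {..d})"
  define u where "u = (\<lambda>j. w j + 1 - M)"
  define S where "S = sum u {..d}"
  have M: "M \<le> w j" if "j \<le> d" for j using that by (simp add: M_def)
  obtain i where i: "i \<le> d" "M = w i" using Min_attained[of "{..d}" w] by (auto simp: M_def)
  have u1: "1 \<le> u j" if "j \<le> d" for j using M[OF that] by (simp add: u_def)
  have "u 0 \<le> S" unfolding S_def using u1 by (intro member_le_sum) (auto intro: order_trans[OF zero_le_one])
  then have S: "S > 0" using u1[of 0] by simp
  define y where "y = (\<lambda>j. u j / S)"
  have ypos: "0 < y j" if "j \<le> d" for j using u1[OF that] S by (simp add: y_def)
  have ysum: "sum y {..d} = 1" using S by (simp add: y_def S_def flip: sum_divide_distrib)
  have mu: "Min (y ` {..d}) = 1 / S"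
  proof (rule Min_eqI)
    show "1 / S \<in> y ` {..d}" using i by (auto simp: y_def u_def image_iff intro!: bexI[of _ i])
    fix t assume "t \<in> y ` {..d}"
    then show "1 / S \<le> t" using u1 S by (auto simp: y_def divide_right_mono)
  qed simp
  have diff: "y j - y 0 = w j / S" for j by (simp add: y_def u_def w_def diff_divide_distrib[symmetric])
  have "(\<Sum>j=1..d. (y j - y 0)\<^sup>2) = (\<Sum>j=1..d. (z j)\<^sup>2 / ((1 - z 0)\<^sup>2 * S\<^sup>2))"
    unfolding diff by (intro sum.cong) (auto simp: w_def power_divide power_mult_distrib)
  also have "\<dots> = (1 - (z 0)\<^sup>2) / ((1 - z 0)\<^sup>2 * S\<^sup>2)" by (simp only: s flip: sum_divide_distrib)
  also have "\<dots> = (1 + z 0) / (1 - z 0) / S\<^sup>2"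
    using z0 by (simp add: divide_simps) (simp add: power2_eq_square algebra_simps)
  finally have a: "(\<Sum>j=1..d. (y j - y 0)\<^sup>2) + (1 - sum y {..d})\<^sup>2 = (1 + z 0) / (1 - z 0) / S\<^sup>2"
    by (simp add: ysum)
  have D: "(1 + z 0) / (1 - z 0) / S\<^sup>2 + (1 / S)\<^sup>2 = 2 / ((1 - z 0) * S\<^sup>2)"
    using z0 S by (simp add: divide_simps)
  have "simplex_to_sphere d y j = z j" for j
  proof -
    consider "j = 0" | "1 \<le> j" "j \<le> d" | "j > d" by linarith
    then show ?thesis
    proof cases
      case 1
      then show ?thesis using z0 S
        unfolding simplex_to_sphere_def Let_def mu a D by (simp add: divide_simps)
    next
      case 2
      then show ?thesis using z0 S
        unfolding simplex_to_sphere_def Let_def mu a D unfolding diff by (simp add: w_def divide_simps power2_eq_square)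
    next
      case 3
      then show ?thesis using z_out by (simp add: simplex_to_sphere_def Let_def)
    qed
  qed
  then show thesis using that[OF ypos ysum] by blast
qed

subsection \<open>Wedges of spheres\<close>

definition wedge_class :: "nat \<Rightarrow> nat \<Rightarrow> (nat \<Rightarrow> real) \<Rightarrow> (nat \<times> (nat \<Rightarrow> real)) set" where
  "wedge_class m i z = wedge_rel m sphere_base `` {(i, z)}"

lemma wedge_class_base: "i < m \<Longrightarrow> wedge_class m i sphere_base = wedge_class m 0 sphere_base"
  by (auto simp: wedge_class_def wedge_rel_def)

lemma wedge_class_eq_iff:
  assumes "z \<noteq> sphere_base"
  shows "wedge_class m i z = wedge_class m i' z' \<longleftrightarrow> i = i' \<and> z = z'"
  using assms by (auto simp: wedge_class_def wedge_rel_def)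

lemma wedge_saturated:
  "wedge_rel m sphere_base `` topspace (sum_topology (\<lambda>_. nsphere d) {..<m}) \<subseteq> topspace (sum_topology (\<lambda>_. nsphere d) {..<m})"
  using sphere_base_in' by (auto simp: wedge_rel_def)

lemma wedge_quotient:
  assumes "m > 0"
  shows "quotient_map (sum_topology (\<lambda>_. nsphere d) {..<m}) (wedge_space m (unit_sphere (Suc d)) sphere_base)
     (\<lambda>p. wedge_class m (fst p) (snd p))"
  using quotient_map_quotient_space[OF equiv_wedge_rel wedge_saturated] assms
  by (simp add: wedge_space_def unit_sphere_Suc wedge_class_def)

text \<open>The inserted class accounts for the empty wedge, where it is the only point.\<close>

lemma topspace_wedge:
  "topspace (wedge_space m (unit_sphere (Suc d)) sphere_base) =
     insert (wedge_class m 0 sphere_base) ((\<lambda>(i, z). wedge_class m i z) ` ({..<m} \<times> topspace (nsphere d)))"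
proof (cases "m = 0")
  case True
  then show ?thesis by (auto simp: wedge_space_def wedge_class_def wedge_rel_def)
next
  case False
  let ?A = "{..<m} \<times> topspace (nsphere d)"
  have "(0, sphere_base) \<in> ?A" using False sphere_base_in' by simp
  then have "wedge_class m 0 sphere_base \<in> (\<lambda>(i, z). wedge_class m i z) ` ?A" by force
  moreover have "(\<lambda>(i, z). wedge_class m i z) ` ?A = topspace (wedge_space m (unit_sphere (Suc d)) sphere_base)"
    using quotient_imp_surjective_map[OF wedge_quotient[of m d]] False by (simp add: case_prod_unfold o_def)
  ultimately show ?thesis by (metis insert_absorb)
qed

lemma continuous_map_wedge_class:
  assumes "i < m"
  shows "continuous_map (nsphere d) (wedge_space m (unit_sphere (Suc d)) sphere_base) (wedge_class m i)"
proof -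
  have "continuous_map (nsphere d) (sum_topology (\<lambda>_. nsphere d) {..<m}) (\<lambda>z. (i, z))"
    using continuous_map_into_sum_topology[of i "{..<m}" "\<lambda>_. nsphere d"] assms by simp
  from continuous_map_compose'[OF this quotient_imp_continuous_map[OF wedge_quotient]] assms
  show ?thesis by simp
qed

lemma Hausdorff_separated:
  assumes "\<And>x y. x \<in> topspace X \<Longrightarrow> y \<in> topspace X \<Longrightarrow> x \<noteq> y \<Longrightarrow> \<exists>f. continuous_map X euclideanreal f \<and> f x \<noteq> f y"
  shows "Hausdorff_space X"
  unfolding Hausdorff_space_def
proof (intro allI impI)
  fix x y assume xy: "x \<in> topspace X \<and> y \<in> topspace X \<and> x \<noteq> y"
  then obtain f where f: "continuous_map X euclideanreal f" "f x \<noteq> f y" using assms by blast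
  obtain U V where UV: "open U" "open V" "f x \<in> U" "f y \<in> V" "U \<inter> V = {}" using hausdorff[OF f(2)] by blast
  show "\<exists>U V. openin X U \<and> openin X V \<and> x \<in> U \<and> y \<in> V \<and> disjnt U V"
  proof (intro exI conjI)
    show "openin X {t \<in> topspace X. f t \<in> U}" "openin X {t \<in> topspace X. f t \<in> V}"
      using UV by (auto intro!: openin_continuous_map_preimage[OF f(1)])
  qed (use xy UV in \<open>auto simp: disjnt_iff\<close>)
qed

text \<open>Points are separated by real functions: the j-th coordinate on copy \<open>i\<close>,
  normalized to vanish at the base point and extended by 0 to the other copies.\<close>

lemma Hausdorff_wedge: "Hausdorff_space (wedge_space m (unit_sphere (Suc d)) sphere_base)"
proof (cases "m = 0")
  case True then show ?thesis by (simp add: wedge_space_def Hausdorff_space_discrete_topology)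
next
  case False
  then have m: "m > 0" by simp
  let ?W = "wedge_space m (unit_sphere (Suc d)) sphere_base"
  define G where "G = (\<lambda>(i::nat) j (p :: nat \<times> (nat \<Rightarrow> real)). if fst p = i then snd p j - sphere_base j else 0)"
  define g where "g = (\<lambda>i j c. G i j (SOME p. p \<in> c))"
  have g: "g i j (wedge_class m i' z) = G i j (i', z)" for i j i' z
  proof -
    have "(i', z) \<in> wedge_class m i' z" by (simp add: wedge_class_def wedge_rel_def)
    then have "(SOME p. p \<in> wedge_class m i' z) \<in> wedge_class m i' z" by (rule someI)
    then show ?thesis by (auto simp: g_def G_def wedge_class_def wedge_rel_def)
  qed
  have cg: "continuous_map ?W euclideanreal (g i j)" for i j
  proof -
    have "continuous_map (sum_topology (\<lambda>_. nsphere d) {..<m}) euclideanreal (g i j \<circ> (\<lambda>p. wedge_class m (fst p) (snd p)))"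
    proof (rule continuous_map_from_sum_topology)
      fix i' assume "i' \<in> {..<m}"
      show "continuous_map (nsphere d) euclideanreal (\<lambda>z. (g i j \<circ> (\<lambda>p. wedge_class m (fst p) (snd p))) (i', z))"
        by (cases "i' = i") (simp_all add: g G_def continuous_map_diff continuous_map_nsphere_projection)
    qed
    then show ?thesis using continuous_compose_quotient_map[OF wedge_quotient[OF m]] by blast
  qed
  show ?thesis
  proof (rule Hausdorff_separated)
    fix c c' assume c: "c \<in> topspace ?W" "c' \<in> topspace ?W" "c \<noteq> c'"
    have "\<exists>i<m. \<exists>z\<in>topspace (nsphere d). c = wedge_class m i z" if "c \<in> topspace ?W" for c
      using that m sphere_base_in'[of d] unfolding topspace_wedge by auto
    then obtain i z i' z' where z: "i < m" "c = wedge_class m i z" "i' < m" "c' = wedge_class m i' z'"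
      using c by metis
    have "\<exists>k j. G k j (i, z) \<noteq> G k j (i', z')"
    proof (rule ccontr)
      assume "\<not> ?thesis"
      then have *: "G k j (i, z) = G k j (i', z')" for k j by blast
      show False
      proof (cases "i = i'")
        case True
        then have "z j = z' j" for j using *[of i j] by (simp add: G_def)
        then have "z = z'" by blast
        then show False using c(3) z True by simp
      next
        case False
        then have "z j = sphere_base j" "z' j = sphere_base j" for j using *[of i j] *[of i' j] by (simp_all add: G_def)
        then have "z = sphere_base" "z' = sphere_base" by blast+
        then show False using c(3) z wedge_class_base by metis
      qed
    qed
    then show "\<exists>f. continuous_map ?W euclideanreal f \<and> f c \<noteq> f c'"
      using cg g z by metis
  qed
qed

subsection \<open>Attaching simplices to a cone\<close>

text \<open>A cone with apex 0 over a complex \<open>K\<close>, together with \<open>m\<close> simplices of dimension \<open>d\<close> whose boundaries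
  lie in \<open>K\<close>; \<open>en i\<close> enumerates the vertices of the i-th one.\<close>

locale coned_complex =
  fixes K :: "nat set set" and en :: "nat \<Rightarrow> nat \<Rightarrow> nat" and m d :: nat
  assumes K: "simplicial_complex K" "{} \<in> K" "0 \<notin> \<Union>K"
    and en_inj: "\<And>i. i < m \<Longrightarrow> inj_on (en i) {..d}"
    and en_nz: "\<And>i j. i < m \<Longrightarrow> j \<le> d \<Longrightarrow> en i j \<noteq> 0"
    and bdry: "\<And>i A. i < m \<Longrightarrow> A \<subset> en i ` {..d} \<Longrightarrow> A \<in> K"
    and cells: "\<And>i. i < m \<Longrightarrow> en i ` {..d} \<notin> K"
    and distinct: "\<And>i i'. i < m \<Longrightarrow> i' < m \<Longrightarrow> en i ` {..d} = en i' ` {..d} \<Longrightarrow> i = i'"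
begin

definition L :: "nat set set" where
  "L = {A. A - {0} \<in> K \<or> (\<exists>i<m. A = en i ` {..d})}"

abbreviation (input) cell :: "nat \<Rightarrow> nat set" where "cell i \<equiv> en i ` {..d}"

definition mu :: "nat \<Rightarrow> (nat \<Rightarrow> real) \<Rightarrow> real" where
  "mu i x = Min ((\<lambda>j. x (en i j)) ` {..d})"

lemma simplicial_complex_L: "simplicial_complex L"
  unfolding simplicial_complex_def
proof (intro conjI ballI allI impI)
  have "\<Union>L \<subseteq> insert 0 (\<Union>K) \<union> (\<Union>i<m. cell i)" by (auto simp: L_def)
  moreover have "finite \<dots>" using K(1) by (auto simp: simplicial_complex_def)
  ultimately show "finite (\<Union>L)" by (rule finite_subset)
  fix A B assume AB: "A \<in> L" "B \<subseteq> A"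
  show "B \<in> L"
  proof (cases "A - {0} \<in> K")
    case True
    then show ?thesis using simplicial_complexD(2)[OF K(1) True, of "B - {0}"] AB(2) by (auto simp: L_def)
  next
    case False
    then obtain i where i: "i < m" "A = cell i" using AB(1) by (auto simp: L_def)
    show ?thesis
    proof (cases "B = A")
      case False
      then have "B \<in> K" using bdry i AB(2) by blast
      then have "B - {0} \<in> K" by (rule simplicial_complexD(2)[OF K(1)]) auto
      then show ?thesis by (simp add: L_def)
    qed (use AB in simp)
  qed
qed

lemma mu_le: "j \<le> d \<Longrightarrow> mu i x \<le> x (en i j)"
  by (simp add: mu_def)

lemma mu_attained: "\<exists>j\<le>d. mu i x = x (en i j)"
  using Min_attained[of "{..d}" "\<lambda>j. x (en i j)"] by (auto simp: mu_def)

lemma mu_nonneg: "x \<in> gpoints L' \<Longrightarrow> 0 \<le> mu i x"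
  using mu_attained[of i x] gpointsD(1) by fastforce

lemma mu_zero_iff:
  assumes "x \<in> gpoints L'"
  shows "mu i x = 0 \<longleftrightarrow> \<not> cell i \<subseteq> vsupp x"
proof
  assume "mu i x = 0"
  then show "\<not> cell i \<subseteq> vsupp x" using mu_attained[of i x] by (force simp: vsupp_def)
next
  assume "\<not> cell i \<subseteq> vsupp x"
  then obtain j where "j \<le> d" "x (en i j) = 0" by (auto simp: vsupp_def)
  then show "mu i x = 0" using mu_le[of j i x] mu_nonneg[OF assms, of i] by simp
qed

text \<open>The attached cells are maximal faces: they avoid the apex, are not in \<open>K\<close>,
  and cannot be proper faces of another cell, whose boundary is in \<open>K\<close>.\<close>

lemma supp_of_mu:
  assumes x: "x \<in> gpoints L" and i: "i < m" "mu i x \<noteq> 0"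
  shows "vsupp x = cell i"
proof -
  have sub: "cell i \<subseteq> vsupp x" using mu_zero_iff[OF x] i(2) by blast
  have "vsupp x - {0} \<notin> K"
  proof
    assume "vsupp x - {0} \<in> K"
    moreover have "cell i \<subseteq> vsupp x - {0}" using sub en_nz[OF i(1)] by force
    ultimately show False using simplicial_complexD(2)[OF K(1)] cells[OF i(1)] by blast
  qed
  then obtain i' where i': "i' < m" "vsupp x = cell i'" using gpointsD(2)[OF x] by (auto simp: L_def)
  have "cell i = cell i'"
  proof (rule ccontr)
    assume "cell i \<noteq> cell i'"
    then have "cell i \<in> K" using bdry[OF i'(1)] sub i'(2) by blast
    then show False using cells[OF i(1)] by simp
  qed
  then show ?thesis using i' by simp
qed

lemma mu_unique: "x \<in> gpoints L \<Longrightarrow> i < m \<Longrightarrow> i' < m \<Longrightarrow> mu i x \<noteq> 0 \<Longrightarrow> mu i' x \<noteq> 0 \<Longrightarrow> i = i'"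
  using supp_of_mu distinct by metis

definition cone :: "(nat \<Rightarrow> real) set" where
  "cone = {x \<in> gpoints L. \<forall>i<m. mu i x = 0}"

lemma cone_iff: "x \<in> gpoints L \<Longrightarrow> x \<in> cone \<longleftrightarrow> vsupp x - {0} \<in> K"
proof
  assume x: "x \<in> gpoints L" "x \<in> cone"
  show "vsupp x - {0} \<in> K"
  proof (rule ccontr)
    assume "vsupp x - {0} \<notin> K"
    then obtain i where "i < m" "vsupp x = cell i" using gpointsD(2)[OF x(1)] by (auto simp: L_def)
    then show False using x(2) mu_zero_iff[OF x(1), of i] by (auto simp: cone_def)
  qed
next
  assume x: "x \<in> gpoints L" "vsupp x - {0} \<in> K"
  have "mu i x = 0" if "i < m" for i
  proof (rule ccontr)
    assume "mu i x \<noteq> 0"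
    then have "vsupp x = cell i" using supp_of_mu[OF x(1) that] by simp
    moreover have "cell i - {0} = cell i" using en_nz[OF that] by force
    ultimately show False using x(2) cells[OF that] by simp
  qed
  then show "x \<in> cone" using x(1) by (simp add: cone_def)
qed

lemma continuous_map_mu: "continuous_map (geo L) euclideanreal (mu i)"
  unfolding mu_def by (intro continuous_map_Min continuous_map_geo_coord) auto

definition to_sphere :: "nat \<Rightarrow> (nat \<Rightarrow> real) \<Rightarrow> nat \<Rightarrow> real" where
  "to_sphere i x = simplex_to_sphere d (\<lambda>j. x (en i j))"

lemma cell_sum:
  assumes x: "x \<in> gpoints L" and i: "i < m" "mu i x \<noteq> 0"
  shows "(\<Sum>j\<le>d. x (en i j)) = 1"
proof -
  have "(\<Sum>j\<le>d. x (en i j)) = sum x (cell i)"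
    using sum.reindex[OF en_inj[OF i(1)], of x] by simp
  then show ?thesis using gpoints_sum[OF x, of "cell i"] supp_of_mu[OF assms] by simp
qed

lemma to_sphere_in: "x \<in> gpoints L \<Longrightarrow> i < m \<Longrightarrow> to_sphere i x \<in> topspace (nsphere d)"
  unfolding to_sphere_def using gpointsD(1) cell_sum
  by (intro simplex_to_sphere_in) (auto simp: mu_def)

lemma to_sphere_base: "x \<in> gpoints L \<Longrightarrow> mu i x = 0 \<Longrightarrow> to_sphere i x = sphere_base"
  unfolding to_sphere_def by (intro simplex_to_sphere_base) (auto simp: gpointsD mu_def)

lemma to_sphere_not_base:
  assumes "x \<in> gpoints L" "mu i x \<noteq> 0"
  shows "to_sphere i x \<noteq> sphere_base"
proof -
  have "to_sphere i x 0 < 1"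
    unfolding to_sphere_def using assms gpointsD(1)[OF assms(1)]
    by (intro simplex_to_sphere_less(2)) (auto simp: mu_def)
  then show ?thesis by (auto simp: sphere_base_def)
qed

lemma continuous_map_to_sphere:
  assumes "i < m"
  shows "continuous_map (geo L) (nsphere d) (to_sphere i)"
  unfolding continuous_map_nsphere_iff
proof (intro conjI allI ballI)
  fix j
  define a where "a = (\<lambda>x :: nat \<Rightarrow> real. (\<Sum>j=1..d. (x (en i j) - x (en i 0))\<^sup>2) + (1 - (\<Sum>j\<le>d. x (en i j)))\<^sup>2)"
  have ca: "continuous_map (geo L) euclideanreal a"
    unfolding a_def by (intro continuous_intros) auto
  have D: "a x + (mu i x)\<^sup>2 \<noteq> 0" if "x \<in> topspace (geo L)" for x
    using simplex_denominator_pos[of d "\<lambda>j. x (en i j)"] gpointsD(1)[of x L] that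
    unfolding a_def mu_def by fastforce
  have "to_sphere i x j = (if j = 0 then (a x - (mu i x)\<^sup>2) / (a x + (mu i x)\<^sup>2)
      else if j \<le> d then 2 * mu i x * (x (en i j) - x (en i 0)) / (a x + (mu i x)\<^sup>2) else 0)" for x
    by (simp add: to_sphere_def simplex_to_sphere_def Let_def a_def mu_def)
  moreover have "continuous_map (geo L) euclideanreal (\<lambda>x. (a x - (mu i x)\<^sup>2) / (a x + (mu i x)\<^sup>2))"
    "continuous_map (geo L) euclideanreal (\<lambda>x. 2 * mu i x * (x (en i j) - x (en i 0)) / (a x + (mu i x)\<^sup>2))"
    using D by (intro continuous_intros ca continuous_map_mu; simp)+
  ultimately show "continuous_map (geo L) euclideanreal (\<lambda>x. to_sphere i x j)"
    by (cases "j = 0"; cases "j \<le> d") simp_all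
qed (use to_sphere_in assms in auto)

definition index :: "(nat \<Rightarrow> real) \<Rightarrow> nat" where
  "index x = (SOME i. i < m \<and> mu i x \<noteq> 0)"

definition to_wedge :: "(nat \<Rightarrow> real) \<Rightarrow> (nat \<times> (nat \<Rightarrow> real)) set" where
  "to_wedge x = (if \<forall>i<m. mu i x = 0 then wedge_class m 0 sphere_base else wedge_class m (index x) (to_sphere (index x) x))"

lemma to_wedge_cone: "x \<in> cone \<Longrightarrow> to_wedge x = wedge_class m 0 sphere_base"
  by (simp add: to_wedge_def cone_def)

lemma to_wedge_cell:
  assumes x: "x \<in> gpoints L" and i: "i < m" "mu i x \<noteq> 0"
  shows "to_wedge x = wedge_class m i (to_sphere i x)"
proof -
  have "\<exists>i. i < m \<and> mu i x \<noteq> 0" using i by blast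
  then have "index x < m \<and> mu (index x) x \<noteq> 0" unfolding index_def by (rule someI_ex)
  then have "index x = i" using mu_unique[OF x] i by blast
  then show ?thesis using i by (auto simp: to_wedge_def)
qed

text \<open>The only fibre with more than one point can be the cone: on an open cell
  \<open>to_sphere\<close> is injective and avoids the base point, and different cells go to
  different copies.\<close>

lemma to_wedge_eq_iff:
  assumes x: "x \<in> gpoints L" "x' \<in> gpoints L" and eq: "to_wedge x = to_wedge x'"
  shows "x = x' \<or> x \<in> cone \<and> x' \<in> cone"
proof (cases "x \<in> cone \<and> x' \<in> cone")
  case False
  have *: "x = x'" if x: "x \<in> gpoints L" "x' \<in> gpoints L" and eq: "to_wedge x = to_wedge x'" and n: "x \<notin> cone" for x x'
  proof -
    obtain i where i: "i < m" "mu i x \<noteq> 0" using n x(1) by (auto simp: cone_def)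
    note w = to_wedge_cell[OF x(1) i] and nb = to_sphere_not_base[OF x(1) i(2)]
    have "x' \<notin> cone"
    proof
      assume "x' \<in> cone"
      then have "wedge_class m i (to_sphere i x) = wedge_class m 0 sphere_base"
        using w eq to_wedge_cone by simp
      then show False using wedge_class_eq_iff[OF nb] nb by blast
    qed
    then obtain i' where i': "i' < m" "mu i' x' \<noteq> 0" using x(2) by (auto simp: cone_def)
    have "wedge_class m i (to_sphere i x) = wedge_class m i' (to_sphere i' x')"
      using w eq to_wedge_cell[OF x(2) i'] by simp
    then have e: "i = i'" "to_sphere i x = to_sphere i' x'" using wedge_class_eq_iff[OF nb] by auto
    have pos: "0 < x (en i j)" "0 < x' (en i j)" if "j \<le> d" for j
      using mu_le[OF that, of i x] mu_le[OF that, of i x'] mu_nonneg[OF x(1), of i] mu_nonneg[OF x(2), of i]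
        i(2) i'(2) e(1) by auto
    have in_cell: "x (en i j) = x' (en i j)" if "j \<le> d" for j
      using simplex_to_sphere_inj[of d "\<lambda>j. x (en i j)" "\<lambda>j. x' (en i j)", OF pos(1) _ pos(2) _ _ that]
        cell_sum[OF x(1) i] cell_sum[OF x(2) i'] e by (simp add: to_sphere_def)
    show "x = x'"
    proof
      fix v
      have "vsupp x = cell i" "vsupp x' = cell i"
        using supp_of_mu[OF x(1) i] supp_of_mu[OF x(2) i'] e(1) by auto
      then have "v \<notin> cell i \<Longrightarrow> x v = 0 \<and> x' v = 0" by (metis in_vsupp)
      then show "x v = x' v" using in_cell by (cases "v \<in> cell i") auto
    qed
  qed
  show ?thesis using *[OF x eq] *[OF x(2,1) eq[symmetric]] False by blast
qed simp

text \<open>The pieces are the cone together with one cell each. The extra index \<open>m\<close>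
  stands for the cone alone and provides a cover even if there are no cells.\<close>

lemma continuous_map_to_wedge:
  "continuous_map (geo L) (wedge_space m (unit_sphere (Suc d)) sphere_base) to_wedge"
proof (rule pasting_lemma_closed[where I = "{..m}"
      and T = "\<lambda>i. {x \<in> gpoints L. \<forall>i'\<in>{..<m} - {i}. mu i' x = 0}"
      and f = "\<lambda>i x. if i < m then wedge_class m i (to_sphere i x) else wedge_class m 0 sphere_base"])
  let ?W = "wedge_space m (unit_sphere (Suc d)) sphere_base"
  fix i assume i: "i \<in> {..m}"
  have "{x \<in> gpoints L. \<forall>i'\<in>{..<m} - {i}. mu i' x = 0} = topspace (geo L) \<inter> (\<Inter>i'\<in>{..<m} - {i}. {x \<in> topspace (geo L). mu i' x \<in> {0}})"
    by auto
  also have "closedin (geo L) \<dots>"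
  proof (cases "{..<m} - {i} = {}")
    case True then show ?thesis using closedin_topspace[of "geo L"] by (simp only: True INT_empty Int_UNIV_right)
  next
    case False
    then show ?thesis
      by (intro closedin_Int closedin_INT closedin_continuous_map_preimage[OF continuous_map_mu] closedin_topspace) auto
  qed
  finally show "closedin (geo L) {x \<in> gpoints L. \<forall>i'\<in>{..<m} - {i}. mu i' x = 0}" .
  show "continuous_map (subtopology (geo L) {x \<in> gpoints L. \<forall>i'\<in>{..<m} - {i}. mu i' x = 0}) ?W
     (\<lambda>x. if i < m then wedge_class m i (to_sphere i x) else wedge_class m 0 sphere_base)"
    using continuous_map_compose'[OF continuous_map_to_sphere continuous_map_wedge_class, of i]
    by (cases "i < m") (auto intro: continuous_map_from_subtopology simp: topspace_wedge)
next
  fix i i' x assume a: "i \<in> {..m}" "i' \<in> {..m}"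
    "x \<in> topspace (geo L) \<inter> {x \<in> gpoints L. \<forall>i'\<in>{..<m} - {i}. mu i' x = 0} \<inter> {x \<in> gpoints L. \<forall>i\<in>{..<m} - {i'}. mu i x = 0}"
  show "(if i < m then wedge_class m i (to_sphere i x) else wedge_class m 0 sphere_base) =
        (if i' < m then wedge_class m i' (to_sphere i' x) else wedge_class m 0 sphere_base)"
  proof (cases "i = i'")
    case False
    then have "mu k x = 0" if "k < m" for k using a that by auto
    then have "(if k < m then wedge_class m k (to_sphere k x) else wedge_class m 0 sphere_base) = wedge_class m 0 sphere_base" for k
      using a(3) to_sphere_base[of x k] wedge_class_base[of k m] by simp
    then show ?thesis by simp
  qed simp
next
  fix x assume "x \<in> topspace (geo L)"
  then have x: "x \<in> gpoints L" by simp
  show "\<exists>i. i \<in> {..m} \<and> x \<in> {x \<in> gpoints L. \<forall>i'\<in>{..<m} - {i}. mu i' x = 0} \<and>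
       to_wedge x = (if i < m then wedge_class m i (to_sphere i x) else wedge_class m 0 sphere_base)"
  proof (cases "x \<in> cone")
    case True
    then have "\<forall>i'\<in>{..<m} - {m}. mu i' x = 0" by (simp add: cone_def)
    then show ?thesis using x to_wedge_cone[OF True] by (intro exI[of _ m] conjI) simp_all
  next
    case False
    then obtain i where i: "i < m" "mu i x \<noteq> 0" using x by (auto simp: cone_def)
    have "\<forall>i'\<in>{..<m} - {i}. mu i' x = 0" using mu_unique[OF x i(1) _ i(2)] by blast
    then show ?thesis using x to_wedge_cell[OF x i] i(1) by (intro exI[of _ i] conjI) simp_all
  qed
qed auto

lemma to_wedge_surj: "to_wedge ` topspace (geo L) = topspace (wedge_space m (unit_sphere (Suc d)) sphere_base)"
proof
  show "to_wedge ` topspace (geo L) \<subseteq> topspace (wedge_space m (unit_sphere (Suc d)) sphere_base)"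
    using continuous_map_image_subset_topspace[OF continuous_map_to_wedge] .
  let ?apex = "\<lambda>u::nat. if u = 0 then 1 else (0::real)"
  have ap: "?apex \<in> gpoints L" using K(2) by (intro vertex_in_gpoints) (simp add: L_def)
  have "vsupp ?apex = {0}" by (auto simp: vsupp_def)
  then have "?apex \<in> cone" using cone_iff[OF ap] K(2) by simp
  then have base: "wedge_class m 0 sphere_base \<in> to_wedge ` topspace (geo L)"
    using to_wedge_cone ap by (intro image_eqI[of _ _ ?apex]) auto
  have "wedge_class m i z \<in> to_wedge ` topspace (geo L)" if iz: "i < m" "z \<in> topspace (nsphere d)" for i z
  proof (cases "z = sphere_base")
    case True then show ?thesis using base wedge_class_base[OF iz(1)] by simp
  next
    case False
    obtain y where y: "\<And>j. j \<le> d \<Longrightarrow> 0 < y j" "sum y {..d} = 1" "simplex_to_sphere d y = z"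
      using simplex_to_sphere_surj[OF iz(2) False] by metis
    define x where "x = (\<lambda>v. if v \<in> cell i then y (inv_into {..d} (en i) v) else 0)"
    have xy: "x (en i j) = y j" if "j \<le> d" for j
      using that inv_into_f_f[OF en_inj[OF iz(1)]] by (simp add: x_def)
    have "cell i \<in> L" using iz(1) by (auto simp: L_def)
    then have x: "x \<in> gpoints L"
    proof (rule gpointsI[OF simplicial_complex_L])
      show "0 \<le> x v" if "v \<in> cell i" for v using that xy y(1) by (auto intro: less_imp_le)
      have "sum x (cell i) = (\<Sum>j\<le>d. x (en i j))" using sum.reindex[OF en_inj[OF iz(1)], of x] by simp
      also have "\<dots> = 1" using y(2) xy by simp
      finally show "sum x (cell i) = 1" .
    qed (simp add: x_def)
    have "mu i x \<noteq> 0" using mu_attained[of i x] xy y(1) by force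
    moreover have "to_sphere i x = z"
      unfolding y(3)[symmetric] to_sphere_def simplex_to_sphere_def Let_def using xy by (auto intro!: ext sum.cong)
    ultimately show ?thesis using to_wedge_cell[OF x iz(1)] x by force
  qed
  then show "topspace (wedge_space m (unit_sphere (Suc d)) sphere_base) \<subseteq> to_wedge ` topspace (geo L)"
    using base unfolding topspace_wedge by auto
qed

text \<open>The self-homotopy of \<open>|L|\<close> contracting the cone first dilates each cell \<open>\<sigma>\<close> so that a collar of its
  boundary is mapped to the boundary, and then pushes the image of the collar into the cone. The amount
  \<open>\<kappa>\<close> subtracted from all coordinates by the dilation equals \<open>\<mu> = min\<^sub>\<sigma> x\<close> on the collar.\<close>

definition total :: "(nat \<Rightarrow> real) \<Rightarrow> real" where
  "total x = (\<Sum>i<m. mu i x)"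

text \<open>\<open>1 / Suc d\<close> is the largest possible value of \<open>total\<close>, taken at
  a barycentre. So \<open>\<kappa>\<close> vanishes both on the cone and at barycentres and is at
  most half that value, which keeps the denominator at least 1/2.\<close>

definition dilate :: "(nat \<Rightarrow> real) \<Rightarrow> nat \<Rightarrow> real" where
  "dilate x = (let \<kappa> = min (total x) (1 / Suc d - total x) in (\<lambda>v. max 0 (x v - \<kappa>) / (1 - Suc d * \<kappa>)))"

text \<open>The weight \<open>\<alpha>\<close> is 1 on the cone and positive exactly where
  \<open>2 * Suc d * total x < 1\<close>; there \<open>dilate x\<close> already lies in the cone, so
  moving towards the apex is possible.\<close>

definition push_in :: "(nat \<Rightarrow> real) \<Rightarrow> nat \<Rightarrow> real" where
  "push_in x = (let \<alpha> = max 0 (1 - 2 * Suc d * total x) in (\<lambda>v. (1 - \<alpha>) * dilate x v + (if v = 0 then \<alpha> else 0)))"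

lemma total_cone: "x \<in> cone \<Longrightarrow> total x = 0"
  by (simp add: total_def cone_def)

lemma total_cell:
  assumes "x \<in> gpoints L" "i < m" "mu i x \<noteq> 0"
  shows "total x = mu i x"
proof -
  have "total x = (\<Sum>i'\<in>{i}. mu i' x)"
    unfolding total_def using mu_unique[OF assms(1)] assms by (intro sum.mono_neutral_right) auto
  then show ?thesis by simp
qed

lemma total_bounds:
  assumes "x \<in> gpoints L"
  shows "0 \<le> total x" "Suc d * total x \<le> 1"
proof -
  show "0 \<le> total x" unfolding total_def using mu_nonneg[OF assms] by (intro sum_nonneg) auto
  show "Suc d * total x \<le> 1"
  proof (cases "x \<in> cone")
    case False
    then obtain i where i: "i < m" "mu i x \<noteq> 0" using assms by (auto simp: cone_def)
    have "real (card {..d}) * mu i x \<le> (\<Sum>j\<le>d. x (en i j))" by (intro sum_bounded_below) (simp add: mu_le)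
    then show ?thesis using cell_sum[OF assms i] total_cell[OF assms i] by simp
  qed (simp add: total_cone)
qed

lemma dilate_cone: "x \<in> cone \<Longrightarrow> dilate x = x"
  using gpointsD(1) by (auto simp: dilate_def total_cone cone_def fun_eq_iff max_def)

lemma kappa_bounds:
  fixes \<kappa> :: real
  assumes "x \<in> gpoints L"
  defines "\<kappa> \<equiv> min (total x) (1 / Suc d - total x)"
  shows "0 \<le> \<kappa>" "Suc d * \<kappa> \<le> 1 / 2"
proof -
  have "total x \<le> 1 / Suc d" using total_bounds(2)[OF assms(1)] by (simp add: field_simps)
  then show "0 \<le> \<kappa>" using total_bounds(1)[OF assms(1)] by (simp add: \<kappa>_def)
  have "\<kappa> \<le> total x" "\<kappa> \<le> 1 / Suc d - total x" unfolding \<kappa>_def by (rule min.cobounded1, rule min.cobounded2)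
  then have "2 * \<kappa> \<le> 1 / Suc d" by linarith
  then show "Suc d * \<kappa> \<le> 1 / 2" by (simp add: field_simps)
qed

lemma dilate_in:
  assumes x: "x \<in> gpoints L"
  shows "dilate x \<in> gpoints L" "vsupp (dilate x) \<subseteq> vsupp x"
    "2 * Suc d * total x < 1 \<Longrightarrow> vsupp (dilate x) - {0} \<in> K"
proof -
  define \<kappa> where "\<kappa> = min (total x) (1 / Suc d - total x)"
  have k: "0 \<le> \<kappa>" "Suc d * \<kappa> \<le> 1 / 2" unfolding \<kappa>_def using kappa_bounds[OF x] by auto
  have E: "dilate x v = max 0 (x v - \<kappa>) / (1 - Suc d * \<kappa>)" for v by (simp add: dilate_def \<kappa>_def Let_def)
  show sub: "vsupp (dilate x) \<subseteq> vsupp x" using k(1) by (auto simp: vsupp_def E)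
  show "dilate x \<in> gpoints L"
  proof (cases "x \<in> cone")
    case True then show ?thesis using x dilate_cone by simp
  next
    case False
    then obtain i where i: "i < m" "mu i x \<noteq> 0" using x by (auto simp: cone_def)
    note tot = total_cell[OF x i] and sx = supp_of_mu[OF x i]
    have ge: "\<kappa> \<le> x v" if v: "v \<in> cell i" for v
      using that mu_le[of _ i x] tot by (force simp: \<kappa>_def)
    have "sum (dilate x) (cell i) = (\<Sum>v\<in>cell i. (x v - \<kappa>) / (1 - Suc d * \<kappa>))"
      using ge by (intro sum.cong) (auto simp: E)
    also have "\<dots> = (sum x (cell i) - Suc d * \<kappa>) / (1 - Suc d * \<kappa>)"
      using card_image[OF en_inj[OF i(1)]] by (simp add: sum_subtractf flip: sum_divide_distrib)
    also have "\<dots> = 1" using gpoints_sum[OF x, of "cell i"] sx k(2) by simp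
    finally have "sum (dilate x) (cell i) = 1" .
    moreover have "cell i \<in> L" using i by (auto simp: L_def)
    ultimately show ?thesis
      using sub sx k(2) by (intro gpointsI[OF simplicial_complex_L]) (auto simp: E vsupp_def)
  qed
  assume small: "2 * Suc d * total x < 1"
  show "vsupp (dilate x) - {0} \<in> K"
  proof (cases "x \<in> cone")
    case True then show ?thesis using dilate_cone cone_iff[OF x] by simp
  next
    case False
    then obtain i where i: "i < m" "mu i x \<noteq> 0" using x by (auto simp: cone_def)
    note tot = total_cell[OF x i] and sx = supp_of_mu[OF x i]
    \<comment> \<open>In the collar, \<open>\<kappa>\<close> is the least coordinate itself.
      Subtracting it kills a vertex of the cell, leaving a proper face.\<close>
    have "total x \<le> 1 / Suc d - total x" using small by (simp add: field_simps)
    then have "\<kappa> = mu i x" using tot by (simp add: \<kappa>_def)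
    moreover obtain j where "j \<le> d" "mu i x = x (en i j)" using mu_attained by blast
    ultimately have "dilate x (en i j) = 0" "en i j \<in> cell i" by (auto simp: E)
    then have "vsupp (dilate x) \<subset> cell i" using sub sx by (auto simp: vsupp_def)
    then have "vsupp (dilate x) \<in> K" using bdry i by blast
    then show ?thesis by (rule simplicial_complexD(2)[OF K(1)]) auto
  qed
qed

lemma push_in_props:
  assumes x: "x \<in> gpoints L"
  shows "push_in x \<in> gpoints L" "vsupp (dilate x) \<union> vsupp (push_in x) \<in> L"
proof -
  let ?ap = "\<lambda>v::nat. if v = 0 then 1 else (0::real)"
  define \<alpha> where "\<alpha> = max 0 (1 - 2 * Suc d * total x)"
  have a: "0 \<le> \<alpha>" "\<alpha> \<le> 1" using total_bounds[OF x] by (auto simp: \<alpha>_def)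
  have p: "push_in x = (\<lambda>v. (1 - \<alpha>) * dilate x v + \<alpha> * ?ap v)"
    by (auto simp: push_in_def \<alpha>_def Let_def fun_eq_iff)
  have sap: "vsupp ?ap = {0}" by (auto simp: vsupp_def)
  have ap: "?ap \<in> gpoints L" using K(2) by (intro vertex_in_gpoints) (simp add: L_def)
  have "push_in x \<in> gpoints L \<and> vsupp (dilate x) \<union> vsupp (push_in x) \<in> L"
  proof (cases "\<alpha> = 0")
    case True
    then have "push_in x = dilate x" using p by simp
    then show ?thesis using dilate_in(1)[OF x] gpointsD(2)[OF dilate_in(1)[OF x]] by simp
  next
    case False
    then have "2 * Suc d * total x < 1" by (auto simp: \<alpha>_def max_def split: if_splits)
    then have K': "vsupp (dilate x) - {0} \<in> K" by (rule dilate_in(3)[OF x])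
    then have ins: "insert 0 (vsupp (dilate x)) \<in> L" by (simp add: L_def)
    have "vsupp (dilate x) \<union> vsupp (push_in x) \<subseteq> insert 0 (vsupp (dilate x))"
      unfolding p by (auto simp: vsupp_def split: if_splits)
    then have "vsupp (dilate x) \<union> vsupp (push_in x) \<in> L"
      by (rule simplicial_complexD(2)[OF simplicial_complex_L ins])
    moreover have "push_in x \<in> gpoints L"
      unfolding p by (rule gpoints_line[OF simplicial_complex_L dilate_in(1)[OF x] ap _ a]) (use ins sap in simp)
    ultimately show ?thesis by simp
  qed
  then show "push_in x \<in> gpoints L" "vsupp (dilate x) \<union> vsupp (push_in x) \<in> L" by auto
qed

lemma continuous_map_total: "continuous_map (geo L) euclideanreal total"
  unfolding total_def by (intro continuous_map_sum continuous_map_mu) auto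

lemma continuous_map_dilate: "continuous_map (geo L) (geo L) dilate"
  unfolding continuous_map_into_geo
proof (intro conjI allI ballI)
  fix v
  have "1 - Suc d * min (total x) (1 / Suc d - total x) \<noteq> 0" if "x \<in> topspace (geo L)" for x
    using kappa_bounds(2)[of x] that by auto
  then show "continuous_map (geo L) euclideanreal (\<lambda>x. dilate x v)"
    unfolding dilate_def Let_def
    by (intro continuous_map_real_divide continuous_map_real_max continuous_map_diff continuous_map_geo_coord
        continuous_map_real_min continuous_map_total continuous_map_real_mult) auto
qed (use dilate_in in auto)

lemma continuous_map_push_in: "continuous_map (geo L) (geo L) push_in"
  unfolding continuous_map_into_geo
proof (intro conjI allI ballI)
  fix v :: nat
  have c: "continuous_map (geo L) euclideanreal (\<lambda>x. max 0 (1 - real (2 * Suc d) * total x))"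
    by (intro continuous_map_real_max continuous_map_diff continuous_map_real_mult continuous_map_total) auto
  have c0: "continuous_map (geo L) euclideanreal (\<lambda>x. if v = 0 then max 0 (1 - real (2 * Suc d) * total x) else 0)"
    using c by (cases "v = 0") (simp_all only: if_True if_False simp_thms continuous_map_const, simp)
  show "continuous_map (geo L) euclideanreal (\<lambda>x. push_in x v)"
    unfolding push_in_def Let_def
    by (intro continuous_map_add[OF _ c0] continuous_map_real_mult continuous_map_diff c
        continuous_map_geo_coord'[OF continuous_map_dilate]) simp
qed (use push_in_props in auto)

text \<open>Both homotopies, from the identity to \<open>dilate\<close> and on to
  \<open>push_in\<close>, map the cone into itself and so respect the fibres of
  \<open>to_wedge\<close>. At the end the whole cone is at the apex, as the collapsing lemma
  requires.\<close>

theorem homotopy_equivalence_to_wedge: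
  "homotopy_equivalence (geo L) (wedge_space m (unit_sphere (Suc d)) sphere_base) to_wedge"
proof (rule homotopy_equivalence_collapse[OF compact_space_geo[OF simplicial_complex_L] Hausdorff_wedge
      continuous_map_to_wedge to_wedge_surj])
  let ?ap = "\<lambda>v::nat. if v = 0 then 1 else (0::real)"
  let ?P = "\<lambda>u. \<forall>x\<in>topspace (geo L). \<forall>x'\<in>topspace (geo L). to_wedge x = to_wedge x' \<longrightarrow> to_wedge (u x) = to_wedge (u x')"
  have push_cone: "push_in x = ?ap" if "x \<in> cone" for x
    using that by (auto simp: push_in_def total_cone fun_eq_iff)
  have P: "?P u" if "\<And>x. x \<in> cone \<Longrightarrow> u x \<in> cone" for u
    using to_wedge_eq_iff to_wedge_cone that by (metis topspace_geo)
  have ins: "(\<lambda>v. (1 - s) * x v + s * ?ap v) \<in> cone" if x: "x \<in> cone" and s: "0 \<le> s" "s \<le> 1" for x s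
  proof -
    have xL: "x \<in> gpoints L" using x by (simp add: cone_def)
    have xK: "vsupp x - {0} \<in> K" using cone_iff[OF xL] x by simp
    have sap: "vsupp ?ap = {0}" by (auto simp: vsupp_def)
    have ap: "?ap \<in> gpoints L" using K(2) by (intro vertex_in_gpoints) (simp add: L_def)
    have i: "insert 0 (vsupp x) \<in> L" using xK by (simp add: L_def)
    have y: "(\<lambda>v. (1 - s) * x v + s * ?ap v) \<in> gpoints L"
      by (rule gpoints_line[OF simplicial_complex_L xL ap _ s]) (use i sap in simp)
    have "vsupp (\<lambda>v. (1 - s) * x v + s * ?ap v) - {0} \<subseteq> vsupp x - {0}" by (auto simp: vsupp_def)
    then have "vsupp (\<lambda>v. (1 - s) * x v + s * ?ap v) - {0} \<in> K" by (rule simplicial_complexD(2)[OF K(1) xK])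
    then show ?thesis using cone_iff[OF y] by simp
  qed
  have "homotopic_with ?P (geo L) (geo L) id dilate"
  proof (rule homotopic_with_geo_line[OF simplicial_complex_L continuous_map_id continuous_map_dilate])
    fix x assume "x \<in> topspace (geo L)"
    then have x: "x \<in> gpoints L" by simp
    then have "vsupp (id x) \<union> vsupp (dilate x) = vsupp x" using dilate_in(2) by auto
    then show "vsupp (id x) \<union> vsupp (dilate x) \<in> L" using gpointsD(2)[OF x] by simp
  next
    fix s :: real
    show "?P (\<lambda>x v. (1 - s) * id x v + s * dilate x v)"
      by (rule P) (simp add: dilate_cone algebra_simps)
  qed
  moreover have "homotopic_with ?P (geo L) (geo L) dilate push_in"
  proof (rule homotopic_with_geo_line[OF simplicial_complex_L continuous_map_dilate continuous_map_push_in])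
    fix s :: real assume s: "0 \<le> s" "s \<le> 1"
    show "?P (\<lambda>x v. (1 - s) * dilate x v + s * push_in x v)"
    proof (rule P)
      fix x assume x: "x \<in> cone"
      show "(\<lambda>v. (1 - s) * dilate x v + s * push_in x v) \<in> cone"
        unfolding dilate_cone[OF x] push_cone[OF x] by (rule ins[OF x s])
    qed
  qed (use push_in_props in auto)
  ultimately show "homotopic_with ?P (geo L) (geo L) id push_in" by (rule homotopic_with_trans)
  fix x x' assume "x \<in> topspace (geo L)" "x' \<in> topspace (geo L)" "to_wedge x = to_wedge x'"
  then show "push_in x = push_in x'" using to_wedge_eq_iff[of x x'] push_cone by auto
qed

end

text \<open>Both complexes map to the same wedge. Since \<open>w\<close> matches the enumerations of
  the cells and preserves the cones, \<open>push w\<close> commutes with these equivalences.\<close>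

lemma homotopy_equivalence_push_coned:
  assumes "coned_complex K1 en1 m d" "coned_complex K2 en2 m d"
    and w: "\<And>i j. i < m \<Longrightarrow> j \<le> d \<Longrightarrow> w (en1 i j) = en2 i j" "w 0 = 0" "\<And>A. A \<in> K1 \<Longrightarrow> w ` A \<in> K2"
  shows "homotopy_equivalence (geo (coned_complex.L K1 en1 m d)) (geo (coned_complex.L K2 en2 m d)) (push w)"
proof -
  interpret A: coned_complex K1 en1 m d by fact
  interpret B: coned_complex K2 en2 m d by fact
  have cell: "w ` en1 i ` {..d} = en2 i ` {..d}" if "i < m" for i
    using w(1)[OF that] by (force simp: image_image)
  have wcone: "w ` A - {0} \<in> K2" if "A - {0} \<in> K1" for A
  proof -
    have "w ` A - {0} \<subseteq> w ` (A - {0})" using w(2) by auto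
    then show ?thesis using simplicial_complexD(2)[OF B.K(1) w(3)[OF that]] by blast
  qed
  have wL: "w ` A \<in> B.L" if "A \<in> A.L" for A
    using that wcone cell unfolding A.L_def B.L_def by blast
  have cont: "continuous_map (geo A.L) (geo B.L) (push w)"
    by (rule continuous_map_push[OF A.simplicial_complex_L wL])
  show ?thesis
  proof (rule homotopy_equivalence_cancel[OF A.homotopy_equivalence_to_wedge B.homotopy_equivalence_to_wedge cont])
    fix x assume "x \<in> topspace (geo A.L)"
    then have x: "x \<in> gpoints A.L" by simp
    have fin: "finite (vsupp x)" using simplicial_complexD(1)[OF A.simplicial_complex_L gpointsD(2)[OF x]] .
    have px: "push w x \<in> gpoints B.L" using cont x by (auto simp: continuous_map_into_geo)
    note vp = vsupp_push[OF fin gpointsD(1)[OF x], of w]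
    show "B.to_wedge (push w x) = A.to_wedge x"
    proof (cases "x \<in> A.cone")
      case True
      then have "vsupp (push w x) - {0} \<in> K2" using A.cone_iff[OF x] wcone vp by simp
      then have "push w x \<in> B.cone" using B.cone_iff[OF px] by simp
      then show ?thesis using True A.to_wedge_cone B.to_wedge_cone by simp
    next
      case False
      then obtain i where i: "i < m" "A.mu i x \<noteq> 0" using x by (auto simp: A.cone_def)
      have sx: "vsupp x = en1 i ` {..d}" by (rule A.supp_of_mu[OF x i])
      have inj: "inj_on w (vsupp x)"
        unfolding sx using B.en_inj[OF i(1)] w(1)[OF i(1)] by (auto simp: inj_on_def)
      have eq: "push w x (en2 i j) = x (en1 i j)" if "j \<le> d" for j
      proof -
        have jx: "en1 i j \<in> vsupp x" using sx that by blast
        have "w v = en2 i j \<longleftrightarrow> v = en1 i j" if "v \<in> vsupp x" for v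
          using inj_on_eq_iff[OF inj that jx] w(1)[OF i(1) \<open>j \<le> d\<close>] by simp
        then have "push w x (en2 i j) = (\<Sum>v\<in>vsupp x. if v = en1 i j then x v else 0)"
          unfolding push_def by (intro sum.cong refl) simp
        then show ?thesis using fin jx by (simp add: sum.delta)
      qed
      have "B.mu i (push w x) = A.mu i x"
        unfolding A.mu_def B.mu_def using eq by (intro arg_cong[of _ _ Min]) (auto simp: image_iff)
      moreover have "B.to_sphere i (push w x) = A.to_sphere i x"
        unfolding A.to_sphere_def B.to_sphere_def simplex_to_sphere_def Let_def
        using eq by (auto intro!: ext sum.cong)
      ultimately show ?thesis using A.to_wedge_cell[OF x i] B.to_wedge_cell[OF px i(1)] i(2) by simp
    qed
  qed
qed

section \<open>Shellings: subspaces, flags and cones\<close>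

subsection \<open>Shellings\<close>

text \<open>The size \<open>f\<close> is the dimension for subspaces and the cardinality for flags
  and simplices. Splitting the list at \<open>x\<close>, rather than indexing it, suits
  concatenation and induction from the right.\<close>

definition shelled :: "('a set \<Rightarrow> nat) \<Rightarrow> nat \<Rightarrow> 'a set list \<Rightarrow> bool" where
  "shelled f k xs \<longleftrightarrow> (\<forall>us x vs. xs = us @ x # vs \<longrightarrow>
     (\<forall>y\<in>set us. \<exists>z\<in>set us. y \<inter> x \<subseteq> z \<inter> x \<and> f (z \<inter> x) + 1 = k))"

lemma shelled_appendD: "shelled f k (xs @ ys) \<Longrightarrow> shelled f k xs"
  unfolding shelled_def by (metis append.assoc append_Cons)

lemma shelled_snocD:
  "shelled f k (xs @ [x]) \<Longrightarrow> y \<in> set xs \<Longrightarrow> \<exists>z\<in>set xs. y \<inter> x \<subseteq> z \<inter> x \<and> f (z \<inter> x) + 1 = k"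
  unfolding shelled_def by blast

lemma shelledI_nth:
  assumes "\<forall>j<length xs. \<forall>i<j. \<exists>l<j. xs ! i \<inter> xs ! j \<subseteq> xs ! l \<inter> xs ! j \<and> f (xs ! l \<inter> xs ! j) + 1 = k"
  shows "shelled f k xs"
  unfolding shelled_def
proof (intro allI impI ballI)
  fix us x vs y assume xs: "xs = us @ x # vs" and "y \<in> set us"
  then obtain i where i: "i < length us" "y = us ! i" by (auto simp: in_set_conv_nth)
  have "length us < length xs" by (simp add: xs)
  then obtain l where "l < length us" "xs ! i \<inter> xs ! length us \<subseteq> xs ! l \<inter> xs ! length us"
    "f (xs ! l \<inter> xs ! length us) + 1 = k"
    using assms i(1) by blast
  then show "\<exists>z\<in>set us. y \<inter> x \<subseteq> z \<inter> x \<and> f (z \<inter> x) + 1 = k"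
    using i by (intro bexI[of _ "us ! l"]) (auto simp: xs nth_append)
qed

lemma shelled_notin:
  assumes "shelled f k (xs @ [x])" "f x = k"
  shows "x \<notin> set xs"
proof
  assume "x \<in> set xs"
  then obtain z where "x \<inter> x \<subseteq> z \<inter> x" "f (z \<inter> x) + 1 = k" using shelled_snocD[OF assms(1)] by blast
  then have "f x + 1 = k" by (metis Int_absorb Int_lower2 subset_antisym)
  then show False using assms(2) by simp
qed

subsection \<open>Flags of subspaces\<close>

text \<open>Two different hyperplanes of \<open>F\<close> span \<open>F\<close>; the claim is then
  the dimension formula.\<close>

lemma dim_Int_hyperplanes:
  fixes G H F :: "('q::{field,finite} ^ 'n) set"
  assumes F: "vec.dim F = Suc k" "vec.subspace F" and G: "vec.subspace G" "G \<subseteq> F" "vec.dim G = k"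
    and H: "vec.subspace H" "H \<subseteq> F" "vec.dim H = k" and "G \<noteq> H"
  shows "vec.dim (G \<inter> H) + 1 = k"
proof -
  let ?S = "{x + y |x y. x \<in> G \<and> y \<in> H}"
  have sub: "vec.subspace ?S" by (rule vec.subspace_sums[OF G(1) H(1)])
  have SF: "?S \<subseteq> F" using G(2) H(2) vec.subspace_add[OF F(2)] by blast
  have "G \<subseteq> ?S" using vec.subspace_0[OF H(1)] by force
  moreover have "H \<subseteq> ?S" using vec.subspace_0[OF G(1)] by force
  moreover have "\<not> H \<subseteq> G" using vec.subspace_dim_equal[OF H(1) G(1)] G(3) H(3) \<open>G \<noteq> H\<close> by auto
  ultimately have "G \<subset> ?S" by blast
  then have "\<not> vec.dim ?S \<le> vec.dim G" using vec.subspace_dim_equal[OF G(1) sub] by blast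
  moreover have "vec.dim ?S \<le> Suc k" using vec.dim_subset[OF SF] F(1) by simp
  ultimately have "vec.dim ?S = Suc k" using G(3) by linarith
  then show ?thesis using vec.dim_sums_Int[OF G(1) H(1)] G(3) H(3) by simp
qed

text \<open>A basis of \<open>A\<close> is extended to one of \<open>F\<close>, and one of the new
  vectors is dropped.\<close>

lemma extend_hyperplane:
  fixes A F :: "('q::{field,finite} ^ 'n) set"
  assumes F: "vec.subspace F" "vec.dim F = Suc k" and A: "vec.subspace A" "A \<subseteq> F" "A \<noteq> F"
  shows "\<exists>H. vec.subspace H \<and> A \<subseteq> H \<and> H \<subseteq> F \<and> vec.dim H = k"
proof -
  obtain B where B: "B \<subseteq> A" "vec.independent B" "A \<subseteq> vec.span B"
    using vec.basis_exists[of A] by metis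
  obtain C where C: "B \<subseteq> C" "C \<subseteq> F" "vec.independent C" "F \<subseteq> vec.span C"
    using vec.maximal_independent_subset_extend[of B F] B A(2) by (metis order_trans)
  have spanC: "vec.span C = F" using C(2,4) vec.span_minimal[OF C(2) F(1)] by blast
  have "B \<noteq> C"
    using B A(2,3) vec.span_minimal[OF B(1) A(1)] spanC by blast
  then obtain v where v: "v \<in> C" "v \<notin> B" using C(1) by blast
  have cC: "card C = Suc k" using vec.dim_eq_card_independent[OF C(3)] vec.dim_span[of C] spanC F(2) by simp
  have ind: "vec.independent (C - {v})" using C(3) vec.independent_mono by blast
  show ?thesis
  proof (intro exI conjI)
    show "vec.subspace (vec.span (C - {v}))" by (rule vec.subspace_span)
    show "A \<subseteq> vec.span (C - {v})" using B(3) vec.span_mono[of B "C - {v}"] C(1) v(2) by blast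
    show "vec.span (C - {v}) \<subseteq> F" using spanC vec.span_mono[of "C - {v}" C] by blast
    show "vec.dim (vec.span (C - {v})) = k"
      using vec.dim_eq_card_independent[OF ind] cC v(1) by (simp add: vec.dim_span)
  qed
qed

definition subspaces_in :: "('q::{field,finite} ^ 'n) set \<Rightarrow> ('q ^ 'n) set set" where
  "subspaces_in F = {V. vec.subspace V \<and> V \<noteq> {0} \<and> V \<subseteq> F}"

definition flags :: "('q::{field,finite} ^ 'n) set \<Rightarrow> ('q ^ 'n) set set set" where
  "flags F = {\<phi> \<in> order_chains (subspaces_in F). card \<phi> = vec.dim F}"

definition hyperplanes :: "('q::{field,finite} ^ 'n) set \<Rightarrow> ('q ^ 'n) set set" where
  "hyperplanes F = {H. vec.subspace H \<and> H \<subseteq> F \<and> vec.dim H + 1 = vec.dim F}"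

lemma subspace_dim_0:
  fixes F :: "('q::{field,finite} ^ 'n) set"
  assumes "vec.subspace F"
  shows "vec.dim F = 0 \<longleftrightarrow> F = {0}"
  using vec.dim_eq_0[of F] vec.subspace_0[OF assms] by auto

lemma order_chains_subset: "A \<in> order_chains P \<Longrightarrow> B \<subseteq> A \<Longrightarrow> B \<in> order_chains P"
  by (auto simp: order_chains_def)

lemma subspaces_in_dim_0:
  assumes "vec.subspace F" "vec.dim F = 0"
  shows "order_chains (subspaces_in F) = {{}}"
proof -
  have F: "F = {0}" using subspace_dim_0 assms by blast
  have "V = {0}" if "vec.subspace V" "V \<subseteq> F" for V using vec.subspace_0[OF that(1)] that(2) F by auto
  then have "subspaces_in F = {}" by (auto simp: subspaces_in_def)
  then show ?thesis by (auto simp: order_chains_def)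
qed

lemma chain_card_le:
  assumes "C \<in> order_chains (subspaces_in F)"
  shows "card C \<le> vec.dim F"
proof -
  have C: "vec.subspace V" "V \<noteq> {0}" "V \<subseteq> F" if "V \<in> C" for V
    using assms that by (auto simp: order_chains_def subspaces_in_def)
  have "inj_on vec.dim C"
  proof (rule inj_onI)
    fix V W assume VW: "V \<in> C" "W \<in> C" "vec.dim V = vec.dim W"
    then have "V \<subseteq> W \<or> W \<subseteq> V" using assms by (auto simp: order_chains_def)
    then show "V = W" using vec.subspace_dim_equal C VW by (metis order_refl)
  qed
  moreover have "vec.dim ` C \<subseteq> {1..vec.dim F}"
  proof clarify
    fix V assume V: "V \<in> C"
    have "vec.dim V \<noteq> 0" using subspace_dim_0 C[OF V] by blast
    then have "1 \<le> vec.dim V" by linarith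
    then show "vec.dim V \<in> {1..vec.dim F}" using vec.dim_subset[OF C(3)[OF V]] by (simp only: atLeastAtMost_iff)
  qed
  ultimately have "card C \<le> card {1..vec.dim F}" by (intro card_inj_on_le) auto
  then show ?thesis by simp
qed

text \<open>The largest member of the chain, or the zero subspace if the chain is empty, is a proper
  subspace of \<open>F\<close> and lies in a hyperplane.\<close>

lemma proper_chain_in_hyperplane:
  fixes F :: "('q::{field,finite} ^ 'n) set"
  assumes F: "vec.subspace F" "vec.dim F = Suc k" and C: "C \<in> order_chains (subspaces_in F)" "F \<notin> C"
  shows "\<exists>H\<in>hyperplanes F. C \<in> order_chains (subspaces_in H)"
proof -
  have "\<exists>A. vec.subspace A \<and> A \<subseteq> F \<and> A \<noteq> F \<and> (\<forall>V\<in>C. V \<subseteq> A)"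
  proof (cases "C = {}")
    case True
    have "{0} \<noteq> F" using subspace_dim_0[OF F(1)] F(2) by auto
    then show ?thesis using True vec.subspace_0[OF F(1)] vec.subspace_single_0 by (intro exI[of _ "{0}"]) auto
  next
    case False
    obtain M where M: "M \<in> C" "\<And>V. V \<in> C \<Longrightarrow> M \<subseteq> V \<Longrightarrow> M = V"
      using finite_has_maximal[of C] False finite_subset[of C UNIV] by (metis finite finite_code)
    have comp: "\<forall>V\<in>C. V \<subseteq> M \<or> M \<subseteq> V" using C(1) M(1) unfolding order_chains_def by blast
    have "V \<subseteq> M" if "V \<in> C" for V using comp M(2)[OF that] that by blast
    moreover have "M \<in> subspaces_in F" "M \<noteq> F" using C M(1) by (auto simp: order_chains_def)
    ultimately show ?thesis by (intro exI[of _ M]) (simp add: subspaces_in_def)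
  qed
  then obtain A where A: "vec.subspace A" "A \<subseteq> F" "A \<noteq> F" "\<forall>V\<in>C. V \<subseteq> A" by blast
  obtain H where H: "vec.subspace H" "A \<subseteq> H" "H \<subseteq> F" "vec.dim H = k"
    using extend_hyperplane[OF F A(1-3)] by blast
  have "H \<in> hyperplanes F" using H F by (simp add: hyperplanes_def)
  moreover have "C \<in> order_chains (subspaces_in H)"
    using C(1) A(4) H(2) unfolding order_chains_def subspaces_in_def by blast
  ultimately show ?thesis by blast
qed

lemma hyperplanes_neq: "H \<in> hyperplanes F \<Longrightarrow> \<not> F \<subseteq> H"
  using vec.dim_subset[of F H] by (auto simp: hyperplanes_def)

lemma insert_flag:
  fixes F :: "('q::{field,finite} ^ 'n) set"
  assumes F: "vec.subspace F" and H: "vec.subspace H" "H \<subseteq> F" "vec.dim H + 1 = vec.dim F" and b: "\<beta> \<in> flags H"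
  shows "insert F \<beta> \<in> flags F" "F \<notin> \<beta>" "\<And>V. V \<in> \<beta> \<Longrightarrow> V \<subseteq> H"
proof -
  have hyp: "H \<in> hyperplanes F" using H by (simp add: hyperplanes_def)
  show VH: "V \<subseteq> H" if "V \<in> \<beta>" for V using b that by (auto simp: flags_def order_chains_def subspaces_in_def)
  then show Fn: "F \<notin> \<beta>" using hyperplanes_neq[OF hyp] by blast
  have "vec.dim F \<noteq> 0" using H(3) by linarith
  then have "F \<noteq> {0}" unfolding subspace_dim_0[OF F] .
  then have FF: "F \<in> subspaces_in F" using F by (simp add: subspaces_in_def)
  have bo: "\<beta> \<in> order_chains (subspaces_in H)" using b by (simp add: flags_def)
  have "subspaces_in H \<subseteq> subspaces_in F" using H(2) by (auto simp: subspaces_in_def)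
  then have sub: "insert F \<beta> \<subseteq> subspaces_in F" using FF bo by (auto simp: order_chains_def)
  have "x \<le> y \<or> y \<le> x" if xy: "x \<in> insert F \<beta>" "y \<in> insert F \<beta>" for x y
  proof (cases "x = F \<or> y = F")
    case True
    have "x \<subseteq> F" "y \<subseteq> F" using sub xy by (auto simp: subspaces_in_def)
    then show ?thesis using True by blast
  next
    case False
    then have "x \<in> \<beta>" "y \<in> \<beta>" using xy by auto
    then show ?thesis using bo unfolding order_chains_def by blast
  qed
  then have "insert F \<beta> \<in> order_chains (subspaces_in F)"
    using sub unfolding order_chains_def by blast
  moreover have "card (insert F \<beta>) = vec.dim F"
  proof -
    have "finite \<beta>" by (rule finite_subset[OF subset_UNIV]) simp
    then show ?thesis using Fn b H(3) by (simp add: flags_def)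
  qed
  ultimately show "insert F \<beta> \<in> flags F" by (simp add: flags_def)
qed

text \<open>A chain that misses \<open>F\<close> lies in a hyperplane and is too short to be
  complete. So every complete flag consists of \<open>F\<close> and a complete flag of a
  hyperplane.\<close>

lemma flags_Suc:
  fixes F :: "('q::{field,finite} ^ 'n) set"
  assumes F: "vec.subspace F" "vec.dim F = Suc k"
  shows "flags F = (\<Union>H\<in>hyperplanes F. insert F ` flags H)"
proof
  show "(\<Union>H\<in>hyperplanes F. insert F ` flags H) \<subseteq> flags F"
    using insert_flag(1)[OF F(1)] by (auto simp: hyperplanes_def)
  show "flags F \<subseteq> (\<Union>H\<in>hyperplanes F. insert F ` flags H)"
  proof
    fix \<phi> assume p: "\<phi> \<in> flags F"
    have fp: "finite \<phi>" by (rule finite_subset[OF subset_UNIV]) simp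
    have "F \<in> \<phi>"
    proof (rule ccontr)
      assume "F \<notin> \<phi>"
      then obtain H where H: "H \<in> hyperplanes F" "\<phi> \<in> order_chains (subspaces_in H)"
        using proper_chain_in_hyperplane[OF F] p by (auto simp: flags_def)
      then show False using chain_card_le[OF H(2)] p by (auto simp: flags_def hyperplanes_def)
    qed
    have "\<phi> - {F} \<in> order_chains (subspaces_in F)"
      using p by (auto simp: flags_def intro: order_chains_subset)
    then obtain H where H: "H \<in> hyperplanes F" "\<phi> - {F} \<in> order_chains (subspaces_in H)"
      using proper_chain_in_hyperplane[OF F] by blast
    have "card (\<phi> - {F}) = vec.dim H"
    proof -
      have "card (\<phi> - {F}) = card \<phi> - 1" using \<open>F \<in> \<phi>\<close> by simp
      moreover have "card \<phi> = vec.dim F" "vec.dim H + 1 = vec.dim F"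
        using H(1) p by (auto simp: flags_def hyperplanes_def)
      ultimately show ?thesis by linarith
    qed
    then have "\<phi> - {F} \<in> flags H" using H(2) by (simp add: flags_def)
    moreover have "\<phi> = insert F (\<phi> - {F})" using \<open>F \<in> \<phi>\<close> by blast
    ultimately show "\<phi> \<in> (\<Union>H\<in>hyperplanes F. insert F ` flags H)" using H(1) by blast
  qed
qed

lemma extend_to_flag:
  fixes F :: "('q::{field,finite} ^ 'n) set"
  assumes "vec.subspace F" "C \<in> order_chains (subspaces_in F)"
  shows "\<exists>\<phi>\<in>flags F. C \<subseteq> \<phi>"
  using assms
proof (induction "vec.dim F" arbitrary: F C)
  case 0
  then show ?case using subspaces_in_dim_0[of F] by (auto simp: flags_def)
next
  case (Suc k)
  note dim = Suc.hyps(2)[symmetric]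
  have "C - {F} \<in> order_chains (subspaces_in F)" using Suc.prems(2) by (auto intro: order_chains_subset)
  then obtain H where H: "H \<in> hyperplanes F" "C - {F} \<in> order_chains (subspaces_in H)"
    using proper_chain_in_hyperplane[OF Suc.prems(1) dim] by blast
  then obtain \<beta> where "\<beta> \<in> flags H" "C - {F} \<subseteq> \<beta>"
    using Suc.hyps(1)[of H "C - {F}"] dim by (auto simp: hyperplanes_def)
  then show ?case using flags_Suc[OF Suc.prems(1) dim] H(1) by blast
qed

lemma append_eq_append_split:
  assumes "xs @ ys = us @ vs" "length xs \<le> length us"
  shows "\<exists>ws. us = xs @ ws \<and> ys = ws @ vs"
  using assms by (auto simp: append_eq_append_conv2)

text \<open>The flags ending in \<open>F\<close> are ordered by their hyperplanes of \<open>F\<close>; those hyperplanes which are contained in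
  earlier facets come first. Any order of the hyperplanes of \<open>F\<close> is a shelling.\<close>

lemma shelled_flags:
  fixes Fs :: "('q::{field,finite} ^ 'n) set list"
  assumes "shelled vec.dim k Fs" "\<And>F. F \<in> set Fs \<Longrightarrow> vec.subspace F \<and> vec.dim F = k"
  shows "\<exists>\<phi>ss. map set \<phi>ss = map flags Fs \<and> shelled card k (concat \<phi>ss)"
  using assms
proof (induction k arbitrary: Fs)
  case 0
  \<comment> \<open>A second facet would have to meet an earlier one in dimension -1.\<close>
  have "length Fs \<le> 1"
  proof (rule ccontr)
    assume "\<not> length Fs \<le> 1"
    then obtain F G vs where "Fs = F # G # vs" by (cases Fs; cases "tl Fs") auto
    then have "Fs = [F] @ G # vs" by simp
    from 0(1)[unfolded shelled_def, rule_format, OF this, of F] show False by simp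
  qed
  moreover have "flags F = {{}}" if "F \<in> set Fs" for F
  proof -
    note F = conjunct1[OF 0(2)[OF that]] conjunct2[OF 0(2)[OF that]]
    show ?thesis unfolding flags_def F(2) subspaces_in_dim_0[OF F] by auto
  qed
  moreover have "shelled card 0 [{}]" by (auto simp: shelled_def Cons_eq_append_conv)
  moreover have "shelled card 0 []" by (simp add: shelled_def)
  ultimately show ?case
  proof (cases Fs)
    case Nil
    then show ?thesis using \<open>shelled card 0 []\<close> by (intro exI[of _ "[]"]) simp
  next
    case (Cons F Gs)
    then have "Fs = [F]" using \<open>length Fs \<le> 1\<close> by simp
    moreover have "flags F = {{}}" using \<open>\<And>F. F \<in> set Fs \<Longrightarrow> flags F = {{}}\<close> Cons by simp
    ultimately show ?thesis using \<open>shelled card 0 [{}]\<close> by (intro exI[of _ "[[{}]]"]) simp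
  qed
next
  case (Suc k)
  note IHk = Suc.IH
  from Suc.prems show ?case
  proof (induction Fs rule: rev_induct)
    case Nil
    show ?case by (intro exI[of _ "[]"]) (simp add: shelled_def)
  next
    case (snoc F Fs)
    have Fs: "vec.subspace G" "vec.dim G = Suc k" if "G \<in> set Fs" for G using snoc.prems(2)[of G] that by auto
    have F: "vec.subspace F" "vec.dim F = Suc k" using snoc.prems(2) by auto
    obtain \<phi>ss where p: "map set \<phi>ss = map flags Fs" "shelled card (Suc k) (concat \<phi>ss)"
      using snoc.IH shelled_appendD[OF snoc.prems(1)] snoc.prems(2) by auto
    have Fnot: "F \<notin> set Fs" using shelled_notin[OF snoc.prems(1)] F(2) by simp
    have fin: "finite (A :: ('q ^ 'n) set set)" for A by (rule finite_subset[OF subset_UNIV]) simp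
    \<comment> \<open>The hyperplanes along which \<open>F\<close> meets earlier facets;
      \<open>Es\<close> lists them before the others in \<open>Rs\<close>.\<close>
    define ES where "ES = {H \<in> hyperplanes F. \<exists>G\<in>set Fs. H \<subseteq> G}"
    obtain Es where Es: "set Es = ES" "distinct Es" using finite_distinct_list[OF fin[of ES]] by blast
    obtain Rs where Rs: "set Rs = hyperplanes F - ES" "distinct Rs"
      using finite_distinct_list[OF fin[of "hyperplanes F - ES"]] by blast
    have hyp: "vec.subspace H" "H \<subseteq> F" "vec.dim H = k" if "H \<in> hyperplanes F" for H
      using that F by (auto simp: hyperplanes_def)
    have ER: "set (Es @ Rs) = hyperplanes F" using Es(1) Rs(1) by (auto simp: ES_def)
    have "distinct (Es @ Rs)" using Es Rs by auto
    then have "shelled vec.dim k (Es @ Rs)"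
      unfolding shelled_def
    proof (intro allI impI ballI)
      fix us x vs y assume d: "distinct (Es @ Rs)" and eq: "Es @ Rs = us @ x # vs" and y: "y \<in> set us"
      have "x \<in> hyperplanes F" "y \<in> hyperplanes F" using ER y unfolding eq by auto
      moreover have "x \<noteq> y" using d y unfolding eq by auto
      ultimately have "vec.dim (y \<inter> x) + 1 = k"
        using dim_Int_hyperplanes[OF F(2,1) hyp[of y] hyp[of x]] by blast
      then show "\<exists>z\<in>set us. y \<inter> x \<subseteq> z \<inter> x \<and> vec.dim (z \<inter> x) + 1 = k" using y by blast
    qed
    then obtain \<beta>ss where b: "map set \<beta>ss = map flags (Es @ Rs)" "shelled card k (concat \<beta>ss)"
      using IHk[of "Es @ Rs"] ER hyp by blast
    define \<beta>E where "\<beta>E = concat (take (length Es) \<beta>ss)"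
    define \<beta>R where "\<beta>R = concat (drop (length Es) \<beta>ss)"
    have bs: "concat \<beta>ss = \<beta>E @ \<beta>R" unfolding \<beta>E_def \<beta>R_def by (metis append_take_drop_id concat_append)
    have setE: "set \<beta>E = (\<Union>H\<in>set Es. flags H)"
    proof -
      have "map set (take (length Es) \<beta>ss) = map flags Es" using arg_cong[OF b(1), of "take (length Es)"] by (simp add: take_map)
      then have "set ` set (take (length Es) \<beta>ss) = flags ` set Es" by (metis set_map)
      then show ?thesis unfolding \<beta>E_def set_concat by simp
    qed
    have setB: "set (\<beta>E @ \<beta>R) = (\<Union>H\<in>hyperplanes F. flags H)"
    proof -
      have "set ` set \<beta>ss = flags ` hyperplanes F" using b(1) ER by (metis set_map)
      then show ?thesis unfolding bs[symmetric] set_concat by simp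
    qed
    have setP: "set (concat \<phi>ss) = (\<Union>G\<in>set Fs. flags G)"
    proof -
      have "set ` set \<phi>ss = flags ` set Fs" using p(1) by (metis set_map)
      then show ?thesis unfolding set_concat by simp
    qed
    have inB: "F \<notin> \<beta>" if bB: "\<beta> \<in> set (\<beta>E @ \<beta>R)" for \<beta>
    proof -
      obtain H where H: "H \<in> hyperplanes F" "\<beta> \<in> flags H" using bB unfolding setB by blast
      then show ?thesis using insert_flag(2)[OF F(1), of H] by (auto simp: hyperplanes_def)
    qed
    have inP: "F \<notin> y" if yP: "y \<in> set (concat \<phi>ss)" for y
    proof
      assume "F \<in> y"
      obtain G where G: "G \<in> set Fs" "y \<in> flags G" using yP unfolding setP by blast
      then have "F \<subseteq> G" using \<open>F \<in> y\<close> by (auto simp: flags_def order_chains_def subspaces_in_def)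
      then have "F = G" using vec.subspace_dim_equal[OF F(1) Fs(1)[OF G(1)]] F(2) Fs(2)[OF G(1)] by simp
      then show False using Fnot G(1) by simp
    qed
    have finflag: "finite (\<beta> :: ('q ^ 'n) set set)" for \<beta> by (rule fin)
    show ?case
    proof (intro exI conjI)
      have "set (map (insert F) (\<beta>E @ \<beta>R)) = flags F" unfolding flags_Suc[OF F] set_map setB by blast
      then show "map set (\<phi>ss @ [map (insert F) (\<beta>E @ \<beta>R)]) = map flags (Fs @ [F])" using p(1) by simp
      show "shelled card (Suc k) (concat (\<phi>ss @ [map (insert F) (\<beta>E @ \<beta>R)]))"
        unfolding shelled_def
      proof (intro allI impI ballI)
        fix us \<psi> vs y assume eq: "concat (\<phi>ss @ [map (insert F) (\<beta>E @ \<beta>R)]) = us @ \<psi> # vs" and y: "y \<in> set us"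
        show "\<exists>z\<in>set us. y \<inter> \<psi> \<subseteq> z \<inter> \<psi> \<and> card (z \<inter> \<psi>) + 1 = Suc k"
        proof (cases "length us < length (concat \<phi>ss)")
          case True
          have "concat \<phi>ss @ map (insert F) (\<beta>E @ \<beta>R) = us @ \<psi> # vs" using eq by simp
          then have "take (length (concat \<phi>ss)) (us @ \<psi> # vs) = concat \<phi>ss" by (metis append_eq_conv_conj)
          then have "concat \<phi>ss = us @ \<psi> # take (length (concat \<phi>ss) - length us - 1) vs"
            using True by (cases "length (concat \<phi>ss) - length us") auto
          then show ?thesis using p(2) y unfolding shelled_def by blast
        next
          case False
          have eq': "concat \<phi>ss @ map (insert F) (\<beta>E @ \<beta>R) = us @ \<psi> # vs" using eq by simp
          then obtain us1 where us: "us = concat \<phi>ss @ us1" "map (insert F) (\<beta>E @ \<beta>R) = us1 @ \<psi> # vs"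
            using append_eq_append_split[OF eq'] False by auto
          obtain us' \<beta> vs' where split: "\<beta>E @ \<beta>R = us' @ \<beta> # vs'" "us1 = map (insert F) us'" "\<psi> = insert F \<beta>"
            using us(2) unfolding map_eq_append_conv map_eq_Cons_conv by blast
          have bB: "\<beta> \<in> set (\<beta>E @ \<beta>R)" and usB: "set us' \<subseteq> set (\<beta>E @ \<beta>R)" unfolding split(1) by auto
          \<comment> \<open>Adding \<open>F\<close> raises all intersections of flags of hyperplanes
            by one element, so the shelling of those flags shells the new ones among
            themselves.\<close>
          have lift: "\<exists>z\<in>set us. insert F (\<alpha> \<inter> \<beta>) \<subseteq> z \<inter> \<psi> \<and> card (z \<inter> \<psi>) + 1 = Suc k" if a: "\<alpha> \<in> set us'" for \<alpha>
          proof -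
            obtain z where z: "z \<in> set us'" "\<alpha> \<inter> \<beta> \<subseteq> z \<inter> \<beta>" "card (z \<inter> \<beta>) + 1 = k"
              using b(2) a unfolding bs split(1) shelled_def by blast
            have "insert F z \<inter> \<psi> = insert F (z \<inter> \<beta>)" unfolding split(3) by blast
            moreover have "card (insert F (z \<inter> \<beta>)) = Suc (card (z \<inter> \<beta>))"
              using inB[OF bB] finflag by (intro card_insert_disjoint) auto
            moreover have "insert F z \<in> set us" using z(1) us(1) split(2) by simp
            ultimately show ?thesis using z(2,3) by (intro bexI[of _ "insert F z"]) auto
          qed
          consider "y \<in> insert F ` set us'" | "y \<in> set (concat \<phi>ss)" using y us(1) split(2) by auto
          then show ?thesis
          proof cases
            case 1
            then obtain \<alpha> where "\<alpha> \<in> set us'" "y = insert F \<alpha>" by blast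
            moreover have "insert F \<alpha> \<inter> \<psi> = insert F (\<alpha> \<inter> \<beta>)" unfolding split(3) by blast
            ultimately show ?thesis using lift by metis
          next
            case 2
            have y\<psi>: "y \<inter> \<psi> = y \<inter> \<beta>" using inP[OF 2] split(3) by blast
            show ?thesis
            proof (cases "length us' < length \<beta>E")
              case True
              then obtain ws where ws: "\<beta>E = us' @ ws" "\<beta> # vs' = ws @ \<beta>R"
                using append_eq_append_split[OF split(1)[symmetric]] by auto
              then have "ws \<noteq> []" using True by auto
              then have "\<beta> \<in> set ws" using ws(2) by (cases ws) auto
              then have "\<beta> \<in> set \<beta>E" using ws(1) by simp
              then obtain H where H: "H \<in> set Es" "\<beta> \<in> flags H" unfolding setE by blast
              \<comment> \<open>The flag \<open>\<beta>\<close> ends in a hyperplane inside an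
                earlier facet \<open>G\<close>. The flag that replaces \<open>F\<close> by
                \<open>G\<close> comes earlier and meets \<open>\<psi>\<close> exactly in
                \<open>\<beta>\<close>, which contains every intersection with an old flag.\<close>
              then obtain G where G: "G \<in> set Fs" "H \<subseteq> G" and Hh: "H \<in> hyperplanes F" using Es(1) by (auto simp: ES_def)
              have "vec.dim H + 1 = vec.dim G" using hyp(3)[OF Hh] Fs(2)[OF G(1)] by simp
              then have "insert G \<beta> \<in> flags G"
                by (rule insert_flag(1)[OF Fs(1)[OF G(1)] hyp(1)[OF Hh] G(2) _ H(2)])
              then have "insert G \<beta> \<in> set us" using G(1) us(1) setP by auto
              moreover have "insert G \<beta> \<inter> \<psi> = \<beta>" using Fnot G(1) inB[OF bB] unfolding split(3) by auto
              moreover have "card \<beta> = k" using H(2) hyp(3)[OF Hh] by (simp add: flags_def)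
              ultimately show ?thesis using y\<psi> by (intro bexI[of _ "insert G \<beta>"]) auto
            next
              case False
              then have E_us: "set \<beta>E \<subseteq> set us'"
                using append_eq_append_split[OF split(1)] by auto
              obtain G where G: "G \<in> set Fs" "y \<in> flags G" using 2 unfolding setP by blast
              \<comment> \<open>Now all flags of the hyperplanes in \<open>Es\<close> precede
                \<open>\<beta>\<close>. The shelling puts the common part of \<open>y\<close> and
                \<open>\<beta>\<close> in such a hyperplane \<open>G' \<inter> F\<close>, so it
                extends to one of those flags, \<open>\<gamma>\<close>, to which \<open>lift\<close>
                applies.\<close>
              obtain G' where G': "G' \<in> set Fs" "G \<inter> F \<subseteq> G' \<inter> F" "vec.dim (G' \<inter> F) + 1 = Suc k"
                using shelled_snocD[OF snoc.prems(1) G(1)] by blast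
              let ?H = "G' \<inter> F"
              have sH: "vec.subspace ?H" by (rule vec.subspace_inter[OF Fs(1)[OF G'(1)] F(1)])
              then have HE: "?H \<in> set Es" using G'(1,3) F(2) unfolding Es(1) ES_def hyperplanes_def by auto
              obtain H\<beta> where "H\<beta> \<in> hyperplanes F" "\<beta> \<in> flags H\<beta>" using bB unfolding setB by blast
              then have b_sub: "V \<subseteq> F" if "V \<in> \<beta>" for V
                using that by (auto simp: flags_def order_chains_def subspaces_in_def hyperplanes_def)
              have "y \<inter> \<beta> \<in> order_chains (subspaces_in ?H)"
                using G(2) G'(2) b_sub unfolding flags_def order_chains_def subspaces_in_def by blast
              then obtain \<gamma> where g: "\<gamma> \<in> flags ?H" "y \<inter> \<beta> \<subseteq> \<gamma>" using extend_to_flag[OF sH] by blast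
              then have "\<gamma> \<in> set us'" using HE setE E_us by blast
              from lift[OF this] obtain z where "z \<in> set us" "insert F (\<gamma> \<inter> \<beta>) \<subseteq> z \<inter> \<psi>" "card (z \<inter> \<psi>) + 1 = Suc k" by blast
              moreover have "y \<inter> \<psi> \<subseteq> \<gamma> \<inter> \<beta>" using g(2) y\<psi> by blast
              ultimately show ?thesis by blast
            qed
          qed
        qed
      qed
    qed
  qed
qed

subsection \<open>Shelled complexes are wedges of spheres up to homotopy\<close>

text \<open>A facet of a shelling which is attached along its whole boundary is left aside; coning off any other
  facet is an elementary expansion. \<open>N\<close> is the set of facets of the second kind.\<close>

lemma shelling_cone:
  fixes K :: "nat set set"
  assumes K: "simplicial_complex K" "0 \<notin> \<Union>K"
    and "shelled card (Suc d) ys" "\<And>\<sigma>. \<sigma> \<in> set ys \<Longrightarrow> \<sigma> \<in> K \<and> card \<sigma> = Suc d"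
  shows "\<exists>N\<subseteq>set ys. (\<forall>\<sigma>\<in>set ys. \<forall>A. A \<subseteq> \<sigma> \<longrightarrow> A \<notin> set ys - N \<longrightarrow> (\<exists>\<tau>\<in>N. A \<subseteq> \<tau>)) \<and> (ys \<noteq> [] \<longrightarrow> N \<noteq> {}) \<and>
     homotopy_equivalence (geo K) (geo (K \<union> {B. 0 \<in> B \<and> (\<exists>\<tau>\<in>N. B - {0} \<subseteq> \<tau>)})) (\<lambda>x. x)"
  using assms(3,4)
proof (induction ys rule: rev_induct)
  case Nil
  have "homeomorphic_map (geo K) (geo K) (\<lambda>x. x)" using homeomorphic_map_id[of "geo K" "geo K"] by (simp add: id_def)
  then show ?case using homeomorphic_imp_homotopy_equivalence by fastforce
next
  case (snoc \<sigma> ys)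
  obtain N where N: "N \<subseteq> set ys" "\<And>\<rho> A. \<rho> \<in> set ys \<Longrightarrow> A \<subseteq> \<rho> \<Longrightarrow> A \<notin> set ys - N \<Longrightarrow> \<exists>\<tau>\<in>N. A \<subseteq> \<tau>"
    "ys \<noteq> [] \<longrightarrow> N \<noteq> {}"
    "homotopy_equivalence (geo K) (geo (K \<union> {B. 0 \<in> B \<and> (\<exists>\<tau>\<in>N. B - {0} \<subseteq> \<tau>)})) (\<lambda>x. x)"
    using snoc.IH shelled_appendD[OF snoc.prems(1)] snoc.prems(2) by (metis (no_types, lifting) UnCI set_append)
  have ysK: "\<rho> \<in> K" "card \<rho> = Suc d" if "\<rho> \<in> set ys" for \<rho> using snoc.prems(2)[of \<rho>] that by auto
  have sK: "\<sigma> \<in> K" "card \<sigma> = Suc d" using snoc.prems(2)[of \<sigma>] by auto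
  have fs: "finite \<sigma>" by (rule simplicial_complexD(1)[OF K(1) sK(1)])
  have snot: "\<sigma> \<notin> set ys" using shelled_notin[OF snoc.prems(1)] sK(2) by simp
  have zero: "0 \<notin> A" if "A \<in> K" for A using K(2) that by blast
  \<comment> \<open>The restriction of \<open>\<sigma>\<close>, its least new face: by
    \<open>old\<close>, a face of \<open>\<sigma>\<close> is new exactly if it contains
    \<open>R\<close>.\<close>
  define R where "R = {v \<in> \<sigma>. \<exists>\<tau>\<in>set ys. \<sigma> - {v} \<subseteq> \<tau>}"
  have old: "(\<exists>\<tau>\<in>set ys. A \<subseteq> \<tau>) \<longleftrightarrow> \<not> R \<subseteq> A" if A: "A \<subseteq> \<sigma>" for A
  proof
    assume "\<exists>\<tau>\<in>set ys. A \<subseteq> \<tau>"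
    then obtain \<tau> z where t: "\<tau> \<in> set ys" "A \<subseteq> \<tau>" "z \<in> set ys" "\<tau> \<inter> \<sigma> \<subseteq> z \<inter> \<sigma>" "card (z \<inter> \<sigma>) + 1 = Suc d"
      using shelled_snocD[OF snoc.prems(1)] by blast
    have "card (\<sigma> - z) = 1" using card_Diff_subset_Int[of \<sigma> z] fs sK(2) t(5) by (simp add: Int_commute)
    then obtain v where v: "\<sigma> - z = {v}" by (auto simp: card_1_singleton_iff)
    then have "v \<in> R" "v \<notin> A" using t A unfolding R_def by blast+
    then show "\<not> R \<subseteq> A" by blast
  next
    assume "\<not> R \<subseteq> A"
    then show "\<exists>\<tau>\<in>set ys. A \<subseteq> \<tau>" using A unfolding R_def by blast
  qed
  have Rs: "R \<subseteq> \<sigma>" by (auto simp: R_def)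
  \<comment> \<open>A face of \<open>\<sigma>\<close> is never an earlier facet: these have as many
    vertices as \<open>\<sigma>\<close> and differ from it.\<close>
  have proper: "A \<notin> set ys - N" if "A \<subseteq> \<sigma>" for A
    using card_subset_eq[OF fs that] ysK(2)[of A] sK(2) snot by auto
  show ?case
  \<comment> \<open>If \<open>R = \<sigma>\<close>, all proper faces are old, and
    \<open>\<sigma>\<close> becomes one of the cells. Otherwise a vertex outside \<open>R\<close>
    makes coning off \<open>\<sigma>\<close> an expansion.\<close>
  proof (cases "R = \<sigma>")
    case True
    have "\<exists>\<tau>\<in>N. A \<subseteq> \<tau>" if a: "\<rho> \<in> set (ys @ [\<sigma>])" "A \<subseteq> \<rho>" "A \<notin> set (ys @ [\<sigma>]) - N" for \<rho> A
    proof -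
      have "A \<noteq> \<sigma>" "A \<notin> set ys - N" using a(3) snot N(1) by auto
      moreover have "\<exists>\<tau>\<in>set ys. A \<subseteq> \<tau>"
        using a(1,2) old[of A] True \<open>A \<noteq> \<sigma>\<close> by auto
      ultimately show ?thesis using N(2) by blast
    qed
    moreover have "N \<noteq> {}"
    proof -
      have "\<sigma> \<noteq> {}" using sK(2) by auto
      then have "ys \<noteq> []" using True by (auto simp: R_def)
      then show ?thesis using N(3) by blast
    qed
    moreover have "N \<subseteq> set (ys @ [\<sigma>])" using N(1) by auto
    ultimately show ?thesis using N(4) by blast
  next
    case False
    let ?L = "K \<union> {B. 0 \<in> B \<and> (\<exists>\<tau>\<in>insert \<sigma> N. B - {0} \<subseteq> \<tau>)}"
    let ?M = "K \<union> {B. 0 \<in> B \<and> (\<exists>\<tau>\<in>N. B - {0} \<subseteq> \<tau>)}"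
    have NK: "\<tau> \<in> K" if "\<tau> \<in> insert \<sigma> N" for \<tau> using that N(1) ysK sK by blast
    have cL: "simplicial_complex ?L"
      unfolding simplicial_complex_def
    proof (intro conjI ballI allI impI)
      have "B \<subseteq> insert 0 (\<Union>K)" if B: "B \<in> ?L" for B
      proof (cases "B \<in> K")
        case False
        then obtain \<tau> where "\<tau> \<in> insert \<sigma> N" "B - {0} \<subseteq> \<tau>" using B by blast
        then show ?thesis using NK[of \<tau>] by blast
      qed blast
      then have "\<Union>?L \<subseteq> insert 0 (\<Union>K)" by (rule Union_least)
      then show "finite (\<Union>?L)" by (rule finite_subset) (use K(1) in \<open>simp add: simplicial_complex_def\<close>)
      fix B C assume B: "B \<in> ?L" "C \<subseteq> B"
      show "C \<in> ?L"
      proof (cases "B \<in> K")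
        case True then show ?thesis using simplicial_complexD(2)[OF K(1)] B(2) by blast
      next
        case False
        then obtain \<tau> where t: "\<tau> \<in> insert \<sigma> N" "B - {0} \<subseteq> \<tau>" using B(1) by blast
        have sub: "C - {0} \<subseteq> \<tau>" using t(2) B(2) by blast
        show ?thesis
        proof (cases "0 \<in> C")
          case True
          have "\<exists>\<tau>\<in>insert \<sigma> N. C - {0} \<subseteq> \<tau>" using sub t(1) by (rule bexI)
          with True have "0 \<in> C \<and> (\<exists>\<tau>\<in>insert \<sigma> N. C - {0} \<subseteq> \<tau>)" by (rule conjI)
          then show ?thesis by (intro UnI2 CollectI)
        next
          case False
          then have "C \<subseteq> \<tau>" using sub by blast
          then have "C \<in> K" by (rule simplicial_complexD(2)[OF K(1) NK[OF t(1)]])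
          then show ?thesis by (rule UnI1)
        qed
      qed
    qed
    have notR: "\<not> R \<subseteq> \<tau>" if "\<tau> \<in> N" for \<tau> using old[OF Rs] N(1) that by blast
    \<comment> \<open>The faces added by the cone over \<open>\<sigma>\<close> are those containing
      0 and \<open>R\<close>: any other face of it through 0 has its base in an earlier facet, and
      therefore in a member of \<open>N\<close>.\<close>
    have L0: "{B \<in> ?L. \<not> insert 0 R \<subseteq> B} = ?M"
    proof
      show "{B \<in> ?L. \<not> insert 0 R \<subseteq> B} \<subseteq> ?M"
      proof
        fix B assume "B \<in> {B \<in> ?L. \<not> insert 0 R \<subseteq> B}"
        then have B: "B \<in> ?L" "\<not> insert 0 R \<subseteq> B" by simp_all
        show "B \<in> ?M"
        proof (rule ccontr)
          assume "B \<notin> ?M"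
          then have s: "0 \<in> B" "B - {0} \<subseteq> \<sigma>" "\<not> (\<exists>\<tau>\<in>N. B - {0} \<subseteq> \<tau>)" using B(1) by simp_all
          then have "\<not> R \<subseteq> B - {0}" using B(2) by blast
          then have "\<exists>\<rho>\<in>set ys. B - {0} \<subseteq> \<rho>" by (rule iffD2[OF old[OF s(2)]])
          then obtain \<rho> where "\<rho> \<in> set ys" "B - {0} \<subseteq> \<rho>" by (rule bexE)
          from N(2)[OF this proper[OF s(2)]] s(3) show False by (rule notE[rotated])
        qed
      qed
      have "\<not> insert 0 R \<subseteq> B" if B: "B \<in> ?M" for B
      proof (cases "B \<in> K")
        case True then show ?thesis using zero[OF True] by simp
      next
        case False
        then have "\<exists>\<tau>\<in>N. B - {0} \<subseteq> \<tau>" using B by simp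
        then obtain \<tau> where t: "\<tau> \<in> N" "B - {0} \<subseteq> \<tau>" by (rule bexE)
        have "0 \<notin> R" using Rs zero[OF sK(1)] by blast
        then have "R \<subseteq> \<tau>" if "insert 0 R \<subseteq> B" using t(2) that by blast
        then show ?thesis using notR[OF t(1)] by iprover
      qed
      moreover have "B \<in> ?L" if "B \<in> ?M" for B using that by simp blast
      ultimately show "?M \<subseteq> {B \<in> ?L. \<not> insert 0 R \<subseteq> B}" by (intro subsetI CollectI conjI)
    qed
    obtain v where v: "v \<in> \<sigma>" "v \<notin> R" using False Rs by blast
    have "homotopy_equivalence (geo {B \<in> ?L. \<not> insert 0 R \<subseteq> B}) (geo ?L) (\<lambda>x. x)"
    proof (rule homotopy_equivalence_expansion[OF cL, of _ "insert 0 \<sigma>" v])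
      show "insert 0 R \<subseteq> insert 0 \<sigma>" "v \<in> insert 0 \<sigma>" "insert 0 \<sigma> \<in> ?L" using Rs v by auto
      show "v \<notin> insert 0 R" using v zero[OF sK(1)] by (metis insertE)
      fix B assume B: "B \<in> ?L" "insert 0 R \<subseteq> B"
      then have "B \<notin> ?M" unfolding L0[symmetric] by simp
      then have "B - {0} \<subseteq> \<sigma>" using B(1) by simp
      then show "B \<subseteq> insert 0 \<sigma>" by blast
    qed simp
    then have "homotopy_equivalence (geo ?M) (geo ?L) (\<lambda>x. x)" unfolding L0 .
    from homotopy_equivalence_compose[OF N(4) this]
    have he: "homotopy_equivalence (geo K) (geo ?L) (\<lambda>x. x)" by (simp add: o_def)
    have "\<exists>\<tau>\<in>insert \<sigma> N. A \<subseteq> \<tau>" if a: "\<rho> \<in> set (ys @ [\<sigma>])" "A \<subseteq> \<rho>" "A \<notin> set (ys @ [\<sigma>]) - insert \<sigma> N" for \<rho> A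
    proof (cases "A \<subseteq> \<sigma>")
      case False
      then have "\<rho> \<in> set ys" "A \<notin> set ys - N" using a by auto
      then show ?thesis using N(2) a(2) by blast
    qed blast
    moreover have "insert \<sigma> N \<subseteq> set (ys @ [\<sigma>])" using N(1) by auto
    ultimately show ?thesis using he by (intro exI[of _ "insert \<sigma> N"] conjI ballI allI impI) simp_all
  qed
qed

text \<open>The facets in \<open>N\<close> generate the base \<open>K'\<close> of the cone, and the
  others are the cells. A proper face of a cell is no facet, so it lies in a member of
  \<open>N\<close>. The cells are enumerated increasingly, as needed for maps of ordered
  complexes.\<close>

lemma shelled_coned_complex:
  fixes xs :: "nat set list"
  assumes sh: "shelled card (Suc d) xs" and xs: "xs \<noteq> []"
    "\<And>\<sigma>. \<sigma> \<in> set xs \<Longrightarrow> finite \<sigma> \<and> card \<sigma> = Suc d \<and> 0 \<notin> \<sigma>"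
  defines "K \<equiv> {A. \<exists>\<sigma>\<in>set xs. A \<subseteq> \<sigma>}"
  obtains K' en m where "coned_complex K' en m d" "\<And>i j j'. i < m \<Longrightarrow> j < j' \<Longrightarrow> j' \<le> d \<Longrightarrow> en i j < en i j'"
    "K \<subseteq> coned_complex.L K' en m d"
    "homotopy_equivalence (geo K) (geo (coned_complex.L K' en m d)) (\<lambda>x. x)"
proof -
  have "\<Union>K \<subseteq> \<Union>(set xs)" unfolding K_def by blast
  moreover have "finite (\<Union>(set xs))" using xs(2) by blast
  ultimately have "finite (\<Union>K)" by (rule finite_subset)
  then have cK: "simplicial_complex K" unfolding simplicial_complex_def K_def by blast
  have K0: "0 \<notin> \<Union>K" using xs(2) unfolding K_def by blast
  have xsK: "\<sigma> \<in> K \<and> card \<sigma> = Suc d" if "\<sigma> \<in> set xs" for \<sigma> using that xs(2) unfolding K_def by blast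
  obtain N where N: "N \<subseteq> set xs" "\<And>\<rho> A. \<rho> \<in> set xs \<Longrightarrow> A \<subseteq> \<rho> \<Longrightarrow> A \<notin> set xs - N \<Longrightarrow> \<exists>\<tau>\<in>N. A \<subseteq> \<tau>"
    "N \<noteq> {}" "homotopy_equivalence (geo K) (geo (K \<union> {B. 0 \<in> B \<and> (\<exists>\<tau>\<in>N. B - {0} \<subseteq> \<tau>)})) (\<lambda>x. x)"
  proof -
    from shelling_cone[OF cK K0 sh xsK] obtain N where NN: "N \<subseteq> set xs \<and> (\<forall>\<sigma>\<in>set xs. \<forall>A. A \<subseteq> \<sigma> \<longrightarrow> A \<notin> set xs - N \<longrightarrow> (\<exists>\<tau>\<in>N. A \<subseteq> \<tau>)) \<and> (xs \<noteq> [] \<longrightarrow> N \<noteq> {}) \<and>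
       homotopy_equivalence (geo K) (geo (K \<union> {B. 0 \<in> B \<and> (\<exists>\<tau>\<in>N. B - {0} \<subseteq> \<tau>)})) (\<lambda>x. x)"
      by (rule exE)
    note N1 = conjunct1[OF NN] note N2 = conjunct1[OF conjunct2[OF NN]]
    note N3 = conjunct1[OF conjunct2[OF conjunct2[OF NN]]] note N4 = conjunct2[OF conjunct2[OF conjunct2[OF NN]]]
    show thesis
    proof (rule that)
      show "N \<subseteq> set xs" by (rule N1)
      show "\<exists>\<tau>\<in>N. A \<subseteq> \<tau>" if "\<rho> \<in> set xs" "A \<subseteq> \<rho>" "A \<notin> set xs - N" for \<rho> A
        using N2[rule_format, OF that] .
      show "N \<noteq> {}" using N3 xs(1) by (rule mp)
    qed (rule N4)
  qed
  define K' where "K' = {A. \<exists>\<tau>\<in>N. A \<subseteq> \<tau>}"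
  define m where "m = card (set xs - N)"
  obtain c where c: "bij_betw c {..<m} (set xs - N)"
    unfolding m_def using ex_bij_betw_nat_finite[of "set xs - N"] by (auto simp: atLeast0LessThan)
  define en where "en = (\<lambda>i j. sorted_list_of_set (c i) ! j)"
  have ci: "c i \<in> set xs" "c i \<notin> N" "finite (c i)" "card (c i) = Suc d" "0 \<notin> c i" if "i < m" for i
    using bij_betwE[OF c] that xs(2) by blast+
  have len: "length (sorted_list_of_set (c i)) = Suc d" if "i < m" for i using ci[OF that] by simp
  have en_img: "en i ` {..d} = c i" if "i < m" for i
  proof -
    have "en i ` {..d} = set (sorted_list_of_set (c i))"
      unfolding en_def set_conv_nth len[OF that] by (auto simp: less_Suc_eq_le)
    then show ?thesis using ci[OF that] by simp
  qed
  have mono: "en i j < en i j'" if "i < m" "j < j'" "j' \<le> d" for i j j'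
    unfolding en_def using sorted_wrt_nth_less[OF strict_sorted_list_of_set[of "c i"]] len[OF that(1)] that by simp
  have K'sub: "K' \<subseteq> K" using N(1) unfolding K_def K'_def by blast
  interpret coned_complex K' en m d
  proof
    show "simplicial_complex K'"
      unfolding simplicial_complex_def
    proof
      show "finite (\<Union>K')" using K'sub cK finite_subset[of "\<Union>K'" "\<Union>K"] by (auto simp: simplicial_complex_def)
    qed (auto simp: K'_def)
    show "{} \<in> K'" using N(3) by (auto simp: K'_def)
    show "0 \<notin> \<Union>K'" using K0 K'sub by blast
  next
    fix i assume i: "i < m"
    show "inj_on (en i) {..d}"
    proof (rule inj_onI)
      fix x y assume "x \<in> {..d}" "y \<in> {..d}" "en i x = en i y"
      then show "x = y" using mono[OF i, of x y] mono[OF i, of y x] by (cases x y rule: linorder_cases) auto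
    qed
    show "en i ` {..d} \<notin> K'"
    proof
      assume "en i ` {..d} \<in> K'"
      then obtain \<tau> where t: "\<tau> \<in> N" "c i \<subseteq> \<tau>" unfolding en_img[OF i] K'_def by blast
      then have "finite \<tau>" "card \<tau> = Suc d" using xs(2) N(1) by blast+
      then have "c i = \<tau>" using card_subset_eq[OF _ t(2)] ci[OF i] by simp
      then show False using t ci[OF i] by simp
    qed
    fix j assume "j \<le> d"
    then have "en i j \<in> c i" using en_img[OF i] by blast
    then show "en i j \<noteq> 0" using ci[OF i] by metis
  next
    fix i A assume i: "i < m" and A: "A \<subset> en i ` {..d}"
    then have A: "A \<subset> c i" using en_img by simp
    have "card A < Suc d" using psubset_card_mono[OF _ A] ci[OF i] by simp
    then have "A \<notin> set xs" using xs(2) by fastforce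
    then show "A \<in> K'" using N(2)[OF ci(1)[OF i]] A unfolding K'_def by blast
  next
    fix i i' assume "i < m" "i' < m" "en i ` {..d} = en i' ` {..d}"
    then show "i = i'" using en_img bij_betw_imp_inj_on[OF c] by (simp add: inj_on_def)
  qed
  have "L = K \<union> {B. 0 \<in> B \<and> (\<exists>\<tau>\<in>N. B - {0} \<subseteq> \<tau>)}"
  proof
    show "L \<subseteq> K \<union> {B. 0 \<in> B \<and> (\<exists>\<tau>\<in>N. B - {0} \<subseteq> \<tau>)}"
    proof
      fix B assume "B \<in> L"
      then consider "B - {0} \<in> K'" | i where "i < m" "B = c i" unfolding L_def using en_img by blast
      then show "B \<in> K \<union> {B. 0 \<in> B \<and> (\<exists>\<tau>\<in>N. B - {0} \<subseteq> \<tau>)}"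
      proof cases
        case 1
        then obtain \<tau> where t: "\<tau> \<in> N" "B - {0} \<subseteq> \<tau>" by (auto simp: K'_def)
        show ?thesis
        proof (cases "0 \<in> B")
          case True
          then show ?thesis using t by blast
        next
          case False
          then have "B \<in> K" using 1 K'sub by auto
          then show ?thesis by blast
        qed
      next
        case 2
        then show ?thesis using ci(1) unfolding K_def by blast
      qed
    qed
    show "K \<union> {B. 0 \<in> B \<and> (\<exists>\<tau>\<in>N. B - {0} \<subseteq> \<tau>)} \<subseteq> L"
    proof
      fix B assume B: "B \<in> K \<union> {B. 0 \<in> B \<and> (\<exists>\<tau>\<in>N. B - {0} \<subseteq> \<tau>)}"
      show "B \<in> L"
      proof (cases "B \<in> K")
        case True
        then obtain \<sigma> where s: "\<sigma> \<in> set xs" "B \<subseteq> \<sigma>" unfolding K_def by blast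
        show ?thesis
        proof (cases "B \<in> set xs - N")
          case True
          then obtain i where "i < m" "B = c i" using bij_betw_imp_surj_on[OF c] by blast
          then show ?thesis unfolding L_def using en_img by blast
        next
          case False
          then have "B - {0} \<in> K'" using N(2)[OF s] unfolding K'_def by blast
          then show ?thesis by (simp add: L_def)
        qed
      next
        case False
        then have "B - {0} \<in> K'" using B unfolding K'_def by blast
        then show ?thesis by (simp add: L_def)
      qed
    qed
  qed
  then show thesis using that[of K' en m] coned_complex_axioms mono N(4) by auto
qed

section \<open>Assembling the three models of the homotopy type\<close>

subsection \<open>Composites of weak equivalences and copies of spaces\<close>

lemma weak_homotopy_equivalence_compose:
  assumes f: "weak_homotopy_equivalence X Y f" and g: "weak_homotopy_equivalence Y Z g"
  shows "weak_homotopy_equivalence X Z (g \<circ> f)"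
  unfolding weak_homotopy_equivalence_def
proof (intro conjI allI impI ballI)
  have cf: "continuous_map X Y f" and cg: "continuous_map Y Z g"
    using f g by (auto simp: weak_homotopy_equivalence_def)
  then show cgf: "continuous_map X Z (g \<circ> f)" by (rule continuous_map_compose)
  have fX: "f x \<in> topspace Y" if "x \<in> topspace X" for x using cf that by (auto simp: continuous_map_def)
  have "bij_betw (induced_components Z g \<circ> induced_components Y f) (path_components_of X) (path_components_of Z)"
    using f g by (intro bij_betw_trans) (auto simp: weak_homotopy_equivalence_def)
  then show "bij_betw (induced_components Z (g \<circ> f)) (path_components_of X) (path_components_of Z)"
    by (rule bij_betw_cong[THEN iffD1, rotated])
       (auto simp: path_components_of_def induced_components_component[OF cf] induced_components_component[OF cg]
          induced_components_component[OF cgf] fX)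
  fix n :: nat and x assume n: "1 \<le> n" and x: "x \<in> topspace X"
  have "bij_betw (induced_homotopy n Z g (f x) \<circ> induced_homotopy n Y f x) (homotopy_group n X x) (homotopy_group n Z (g (f x)))"
    using f g n x fX by (intro bij_betw_trans) (auto simp: weak_homotopy_equivalence_def)
  moreover have "induced_homotopy n Z (g \<circ> f) x C = (induced_homotopy n Z g (f x) \<circ> induced_homotopy n Y f x) C"
    if C: "C \<in> homotopy_group n X x" for C
  proof -
    obtain u where u: "u \<in> sphere_maps n X x" "C = sphere_homotopy n X x `` {u}"
      using C by (auto simp: homotopy_group_def quotient_def)
    have "f \<circ> u \<in> sphere_maps n Y (f x)" using u(1) cf by (auto simp: sphere_maps_def intro: continuous_map_compose)
    then show ?thesis
      unfolding u(2) using induced_homotopy_class[OF cgf u(1)] induced_homotopy_class[OF cf u(1)] induced_homotopy_class[OF cg]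
      by (simp add: o_assoc)
  qed
  ultimately show "bij_betw (induced_homotopy n Z (g \<circ> f) x) (homotopy_group n X x) (homotopy_group n Z ((g \<circ> f) x))"
    using bij_betw_cong[of "homotopy_group n X x" "induced_homotopy n Z (g \<circ> f) x"] by (metis comp_apply)
qed

text \<open>The apex \<open>W\<close> may have any type; its topology is transported along the
  injection \<open>j\<close> to the type prescribed in the definition.\<close>

lemma same_weak_homotopy_typeI:
  fixes X :: "'a topology" and j :: "'c \<Rightarrow> ('a \<times> real) set"
  assumes f: "weak_homotopy_equivalence W X f" and g: "weak_homotopy_equivalence W Y g" and j: "inj_on j (topspace W)"
  shows "same_weak_homotopy_type X Y"
proof -
  define r where "r = inv_into (topspace W) j"
  define Z where "Z = pullback_topology (j ` topspace W) r W"
  have rj: "r (j x) = x" if "x \<in> topspace W" for x using inv_into_f_f[OF j that] by (simp add: r_def)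
  have Z: "topspace Z = j ` topspace W" using rj by (auto simp: Z_def topspace_pullback_topology)
  have "continuous_map Z W r"
    using continuous_map_pullback[OF continuous_map_id, of "j ` topspace W" r W] by (simp add: Z_def)
  moreover have "continuous_map W Z j"
    unfolding Z_def by (rule continuous_map_pullback') (use rj in \<open>auto intro: continuous_map_eq[OF continuous_map_id]\<close>)
  ultimately have "homeomorphic_maps Z W r j"
    unfolding homeomorphic_maps_def using rj Z by auto
  then have "weak_homotopy_equivalence Z W r"
    using homeomorphic_map_maps homeomorphic_imp_homotopy_equivalence homotopy_equivalence_imp_weak by blast
  from weak_homotopy_equivalence_compose[OF this f] weak_homotopy_equivalence_compose[OF this g]
  show ?thesis unfolding same_weak_homotopy_type_def by (intro exI conjI)
qed

lemma sorted_wrt_del_nth: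
  assumes "sorted_wrt R xs" "i < length xs"
  shows "sorted_wrt R (del_nth i xs)"
  unfolding sorted_wrt_iff_nth_less
proof (intro allI impI)
  fix a b assume ab: "a < b" "b < length (del_nth i xs)"
  have "(if a < i then a else Suc a) < (if b < i then b else Suc b)" using ab(1) by auto
  then show "R (del_nth i xs ! a) (del_nth i xs ! b)"
    using ab assms by (simp add: nth_del_nth length_del_nth sorted_wrt_nth_less del: if_split cong: if_cong)
qed

lemma sorted_wrt_dup_nth:
  fixes xs :: "'a::order list"
  assumes "sorted_wrt (\<le>) xs" "i < length xs"
  shows "sorted_wrt (\<le>) (dup_nth i xs)"
proof -
  have "dup_nth i xs = take i xs @ xs ! i # xs ! i # drop (Suc i) xs"
    using assms(2) by (simp add: dup_nth_def take_Suc_conv_app_nth Cons_nth_drop_Suc)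
  moreover have "sorted_wrt (\<le>) (take i xs @ xs ! i # drop (Suc i) xs)" using assms id_take_nth_drop[of i xs] by simp
  ultimately show ?thesis by (auto simp: sorted_wrt_append)
qed

lemma set_del_nth: "set (del_nth i xs) \<subseteq> set xs"
  by (auto simp: del_nth_def dest: in_set_takeD in_set_dropD)

lemma set_dup_nth: "set (dup_nth i xs) = set xs"
proof -
  have "set xs = set (take (Suc i) xs) \<union> set (drop (Suc i) xs)" by (metis append_take_drop_id set_append)
  moreover have "set (drop (Suc i) xs) \<subseteq> set (drop i xs)" by (rule set_drop_subset_set_drop) simp
  moreover have "set (drop i xs) \<subseteq> set xs" by (rule set_drop_subset)
  ultimately show ?thesis by (auto simp: dup_nth_def)
qed

subsection \<open>Nerves\<close>

text \<open>On a chain, a linear extension is an order isomorphism onto its image, so weakly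
  increasing lists in the poset correspond to sorted lists of numbers supported on the image of a
  chain.\<close>

lemma vertex_presentation_nerve:
  fixes P :: "'a::order set" and e :: "'a \<Rightarrow> nat"
  assumes P: "finite P" and inj: "inj_on e P" and mono: "\<And>a b. a \<in> P \<Longrightarrow> b \<in> P \<Longrightarrow> a < b \<Longrightarrow> e a < e b"
  shows "vertex_presentation (nerve P) (map e) ((`) e ` order_chains P)"
proof
  show "simplicial_complex ((`) e ` order_chains P)"
    unfolding simplicial_complex_def
  proof (intro conjI ballI allI impI)
    have "\<Union>((`) e ` order_chains P) \<subseteq> e ` P" by (auto simp: order_chains_def)
    then show "finite (\<Union>((`) e ` order_chains P))" by (rule finite_subset) (use P in simp)
    fix A B assume "A \<in> (`) e ` order_chains P" "B \<subseteq> A"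
    then obtain C D where "C \<in> order_chains P" "D \<subseteq> C" "B = e ` D" by (metis imageE subset_imageE)
    then show "B \<in> (`) e ` order_chains P" using order_chains_subset by blast
  qed
next
  fix n
  have le: "a \<le> b" if "a \<in> P" "b \<in> P" "a \<le> b \<or> b \<le> a" "e a \<le> e b" for a b
    using mono[of b a] that by (metis leD order_le_less)
  have le': "e a \<le> e b" if "a \<in> P" "b \<in> P" "a \<le> b" for a b
    using mono[of a b] that by (metis order_le_less)
  show "bij_betw (map e) (splx (nerve P) n)
     {xs. length xs = Suc n \<and> sorted xs \<and> set xs \<in> (`) e ` order_chains P}"
  proof (rule bij_betw_imageI)
    have "inj_on (map e) (lists P)" using inj by (rule inj_on_map_lists)
    then show "inj_on (map e) (splx (nerve P) n)"
      by (rule inj_on_subset) (auto simp: nerve_def in_lists_conv_set)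
    show "map e ` splx (nerve P) n = {xs. length xs = Suc n \<and> sorted xs \<and> set xs \<in> (`) e ` order_chains P}"
    proof (intro subset_antisym subsetI)
      fix ys assume "ys \<in> map e ` splx (nerve P) n"
      then obtain xs where xs: "ys = map e xs" "length xs = Suc n" "set xs \<subseteq> P" "sorted_wrt (\<le>) xs"
        by (auto simp: nerve_def)
      have "x \<le> y \<or> y \<le> x" if h: "x \<in> set xs" "y \<in> set xs" for x y
      proof -
        obtain i j where ij: "i < length xs" "j < length xs" "x = xs ! i" "y = xs ! j"
          using h by (auto simp: in_set_conv_nth)
        consider "i < j" | "i = j" | "j < i" by linarith
        then show ?thesis using sorted_wrt_nth_less[OF xs(4)] ij by cases auto
      qed
      then have "set xs \<in> order_chains P" using xs(3) by (auto simp: order_chains_def)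
      moreover have "sorted ys"
        unfolding xs(1) sorted_wrt_map
        by (rule sorted_wrt_mono_rel[OF _ xs(4)]) (use xs(3) le' in blast)
      ultimately show "ys \<in> {xs. length xs = Suc n \<and> sorted xs \<and> set xs \<in> (`) e ` order_chains P}"
        using xs(1,2) by simp
    next
      fix ys assume "ys \<in> {xs. length xs = Suc n \<and> sorted xs \<and> set xs \<in> (`) e ` order_chains P}"
      then have "set ys \<in> (`) e ` order_chains P" and ys: "length ys = Suc n" "sorted ys" by simp_all
      then obtain C where C: "C \<in> order_chains P" "set ys = e ` C" by blast
      have CP: "C \<subseteq> P" using C(1) by (simp add: order_chains_def)
      define xs where "xs = map (inv_into C e) ys"
      have mxs: "map e xs = ys"
        unfolding xs_def map_map by (rule map_idI) (use C(2) in \<open>simp add: f_inv_into_f\<close>)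
      have sC: "set xs \<subseteq> C" unfolding xs_def set_map C(2) by (auto intro: inv_into_into)
      have "sorted_wrt (\<lambda>x y. e x \<le> e y) xs" using ys(2) unfolding mxs[symmetric] sorted_wrt_map .
      then have "sorted_wrt (\<le>) xs"
      proof (rule sorted_wrt_mono_rel[rotated])
        fix x y assume a: "x \<in> set xs" "y \<in> set xs" "e x \<le> e y"
        have "x \<in> C" "y \<in> C" using a sC by auto
        moreover from this have "x \<le> y \<or> y \<le> x" using C(1) by (simp add: order_chains_def)
        ultimately show "x \<le> y" using le CP a(3) by blast
      qed
      moreover have "length xs = Suc n" "set xs \<subseteq> P" using ys(1) sC CP by (auto simp: xs_def)
      ultimately have "xs \<in> splx (nerve P) n" by (simp add: nerve_def)
      then show "ys \<in> map e ` splx (nerve P) n" using mxs by blast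
    qed
  qed
next
  fix n i x assume x: "x \<in> splx (nerve P) (Suc n)" "i \<le> Suc n"
  then show "face (nerve P) n i x \<in> splx (nerve P) n"
    using set_del_nth[of i x] by (auto simp: nerve_def del_nth_def[symmetric] length_del_nth sorted_wrt_del_nth)
  show "map e (face (nerve P) n i x) = del_nth i (map e x)"
    by (simp add: nerve_def del_nth_def take_map drop_map)
next
  fix n i x assume x: "x \<in> splx (nerve P) n" "i \<le> n"
  show "map e (degen (nerve P) n i x) = dup_nth i (map e x)"
    by (simp add: nerve_def dup_nth_def take_map drop_map)
  show "degen (nerve P) n i x \<in> splx (nerve P) (Suc n)"
    using x by (auto simp: nerve_def dup_nth_def[symmetric] length_dup_nth sorted_wrt_dup_nth set_dup_nth)
qed

subsection \<open>Ordered simplicial complexes as simplicial sets\<close>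

text \<open>The two components 0 only give the simplices the type prescribed for the apex in
  \<open>same_weak_homotopy_type_sset\<close>.\<close>

definition complex_sset :: "nat set set \<Rightarrow> (nat \<times> nat \<times> nat list) sset" where
  "complex_sset L =
     \<lparr>splx = (\<lambda>n. (\<lambda>xs. (0, 0, xs)) ` {xs. length xs = Suc n \<and> sorted xs \<and> set xs \<in> L}),
      face = (\<lambda>n i (a, b, xs). (a, b, del_nth i xs)),
      degen = (\<lambda>n i (a, b, xs). (a, b, dup_nth i xs))\<rparr>"

lemma vertex_presentation_complex_sset:
  assumes "simplicial_complex L"
  shows "vertex_presentation (complex_sset L) (snd \<circ> snd) L"
proof
  fix n
  show "bij_betw (snd \<circ> snd) (splx (complex_sset L) n) {xs. length xs = Suc n \<and> sorted xs \<and> set xs \<in> L}"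
    by (rule bij_betwI[of _ _ _ "\<lambda>xs. (0, 0, xs)"]) (auto simp: complex_sset_def)
next
  fix n i x assume x: "x \<in> splx (complex_sset L) (Suc n)" "i \<le> Suc n"
  then obtain xs where xs: "x = (0, 0, xs)" "length xs = Suc (Suc n)" "sorted xs" "set xs \<in> L"
    by (auto simp: complex_sset_def)
  then show "face (complex_sset L) n i x \<in> splx (complex_sset L) n"
    using x(2) by (auto simp: complex_sset_def length_del_nth sorted_wrt_del_nth
        intro!: imageI simplicial_complexD(2)[OF assms xs(4) set_del_nth])
  show "(snd \<circ> snd) (face (complex_sset L) n i x) = del_nth i ((snd \<circ> snd) x)"
    using xs(1) by (simp add: complex_sset_def)
next
  fix n i x assume x: "x \<in> splx (complex_sset L) n" "i \<le> n"
  then obtain xs where xs: "x = (0, 0, xs)" "length xs = Suc n" "sorted xs" "set xs \<in> L"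
    by (auto simp: complex_sset_def)
  then show "degen (complex_sset L) n i x \<in> splx (complex_sset L) (Suc n)"
    using x(2) by (auto simp: complex_sset_def length_dup_nth sorted_wrt_dup_nth set_dup_nth intro!: imageI)
  show "(snd \<circ> snd) (degen (complex_sset L) n i x) = dup_nth i ((snd \<circ> snd) x)"
    using xs(1) by (simp add: complex_sset_def)
qed (rule assms)

lemma presentation_map_complex_sset:
  assumes "vertex_presentation X vl K" "simplicial_complex L"
    and w: "\<And>n x. x \<in> splx X n \<Longrightarrow> sorted (map w (vl x)) \<and> set (map w (vl x)) \<in> L"
  shows "presentation_map X vl K (complex_sset L) (snd \<circ> snd) L (\<lambda>n x. (0, 0, map w (vl x))) w"
proof -
  interpret X: vertex_presentation X vl K by (rule assms)
  interpret Y: vertex_presentation "complex_sset L" "snd \<circ> snd" L by (rule vertex_presentation_complex_sset[OF assms(2)])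
  show ?thesis
  proof
    fix n x assume x: "x \<in> splx X n"
    show "(0, 0, map w (vl x)) \<in> splx (complex_sset L) n"
      using w[OF x] X.vl_props(1)[OF x] by (auto simp: complex_sset_def)
  qed simp
qed

subsection \<open>Wedges of boundaries of simplices\<close>

text \<open>Numbers the vertices of copy \<open>i\<close> of a k-simplex: the base vertices of all
  copies become 0, the others fill consecutive blocks of length \<open>k\<close>.\<close>

definition wedge_vertex :: "nat \<Rightarrow> nat \<Rightarrow> nat \<Rightarrow> nat" where
  "wedge_vertex k i j = (if j = 0 then 0 else i * k + j)"

text \<open>The vertices of the face opposite to the base vertex: \<open>wedge_cell d i j\<close> is
  \<open>wedge_vertex (Suc d) i (Suc j)\<close>.\<close>

definition wedge_cell :: "nat \<Rightarrow> nat \<Rightarrow> nat \<Rightarrow> nat" where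
  "wedge_cell d i j = i * Suc d + Suc j"

text \<open>The empty face is added separately so that the apex survives when
  \<open>m = 0\<close>.\<close>

definition wedge_link :: "nat \<Rightarrow> nat \<Rightarrow> nat set set" where
  "wedge_link m d = {A. A = {} \<or> (\<exists>i<m. A \<subset> wedge_cell d i ` {..d})}"

definition wedge_vertices :: "nat \<Rightarrow> nat \<times> nat list \<Rightarrow> nat list" where
  "wedge_vertices d p = map (wedge_vertex (Suc d) (fst p)) (snd p)"

lemma wedge_cell_eq: "j \<le> d \<Longrightarrow> j' \<le> d \<Longrightarrow> wedge_cell d i j = wedge_cell d i' j' \<Longrightarrow> i = i' \<and> j = j'"
proof -
  assume *: "j \<le> d" "j' \<le> d" "wedge_cell d i j = wedge_cell d i' j'"
  then have eq: "i * Suc d + j = i' * Suc d + j'" by (simp add: wedge_cell_def)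
  have "(i * Suc d + j) div Suc d = i" "(i' * Suc d + j') div Suc d = i'"
    using *(1,2) by (simp_all add: div_mult_self3 del: mult_Suc_right)
  then have "i = i'" using eq by simp
  then show ?thesis using eq by simp
qed

lemma coned_complex_wedge: "coned_complex (wedge_link m d) (wedge_cell d) m d"
proof
  show "simplicial_complex (wedge_link m d)"
    unfolding simplicial_complex_def
  proof (intro conjI ballI allI impI)
    have "\<Union>(wedge_link m d) \<subseteq> (\<Union>i<m. wedge_cell d i ` {..d})" unfolding wedge_link_def by blast
    then show "finite (\<Union>(wedge_link m d))" by (rule finite_subset) simp
    show "B \<in> wedge_link m d" if "A \<in> wedge_link m d" "B \<subseteq> A" for A B
      using that unfolding wedge_link_def by blast
  qed
  show "{} \<in> wedge_link m d" by (simp add: wedge_link_def)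
  show "0 \<notin> \<Union>(wedge_link m d)" by (auto simp: wedge_link_def wedge_cell_def)
  show inj: "inj_on (wedge_cell d i) {..d}" for i by (simp add: inj_on_def wedge_cell_def)
  show "wedge_cell d i j \<noteq> 0" for i j by (simp add: wedge_cell_def)
  show "A \<in> wedge_link m d" if "i < m" "A \<subset> wedge_cell d i ` {..d}" for i A
    using that unfolding wedge_link_def by blast
  show "wedge_cell d i ` {..d} \<notin> wedge_link m d" if "i < m" for i
  proof
    assume "wedge_cell d i ` {..d} \<in> wedge_link m d"
    then have "wedge_cell d i ` {..d} = {} \<or> (\<exists>i'<m. wedge_cell d i ` {..d} \<subset> wedge_cell d i' ` {..d})"
      unfolding wedge_link_def by (rule CollectD)
    then have "\<exists>i'<m. wedge_cell d i ` {..d} \<subset> wedge_cell d i' ` {..d}" by simp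
    then obtain i' where "wedge_cell d i ` {..d} \<subset> wedge_cell d i' ` {..d}" by (elim exE conjE)
    from psubset_card_mono[OF _ this] show False by (simp add: card_image inj)
  qed
  show "i = i'" if "wedge_cell d i ` {..d} = wedge_cell d i' ` {..d}" for i i'
  proof -
    have "wedge_cell d i 0 \<in> wedge_cell d i' ` {..d}" using that by blast
    then show ?thesis using wedge_cell_eq[of 0 d] by auto
  qed
qed

abbreviation wedge_complex :: "nat \<Rightarrow> nat \<Rightarrow> nat set set" where
  "wedge_complex m d \<equiv> coned_complex.L (wedge_link m d) (wedge_cell d) m d"

lemma wedge_vertex_image: "wedge_vertex (Suc d) i ` {0..Suc d} = insert 0 (wedge_cell d i ` {..d})"
proof -
  have "{0..Suc d} = insert 0 (Suc ` {..d})" by (auto simp: image_iff) (metis atMost_iff Suc_le_mono not0_implies_Suc gr0_conv_Suc)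
  then have "wedge_vertex (Suc d) i ` {0..Suc d} = insert (wedge_vertex (Suc d) i 0) ((\<lambda>j. wedge_vertex (Suc d) i (Suc j)) ` {..d})"
    by (simp only: image_insert image_image)
  then show ?thesis by (simp add: wedge_vertex_def wedge_cell_def)
qed

text \<open>The coned complex over the wedge link is the union of the boundaries of the simplices: a
  proper face either has a proper part of the opposite face as its base, with or without 0, or is
  the opposite face.\<close>

lemma wedge_complex_iff: "A \<in> wedge_complex m d \<longleftrightarrow> A \<subseteq> {0} \<or> (\<exists>i<m. A \<subset> wedge_vertex (Suc d) i ` {0..Suc d})"
proof -
  interpret coned_complex "wedge_link m d" "wedge_cell d" m d by (rule coned_complex_wedge)
  have z: "0 \<notin> wedge_cell d i ` {..d}" for i by (auto simp: wedge_cell_def)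
  have "A - {0} \<subset> C \<or> A = C \<longleftrightarrow> A \<subset> insert 0 C" if "0 \<notin> C" for C using that by blast
  then have e1: "(A - {0} \<subset> wedge_cell d i ` {..d} \<or> A = wedge_cell d i ` {..d}) \<longleftrightarrow> A \<subset> wedge_vertex (Suc d) i ` {0..Suc d}" for i
    unfolding wedge_vertex_image using z by simp
  have e2: "A \<subseteq> {0} \<longleftrightarrow> A - {0} = {}" by blast
  have "A \<in> L \<longleftrightarrow> A - {0} \<in> wedge_link m d \<or> (\<exists>i<m. A = wedge_cell d i ` {..d})"
    by (simp only: L_def mem_Collect_eq)
  then show ?thesis unfolding e1[symmetric] e2 wedge_link_def mem_Collect_eq by iprover
qed

lemma mono_wedge_vertex: "j \<le> j' \<Longrightarrow> wedge_vertex k i j \<le> wedge_vertex k i j'"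
  by (simp add: wedge_vertex_def)

lemma inj_on_wedge_vertex: "inj_on (wedge_vertex k i) A"
  by (auto simp: inj_on_def wedge_vertex_def split: if_splits)

lemma base_simplex_boundary: "base_simplex (boundary_simplex k) [0] n = replicate (Suc n) 0"
  by (induction n) (simp_all add: boundary_simplex_def nerve_def)

text \<open>Normal form of the simplices: a degenerate base simplex is always represented in copy 0.
  For \<open>m = 0\<close> no other simplices remain, as \<open>fst p < 0\<close> is
  impossible.\<close>

lemma splx_wedge:
  "p \<in> splx (wedge_sset m (boundary_simplex (Suc d)) [0]) n \<longleftrightarrow>
     length (snd p) = Suc n \<and> sorted (snd p) \<and> set (snd p) \<subset> {0..Suc d} \<and>
     (if set (snd p) \<subseteq> {0} then fst p = 0 else fst p < m)"
proof -
  have rep: "xs = replicate (Suc n) 0 \<longleftrightarrow> length xs = Suc n \<and> set xs \<subseteq> {0}" for xs :: "nat list"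
  proof
    assume "length xs = Suc n \<and> set xs \<subseteq> {0}"
    then show "xs = replicate (Suc n) 0" using replicate_eqI[of xs "Suc n" 0] by auto
  qed auto
  have "Suc d \<in> {0..Suc d}" "Suc d \<notin> {0}" by simp_all
  then have ne: "{0} \<noteq> {0..Suc d}" by metis
  have srep: "xs = replicate (Suc n) 0 \<Longrightarrow> sorted xs \<and> set xs \<subset> {0..Suc d}" for xs
    using ne by (auto simp: sorted_replicate simp del: replicate_Suc)
  have B: "xs \<in> splx (boundary_simplex (Suc d)) n \<longleftrightarrow> length xs = Suc n \<and> sorted xs \<and> set xs \<subset> {0..Suc d}" for xs
    by (auto simp: boundary_simplex_def nerve_def)
  show ?thesis
  proof (cases "m = 0")
    case True
    have "p = (0, replicate (Suc n) 0) \<longleftrightarrow> fst p = 0 \<and> snd p = replicate (Suc n) 0" by (cases p) simp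
    also have "\<dots> \<longleftrightarrow> length (snd p) = Suc n \<and> sorted (snd p) \<and> set (snd p) \<subset> {0..Suc d} \<and> set (snd p) \<subseteq> {0} \<and> fst p = 0"
      using rep[of "snd p"] srep[of "snd p"] by iprover
    finally show ?thesis using True by (simp add: wedge_sset_def base_simplex_boundary del: replicate_Suc)
  next
    case False
    obtain i xs where p: "p = (i, xs)" by (cases p)
    have "p \<in> splx (wedge_sset m (boundary_simplex (Suc d)) [0]) n \<longleftrightarrow>
       p \<in> (\<lambda>q. if snd q = replicate (Suc n) 0 then (0, snd q) else q) ` ({..<m} \<times> splx (boundary_simplex (Suc d)) n)"
      using False by (simp add: wedge_sset_def wedge_rep_def[abs_def] base_simplex_boundary del: replicate_Suc)
    also have "\<dots> \<longleftrightarrow> xs \<in> splx (boundary_simplex (Suc d)) n \<and> (\<exists>j<m. i = (if xs = replicate (Suc n) 0 then 0 else j))"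
    proof
      assume "p \<in> (\<lambda>q. if snd q = replicate (Suc n) 0 then (0, snd q) else q) ` ({..<m} \<times> splx (boundary_simplex (Suc d)) n)"
      then obtain j ys where "j < m" "ys \<in> splx (boundary_simplex (Suc d)) n"
        "p = (if ys = replicate (Suc n) 0 then (0, ys) else (j, ys))"
        by (elim imageE SigmaE) (simp del: replicate_Suc)
      then show "xs \<in> splx (boundary_simplex (Suc d)) n \<and> (\<exists>j<m. i = (if xs = replicate (Suc n) 0 then 0 else j))"
        unfolding p by (cases "ys = replicate (Suc n) 0") (simp_all del: replicate_Suc, blast)
    next
      assume h: "xs \<in> splx (boundary_simplex (Suc d)) n \<and> (\<exists>j<m. i = (if xs = replicate (Suc n) 0 then 0 else j))"
      then obtain j where "j < m" "i = (if xs = replicate (Suc n) 0 then 0 else j)" by blast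
      then show "p \<in> (\<lambda>q. if snd q = replicate (Suc n) 0 then (0, snd q) else q) ` ({..<m} \<times> splx (boundary_simplex (Suc d)) n)"
        using h unfolding p by (intro image_eqI[of _ _ "(j, xs)"]) (simp_all del: replicate_Suc)
    qed
    also have "\<dots> \<longleftrightarrow> (length xs = Suc n \<and> sorted xs \<and> set xs \<subset> {0..Suc d}) \<and> (if set xs \<subseteq> {0} then i = 0 else i < m)"
    proof (cases "length xs = Suc n")
      case True
      show ?thesis
      proof (cases "set xs \<subseteq> {0}")
        case z: True
        then have "xs = replicate (Suc n) 0" using True rep by blast
        then show ?thesis using z B False by (simp del: replicate_Suc) blast
      next
        case z: False
        then have "xs \<noteq> replicate (Suc n) 0" using rep by blast
        then show ?thesis using z B by (simp del: replicate_Suc)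
      qed
    qed (simp add: B)
    finally show ?thesis by (simp add: p)
  qed
qed

lemma wedge_vertices_rep:
  "wedge_vertices d (wedge_rep (boundary_simplex k) [0] n p) = wedge_vertices d p"
  by (simp add: wedge_vertices_def wedge_rep_def base_simplex_boundary wedge_vertex_def del: replicate_Suc)

lemma wedge_rep_in:
  assumes p: "p \<in> splx (wedge_sset m (boundary_simplex (Suc d)) [0]) n'"
    and xs: "length xs = Suc n" "sorted xs" "set xs \<subseteq> set (snd p)"
  shows "wedge_rep (boundary_simplex (Suc d)) [0] n (fst p, xs) \<in> splx (wedge_sset m (boundary_simplex (Suc d)) [0]) n"
proof (cases "set xs \<subseteq> {0}")
  case True
  then have "xs = replicate (Suc n) 0" using replicate_eqI[of xs "Suc n" 0] xs(1) by auto
  then have "wedge_rep (boundary_simplex (Suc d)) [0] n (fst p, xs) = (0, xs)"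
    by (simp add: wedge_rep_def base_simplex_boundary del: replicate_Suc)
  then show ?thesis using xs p True by (simp add: splx_wedge) blast
next
  case False
  then have "xs \<noteq> replicate (Suc n) 0" by auto
  then have "wedge_rep (boundary_simplex (Suc d)) [0] n (fst p, xs) = (fst p, xs)"
    by (simp add: wedge_rep_def base_simplex_boundary del: replicate_Suc)
  moreover have "\<not> set (snd p) \<subseteq> {0}" using False xs(3) by blast
  ultimately show ?thesis using xs p False by (simp add: splx_wedge) blast
qed

lemma vertex_presentation_wedge:
  "vertex_presentation (wedge_sset m (boundary_simplex (Suc d)) [0]) (wedge_vertices d) (wedge_complex m d)"
proof
  let ?W = "wedge_sset m (boundary_simplex (Suc d)) [0]"
  show "simplicial_complex (wedge_complex m d)"
    by (rule coned_complex.simplicial_complex_L[OF coned_complex_wedge])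
next
  fix n
  let ?W = "wedge_sset m (boundary_simplex (Suc d)) [0]"
  show "bij_betw (wedge_vertices d) (splx ?W n) {xs. length xs = Suc n \<and> sorted xs \<and> set xs \<in> wedge_complex m d}"
  proof (rule bij_betw_imageI)
    show "inj_on (wedge_vertices d) (splx ?W n)"
    proof (rule inj_onI)
      fix p q assume p: "p \<in> splx ?W n" and q: "q \<in> splx ?W n" and eq: "wedge_vertices d p = wedge_vertices d q"
      have sp: "set (snd p) \<subseteq> {0..Suc d}" and sq: "set (snd q) \<subseteq> {0..Suc d}" using p q by (auto simp: splx_wedge)
      have img: "wedge_vertex (Suc d) (fst p) ` set (snd p) = wedge_vertex (Suc d) (fst q) ` set (snd q)"
        using arg_cong[OF eq, of set] by (simp add: wedge_vertices_def)
      have zero: "A \<subseteq> {0} \<longleftrightarrow> wedge_vertex (Suc d) i ` A \<subseteq> {0}" for A i by (auto simp: wedge_vertex_def)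
      have fst: "fst p = fst q"
      proof (cases "set (snd p) \<subseteq> {0}")
        case True
        then have "set (snd q) \<subseteq> {0}" using zero img by metis
        then show ?thesis using p q True by (simp add: splx_wedge)
      next
        case False
        then obtain j where j: "j \<in> set (snd p)" "j \<noteq> 0" by blast
        then obtain j' where j': "j' \<in> set (snd q)" "wedge_vertex (Suc d) (fst p) j = wedge_vertex (Suc d) (fst q) j'"
          using img by blast
        have "j' \<noteq> 0" using j'(2) j(2) by (auto simp: wedge_vertex_def split: if_splits)
        then have "wedge_cell d (fst p) (j - 1) = wedge_cell d (fst q) (j' - 1)"
          using j'(2) j(2) by (simp add: wedge_vertex_def wedge_cell_def)
        moreover have "j - 1 \<le> d" "j' - 1 \<le> d" using j(1) j'(1) sp sq by fastforce+
        ultimately show ?thesis using wedge_cell_eq by blast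
      qed
      have "snd p = snd q"
        using eq inj_on_wedge_vertex[of "Suc d" "fst p" "set (snd p) \<union> set (snd q)"]
        by (simp add: wedge_vertices_def fst inj_on_map_eq_map)
      then show "p = q" using fst by (simp add: prod_eq_iff)
    qed
    show "wedge_vertices d ` splx ?W n = {xs. length xs = Suc n \<and> sorted xs \<and> set xs \<in> wedge_complex m d}"
    proof (intro subset_antisym subsetI)
      fix xs assume "xs \<in> wedge_vertices d ` splx ?W n"
      then obtain p where p: "p \<in> splx ?W n" "xs = wedge_vertices d p" by blast
      note ps = p(1)[unfolded splx_wedge]
      have "set xs \<in> wedge_complex m d"
      proof (cases "set (snd p) \<subseteq> {0}")
        case True
        then have "set xs \<subseteq> {0}" by (auto simp: p(2) wedge_vertices_def wedge_vertex_def)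
        then show ?thesis by (simp add: wedge_complex_iff)
      next
        case False
        then have "fst p < m" using ps by simp
        moreover have "set xs \<subset> wedge_vertex (Suc d) (fst p) ` {0..Suc d}"
          using ps image_strict_mono[OF inj_on_wedge_vertex, of "set (snd p)" "{0..Suc d}"]
          by (simp add: p(2) wedge_vertices_def)
        ultimately show ?thesis unfolding wedge_complex_iff by (intro disjI2 exI conjI)
      qed
      moreover have "sorted xs"
        unfolding p(2) wedge_vertices_def sorted_wrt_map
        by (rule sorted_wrt_mono_rel[of _ "(\<le>)"]) (use ps mono_wedge_vertex in auto)
      ultimately show "xs \<in> {xs. length xs = Suc n \<and> sorted xs \<and> set xs \<in> wedge_complex m d}"
        using ps by (simp add: p(2) wedge_vertices_def)
    next
      fix xs assume "xs \<in> {xs. length xs = Suc n \<and> sorted xs \<and> set xs \<in> wedge_complex m d}"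
      then have xs: "length xs = Suc n" "sorted xs" "set xs \<in> wedge_complex m d" by simp_all
      show "xs \<in> wedge_vertices d ` splx ?W n"
      proof (cases "set xs \<subseteq> {0}")
        case True
        have "Suc d \<in> {0..Suc d}" "Suc d \<notin> set xs" using True by auto
        then have "set xs \<subset> {0..Suc d}" using True by auto
        then have "(0, xs) \<in> splx ?W n" using xs True by (simp add: splx_wedge)
        moreover have "map (wedge_vertex (Suc d) 0) xs = xs" by (rule map_idI) (simp add: wedge_vertex_def)
        ultimately show ?thesis by (metis fst_conv imageI snd_conv wedge_vertices_def)
      next
        case False
        then have "\<exists>i<m. set xs \<subset> wedge_vertex (Suc d) i ` {0..Suc d}" using xs(3) by (simp add: wedge_complex_iff)
        then obtain i where i: "i < m" "set xs \<subset> wedge_vertex (Suc d) i ` {0..Suc d}" by blast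
        \<comment> \<open>Subtracting the start of the block recovers the local vertex numbers;
          truncated subtraction sends the base vertex 0 to 0.\<close>
        define ys where "ys = map (\<lambda>u. u - i * Suc d) xs"
        have inv: "wedge_vertex (Suc d) i (u - i * Suc d) = u \<and> u - i * Suc d \<le> Suc d" if u: "u \<in> set xs" for u
        proof -
          obtain j where "j \<in> {0..Suc d}" "u = wedge_vertex (Suc d) i j" using i(2) u by blast
          then show ?thesis by (simp add: wedge_vertex_def)
        qed
        have xy: "map (wedge_vertex (Suc d) i) ys = xs"
          unfolding ys_def map_map by (rule map_idI) (use inv in simp)
        then have sxy: "set xs = wedge_vertex (Suc d) i ` set ys" by (metis set_map)
        have "set ys \<subseteq> {0..Suc d}" using inv by (auto simp: ys_def)
        moreover have "set ys \<noteq> {0..Suc d}" using i(2) sxy by auto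
        moreover have "\<not> set ys \<subseteq> {0}"
        proof
          assume "set ys \<subseteq> {0}"
          then have "set xs \<subseteq> {0}" unfolding sxy by (auto simp: wedge_vertex_def)
          then show False using False by contradiction
        qed
        moreover have "sorted ys"
          unfolding ys_def sorted_wrt_map by (rule sorted_wrt_mono_rel[OF _ xs(2)]) (rule diff_le_mono)
        ultimately have "(i, ys) \<in> splx ?W n" using xs(1) i(1) by (simp add: splx_wedge ys_def psubset_eq)
        moreover have "xs = wedge_vertices d (i, ys)" by (simp add: wedge_vertices_def xy)
        ultimately show ?thesis by (rule image_eqI[rotated])
      qed
    qed
  qed
next
  let ?W = "wedge_sset m (boundary_simplex (Suc d)) [0]"
  fix n i p assume p: "p \<in> splx ?W (Suc n)" "i \<le> Suc n"
  have face: "face ?W n i p = wedge_rep (boundary_simplex (Suc d)) [0] n (fst p, del_nth i (snd p))"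
    by (simp add: wedge_sset_def boundary_simplex_def nerve_def del_nth_def)
  show "wedge_vertices d (face ?W n i p) = del_nth i (wedge_vertices d p)"
    unfolding face wedge_vertices_rep by (simp add: wedge_vertices_def del_nth_def take_map drop_map)
  show "face ?W n i p \<in> splx ?W n"
    unfolding face
    by (rule wedge_rep_in[OF p(1)]) (use p set_del_nth[of i "snd p"] in \<open>simp_all add: splx_wedge length_del_nth sorted_wrt_del_nth\<close>)
next
  let ?W = "wedge_sset m (boundary_simplex (Suc d)) [0]"
  fix n i p assume p: "p \<in> splx ?W n" "i \<le> n"
  have degen: "degen ?W n i p = wedge_rep (boundary_simplex (Suc d)) [0] (Suc n) (fst p, dup_nth i (snd p))"
    by (simp add: wedge_sset_def boundary_simplex_def nerve_def dup_nth_def)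
  show "wedge_vertices d (degen ?W n i p) = dup_nth i (wedge_vertices d p)"
    unfolding degen wedge_vertices_rep by (simp add: wedge_vertices_def dup_nth_def take_map drop_map)
  show "degen ?W n i p \<in> splx ?W (Suc n)"
    unfolding degen
    by (rule wedge_rep_in[OF p(1)]) (use p in \<open>simp_all add: splx_wedge length_dup_nth sorted_wrt_dup_nth set_dup_nth\<close>)
qed

text \<open>Quotient and remainder decode a vertex number into its cell and position, and
  \<open>w\<close> sends it to the corresponding vertex of the given complex. It preserves order on
  each simplex because \<open>en i\<close> is increasing and the apex 0 is least.\<close>

lemma wedge_to_coned_complex:
  assumes "coned_complex K en m d" and mono: "\<And>i j j'. i < m \<Longrightarrow> j < j' \<Longrightarrow> j' \<le> d \<Longrightarrow> en i j < en i j'"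
  defines "w \<equiv> \<lambda>v. if v = 0 then 0 else en ((v - 1) div Suc d) ((v - 1) mod Suc d)"
  shows "homotopy_equivalence (geo (wedge_complex m d)) (geo (coned_complex.L K en m d)) (push w)"
    and "p \<in> splx (wedge_sset m (boundary_simplex (Suc d)) [0]) n \<Longrightarrow>
      sorted (map w (wedge_vertices d p)) \<and> set (map w (wedge_vertices d p)) \<in> coned_complex.L K en m d"
proof -
  interpret coned_complex K en m d by (rule assms)
  interpret W: vertex_presentation "wedge_sset m (boundary_simplex (Suc d)) [0]" "wedge_vertices d" "wedge_complex m d"
    by (rule vertex_presentation_wedge)
  have w0: "w 0 = 0" by (simp add: w_def)
  have wc: "w (wedge_cell d i j) = en i j" if "j \<le> d" for i j
    using that by (simp add: w_def wedge_cell_def div_mult_self3 del: mult_Suc_right)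
  have wlink: "w ` A \<in> K" if A: "A \<in> wedge_link m d" for A
  proof (cases "A = {}")
    case False
    then have "\<exists>i<m. A \<subset> wedge_cell d i ` {..d}" using A by (simp add: wedge_link_def)
    then obtain i where i: "i < m" "A \<subset> wedge_cell d i ` {..d}" by blast
    have cell: "w ` wedge_cell d i ` {..d} = en i ` {..d}"
      unfolding image_image by (rule image_cong[OF refl]) (simp add: wc)
    have "inj_on w (wedge_cell d i ` {..d})"
      proof (rule inj_onI)
      fix x y assume "x \<in> wedge_cell d i ` {..d}" "y \<in> wedge_cell d i ` {..d}" and eq: "w x = w y"
      then obtain a b where ab: "a \<le> d" "x = wedge_cell d i a" "b \<le> d" "y = wedge_cell d i b" by auto
      then have "en i a = en i b" using eq wc by simp
      then show "x = y" using inj_onD[OF en_inj[OF i(1)], of a b] ab by simp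
    qed
    from image_strict_mono[OF this i(2)] show ?thesis unfolding cell by (rule bdry[OF i(1)])
  qed (simp add: K(2))
  show "homotopy_equivalence (geo (wedge_complex m d)) (geo L) (push w)"
    by (rule homotopy_equivalence_push_coned[OF coned_complex_wedge assms(1) wc w0 wlink])
  assume p: "p \<in> splx (wedge_sset m (boundary_simplex (Suc d)) [0]) n"
  have "set (wedge_vertices d p) \<in> wedge_complex m d" by (rule W.vl_props(3)[OF p])
  then have "set (wedge_vertices d p) - {0} \<in> wedge_link m d \<or> (\<exists>i<m. set (wedge_vertices d p) = wedge_cell d i ` {..d})"
    unfolding coned_complex.L_def[OF coned_complex_wedge] by (rule CollectD)
  then have "w ` set (wedge_vertices d p) \<in> L"
  proof
    assume "set (wedge_vertices d p) - {0} \<in> wedge_link m d"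
    from wlink[OF this] have "w ` set (wedge_vertices d p) - {0} \<in> K"
      by (rule simplicial_complexD(2)[OF K(1)]) (use w0 in blast)
    then show ?thesis by (simp add: L_def)
  next
    assume "\<exists>i<m. set (wedge_vertices d p) = wedge_cell d i ` {..d}"
    then obtain i where "i < m" "set (wedge_vertices d p) = wedge_cell d i ` {..d}" by blast
    then have "i < m" "w ` set (wedge_vertices d p) = en i ` {..d}" using wc by (auto simp: image_image)
    then show ?thesis unfolding L_def by blast
  qed
  moreover have "sorted (map w (wedge_vertices d p))"
  proof -
    note ps = p[unfolded splx_wedge]
    have val: "w (wedge_vertex (Suc d) (fst p) j) = (if j = 0 then 0 else en (fst p) (j - 1))" if "j \<in> set (snd p)" for j
    proof (cases "j = 0")
      case False
      then have "wedge_vertex (Suc d) (fst p) j = wedge_cell d (fst p) (j - 1)"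
        by (simp add: wedge_vertex_def wedge_cell_def)
      moreover have "j - 1 \<le> d" using that ps by fastforce
      ultimately show ?thesis using wc False by simp
    qed (simp add: wedge_vertex_def w0)
    have le: "w (wedge_vertex (Suc d) (fst p) j) \<le> w (wedge_vertex (Suc d) (fst p) j')"
      if j: "j \<in> set (snd p)" "j' \<in> set (snd p)" "j \<le> j'" for j j'
    proof (cases "j = 0 \<or> j = j'")
      case False
      then have "\<not> set (snd p) \<subseteq> {0}" using j(1) by blast
      then have "fst p < m" using ps by simp
      moreover have "j' - 1 \<le> d" using j(2) ps by fastforce
      ultimately have "en (fst p) (j - 1) < en (fst p) (j' - 1)" using False j(3) by (intro mono) auto
      then show ?thesis using val j False by simp
    qed (use val j in auto)
    show ?thesis
      unfolding wedge_vertices_def map_map sorted_wrt_map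
      by (rule sorted_wrt_mono_rel[of _ "(\<le>)"]) (use le ps in auto)
  qed
  ultimately show "sorted (map w (wedge_vertices d p)) \<and> set (map w (wedge_vertices d p)) \<in> L" by simp
qed

subsection \<open>Posets whose order complex is shellable\<close>

text \<open>Brings an inclusion of complexes into the form \<open>push w\<close> used for maps of
  presented simplicial sets.\<close>

lemma homotopy_equivalence_push_id:
  assumes L: "simplicial_complex L" and he: "homotopy_equivalence (geo L) (geo L') (\<lambda>x. x)"
  shows "homotopy_equivalence (geo L) (geo L') (push (\<lambda>v. v))"
proof (rule homotopy_equivalence_homotopic[OF he homotopic_with_equal])
  show "continuous_map (geo L) (geo L') (\<lambda>x. x)" using he by (simp add: homotopy_equivalence_def)
  show "x = push (\<lambda>v. v) x" if "x \<in> topspace (geo L)" for x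
  proof -
    have "x \<in> gpoints L" using that by (simp add: geo_def)
    then have "finite (vsupp x)" using simplicial_complexD(1)[OF L] gpointsD(2) by blast
    then show ?thesis by (simp add: push_id)
  qed
qed simp_all

lemma shelled_image:
  assumes sh: "shelled card k \<phi>s" and inj: "inj_on e P" and sub: "\<And>\<phi>. \<phi> \<in> set \<phi>s \<Longrightarrow> \<phi> \<subseteq> P"
  shows "shelled card k (map ((`) e) \<phi>s)"
  unfolding shelled_def
proof (intro allI impI ballI)
  fix us x vs y assume "map ((`) e) \<phi>s = us @ x # vs" and y: "y \<in> set us"
  then obtain us' x' vs' where s: "\<phi>s = us' @ x' # vs'" "us = map ((`) e) us'" "x = e ` x'"
    by (auto simp: map_eq_append_conv map_eq_Cons_conv)
  obtain y' where y': "y' \<in> set us'" "y = e ` y'" using y s(2) by auto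
  have "\<exists>z'\<in>set us'. y' \<inter> x' \<subseteq> z' \<inter> x' \<and> card (z' \<inter> x') + 1 = k"
    using sh[unfolded shelled_def] s(1) y'(1) by blast
  then obtain z' where z': "z' \<in> set us'" "y' \<inter> x' \<subseteq> z' \<inter> x'" "card (z' \<inter> x') + 1 = k" by blast
  have P: "x' \<subseteq> P" "y' \<subseteq> P" "z' \<subseteq> P" using s(1) y'(1) z'(1) sub by auto
  have "y \<inter> x = e ` (y' \<inter> x')" unfolding y' s using inj_on_image_Int[OF inj P(2,1)] by simp
  moreover have zx: "e ` z' \<inter> x = e ` (z' \<inter> x')" unfolding s using inj_on_image_Int[OF inj P(3,1)] by simp
  ultimately have "y \<inter> x \<subseteq> e ` z' \<inter> x" using z'(2) by blast
  moreover have "inj_on e (z' \<inter> x')" using inj by (rule inj_on_subset) (use P in blast)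
  then have "card (e ` z' \<inter> x) + 1 = k" unfolding zx using z'(3) by (simp add: card_image)
  moreover have "e ` z' \<in> set us" using z'(1) s(2) by simp
  ultimately show "\<exists>z\<in>set us. y \<inter> x \<subseteq> z \<inter> x \<and> card (z \<inter> x) + 1 = k" by (intro bexI[of _ "e ` z'"] conjI)
qed

text \<open>All three equivalences come from one coned complex \<open>L\<close>, obtained after
  numbering \<open>P\<close> by a linear extension: the two spaces are compared with its quotient
  wedge, the nerve with its ordered simplicial set.\<close>

lemma shelled_order_complex:
  fixes P :: "'a::order set"
  assumes P: "finite P" and sh: "shelled card (Suc d) \<phi>s" "\<phi>s \<noteq> []"
    and card: "\<And>\<phi>. \<phi> \<in> set \<phi>s \<Longrightarrow> card \<phi> = Suc d"
    and chains: "order_chains P = {A. \<exists>\<phi>\<in>set \<phi>s. A \<subseteq> \<phi>}"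
  shows "\<exists>m. same_weak_homotopy_type (alexandroff_space P) (wedge_space m (unit_sphere (Suc d)) sphere_base)"
    "\<exists>m. same_weak_homotopy_type_sset (nerve P) (wedge_sset m (boundary_simplex (Suc d)) [0])"
    "\<exists>m. same_weak_homotopy_type (classifying_space P) (wedge_space m (unit_sphere (Suc d)) sphere_base)"
proof -
  obtain e :: "'a \<Rightarrow> nat" where e: "inj_on e P" "\<And>a b. a \<in> P \<Longrightarrow> b \<in> P \<Longrightarrow> a < b \<Longrightarrow> e a < e b" "\<And>a. a \<in> P \<Longrightarrow> 1 \<le> e a"
    using linear_extension[OF P] by blast
  have cP: "simplicial_complex (order_chains P)" by (rule simplicial_complex_chains[OF P])
  have uP: "\<Union>(order_chains P) \<subseteq> P" by (auto simp: order_chains_def)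
  have \<phi>P: "\<phi> \<subseteq> P" if "\<phi> \<in> set \<phi>s" for \<phi>
  proof -
    have "\<phi> \<in> order_chains P" unfolding chains using that by blast
    then show ?thesis by (simp add: order_chains_def)
  qed
  define xs where "xs = map ((`) e) \<phi>s"
  define K where "K = {A. \<exists>\<sigma>\<in>set xs. A \<subseteq> \<sigma>}"
  have K: "K = (`) e ` order_chains P"
  proof (intro subset_antisym subsetI)
    fix A assume "A \<in> K"
    then obtain \<phi> where "\<phi> \<in> set \<phi>s" "A \<subseteq> e ` \<phi>" by (auto simp: K_def xs_def)
    moreover from this obtain B where "B \<subseteq> \<phi>" "A = e ` B" by (auto simp: subset_image_iff)
    ultimately show "A \<in> (`) e ` order_chains P" unfolding chains by blast
  next
    fix A assume "A \<in> (`) e ` order_chains P"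
    then obtain B \<phi> where "A = e ` B" "B \<subseteq> \<phi>" "\<phi> \<in> set \<phi>s" unfolding chains by blast
    then have "A \<subseteq> e ` \<phi>" "e ` \<phi> \<in> set xs" by (auto simp: xs_def)
    then show "A \<in> K" unfolding K_def by blast
  qed
  have xs: "finite \<sigma> \<and> card \<sigma> = Suc d \<and> 0 \<notin> \<sigma>" if "\<sigma> \<in> set xs" for \<sigma>
  proof -
    obtain \<phi> where p: "\<phi> \<in> set \<phi>s" "\<sigma> = e ` \<phi>" using \<open>\<sigma> \<in> set xs\<close> by (auto simp: xs_def)
    have "inj_on e \<phi>" using e(1) by (rule inj_on_subset) (rule \<phi>P[OF p(1)])
    then have "card \<sigma> = Suc d" using card[OF p(1)] p(2) by (simp add: card_image)
    moreover have "finite \<sigma>" using \<phi>P[OF p(1)] P finite_subset p(2) by blast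
    moreover have "0 \<notin> \<sigma>" using e(3) \<phi>P[OF p(1)] p(2) by fastforce
    ultimately show ?thesis by simp
  qed
  have shx: "shelled card (Suc d) xs" unfolding xs_def by (rule shelled_image[OF sh(1) e(1) \<phi>P])
  have ne: "xs \<noteq> []" using sh(2) by (simp add: xs_def)
  obtain K' en m where cc: "coned_complex K' en m d"
    and mono: "\<And>i j j'. i < m \<Longrightarrow> j < j' \<Longrightarrow> j' \<le> d \<Longrightarrow> en i j < en i j'"
    and KL: "K \<subseteq> coned_complex.L K' en m d"
    and heL: "homotopy_equivalence (geo K) (geo (coned_complex.L K' en m d)) (\<lambda>x. x)"
    by (rule shelled_coned_complex[OF shx ne xs, folded K_def]) (simp, rule that)
  define L where "L = coned_complex.L K' en m d"
  note KL = KL[folded L_def] and heL = heL[folded L_def]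
  have cL: "simplicial_complex L" unfolding L_def by (rule coned_complex.simplicial_complex_L[OF cc])
  from coned_complex.homotopy_equivalence_to_wedge[OF cc, folded L_def]
  obtain h where h: "homotopy_equivalence (geo L) (wedge_space m (unit_sphere (Suc d)) sphere_base) h"
    by (rule that)
  note heW = homotopy_equivalence_compose[OF heL h]
  interpret N: vertex_presentation "nerve P" "map e" K
    unfolding K by (rule vertex_presentation_nerve[OF P e(1,2)])

  have "homotopy_equivalence (geo (order_chains P)) (geo K) (push e)"
    unfolding K by (rule homotopy_equivalence_push[OF cP]) (use inj_on_subset[OF e(1) uP] in simp)
  from homotopy_equivalence_imp_weak[OF homotopy_equivalence_compose[OF this heW]]
  show "\<exists>m. same_weak_homotopy_type (alexandroff_space P) (wedge_space m (unit_sphere (Suc d)) sphere_base)"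
  proof (intro exI same_weak_homotopy_typeI[OF mccord_weak_homotopy_equivalence[OF P]])
    \<comment> \<open>A point of the order complex is coded by the graph of its coordinates on
      \<open>P\<close>, a set of the type prescribed for the apex; outside \<open>P\<close> the
      coordinates vanish.\<close>
    show "inj_on (\<lambda>x. (\<lambda>a. (a, x a)) ` P) (topspace (geo (order_chains P)))"
    proof (rule inj_onI)
      fix x y assume "x \<in> topspace (geo (order_chains P))" "y \<in> topspace (geo (order_chains P))"
        and eq: "(\<lambda>a. (a, x a)) ` P = (\<lambda>a. (a, y a)) ` P"
      then have "x \<in> gpoints (order_chains P)" "y \<in> gpoints (order_chains P)" by (simp_all add: geo_def)
      then have s: "vsupp x \<subseteq> P" "vsupp y \<subseteq> P" using gpointsD(2) uP by blast+
      show "x = y"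
      proof
        fix a
        show "x a = y a"
        proof (cases "a \<in> P")
          case True
          then have "(a, x a) \<in> (\<lambda>a. (a, y a)) ` P" using eq by blast
          then show ?thesis by auto
        next
          case False
          then have "a \<notin> vsupp x" "a \<notin> vsupp y" using s by auto
          then show ?thesis by (simp add: vsupp_def)
        qed
      qed
    qed
  qed

  from homeomorphic_imp_homotopy_equivalence[OF N.homeomorphic_realization]
  have "homotopy_equivalence (realization (nerve P)) (geo K) N.realization_coords" .
  note heR = homotopy_equivalence_imp_weak[OF homotopy_equivalence_compose[OF this heW]]
  have "homotopy_equivalence (realization (nerve P)) (realization (nerve P)) id"
    by (rule homeomorphic_imp_homotopy_equivalence) simp
  note heI = homotopy_equivalence_imp_weak[OF this]
  show "\<exists>m. same_weak_homotopy_type (classifying_space P) (wedge_space m (unit_sphere (Suc d)) sphere_base)"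
    unfolding classifying_space_def
    by (rule exI, rule same_weak_homotopy_typeI[OF heI heR, where j = "\<lambda>x. {(x, 0)}"]) (simp add: inj_on_def)

  have w: "sorted (map (\<lambda>v. v) (map e x)) \<and> set (map (\<lambda>v. v) (map e x)) \<in> L" if "x \<in> splx (nerve P) n" for n x
    using N.vl_props(2,3)[OF that] KL by (metis list.map_ident subsetD)
  \<comment> \<open>The cospan has apex \<open>complex_sset L\<close>: the nerve enters by the
    inclusion of the order complex, the wedge by the matching of cells.\<close>
  have f: "weak_equivalence_sset (nerve P) (complex_sset L) (\<lambda>n x. (0, 0, map (\<lambda>v. v) (map e x)))"
    by (rule presentation_map.weak_equivalence[OF presentation_map_complex_sset[OF N.vertex_presentation_axioms cL]], rule w)
      (assumption, rule homotopy_equivalence_push_id[OF N.L heL])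
  let ?w = "\<lambda>v. if v = 0 then 0 else en ((v - 1) div Suc d) ((v - 1) mod Suc d)"
  have g: "weak_equivalence_sset (wedge_sset m (boundary_simplex (Suc d)) [0]) (complex_sset L)
      (\<lambda>n x. (0, 0, map ?w (wedge_vertices d x)))"
  proof (rule presentation_map.weak_equivalence[OF presentation_map_complex_sset[OF vertex_presentation_wedge cL]])
    show "sorted (map ?w (wedge_vertices d p)) \<and> set (map ?w (wedge_vertices d p)) \<in> L"
      if "p \<in> splx (wedge_sset m (boundary_simplex (Suc d)) [0]) n" for p n
      unfolding L_def by (rule wedge_to_coned_complex(2)[OF cc mono that])
    show "homotopy_equivalence (geo (wedge_complex m d)) (geo L) (push ?w)"
      unfolding L_def by (rule wedge_to_coned_complex(1)[OF cc mono])
  qed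
  show "\<exists>m. same_weak_homotopy_type_sset (nerve P) (wedge_sset m (boundary_simplex (Suc d)) [0])"
    unfolding same_weak_homotopy_type_sset_def by (intro exI conjI, rule f, rule g)
qed

lemma topspace_quotient_space_empty:
  assumes "equiv UNIV R" "topspace X = {}"
  shows "topspace (quotient_space X R) = {}"
  using topspace_quotient_space[OF assms(1), of X] unfolding assms(2) by simp

lemma same_weak_homotopy_type_empty:
  assumes "topspace X = {}" "topspace Y = {}"
  shows "same_weak_homotopy_type X Y"
proof -
  have w: "weak_homotopy_equivalence X Z (\<lambda>_. undefined)" if "topspace Z = {}" for Z :: "'c topology"
  proof (intro homotopy_equivalence_imp_weak homeomorphic_imp_homotopy_equivalence)
    show "homeomorphic_map X Z (\<lambda>_. undefined)"
      using assms(1) that by (simp add: homeomorphic_map_def quotient_map_def)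
  qed
  show ?thesis by (rule same_weak_homotopy_typeI[OF w[OF assms(1)] w[OF assms(2)], of "\<lambda>_. {}"]) (simp add: assms(1))
qed

lemma same_weak_homotopy_type_sset_empty:
  fixes Y :: "(nat \<times> nat list) sset"
  assumes "\<And>n. splx X n = {}" "\<And>n. splx Y n = {}"
  shows "same_weak_homotopy_type_sset X Y"
proof -
  have c: "simplicial_complex {}" by (simp add: simplicial_complex_def)
  have v: "vertex_presentation Z (\<lambda>_. []) {}" if "\<And>n. splx Z n = {}" for Z :: "'c sset"
    by unfold_locales (use that c in \<open>simp_all add: bij_betw_def\<close>)
  have "homotopy_equivalence (geo {}) (geo {}) (push (\<lambda>v::nat. v))"
    using homotopy_equivalence_push[OF c, of "\<lambda>v. v"] by simp
  note he = this
  have e: "weak_equivalence_sset Z (complex_sset {}) (\<lambda>n x. (0, 0, map (\<lambda>v. v) []))" if Z: "\<And>n. splx Z n = {}" for Z :: "'c sset"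
    by (rule presentation_map.weak_equivalence[OF presentation_map_complex_sset[OF v[OF Z] c] he]) (use Z in simp)
  show ?thesis unfolding same_weak_homotopy_type_sset_def by (intro exI conjI, rule e[OF assms(1)], rule e[OF assms(2)])
qed

subsection \<open>Shellable q-complexes\<close>

lemma exists_facet:
  fixes \<Delta> :: "'a::finite set set"
  assumes "A \<in> \<Delta>"
  obtains F where "F \<in> facets \<Delta>" "A \<subseteq> F"
proof -
  obtain F where "F \<in> \<Delta>" "A \<subseteq> F" "\<forall>B\<in>\<Delta>. F \<subseteq> B \<longrightarrow> F = B"
    using finite_has_maximal2[OF finite[of \<Delta>] assms] by blast
  then show thesis by (intro that[of F]) (auto simp: facets_def)
qed

text \<open>A face of maximal dimension lies in some facet, and purity carries its dimension to all
  facets.\<close>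

lemma dim_facet:
  fixes \<Delta> :: "('q::{field,finite} ^ 'n) set set"
  assumes "\<Delta> \<noteq> {}" "pure \<Delta>" "F \<in> facets \<Delta>"
  shows "vec.dim F = q_dim \<Delta>"
proof -
  have "Max (vec.dim ` \<Delta>) \<in> vec.dim ` \<Delta>" using assms(1) by (intro Max_in) auto
  then obtain A where A: "A \<in> \<Delta>" "vec.dim A = q_dim \<Delta>" by (auto simp: q_dim_def)
  obtain G where G: "G \<in> facets \<Delta>" "A \<subseteq> G" by (rule exists_facet[OF A(1)])
  have "vec.dim G \<le> q_dim \<Delta>" using G(1) unfolding q_dim_def by (intro Max_ge imageI) (simp_all add: facets_def)
  moreover have "vec.dim F = vec.dim G" by (rule assms(2)[unfolded pure_def, rule_format, OF assms(3) G(1)])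
  ultimately show ?thesis using vec.dim_subset[OF G(2)] A(2) by simp
qed

text \<open>The largest member of a chain of faces lies in a facet, and the chain extends to a
  complete flag there; for the empty chain any face serves instead.\<close>

lemma chains_of_faces:
  fixes \<Delta> :: "('q::{field,finite} ^ 'n) set set"
  assumes \<Delta>: "q_complex \<Delta>" "\<Delta> \<noteq> {}"
  shows "order_chains (\<Delta> - {{0}}) = {A. \<exists>F\<in>facets \<Delta>. \<exists>\<phi>\<in>flags F. A \<subseteq> \<phi>}"
proof (intro subset_antisym subsetI)
  fix A assume A: "A \<in> order_chains (\<Delta> - {{0}})"
  have "\<exists>M\<in>\<Delta>. \<forall>V\<in>A. V \<subseteq> M"
  proof (cases "A = {}")
    case False
    have "finite A" by simp
    then obtain M where M: "M \<in> A" "\<And>V. V \<in> A \<Longrightarrow> M \<subseteq> V \<Longrightarrow> M = V"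
      using finite_has_maximal[OF _ False] by metis
    have "V \<subseteq> M" if V: "V \<in> A" for V
    proof -
      have "V \<subseteq> M \<or> M \<subseteq> V" using A V M(1) by (simp add: order_chains_def)
      then show ?thesis using M(2)[OF V] by blast
    qed
    moreover have "M \<in> \<Delta>" using M(1) A by (auto simp: order_chains_def)
    ultimately show ?thesis by blast
  qed (use \<Delta>(2) in auto)
  then obtain M where M: "M \<in> \<Delta>" "\<And>V. V \<in> A \<Longrightarrow> V \<subseteq> M" by blast
  obtain F where F: "F \<in> facets \<Delta>" "M \<subseteq> F" by (rule exists_facet[OF M(1)])
  have "A \<subseteq> subspaces_in F"
  proof
    fix V assume V: "V \<in> A"
    have "V \<in> \<Delta> - {{0}}" using A V unfolding order_chains_def by blast
    then have "V \<in> \<Delta>" "V \<noteq> {0}" by simp_all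
    moreover have "vec.subspace V" using \<Delta>(1) \<open>V \<in> \<Delta>\<close> by (simp add: q_complex_def)
    ultimately show "V \<in> subspaces_in F" using order_trans[OF M(2)[OF V] F(2)] by (simp add: subspaces_in_def)
  qed
  then have "A \<in> order_chains (subspaces_in F)" using A by (simp add: order_chains_def)
  moreover have "vec.subspace F" using F(1) \<Delta>(1) by (simp add: facets_def q_complex_def)
  ultimately have "\<exists>\<phi>\<in>flags F. A \<subseteq> \<phi>" by (intro extend_to_flag)
  then show "A \<in> {A. \<exists>F\<in>facets \<Delta>. \<exists>\<phi>\<in>flags F. A \<subseteq> \<phi>}" using F(1) by blast
next
  fix A assume "A \<in> {A. \<exists>F\<in>facets \<Delta>. \<exists>\<phi>\<in>flags F. A \<subseteq> \<phi>}"
  then obtain F \<phi> where F: "F \<in> facets \<Delta>" "\<phi> \<in> flags F" "A \<subseteq> \<phi>" by blast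
  have "F \<in> \<Delta>" using F(1) by (simp add: facets_def)
  with \<Delta>(1) have "\<forall>V. vec.subspace V \<and> V \<subseteq> F \<longrightarrow> V \<in> \<Delta>" unfolding q_complex_def by (elim conjE) (rule bspec)
  then have "subspaces_in F \<subseteq> \<Delta> - {{0}}" unfolding subspaces_in_def by blast
  moreover have "\<phi> \<in> order_chains (subspaces_in F)" using F(2) by (simp add: flags_def)
  ultimately have "\<phi> \<in> order_chains (\<Delta> - {{0}})" using chains_mono by blast
  then show "A \<in> order_chains (\<Delta> - {{0}})" using F(3) order_chains_subset by blast
qed

theorem theorem3p3:
  fixes \<Delta> :: "('q::{field,finite} ^ 'n) set set" and k :: nat
  assumes "q_complex \<Delta>" and "\<Delta> \<noteq> {}" and "pure \<Delta>" and "q_dim \<Delta> = k" and "shellable \<Delta>"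
  shows "(\<exists>m. same_weak_homotopy_type
                (alexandroff_space (\<Delta> - {{0}})) (wedge_space m (unit_sphere k) sphere_base)) \<and>
         (\<exists>m. same_weak_homotopy_type_sset
                (nerve (\<Delta> - {{0}})) (wedge_sset m (boundary_simplex k) [0])) \<and>
         (\<exists>m. same_weak_homotopy_type
                (classifying_space (\<Delta> - {{0}})) (wedge_space m (unit_sphere k) sphere_base))"
proof -
  define P where "P = \<Delta> - {{0}}"
  have dimF: "vec.dim F = k" and subF: "vec.subspace F" if "F \<in> facets \<Delta>" for F
    using dim_facet[OF assms(2,3) that] assms(1,4) that by (auto simp: facets_def q_complex_def)
  show ?thesis
  proof (cases k)
    \<comment> \<open>Only the zero subspace is left, so the poset and all three models are empty.
      They are matched with one copy of the (-1)-sphere, since the wedge of no spheres is a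
      point.\<close>
    case 0
    have "A = {0}" if A: "A \<in> \<Delta>" for A
    proof -
      obtain F where F: "F \<in> facets \<Delta>" "A \<subseteq> F" by (rule exists_facet[OF A])
      have "vec.subspace A" using assms(1) that by (simp add: q_complex_def)
      moreover have "vec.dim A = 0" using vec.dim_subset[OF F(2)] dimF[OF F(1)] 0 by simp
      ultimately show ?thesis using subspace_dim_0 by blast
    qed
    then have P: "P = {}" unfolding P_def by blast
    have N: "splx (nerve ({}::('q ^ 'n) set set)) n = {}" for n by (auto simp: nerve_def)
    have "splx (boundary_simplex 0) n = {}" for n
    proof -
      have "set xs = {0..0::nat}" if "length xs = Suc n" "set xs \<subseteq> {0..0::nat}" for xs
        using that by (cases xs) auto
      then show ?thesis by (simp add: boundary_simplex_def nerve_def)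
    qed
    then have "splx (wedge_sset 1 (boundary_simplex 0) [0]) n = {}" for n by (simp add: wedge_sset_def)
    then have 2: "same_weak_homotopy_type_sset (nerve P) (wedge_sset 1 (boundary_simplex k) [0])"
      unfolding P 0 by (intro same_weak_homotopy_type_sset_empty N)
    have R: "topspace (realization X) = {}" if "\<And>n. splx X n = {}" for X :: "('q ^ 'n) set list sset"
    proof -
      have "topspace (sum_topology (\<lambda>(n, x). subtopology (powertop_real UNIV) (standard_simplex n)) (SIGMA n:UNIV. splx X n)) = {}"
        using that by (simp add: topspace_sum_topology del: null_topspace_iff_trivial)
      then show ?thesis unfolding realization_def  by (rule topspace_quotient_space_empty[OF equiv_glue_rel])
    qed
    have W: "topspace (wedge_space 1 (unit_sphere k) sphere_base) = {}"
    proof -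
      have "topspace (sum_topology (\<lambda>_. unit_sphere 0) {..<1}) = {}"
        by (simp add: topspace_sum_topology topspace_unit_sphere_0 del: null_topspace_iff_trivial)
      from topspace_quotient_space_empty[OF equiv_wedge_rel this] show ?thesis
        unfolding 0 wedge_space_def by (simp only: if_False one_neq_zero)
    qed
    have 1: "same_weak_homotopy_type (alexandroff_space P) (wedge_space 1 (unit_sphere k) sphere_base)"
      by (rule same_weak_homotopy_type_empty[OF _ W]) (simp add: P topspace_alexandroff)
    have 3: "same_weak_homotopy_type (classifying_space P) (wedge_space 1 (unit_sphere k) sphere_base)"
      unfolding P classifying_space_def by (rule same_weak_homotopy_type_empty[OF R[OF N] W])
    show ?thesis using 1 2 3 unfolding P_def by blast
  next
    case (Suc d)
    obtain Fs where Fs: "set Fs = facets \<Delta>" and sh: "\<forall>j<length Fs. \<forall>i<j. \<exists>l<j.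
        Fs ! i \<inter> Fs ! j \<subseteq> Fs ! l \<inter> Fs ! j \<and> vec.dim (Fs ! l \<inter> Fs ! j) + 1 = k"
      using assms(4,5) unfolding shellable_def by blast
    obtain \<phi>ss where \<phi>ss: "map set \<phi>ss = map flags Fs" "shelled card k (concat \<phi>ss)"
      using shelled_flags[OF shelledI_nth[OF sh]] dimF subF Fs by blast
    have set: "set (concat \<phi>ss) = (\<Union>F\<in>facets \<Delta>. flags F)"
      using arg_cong[OF \<phi>ss(1), of set] by (simp add: Fs)
    have "order_chains P = {A. \<exists>F\<in>facets \<Delta>. \<exists>\<phi>\<in>flags F. A \<subseteq> \<phi>}"
      unfolding P_def by (rule chains_of_faces[OF assms(1,2)])
    also have "\<dots> = {A. \<exists>\<phi>\<in>set (concat \<phi>ss). A \<subseteq> \<phi>}" unfolding set by blast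
    finally have chains: "order_chains P = {A. \<exists>\<phi>\<in>set (concat \<phi>ss). A \<subseteq> \<phi>}" .
    \<comment> \<open>The empty chain lies in some flag, so the list of flags is not empty.\<close>
    have "{} \<in> order_chains P" by (simp add: order_chains_def)
    then obtain \<phi> where "\<phi> \<in> set (concat \<phi>ss)" unfolding chains by (elim CollectE bexE)
    then have ne: "concat \<phi>ss \<noteq> []" by (metis empty_iff list.set(1))
    have card: "card \<phi> = Suc d" if \<phi>: "\<phi> \<in> set (concat \<phi>ss)" for \<phi>
    proof -
      obtain F where F: "F \<in> facets \<Delta>" "\<phi> \<in> flags F" using \<phi> unfolding set by (rule UN_E)
      then have "card \<phi> = vec.dim F" by (simp add: flags_def)
      then show ?thesis unfolding dimF[OF F(1)] Suc .
    qed
    note * = shelled_order_complex[OF _ \<phi>ss(2)[unfolded Suc] ne card chains]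
    have "finite P" by simp
    from *[OF this] show ?thesis unfolding P_def Suc by (intro conjI)
  qed
qed

end
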